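(* Let $R$ be a commutative complete Noetherian Cohen--Macaulay local ring with algebraically closed residue field. If $R$ is an isolated singularity, then there is a bijective correspondence between closed subsets $\mathcal{X}$ of $\mathsf{Sp}\,\mathcal{C}(R)$ and Serre subcategories $\mathcal{F}$ of $\mathrm{mod}\,\underline{\mathcal{C}}(R)$ with $({}^{\perp}\mathcal{F})^{\perp}=\mathcal{F}$.
   Context: All modules are finitely generated. $\mathcal{C}(R)$ is the full subcategory of $\mathrm{mod}\,R$ of maximal Cohen--Macaulay modules, i.e. modules $M$ with $\mathrm{Ext}^i_R(k,M)=0$ for all $i<\dim R$, where $k$ is the residue field. The stable category $\underline{\mathcal{C}}(R)$ has the same objects, with morphisms $\underline{\mathrm{Hom}}_R(M,N)=\mathrm{Hom}_R(M,N)/\{\text{morphisms factoring through a free } R\text{-module}\}$. $\mathrm{mod}\,\underline{\mathcal{C}}(R)$ is the (abelian) category of finitely presented contravariant additive functors $F:\underline{\mathcal{C}}(R)\to Ab$, i.e. those admitting an exact sequence $\underline{\mathrm{Hom}}_R(-,N)\to\underline{\mathrm{Hom}}_R(-,M)\to F\to 0$ with $M,N\in\mathcal{C}(R)$. $\mathsf{Sp}\,\mathcal{C}(R)$ is the set of isomorphism classes of indecomposable modules in $\mathcal{C}(R)$ except $R$ and $0$. For $\mathcal{X}\subseteq\mathsf{Sp}\,\mathcal{C}(R)$, $\Sigma(\mathcal{X})=\{F\in\mathrm{mod}\,\underline{\mathcal{C}}(R)\mid F(X)=0\ \text{for all } X\in\mathcal{X}\}$; for a subcategory $\mathcal{F}$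 of $\mathrm{mod}\,\underline{\mathcal{C}}(R)$, $\gamma(\mathcal{F})=\{M\in\mathsf{Sp}\,\mathcal{C}(R)\mid F(M)=0\ \text{for all } F\in\mathcal{F}\}$. $\mathsf{Sp}\,\mathcal{C}(R)$ carries the topology in which $\mathcal{X}$ is closed iff $\gamma(\Sigma(\mathcal{X}))=\mathcal{X}$ (the operator $\gamma\circ\Sigma$ is a Kuratowski closure operator). $(R,\mathfrak m)$ is an isolated singularity if $R_{\mathfrak p}$ is regular for every prime ideal $\mathfrak p\neq\mathfrak m$. For a subcategory $\mathcal{F}$ of the abelian category $\mathcal{A}=\mathrm{mod}\,\underline{\mathcal{C}}(R)$, ${}^{\perp}\mathcal{F}=\{G\in\mathcal{A}\mid \mathrm{Hom}_{\mathcal{A}}(G,F)=0\ \text{for all } F\in\mathcal{F}\}$ and $\mathcal{F}^{\perp}=\{G\in\mathcal{A}\mid \mathrm{Hom}_{\mathcal{A}}(F,G)=0\ \text{for all } F\in\mathcal{F}\}$. Subcategories are full and closed under isomorphisms; a Serre subcategory is a nonempty one such that for every short exact sequence $0\to H\to G\to F\to 0$, $G$ is in it iff both $H$ and $F$ are. *)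

theory Defs
  imports "HOL-Algebra.Algebra" "HOL-Library.Extended_Nat"
begin

section \<open>Local rings\<close>

definition local_ring :: "'a ring \<Rightarrow> bool" where
  "local_ring R \<longleftrightarrow> cring R \<and> (\<exists>!I. maximalideal I R)"

text \<open>Only meaningful for local rings.\<close>

definition max_ideal :: "'a ring \<Rightarrow> 'a set" where
  "max_ideal R = (THE I. maximalideal I R)"

primrec ideal_pow :: "'a ring \<Rightarrow> 'a set \<Rightarrow> nat \<Rightarrow> 'a set" where
  "ideal_pow R I 0 = carrier R"
| "ideal_pow R I (Suc n) = ideal_prod R I (ideal_pow R I n)"

text \<open>Complete includes separated: the canonical map from \<open>R\<close> to the inverse limit of the
  \<open>R / I\<^sup>k\<close> is bijective.\<close>

definition adically_complete :: "'a ring \<Rightarrow> 'a set \<Rightarrow> bool" where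
  "adically_complete R I \<longleftrightarrow>
     (\<Inter>k. ideal_pow R I k) = {\<zero>\<^bsub>R\<^esub>} \<and>
     (\<forall>x :: nat \<Rightarrow> 'a. range x \<subseteq> carrier R \<longrightarrow>
        (\<forall>k. \<exists>N. \<forall>m\<ge>N. \<forall>n\<ge>N. x m \<ominus>\<^bsub>R\<^esub> x n \<in> ideal_pow R I k) \<longrightarrow>
        (\<exists>l\<in>carrier R. \<forall>k. \<exists>N. \<forall>n\<ge>N. x n \<ominus>\<^bsub>R\<^esub> l \<in> ideal_pow R I k))"

text \<open>The Krull dimension, as a supremum of lengths of chains of primes, so that an infinite
  dimension is \<open>\<infinity>\<close>.\<close>

definition krull_dim :: "'a ring \<Rightarrow> enat" where
  "krull_dim R = Sup {enat n | n. \<exists>P :: nat \<Rightarrow> 'a set.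
     (\<forall>i\<le>n. primeideal (P i) R) \<and> (\<forall>i<n. P i \<subset> P (Suc i))}"

definition regular_local_ring :: "'a ring \<Rightarrow> bool" where
  "regular_local_ring R \<longleftrightarrow> local_ring R \<and> noetherian_ring R \<and>
     (\<exists>A \<subseteq> carrier R. finite A \<and> max_ideal R = Idl\<^bsub>R\<^esub> A \<and> enat (card A) = krull_dim R)"

definition frac_rel :: "'a ring \<Rightarrow> 'a set \<Rightarrow> (('a \<times> 'a) \<times> ('a \<times> 'a)) set" where
  "frac_rel R P = {((a, s), (b, t)). a \<in> carrier R \<and> b \<in> carrier R \<and>
     s \<in> carrier R - P \<and> t \<in> carrier R - P \<and>
     (\<exists>u\<in>carrier R - P. u \<otimes>\<^bsub>R\<^esub> (a \<otimes>\<^bsub>R\<^esub> t \<ominus>\<^bsub>R\<^esub> b \<otimes>\<^bsub>R\<^esub> s) = \<zero>\<^bsub>R\<^esub>)}"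

text \<open>The localization at a prime \<open>P\<close>. The fraction \<open>a/s\<close> is the \<open>frac_rel\<close>-class of \<open>(a, s)\<close>;
  the unions in the operations run over representatives and all their members coincide.\<close>

definition localization :: "'a ring \<Rightarrow> 'a set \<Rightarrow> ('a \<times> 'a) set ring" where
  "localization R P =
     \<lparr>carrier = (carrier R \<times> (carrier R - P)) // frac_rel R P,
      monoid.mult = (\<lambda>U V. \<Union>x\<in>U. \<Union>y\<in>V. frac_rel R P `` {(fst x \<otimes>\<^bsub>R\<^esub> fst y, snd x \<otimes>\<^bsub>R\<^esub> snd y)}),
      one = frac_rel R P `` {(\<one>\<^bsub>R\<^esub>, \<one>\<^bsub>R\<^esub>)},
      ring.zero = frac_rel R P `` {(\<zero>\<^bsub>R\<^esub>, \<one>\<^bsub>R\<^esub>)},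
      ring.add = (\<lambda>U V. \<Union>x\<in>U. \<Union>y\<in>V. frac_rel R P ``
        {(fst x \<otimes>\<^bsub>R\<^esub> snd y \<oplus>\<^bsub>R\<^esub> fst y \<otimes>\<^bsub>R\<^esub> snd x, snd x \<otimes>\<^bsub>R\<^esub> snd y)})\<rparr>"

definition isolated_singularity :: "'a ring \<Rightarrow> bool" where
  "isolated_singularity R \<longleftrightarrow>
     (\<forall>P. primeideal P R \<and> P \<noteq> max_ideal R \<longrightarrow> regular_local_ring (localization R P))"


section \<open>Modules\<close>

text \<open>The fields \<open>mult\<close> and \<open>one\<close> of a module record play no role.

  Homomorphisms are extensional functions, so that equality of homomorphisms is equality of
  functions.\<close>

definition mod_hom :: "'a ring \<Rightarrow> ('a, 'm) module \<Rightarrow> ('a, 'n) module \<Rightarrow> ('m \<Rightarrow> 'n) set" where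
  "mod_hom R M N = {f \<in> carrier M \<rightarrow>\<^sub>E carrier N.
     (\<forall>x\<in>carrier M. \<forall>y\<in>carrier M. f (x \<oplus>\<^bsub>M\<^esub> y) = f x \<oplus>\<^bsub>N\<^esub> f y) \<and>
     (\<forall>r\<in>carrier R. \<forall>x\<in>carrier M. f (r \<odot>\<^bsub>M\<^esub> x) = r \<odot>\<^bsub>N\<^esub> f x)}"

definition hom_group :: "'a ring \<Rightarrow> ('a, 'm) module \<Rightarrow> ('a, 'n) module \<Rightarrow> ('m \<Rightarrow> 'n) monoid" where
  "hom_group R M N = \<lparr>carrier = mod_hom R M N,
     monoid.mult = (\<lambda>f g. \<lambda>x\<in>carrier M. f x \<oplus>\<^bsub>N\<^esub> g x),
     one = (\<lambda>x\<in>carrier M. \<zero>\<^bsub>N\<^esub>)\<rparr>"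

definition mod_iso :: "'a ring \<Rightarrow> ('a, 'm) module \<Rightarrow> ('a, 'n) module \<Rightarrow> bool" where
  "mod_iso R M N \<longleftrightarrow> (\<exists>f\<in>mod_hom R M N. bij_betw f (carrier M) (carrier N))"

definition fg_module :: "'a ring \<Rightarrow> ('a, 'm) module \<Rightarrow> bool" where
  "fg_module R M \<longleftrightarrow> module R M \<and>
     (\<exists>A \<subseteq> carrier M. finite A \<and> (\<forall>N. submodule N R M \<and> A \<subseteq> N \<longrightarrow> N = carrier M))"

definition indecomposable :: "'a ring \<Rightarrow> ('a, 'm) module \<Rightarrow> bool" where
  "indecomposable R M \<longleftrightarrow> carrier M \<noteq> {\<zero>\<^bsub>M\<^esub>} \<and>
     (\<forall>A B. submodule A R M \<and> submodule B R M \<and>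
        A <+>\<^bsub>M\<^esub> B = carrier M \<and> A \<inter> B = {\<zero>\<^bsub>M\<^esub>} \<longrightarrow> A = {\<zero>\<^bsub>M\<^esub>} \<or> B = {\<zero>\<^bsub>M\<^esub>})"

definition free_module :: "'a ring \<Rightarrow> nat \<Rightarrow> ('a, nat \<Rightarrow> 'a) module" where
  "free_module R n = \<lparr>carrier = {..<n} \<rightarrow>\<^sub>E carrier R,
     monoid.mult = (\<lambda>x y. \<lambda>i\<in>{..<n}. x i \<otimes>\<^bsub>R\<^esub> y i),
     one = (\<lambda>i\<in>{..<n}. \<one>\<^bsub>R\<^esub>),
     ring.zero = (\<lambda>i\<in>{..<n}. \<zero>\<^bsub>R\<^esub>),
     ring.add = (\<lambda>x y. \<lambda>i\<in>{..<n}. x i \<oplus>\<^bsub>R\<^esub> y i),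
     smult = (\<lambda>r x. \<lambda>i\<in>{..<n}. r \<otimes>\<^bsub>R\<^esub> x i)\<rparr>"

definition residue_module :: "'a ring \<Rightarrow> ('a, 'a set) module" where
  "residue_module R = (let I = max_ideal R; k = R Quot I in
     \<lparr>carrier = carrier k, monoid.mult = monoid.mult k, one = one k,
      ring.zero = ring.zero k, ring.add = ring.add k,
      smult = (\<lambda>r x. (I +>\<^bsub>R\<^esub> r) \<otimes>\<^bsub>k\<^esub> x)\<rparr>)"


section \<open>Ext and maximal Cohen--Macaulay modules\<close>

text \<open>A resolution
  \<open>\<cdots> \<rightarrow> R\<^bsup>n 2\<^esup> \<rightarrow> R\<^bsup>n 1\<^esup> \<rightarrow> R\<^bsup>n 0\<^esup> \<rightarrow> K \<rightarrow> 0\<close>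
  by free modules of finite rank, with \<open>d i\<close> the map out of the module in degree \<open>Suc i\<close> and
  \<open>e\<close> the augmentation. One exists for every finitely generated \<open>K\<close> over a Noetherian ring.\<close>

definition free_resolution ::
    "'a ring \<Rightarrow> ('a, 'm) module \<Rightarrow>
     (nat \<Rightarrow> nat) \<times> (nat \<Rightarrow> (nat \<Rightarrow> 'a) \<Rightarrow> (nat \<Rightarrow> 'a)) \<times> ((nat \<Rightarrow> 'a) \<Rightarrow> 'm) \<Rightarrow> bool" where
  "free_resolution R K = (\<lambda>(n, d, e).
     e \<in> mod_hom R (free_module R (n 0)) K \<and>
     (\<forall>i. d i \<in> mod_hom R (free_module R (n (Suc i))) (free_module R (n i))) \<and>
     e ` carrier (free_module R (n 0)) = carrier K \<and>
     a_kernel (free_module R (n 0)) K e = d 0 ` carrier (free_module R (n 1)) \<and>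
     (\<forall>i. a_kernel (free_module R (n (Suc i))) (free_module R (n i)) (d i) =
            d (Suc i) ` carrier (free_module R (n (Suc (Suc i))))))"

definition cocycles ::
    "'a ring \<Rightarrow> (nat \<Rightarrow> nat) \<Rightarrow> (nat \<Rightarrow> (nat \<Rightarrow> 'a) \<Rightarrow> (nat \<Rightarrow> 'a)) \<Rightarrow> ('a, 'm) module \<Rightarrow>
     nat \<Rightarrow> ((nat \<Rightarrow> 'a) \<Rightarrow> 'm) set" where
  "cocycles R n d M i = {f \<in> mod_hom R (free_module R (n i)) M.
     compose (carrier (free_module R (n (Suc i)))) f (d i) =
     one (hom_group R (free_module R (n (Suc i))) M)}"

primrec coboundaries ::
    "'a ring \<Rightarrow> (nat \<Rightarrow> nat) \<Rightarrow> (nat \<Rightarrow> (nat \<Rightarrow> 'a) \<Rightarrow> (nat \<Rightarrow> 'a)) \<Rightarrow> ('a, 'm) module \<Rightarrow>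
     nat \<Rightarrow> ((nat \<Rightarrow> 'a) \<Rightarrow> 'm) set" where
  "coboundaries R n d M 0 = {one (hom_group R (free_module R (n 0)) M)}"
| "coboundaries R n d M (Suc i) =
     (\<lambda>f. compose (carrier (free_module R (n (Suc i)))) f (d i)) `
       mod_hom R (free_module R (n i)) M"

definition Ext ::
    "'a ring \<Rightarrow> nat \<Rightarrow> ('a, 'k) module \<Rightarrow> ('a, 'm) module \<Rightarrow> ((nat \<Rightarrow> 'a) \<Rightarrow> 'm) set monoid" where
  "Ext R i K M = (case SOME res. free_resolution R K res of (n, d, e) \<Rightarrow>
     (hom_group R (free_module R (n i)) M\<lparr>carrier := cocycles R n d M i\<rparr>)
       Mod coboundaries R n d M i)"

definition mcm_module :: "'a ring \<Rightarrow> ('a, 'm) module \<Rightarrow> bool" where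
  "mcm_module R M \<longleftrightarrow> fg_module R M \<and>
     (\<forall>i. enat i < krull_dim R \<longrightarrow> trivial_group (Ext R i (residue_module R) M))"

definition cohen_macaulay_ring :: "'a ring \<Rightarrow> bool" where
  "cohen_macaulay_ring R \<longleftrightarrow> mcm_module R (free_module R 1)"


section \<open>The category of maximal Cohen--Macaulay modules and its stable category\<close>

text \<open>To quantify over modules they have to live on one fixed type, here \<open>nat \<Rightarrow> 'a\<close>. It contains
  the free modules \<open>R\<^sup>n\<close>, and an isomorphic copy of every finitely generated module: such a
  module is a quotient of some \<open>R\<^sup>n\<close>, and a choice of representatives in \<open>R\<^sup>n\<close> transports its
  structure to a subset of \<open>nat \<Rightarrow> 'a\<close>.\<close>

type_synonym 'a rmod = "('a, nat \<Rightarrow> 'a) module"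

definition CM :: "'a ring \<Rightarrow> 'a rmod set" where
  "CM R = {M. mcm_module R M}"

text \<open>Maps between finitely generated modules that factor through a free module factor through one
  of finite rank.\<close>

definition free_factoring :: "'a ring \<Rightarrow> 'a rmod \<Rightarrow> 'a rmod \<Rightarrow> ((nat \<Rightarrow> 'a) \<Rightarrow> (nat \<Rightarrow> 'a)) set" where
  "free_factoring R M N = {compose (carrier M) g f | f g n.
     f \<in> mod_hom R M (free_module R n) \<and> g \<in> mod_hom R (free_module R n) N}"

type_synonym 'a smor = "((nat \<Rightarrow> 'a) \<Rightarrow> (nat \<Rightarrow> 'a)) set"

definition stable_hom :: "'a ring \<Rightarrow> 'a rmod \<Rightarrow> 'a rmod \<Rightarrow> 'a smor monoid" where
  "stable_hom R M N = hom_group R M N Mod free_factoring R M N"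

definition stable_class ::
    "'a ring \<Rightarrow> 'a rmod \<Rightarrow> 'a rmod \<Rightarrow> ((nat \<Rightarrow> 'a) \<Rightarrow> (nat \<Rightarrow> 'a)) \<Rightarrow> 'a smor" where
  "stable_class R M N f = free_factoring R M N #>\<^bsub>hom_group R M N\<^esub> f"

definition stable_id :: "'a ring \<Rightarrow> 'a rmod \<Rightarrow> 'a smor" where
  "stable_id R M = stable_class R M M (\<lambda>x\<in>carrier M. x)"

text \<open>The composite of \<open>f\<close> from \<open>U\<close> to \<open>V\<close> with \<open>g\<close> from \<open>V\<close> to \<open>W\<close>; again the union is over
  representatives, which all yield the same class.\<close>

definition stable_comp :: "'a ring \<Rightarrow> 'a rmod \<Rightarrow> 'a rmod \<Rightarrow> 'a smor \<Rightarrow> 'a smor \<Rightarrow> 'a smor" where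
  "stable_comp R U W g f = (\<Union>v\<in>g. \<Union>u\<in>f. stable_class R U W (compose (carrier U) v u))"


section \<open>Functors on the stable category\<close>

text \<open>Abelian groups are written multiplicatively. \<open>fun_mor F U V c\<close> is the map from \<open>F V\<close> to \<open>F U\<close>
  induced by a stable morphism \<open>c\<close> from \<open>U\<close> to \<open>V\<close>. Values outside \<open>CM R\<close> and off the carriers
  are irrelevant, in the sense that functors differing only there are isomorphic.\<close>

record ('a, 'v) sfunctor =
  fun_ob :: "'a rmod \<Rightarrow> 'v monoid"
  fun_mor :: "'a rmod \<Rightarrow> 'a rmod \<Rightarrow> 'a smor \<Rightarrow> 'v \<Rightarrow> 'v"

definition additive_functor :: "'a ring \<Rightarrow> ('a, 'v) sfunctor \<Rightarrow> bool" where
  "additive_functor R F \<longleftrightarrow>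
     (\<forall>U\<in>CM R. comm_group (fun_ob F U)) \<and>
     (\<forall>U\<in>CM R. \<forall>V\<in>CM R. \<forall>c\<in>carrier (stable_hom R U V).
        fun_mor F U V c \<in> hom (fun_ob F V) (fun_ob F U)) \<and>
     (\<forall>U\<in>CM R. \<forall>x\<in>carrier (fun_ob F U). fun_mor F U U (stable_id R U) x = x) \<and>
     (\<forall>U\<in>CM R. \<forall>V\<in>CM R. \<forall>W\<in>CM R.
        \<forall>c\<in>carrier (stable_hom R U V). \<forall>c'\<in>carrier (stable_hom R V W). \<forall>x\<in>carrier (fun_ob F W).
        fun_mor F U W (stable_comp R U W c' c) x = fun_mor F U V c (fun_mor F V W c' x)) \<and>
     (\<forall>U\<in>CM R. \<forall>V\<in>CM R.
        \<forall>c\<in>carrier (stable_hom R U V). \<forall>c'\<in>carrier (stable_hom R U V). \<forall>x\<in>carrier (fun_ob F V).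
        fun_mor F U V (c \<otimes>\<^bsub>stable_hom R U V\<^esub> c') x =
        fun_mor F U V c x \<otimes>\<^bsub>fun_ob F U\<^esub> fun_mor F U V c' x)"

definition representable :: "'a ring \<Rightarrow> 'a rmod \<Rightarrow> ('a, 'a smor) sfunctor" where
  "representable R M = \<lparr>fun_ob = (\<lambda>U. stable_hom R U M),
     fun_mor = (\<lambda>U V c g. stable_comp R U M g c)\<rparr>"

definition nat_trans ::
    "'a ring \<Rightarrow> ('a, 'v) sfunctor \<Rightarrow> ('a, 'w) sfunctor \<Rightarrow> ('a rmod \<Rightarrow> 'v \<Rightarrow> 'w) \<Rightarrow> bool" where
  "nat_trans R F G \<eta> \<longleftrightarrow>
     (\<forall>U\<in>CM R. \<eta> U \<in> hom (fun_ob F U) (fun_ob G U)) \<and>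
     (\<forall>U\<in>CM R. \<forall>V\<in>CM R. \<forall>c\<in>carrier (stable_hom R U V). \<forall>y\<in>carrier (fun_ob F V).
        \<eta> U (fun_mor F U V c y) = fun_mor G U V c (\<eta> V y))"

definition functor_iso :: "'a ring \<Rightarrow> ('a, 'v) sfunctor \<Rightarrow> ('a, 'w) sfunctor \<Rightarrow> bool" where
  "functor_iso R F G \<longleftrightarrow> (\<exists>\<eta>. nat_trans R F G \<eta> \<and>
     (\<forall>U\<in>CM R. bij_betw (\<eta> U) (carrier (fun_ob F U)) (carrier (fun_ob G U))))"

text \<open>Exactness of sequences of functors is pointwise. The kernels and cokernels of the
  abelian category \<open>mod_CM\<close> below are the pointwise ones, so its exact sequences are the same.\<close>

definition fin_presented :: "'a ring \<Rightarrow> ('a, 'v) sfunctor \<Rightarrow> bool" where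
  "fin_presented R F \<longleftrightarrow> (\<exists>M\<in>CM R. \<exists>N\<in>CM R. \<exists>\<alpha> \<beta>.
     nat_trans R (representable R N) (representable R M) \<alpha> \<and>
     nat_trans R (representable R M) F \<beta> \<and>
     (\<forall>U\<in>CM R.
        \<alpha> U ` carrier (stable_hom R U N) = kernel (stable_hom R U M) (fun_ob F U) (\<beta> U) \<and>
        \<beta> U ` carrier (stable_hom R U M) = carrier (fun_ob F U)))"

text \<open>The values of a finitely presented functor are quotients of the groups
  \<open>stable_hom R U M\<close>, so up to isomorphism it takes values on the type of sets of stable
  morphisms.\<close>

type_synonym 'a fp_functor = "('a, 'a smor set) sfunctor"

definition mod_CM :: "'a ring \<Rightarrow> 'a fp_functor set" where
  "mod_CM R = {F. additive_functor R F \<and> fin_presented R F}"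

definition short_exact ::
    "'a ring \<Rightarrow> 'a fp_functor \<Rightarrow> 'a fp_functor \<Rightarrow> 'a fp_functor \<Rightarrow> bool" where
  "short_exact R H G F \<longleftrightarrow> (\<exists>\<alpha> \<beta>. nat_trans R H G \<alpha> \<and> nat_trans R G F \<beta> \<and>
     (\<forall>U\<in>CM R. inj_on (\<alpha> U) (carrier (fun_ob H U)) \<and>
        \<alpha> U ` carrier (fun_ob H U) = kernel (fun_ob G U) (fun_ob F U) (\<beta> U) \<and>
        \<beta> U ` carrier (fun_ob G U) = carrier (fun_ob F U)))"

text \<open>Full subcategories are given by their sets of objects.\<close>

definition iso_closed_subcategory :: "'a ring \<Rightarrow> 'a fp_functor set \<Rightarrow> bool" where
  "iso_closed_subcategory R \<F> \<longleftrightarrow> \<F> \<subseteq> mod_CM R \<and>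
     (\<forall>F\<in>\<F>. \<forall>G\<in>mod_CM R. functor_iso R F G \<longrightarrow> G \<in> \<F>)"

definition serre_subcategory :: "'a ring \<Rightarrow> 'a fp_functor set \<Rightarrow> bool" where
  "serre_subcategory R \<F> \<longleftrightarrow> iso_closed_subcategory R \<F> \<and> \<F> \<noteq> {} \<and>
     (\<forall>H\<in>mod_CM R. \<forall>G\<in>mod_CM R. \<forall>F\<in>mod_CM R.
        short_exact R H G F \<longrightarrow> (G \<in> \<F> \<longleftrightarrow> H \<in> \<F> \<and> F \<in> \<F>))"

definition zero_hom :: "'a ring \<Rightarrow> 'a fp_functor \<Rightarrow> 'a fp_functor \<Rightarrow> bool" where
  "zero_hom R G F \<longleftrightarrow> (\<forall>\<eta>. nat_trans R G F \<eta> \<longrightarrow>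
     (\<forall>U\<in>CM R. \<forall>x\<in>carrier (fun_ob G U). \<eta> U x = \<one>\<^bsub>fun_ob F U\<^esub>))"

definition left_perp :: "'a ring \<Rightarrow> 'a fp_functor set \<Rightarrow> 'a fp_functor set" where
  "left_perp R \<F> = {G \<in> mod_CM R. \<forall>F\<in>\<F>. zero_hom R G F}"

definition right_perp :: "'a ring \<Rightarrow> 'a fp_functor set \<Rightarrow> 'a fp_functor set" where
  "right_perp R \<F> = {G \<in> mod_CM R. \<forall>F\<in>\<F>. zero_hom R F G}"


section \<open>The spectrum\<close>

definition CM_iso_rel :: "'a ring \<Rightarrow> ('a rmod \<times> 'a rmod) set" where
  "CM_iso_rel R = {(M, N). M \<in> CM R \<and> N \<in> CM R \<and> mod_iso R M N}"

definition Sp :: "'a ring \<Rightarrow> 'a rmod set set" where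
  "Sp R = {M \<in> CM R. indecomposable R M \<and> \<not> mod_iso R M (free_module R 1)} // CM_iso_rel R"

definition Sp_Sigma :: "'a ring \<Rightarrow> 'a rmod set set \<Rightarrow> 'a fp_functor set" where
  "Sp_Sigma R \<U> = {F \<in> mod_CM R. \<forall>c\<in>\<U>. \<forall>U\<in>c. trivial_group (fun_ob F U)}"

definition Sp_gamma :: "'a ring \<Rightarrow> 'a fp_functor set \<Rightarrow> 'a rmod set set" where
  "Sp_gamma R \<F> = {c \<in> Sp R. \<forall>F\<in>\<F>. \<forall>M\<in>c. trivial_group (fun_ob F M)}"

definition Sp_closed :: "'a ring \<Rightarrow> 'a rmod set set \<Rightarrow> bool" where
  "Sp_closed R \<U> \<longleftrightarrow> \<U> \<subseteq> Sp R \<and> Sp_gamma R (Sp_Sigma R \<U>) = \<U>"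

end

(* The functors vanishing on a set of modules form the right perpendicular of the corresponding
   representable functors (Yoneda), so they are a Serre subcategory equal to its double perpendicular.
   Conversely let FF be a Serre subcategory with this property, and suppose that G vanishes where all of
   FF does but admits a nonzero map from some H in the left perpendicular of FF.  Splitting the generator
   of H into summands produces a nonzero quotient Q of H generated by a single indecomposable N with
   G(N) nonzero; hence some F in FF is nonzero at N, and F contains a nonzero quotient of the functor
   represented by N.  By completeness the endomorphism ring of N is local, so two nonzero quotients of
   this functor have a common nonzero quotient; thus H maps nontrivially to a quotient of F, which lies
   in FF: a contradiction.  Almost split sequences are not needed, and finitely presented functors have
   finitely presented cyclic subfunctors because weak pullbacks of maximal Cohen-Macaulay modules
   exist. *)

theory Submission
  imports Defs
begin

section \<open>Homomorphisms, spans and Noetherian modules\<close>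

text \<open>The common quotient: let the two quotients of the functor represented by N be taken by
  right ideals I and J. If I + J contained the identity, then \<phi> would lie in I and id - \<phi>
  in J for some \<phi>; one of the two is invertible, so one of the quotients would vanish. The sum
  I + J is never formed: its quotient sits inside F divided by the subfunctor that I generates from
  an element y of F(N).

  Locality is the analytic part. The endomorphism ring of N is not commutative, so an endomorphism
  is lifted to R^n and placed in a finite commutative algebra of endomorphisms of R^n. There the
  powers of the lift stabilise modulo \<mm> and produce an idempotent modulo \<mm>; Newton iteration
  makes it exact, indecomposability forces the idempotent induced on N to be 0 or 1, and Nakayama's
  lemma concludes.

  In place of a Krull-Schmidt decomposition of the generator, summands are split off by idempotents
  with maximal image, which the ascending chain condition supplies.\<close>

abbreviation id_hom :: "('a, 'm) module \<Rightarrow> 'm \<Rightarrow> 'm" where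
  "id_hom M \<equiv> (\<lambda>x\<in>carrier M. x)"

definition hom_plus :: "('a, 'm) module \<Rightarrow> ('a, 'n) module \<Rightarrow> ('m \<Rightarrow> 'n) \<Rightarrow> ('m \<Rightarrow> 'n) \<Rightarrow> 'm \<Rightarrow> 'n" where
  "hom_plus M N f g = (\<lambda>x\<in>carrier M. f x \<oplus>\<^bsub>N\<^esub> g x)"

definition hom_diff :: "('a, 'm) module \<Rightarrow> ('a, 'n) module \<Rightarrow> ('m \<Rightarrow> 'n) \<Rightarrow> ('m \<Rightarrow> 'n) \<Rightarrow> 'm \<Rightarrow> 'n" where
  "hom_diff M N f g = (\<lambda>x\<in>carrier M. f x \<ominus>\<^bsub>N\<^esub> g x)"

definition hom_zero :: "('a, 'm) module \<Rightarrow> ('a, 'n) module \<Rightarrow> 'm \<Rightarrow> 'n" where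
  "hom_zero M N = (\<lambda>x\<in>carrier M. \<zero>\<^bsub>N\<^esub>)"

definition spanned :: "'a ring \<Rightarrow> ('a, 'm) module \<Rightarrow> 'm set \<Rightarrow> 'm set" where
  "spanned R M A = \<Inter>{W. submodule W R M \<and> A \<subseteq> W}"

definition noeth :: "'a ring \<Rightarrow> ('a, 'm) module \<Rightarrow> bool" where
  "noeth R M \<longleftrightarrow> (\<forall>W. submodule W R M \<longrightarrow> (\<exists>A\<subseteq>W. finite A \<and> W = spanned R M A))"

lemma mod_homD:
  assumes "f \<in> mod_hom R M N"
  shows "x \<in> carrier M \<Longrightarrow> f x \<in> carrier N"
    and "\<lbrakk>x \<in> carrier M; y \<in> carrier M\<rbrakk> \<Longrightarrow> f (x \<oplus>\<^bsub>M\<^esub> y) = f x \<oplus>\<^bsub>N\<^esub> f y"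
    and "\<lbrakk>r \<in> carrier R; x \<in> carrier M\<rbrakk> \<Longrightarrow> f (r \<odot>\<^bsub>M\<^esub> x) = r \<odot>\<^bsub>N\<^esub> f x"
    and "f \<in> extensional (carrier M)"
  using assms by (auto simp: mod_hom_def PiE_def)

lemma hom_eqI:
  assumes "f \<in> mod_hom R M N" "g \<in> mod_hom R M N'" "\<And>x. x \<in> carrier M \<Longrightarrow> f x = g x"
  shows "f = g"
  using assms by (auto intro!: extensionalityI[of f "carrier M" g] dest: mod_homD(4))

lemma mod_homI:
  assumes "module R M"
    and "\<And>x. x \<in> carrier M \<Longrightarrow> f x \<in> carrier N"
    and "\<And>x y. \<lbrakk>x \<in> carrier M; y \<in> carrier M\<rbrakk> \<Longrightarrow> f (x \<oplus>\<^bsub>M\<^esub> y) = f x \<oplus>\<^bsub>N\<^esub> f y"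
    and "\<And>r x. \<lbrakk>r \<in> carrier R; x \<in> carrier M\<rbrakk> \<Longrightarrow> f (r \<odot>\<^bsub>M\<^esub> x) = r \<odot>\<^bsub>N\<^esub> f x"
  shows "restrict f (carrier M) \<in> mod_hom R M N"
proof -
  interpret module R M by fact
  show ?thesis using assms(2-) by (auto simp: mod_hom_def)
qed

lemma id_hom_closed: "module R M \<Longrightarrow> id_hom M \<in> mod_hom R M M"
  using mod_homI[of R M "\<lambda>x. x" M] by simp

lemma compose_hom:
  assumes "module R M" "f \<in> mod_hom R M N" "g \<in> mod_hom R N L"
  shows "compose (carrier M) g f \<in> mod_hom R M L"
  unfolding compose_def
  by (rule mod_homI) (use assms in \<open>auto simp: mod_homD\<close>)

lemma compose_hom_assoc:
  assumes "f \<in> mod_hom R M N"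
  shows "compose (carrier M) h (compose (carrier M) g f) = compose (carrier M) (compose (carrier N) h g) f"
  using assms by (auto simp: compose_def fun_eq_iff mod_homD)

lemma compose_id_hom:
  assumes "f \<in> mod_hom R M N"
  shows "compose (carrier M) f (id_hom M) = f" "compose (carrier M) (id_hom N) f = f"
  using mod_homD[OF assms] by (auto simp: compose_def fun_eq_iff extensional_def)

lemma hom_0:
  assumes "module R M" "module R N" "f \<in> mod_hom R M N"
  shows "f \<zero>\<^bsub>M\<^esub> = \<zero>\<^bsub>N\<^esub>"
proof -
  interpret M: module R M by fact
  interpret N: module R N by fact
  have "f (\<zero>\<^bsub>R\<^esub> \<odot>\<^bsub>M\<^esub> \<zero>\<^bsub>M\<^esub>) = \<zero>\<^bsub>R\<^esub> \<odot>\<^bsub>N\<^esub> f \<zero>\<^bsub>M\<^esub>"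
    using mod_homD(3)[OF assms(3)] by blast
  then show ?thesis using mod_homD(1)[OF assms(3)] by simp
qed

lemma hom_neg:
  assumes "module R M" "module R N" "f \<in> mod_hom R M N" "x \<in> carrier M"
  shows "f (\<ominus>\<^bsub>M\<^esub> x) = \<ominus>\<^bsub>N\<^esub> f x"
proof -
  interpret M: module R M by fact
  interpret N: module R N by fact
  have "f x \<oplus>\<^bsub>N\<^esub> f (\<ominus>\<^bsub>M\<^esub> x) = \<zero>\<^bsub>N\<^esub>"
    using mod_homD(2)[OF assms(3,4), of "\<ominus>\<^bsub>M\<^esub> x"] assms(4) hom_0[OF assms(1-3)] by (simp add: M.r_neg)
  then show ?thesis using mod_homD(1)[OF assms(3)] assms(4)
    by (metis M.a_inv_closed N.a_comm N.minus_equality)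
qed

lemma hom_minus:
  assumes "module R M" "module R N" "f \<in> mod_hom R M N" "x \<in> carrier M" "y \<in> carrier M"
  shows "f (x \<ominus>\<^bsub>M\<^esub> y) = f x \<ominus>\<^bsub>N\<^esub> f y"
proof -
  interpret M: module R M by fact
  show ?thesis using assms by (simp add: a_minus_def mod_homD hom_neg)
qed

lemma hom_plus_closed:
  assumes "module R M" "module R N" "f \<in> mod_hom R M N" "g \<in> mod_hom R M N"
  shows "hom_plus M N f g \<in> mod_hom R M N"
proof -
  interpret M: module R M by fact
  interpret N: module R N by fact
  show ?thesis unfolding hom_plus_def
    by (rule mod_homI[OF assms(1)])
      (use assms in \<open>auto simp: mod_homD N.smult_r_distr N.a_ac\<close>)
qed

lemma hom_zero_closed:
  assumes "module R M" "module R N"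
  shows "hom_zero M N \<in> mod_hom R M N"
proof -
  interpret M: module R M by fact
  interpret N: module R N by fact
  show ?thesis unfolding hom_zero_def by (rule mod_homI[OF assms(1)]) auto
qed

lemma hom_diff_closed:
  assumes "module R M" "module R N" "f \<in> mod_hom R M N" "g \<in> mod_hom R M N"
  shows "hom_diff M N f g \<in> mod_hom R M N"
proof -
  interpret M: module R M by fact
  interpret N: module R N by fact
  show ?thesis unfolding hom_diff_def
    by (rule mod_homI[OF assms(1)])
      (use assms in \<open>auto simp: mod_homD N.smult_r_distr N.a_ac a_minus_def N.minus_add N.smult_r_minus\<close>)
qed

section \<open>Submodules and spans\<close>

lemma submoduleD:
  assumes "module R M" "submodule W R M"
  shows "W \<subseteq> carrier M" and "\<zero>\<^bsub>M\<^esub> \<in> W"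
    and "\<And>x y. x \<in> W \<Longrightarrow> y \<in> W \<Longrightarrow> x \<oplus>\<^bsub>M\<^esub> y \<in> W"
    and "\<And>x. x \<in> W \<Longrightarrow> \<ominus>\<^bsub>M\<^esub> x \<in> W"
    and "\<And>x y. x \<in> W \<Longrightarrow> y \<in> W \<Longrightarrow> x \<ominus>\<^bsub>M\<^esub> y \<in> W"
    and "\<And>r x. r \<in> carrier R \<Longrightarrow> x \<in> W \<Longrightarrow> r \<odot>\<^bsub>M\<^esub> x \<in> W"
proof -
  interpret M: module R M by fact
  note E = M.submoduleE[OF assms(2)]
  show "W \<subseteq> carrier M" by (fact E(1))
  show "\<zero>\<^bsub>M\<^esub> \<in> W"
    using E(1,2,3,5) by (metis M.r_neg equals0I subsetD)
  show "\<And>x y. x \<in> W \<Longrightarrow> y \<in> W \<Longrightarrow> x \<oplus>\<^bsub>M\<^esub> y \<in> W" by (fact E(5))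
  show "\<And>x. x \<in> W \<Longrightarrow> \<ominus>\<^bsub>M\<^esub> x \<in> W" by (fact E(3))
  show "\<And>x y. x \<in> W \<Longrightarrow> y \<in> W \<Longrightarrow> x \<ominus>\<^bsub>M\<^esub> y \<in> W" using E(3,5) by (simp add: a_minus_def)
  show "\<And>r x. r \<in> carrier R \<Longrightarrow> x \<in> W \<Longrightarrow> r \<odot>\<^bsub>M\<^esub> x \<in> W" by (fact E(4))
qed

text \<open>Negation is the action of the scalar -1, so closure under it comes for free.\<close>

lemma submoduleI':
  assumes "module R M" "W \<subseteq> carrier M" "\<zero>\<^bsub>M\<^esub> \<in> W"
    and "\<And>x y. x \<in> W \<Longrightarrow> y \<in> W \<Longrightarrow> x \<oplus>\<^bsub>M\<^esub> y \<in> W"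
    and "\<And>r x. r \<in> carrier R \<Longrightarrow> x \<in> W \<Longrightarrow> r \<odot>\<^bsub>M\<^esub> x \<in> W"
  shows "submodule W R M"
proof -
  interpret M: module R M by fact
  have "\<ominus>\<^bsub>M\<^esub> x \<in> W" if "x \<in> W" for x
  proof -
    have "x \<in> carrier M" using that assms(2) by auto
    then have "(\<ominus>\<^bsub>R\<^esub> \<one>\<^bsub>R\<^esub>) \<odot>\<^bsub>M\<^esub> x = \<ominus>\<^bsub>M\<^esub> x" by (simp add: M.smult_l_minus)
    then show ?thesis using assms(5)[of "\<ominus>\<^bsub>R\<^esub> \<one>\<^bsub>R\<^esub>" x] that by simp
  qed
  then show ?thesis using assms by (auto intro!: M.submoduleI)
qed

lemma submodule_carrier: "module R M \<Longrightarrow> submodule (carrier M) R M"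
  by (rule module.carrier_is_submodule)

lemma submodule_zero:
  assumes "module R M" shows "submodule {\<zero>\<^bsub>M\<^esub>} R M"
proof -
  interpret M: module R M by fact
  show ?thesis by (rule submoduleI'[OF assms]) auto
qed

lemma submodule_Int:
  assumes "module R M" "submodule V R M" "submodule W R M"
  shows "submodule (V \<inter> W) R M"
  using submoduleD[OF assms(1,2)] submoduleD[OF assms(1,3)] by (intro submoduleI'[OF assms(1)]) auto

lemma submodule_image:
  assumes "module R M" "module R N" "f \<in> mod_hom R M N" "submodule W R M"
  shows "submodule (f ` W) R N"
proof -
  note W = submoduleD[OF assms(1,4)] and f = mod_homD[OF assms(3)]
  show ?thesis
  proof (rule submoduleI'[OF assms(2)])
    show "f ` W \<subseteq> carrier N" using W f by auto
    show "\<zero>\<^bsub>N\<^esub> \<in> f ` W" using hom_0[OF assms(1-3)] W(2) by force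
    show "x \<oplus>\<^bsub>N\<^esub> y \<in> f ` W" if xy: "x \<in> f ` W" "y \<in> f ` W" for x y
    proof -
      obtain u v where uv: "u \<in> W" "v \<in> W" "x = f u" "y = f v" using xy by auto
      then have "u \<in> carrier M" "v \<in> carrier M" using W(1) by auto
      from f(2)[OF this] show ?thesis using uv W(3)[OF uv(1,2)] by (intro image_eqI[of _ _ "u \<oplus>\<^bsub>M\<^esub> v"]) auto
    qed
    show "r \<odot>\<^bsub>N\<^esub> x \<in> f ` W" if r: "r \<in> carrier R" and x: "x \<in> f ` W" for r x
    proof -
      obtain u where u: "u \<in> W" "x = f u" using x by auto
      then have "u \<in> carrier M" using W(1) by auto
      from f(3)[OF r this] show ?thesis using u W(6)[OF r u(1)] by (intro image_eqI[of _ _ "r \<odot>\<^bsub>M\<^esub> u"]) auto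
    qed
  qed
qed

lemma submodule_vimage:
  assumes "module R M" "module R N" "f \<in> mod_hom R M N" "submodule W R N"
  shows "submodule {x \<in> carrier M. f x \<in> W} R M"
proof -
  interpret M: module R M by fact
  note W = submoduleD[OF assms(2,4)] and f = mod_homD[OF assms(3)]
  show ?thesis
    by (rule submoduleI'[OF assms(1)]) (use W f hom_0[OF assms(1-3)] in auto)
qed

lemma submodule_kernel:
  assumes "module R M" "module R N" "f \<in> mod_hom R M N"
  shows "submodule {x \<in> carrier M. f x = \<zero>\<^bsub>N\<^esub>} R M"
  using submodule_vimage[OF assms submodule_zero[OF assms(2)]] by simp

lemma spanned_subset: "A \<subseteq> spanned R M A"
  by (auto simp: spanned_def)

lemma spanned_least: "submodule W R M \<Longrightarrow> A \<subseteq> W \<Longrightarrow> spanned R M A \<subseteq> W"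
  by (auto simp: spanned_def)

lemma spanned_mono: "A \<subseteq> B \<Longrightarrow> spanned R M A \<subseteq> spanned R M B"
  by (auto simp: spanned_def)

lemma submodule_spanned:
  assumes "module R M" "A \<subseteq> carrier M"
  shows "submodule (spanned R M A) R M"
proof -
  have c: "carrier M \<in> {W. submodule W R M \<and> A \<subseteq> W}"
    using assms submodule_carrier by auto
  show ?thesis
    by (rule submoduleI'[OF assms(1)])
      (use c submoduleD[OF assms(1)] in \<open>auto simp: spanned_def\<close>)
qed

lemma spanned_image:
  assumes "module R M" "module R N" "f \<in> mod_hom R M N" "A \<subseteq> carrier M"
  shows "f ` spanned R M A = spanned R N (f ` A)"
proof
  have "spanned R M A \<subseteq> {x \<in> carrier M. f x \<in> spanned R N (f ` A)}"
    using assms mod_homD(1)[OF assms(3)] spanned_subset[of "f ` A" R N]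
    by (intro spanned_least submodule_vimage[OF assms(1-3)] submodule_spanned) (auto simp: subset_eq)
  then show "f ` spanned R M A \<subseteq> spanned R N (f ` A)" by auto
  show "spanned R N (f ` A) \<subseteq> f ` spanned R M A"
    using spanned_subset[of A R M]
    by (intro spanned_least submodule_image[OF assms(1-3)] submodule_spanned assms) auto
qed

lemma fg_module_iff:
  "fg_module R M \<longleftrightarrow> module R M \<and> (\<exists>A\<subseteq>carrier M. finite A \<and> carrier M = spanned R M A)"
proof (cases "module R M")
  case True
  have "(\<forall>N. submodule N R M \<and> A \<subseteq> N \<longrightarrow> N = carrier M) \<longleftrightarrow> carrier M = spanned R M A"
    if "A \<subseteq> carrier M" for A
  proof
    assume "\<forall>N. submodule N R M \<and> A \<subseteq> N \<longrightarrow> N = carrier M"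
    then show "carrier M = spanned R M A"
      using submodule_spanned[OF True that] spanned_subset[of A R M] by auto
  next
    assume *: "carrier M = spanned R M A"
    show "\<forall>N. submodule N R M \<and> A \<subseteq> N \<longrightarrow> N = carrier M"
      using spanned_least[of _ R M A] * submoduleD(1)[OF True] by blast
  qed
  then show ?thesis unfolding fg_module_def using True by auto
qed (simp add: fg_module_def)

section \<open>Noetherian modules\<close>

lemma noethD:
  assumes "noeth R M" "submodule W R M"
  obtains A where "A \<subseteq> W" "finite A" "W = spanned R M A"
  using assms unfolding noeth_def by auto

lemma noeth_imp_fg: "module R M \<Longrightarrow> noeth R M \<Longrightarrow> fg_module R M"
  using submodule_carrier[of R M] unfolding fg_module_iff noeth_def by blast

lemma fg_image:
  assumes "fg_module R M" "module R N" "f \<in> mod_hom R M N" "f ` carrier M = carrier N"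
  shows "fg_module R N"
proof -
  obtain A where M: "module R M" and A: "A \<subseteq> carrier M" "finite A" "carrier M = spanned R M A"
    using assms(1) unfolding fg_module_iff by auto
  have "carrier N = spanned R N (f ` A)"
    using spanned_image[OF M assms(2,3) A(1)] A(3) assms(4) by simp
  moreover have "f ` A \<subseteq> carrier N" using A(1) assms(4) by auto
  ultimately show ?thesis using A(2) assms(2) unfolding fg_module_iff by auto
qed

lemma noeth_image:
  assumes "module R M" "module R N" "f \<in> mod_hom R M N" "f ` carrier M = carrier N" "noeth R M"
  shows "noeth R N"
  unfolding noeth_def
proof (intro allI impI)
  fix W assume W: "submodule W R N"
  let ?V = "{x \<in> carrier M. f x \<in> W}"
  have V: "submodule ?V R M" by (rule submodule_vimage[OF assms(1-3) W])
  obtain A where A: "A \<subseteq> ?V" "finite A" "?V = spanned R M A"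
    by (rule noethD[OF assms(5) V])
  have fV: "f ` ?V = W"
    using submoduleD(1)[OF assms(2) W] assms(4) by (force simp: image_iff)
  have "W = spanned R N (f ` A)"
    using spanned_image[OF assms(1-3), of A] A(1) fV unfolding A(3)[symmetric] by auto
  then show "\<exists>A\<subseteq>W. finite A \<and> W = spanned R N A"
    using A(1,2) by (intro exI[of _ "f ` A"]) auto
qed

lemma noeth_inj:
  assumes "module R M" "module R N" "f \<in> mod_hom R M N" "inj_on f (carrier M)" "noeth R N"
  shows "noeth R M"
  unfolding noeth_def
proof (intro allI impI)
  fix W assume W: "submodule W R M"
  obtain B where B: "B \<subseteq> f ` W" "finite B" "f ` W = spanned R N B"
    by (rule noethD[OF assms(5) submodule_image[OF assms(1-3) W]])
  obtain A where A: "A \<subseteq> W" "finite A" "B = f ` A"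
    using finite_subset_image[OF B(2,1)] by blast
  have WM: "W \<subseteq> carrier M" by (rule submoduleD(1)[OF assms(1) W])
  have "f ` spanned R M A = f ` W"
    using spanned_image[OF assms(1-3), of A] A WM B(3) by auto
  moreover have "spanned R M A \<subseteq> W" by (rule spanned_least[OF W A(1)])
  ultimately have "spanned R M A = W"
    using assms(4) WM by (metis inj_on_image_eq_iff order_trans)
  then show "\<exists>A\<subseteq>W. finite A \<and> W = spanned R M A" using A by blast
qed

text \<open>The kernel is not made into a module of its own: its chain condition is phrased through
  the submodules of \<open>M\<close> that it contains. A submodule \<open>W\<close> is generated by
  lifts of generators of its image together with generators of its part inside the kernel.\<close>

lemma noeth_extension:
  assumes "module R M" "module R N" "f \<in> mod_hom R M N" "noeth R N"
    and ker: "\<And>W. submodule W R M \<Longrightarrow> W \<subseteq> {x \<in> carrier M. f x = \<zero>\<^bsub>N\<^esub>} \<Longrightarrow>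
      \<exists>A\<subseteq>W. finite A \<and> W = spanned R M A"
  shows "noeth R M"
  unfolding noeth_def
proof (intro allI impI)
  interpret M: module R M by fact
  interpret N: module R N by fact
  fix W assume W: "submodule W R M"
  note D = submoduleD[OF assms(1) W]
  let ?K = "{x \<in> carrier M. f x = \<zero>\<^bsub>N\<^esub>}"
  obtain B where B: "B \<subseteq> f ` W" "finite B" "f ` W = spanned R N B"
    by (rule noethD[OF assms(4) submodule_image[OF assms(1-3) W]])
  obtain A where A: "A \<subseteq> W" "finite A" "B = f ` A"
    using finite_subset_image[OF B(2,1)] by blast
  have "submodule (W \<inter> ?K) R M"
    by (rule submodule_Int[OF assms(1) W submodule_kernel[OF assms(1-3)]])
  from ker[OF this] obtain C where C: "C \<subseteq> W \<inter> ?K" "finite C" "W \<inter> ?K = spanned R M C" by blast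
  have AC: "A \<union> C \<subseteq> carrier M" using A C D(1) by auto
  note S = submoduleD[OF assms(1) submodule_spanned[OF assms(1) AC]]
  have "W \<subseteq> spanned R M (A \<union> C)"
  proof
    fix w assume w: "w \<in> W"
    have "f w \<in> spanned R N (f ` A)" using w B(3) A(3) by blast
    then have "f w \<in> f ` spanned R M A"
      using spanned_image[OF assms(1-3), of A] A(1) D(1) by auto
    then obtain a where a: "a \<in> spanned R M A" "f w = f a" by auto
    have aW: "a \<in> W" using a(1) spanned_least[OF W A(1)] by auto
    have aM: "a \<in> carrier M" "w \<in> carrier M" using aW D(1) w by auto
    have "f (w \<ominus>\<^bsub>M\<^esub> a) = \<zero>\<^bsub>N\<^esub>"
      using hom_minus[OF assms(1-3) aM(2,1)] a(2) mod_homD(1)[OF assms(3) aM(1)]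
      by (simp add: a_minus_def N.r_neg)
    moreover have "w \<ominus>\<^bsub>M\<^esub> a \<in> W" by (rule D(5)[OF w aW])
    ultimately have "w \<ominus>\<^bsub>M\<^esub> a \<in> spanned R M C" using C(3) aM by auto
    then have 1: "w \<ominus>\<^bsub>M\<^esub> a \<in> spanned R M (A \<union> C)" using spanned_mono[of C "A \<union> C"] by blast
    have 2: "a \<in> spanned R M (A \<union> C)" using a(1) spanned_mono[of A "A \<union> C"] by blast
    have "w = (w \<ominus>\<^bsub>M\<^esub> a) \<oplus>\<^bsub>M\<^esub> a" using aM by (simp add: a_minus_def M.a_assoc M.l_neg)
    then show "w \<in> spanned R M (A \<union> C)" using S(3)[OF 1 2] by simp
  qed
  moreover have "spanned R M (A \<union> C) \<subseteq> W" by (rule spanned_least[OF W]) (use A C in auto)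
  ultimately show "\<exists>A\<subseteq>W. finite A \<and> W = spanned R M A"
    using A C by (intro exI[of _ "A \<union> C"]) auto
qed

lemma chain_Union_submodule:
  assumes "module R M" "subset.chain {W. submodule W R M} C" "C \<noteq> {}"
  shows "submodule (\<Union>C) R M"
proof (rule submoduleI'[OF assms(1)])
  have sub: "\<And>W. W \<in> C \<Longrightarrow> submodule W R M" using assms(2) by (auto simp: subset.chain_def)
  note D = submoduleD[OF assms(1) sub]
  show "\<Union>C \<subseteq> carrier M" using D by auto
  show "\<zero>\<^bsub>M\<^esub> \<in> \<Union>C" using D(2) assms(3) by auto
  show "r \<odot>\<^bsub>M\<^esub> x \<in> \<Union>C" if "r \<in> carrier R" "x \<in> \<Union>C" for r x using that D(6) by auto
  show "x \<oplus>\<^bsub>M\<^esub> y \<in> \<Union>C" if xy: "x \<in> \<Union>C" "y \<in> \<Union>C" for x y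
  proof -
    obtain V W where VW: "V \<in> C" "W \<in> C" "x \<in> V" "y \<in> W" using xy by auto
    then have "V \<subseteq> W \<or> W \<subseteq> V" using assms(2) by (auto simp: subset.chain_def)
    then show ?thesis
    proof
      assume "V \<subseteq> W" then show ?thesis using D(3)[OF VW(2), of x y] VW by auto
    next
      assume "W \<subseteq> V" then show ?thesis using D(3)[OF VW(1), of x y] VW by auto
    qed
  qed
qed

text \<open>The union of a chain is finitely generated, and its finitely many generators already lie
  in one member, so Zorn's lemma applies. In this form the chain condition drives Nakayama's lemma,
  the integral equations and the splitting off of summands.\<close>

lemma noeth_maximal:
  assumes "module R M" "noeth R M" "Z \<noteq> {}" "\<And>W. W \<in> Z \<Longrightarrow> submodule W R M"
  obtains W where "W \<in> Z" "\<And>V. V \<in> Z \<Longrightarrow> W \<subseteq> V \<Longrightarrow> V = W"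
proof -
  have "\<exists>W\<in>Z. \<forall>V\<in>Z. W \<subseteq> V \<longrightarrow> V = W"
  proof (rule subset_Zorn_nonempty[OF assms(3)])
    fix C assume C: "C \<noteq> {}" "subset.chain Z C"
    have C': "subset.chain {W. submodule W R M} C"
      using C(2) assms(4) by (auto simp: subset.chain_def)
    obtain A where A: "A \<subseteq> \<Union>C" "finite A" "\<Union>C = spanned R M A"
      by (rule noethD[OF assms(2) chain_Union_submodule[OF assms(1) C' C(1)]])
    obtain W where W: "W \<in> C" "A \<subseteq> W"
      using finite_subset_Union_chain[OF A(2,1) C(1)] C(2) by blast
    have "\<Union>C \<subseteq> W" using spanned_least[of W R M A] A(3) W assms(4) C(2)
      by (auto simp: subset.chain_def)
    then have "\<Union>C = W" using W(1) by auto
    then show "\<Union>C \<in> Z" using W(1) C(2) by (auto simp: subset.chain_def)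
  qed
  then show ?thesis using that by blast
qed

lemma submodule_add_cyclic:
  assumes "module R M" "submodule W R M" "x \<in> carrier M"
  shows "submodule {(r \<odot>\<^bsub>M\<^esub> x) \<oplus>\<^bsub>M\<^esub> w | r w. r \<in> carrier R \<and> w \<in> W} R M" (is "submodule ?S R M")
    and "x \<in> {(r \<odot>\<^bsub>M\<^esub> x) \<oplus>\<^bsub>M\<^esub> w | r w. r \<in> carrier R \<and> w \<in> W}"
    and "W \<subseteq> {(r \<odot>\<^bsub>M\<^esub> x) \<oplus>\<^bsub>M\<^esub> w | r w. r \<in> carrier R \<and> w \<in> W}"
proof -
  interpret M: module R M by fact
  note D = submoduleD[OF assms(1,2)]
  note Dc = subsetD[OF D(1)]
  show "x \<in> ?S" using assms(3) D(2) by (auto intro!: exI[of _ "\<one>\<^bsub>R\<^esub>"] exI[of _ "\<zero>\<^bsub>M\<^esub>"])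
  show "W \<subseteq> ?S"
  proof
    fix w assume "w \<in> W"
    then show "w \<in> ?S" using assms(3) Dc by (auto intro!: exI[of _ "\<zero>\<^bsub>R\<^esub>"] exI[of _ w])
  qed
  show "submodule ?S R M"
  proof (rule submoduleI'[OF assms(1)])
    show "?S \<subseteq> carrier M" using assms(3) Dc by auto
    show "\<zero>\<^bsub>M\<^esub> \<in> ?S"
      using assms(3) D(2) by (auto intro!: exI[of _ "\<zero>\<^bsub>R\<^esub>"] exI[of _ "\<zero>\<^bsub>M\<^esub>"])
    show "u \<oplus>\<^bsub>M\<^esub> v \<in> ?S" if uv: "u \<in> ?S" "v \<in> ?S" for u v
    proof -
      obtain r w r' w' where rw: "r \<in> carrier R" "w \<in> W" "r' \<in> carrier R" "w' \<in> W"
        "u = (r \<odot>\<^bsub>M\<^esub> x) \<oplus>\<^bsub>M\<^esub> w" "v = (r' \<odot>\<^bsub>M\<^esub> x) \<oplus>\<^bsub>M\<^esub> w'" using uv by auto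
      have "u \<oplus>\<^bsub>M\<^esub> v = ((r \<oplus>\<^bsub>R\<^esub> r') \<odot>\<^bsub>M\<^esub> x) \<oplus>\<^bsub>M\<^esub> (w \<oplus>\<^bsub>M\<^esub> w')"
        using rw Dc assms(3) by (simp add: M.smult_l_distr M.a_ac)
      moreover have "w \<oplus>\<^bsub>M\<^esub> w' \<in> W" using D(3) rw by auto
      ultimately show ?thesis using rw M.R.a_closed by blast
    qed
    show "a \<odot>\<^bsub>M\<^esub> u \<in> ?S" if a: "a \<in> carrier R" and u: "u \<in> ?S" for a u
    proof -
      obtain r w where rw: "r \<in> carrier R" "w \<in> W" "u = (r \<odot>\<^bsub>M\<^esub> x) \<oplus>\<^bsub>M\<^esub> w" using u by auto
      have "a \<odot>\<^bsub>M\<^esub> u = ((a \<otimes>\<^bsub>R\<^esub> r) \<odot>\<^bsub>M\<^esub> x) \<oplus>\<^bsub>M\<^esub> (a \<odot>\<^bsub>M\<^esub> w)"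
        using rw Dc assms(3) a by (simp add: M.smult_r_distr M.smult_assoc1)
      moreover have "a \<odot>\<^bsub>M\<^esub> w \<in> W" using D(6) rw a by auto
      ultimately show ?thesis using rw a M.R.m_closed by blast
    qed
  qed
qed

section \<open>Free modules and free resolutions\<close>

lemma free_module_simps:
  "carrier (free_module R n) = {..<n} \<rightarrow>\<^sub>E carrier R"
  "\<zero>\<^bsub>free_module R n\<^esub> = (\<lambda>i\<in>{..<n}. \<zero>\<^bsub>R\<^esub>)"
  "x \<oplus>\<^bsub>free_module R n\<^esub> y = (\<lambda>i\<in>{..<n}. x i \<oplus>\<^bsub>R\<^esub> y i)"
  "r \<odot>\<^bsub>free_module R n\<^esub> x = (\<lambda>i\<in>{..<n}. r \<otimes>\<^bsub>R\<^esub> x i)"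
  by (simp_all add: free_module_def)

lemma free_memD: "x \<in> carrier (free_module R n) \<Longrightarrow> i < n \<Longrightarrow> x i \<in> carrier R"
  by (auto simp: free_module_simps)

lemma free_mem_arb: "x \<in> carrier (free_module R n) \<Longrightarrow> \<not> i < n \<Longrightarrow> x i = undefined"
  using PiE_arb[of x "{..<n}" "\<lambda>_. carrier R" i] by (simp add: free_module_simps)

lemma module_free:
  fixes R :: "'a ring"
  assumes "cring R" shows "module R (free_module R n)"
proof -
  interpret cring R by fact
  have ag: "abelian_group (free_module R n)"
  proof (rule abelian_groupI)
    fix x assume x: "x \<in> carrier (free_module R n)"
    have xi: "\<And>i. i < n \<Longrightarrow> x i \<in> carrier R" using x by (auto simp: free_module_simps)
    have "(\<lambda>i\<in>{..<n}. \<ominus>\<^bsub>R\<^esub> x i) \<oplus>\<^bsub>free_module R n\<^esub> x = \<zero>\<^bsub>free_module R n\<^esub>"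
      using xi by (simp add: free_module_simps l_neg cong: restrict_cong)
    moreover have "(\<lambda>i\<in>{..<n}. \<ominus>\<^bsub>R\<^esub> x i) \<in> carrier (free_module R n)"
      using x by (auto simp: free_module_simps)
    ultimately show "\<exists>y\<in>carrier (free_module R n). y \<oplus>\<^bsub>free_module R n\<^esub> x = \<zero>\<^bsub>free_module R n\<^esub>"
      by blast
  next
    fix x y z
    assume "x \<in> carrier (free_module R n)" "y \<in> carrier (free_module R n)"
      "z \<in> carrier (free_module R n)"
    note c = this[THEN free_memD]
    show "x \<oplus>\<^bsub>free_module R n\<^esub> y \<oplus>\<^bsub>free_module R n\<^esub> z = x \<oplus>\<^bsub>free_module R n\<^esub> (y \<oplus>\<^bsub>free_module R n\<^esub> z)"
      using c by (simp add: free_module_simps a_assoc cong: restrict_cong)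
  next
    fix x y
    assume "x \<in> carrier (free_module R n)" "y \<in> carrier (free_module R n)"
    note c = this[THEN free_memD]
    show "x \<oplus>\<^bsub>free_module R n\<^esub> y = y \<oplus>\<^bsub>free_module R n\<^esub> x"
      using c by (simp add: free_module_simps a_comm cong: restrict_cong)
    show "x \<oplus>\<^bsub>free_module R n\<^esub> y \<in> carrier (free_module R n)"
      using c by (simp add: free_module_simps)
  next
    fix x assume x: "x \<in> carrier (free_module R n)"
    have "\<zero>\<^bsub>free_module R n\<^esub> \<oplus>\<^bsub>free_module R n\<^esub> x = restrict x {..<n}"
      using free_memD[OF x] by (simp add: free_module_simps cong: restrict_cong)
    then show "\<zero>\<^bsub>free_module R n\<^esub> \<oplus>\<^bsub>free_module R n\<^esub> x = x"
      using x by (simp add: free_module_simps PiE_restrict)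
  qed (simp add: free_module_simps)
  show ?thesis
  proof (rule moduleI[OF _ ag])
    fix x assume x: "x \<in> carrier (free_module R n)"
    have "\<one>\<^bsub>R\<^esub> \<odot>\<^bsub>free_module R n\<^esub> x = restrict x {..<n}"
      using free_memD[OF x] by (simp add: free_module_simps cong: restrict_cong)
    then show "\<one>\<^bsub>R\<^esub> \<odot>\<^bsub>free_module R n\<^esub> x = x"
      using x by (simp add: free_module_simps PiE_restrict)
  next
    fix a x y
    assume a: "a \<in> carrier R" and "x \<in> carrier (free_module R n)" "y \<in> carrier (free_module R n)"
    note c = this(2,3)[THEN free_memD]
    show "a \<odot>\<^bsub>free_module R n\<^esub> (x \<oplus>\<^bsub>free_module R n\<^esub> y) =
        (a \<odot>\<^bsub>free_module R n\<^esub> x) \<oplus>\<^bsub>free_module R n\<^esub> (a \<odot>\<^bsub>free_module R n\<^esub> y)"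
      using a c by (simp add: free_module_simps r_distr cong: restrict_cong)
  next
    fix a b x
    assume a: "a \<in> carrier R" "b \<in> carrier R" and "x \<in> carrier (free_module R n)"
    note c = this(3)[THEN free_memD]
    show "(a \<oplus>\<^bsub>R\<^esub> b) \<odot>\<^bsub>free_module R n\<^esub> x =
        (a \<odot>\<^bsub>free_module R n\<^esub> x) \<oplus>\<^bsub>free_module R n\<^esub> (b \<odot>\<^bsub>free_module R n\<^esub> x)"
      using a c by (simp add: free_module_simps l_distr cong: restrict_cong)
    show "(a \<otimes>\<^bsub>R\<^esub> b) \<odot>\<^bsub>free_module R n\<^esub> x = a \<odot>\<^bsub>free_module R n\<^esub> (b \<odot>\<^bsub>free_module R n\<^esub> x)"
      using a c by (simp add: free_module_simps m_assoc cong: restrict_cong)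
    show "a \<odot>\<^bsub>free_module R n\<^esub> x \<in> carrier (free_module R n)"
      using a c by (simp add: free_module_simps)
  qed (rule assms)
qed

section \<open>Linear combinations and maps out of R^n\<close>

primrec lin_sum :: "('a, 'm) module \<Rightarrow> (nat \<Rightarrow> 'm) \<Rightarrow> (nat \<Rightarrow> 'a) \<Rightarrow> nat \<Rightarrow> 'm" where
  "lin_sum M x r 0 = \<zero>\<^bsub>M\<^esub>"
| "lin_sum M x r (Suc n) = lin_sum M x r n \<oplus>\<^bsub>M\<^esub> (r n \<odot>\<^bsub>M\<^esub> x n)"

definition lin_map :: "'a ring \<Rightarrow> ('a, 'm) module \<Rightarrow> (nat \<Rightarrow> 'm) \<Rightarrow> nat \<Rightarrow> (nat \<Rightarrow> 'a) \<Rightarrow> 'm" where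
  "lin_map R M x n = (\<lambda>r\<in>carrier (free_module R n). lin_sum M x r n)"

definition unit_vec :: "'a ring \<Rightarrow> nat \<Rightarrow> nat \<Rightarrow> nat \<Rightarrow> 'a" where
  "unit_vec R n i = (\<lambda>j\<in>{..<n}. if j = i then \<one>\<^bsub>R\<^esub> else \<zero>\<^bsub>R\<^esub>)"

lemma unit_vec_closed: "cring R \<Longrightarrow> unit_vec R n i \<in> carrier (free_module R n)"
proof -
  assume "cring R"
  then interpret cring R .
  show ?thesis by (auto simp: unit_vec_def free_module_simps)
qed

lemma lin_sum_cong: "(\<And>i. i < n \<Longrightarrow> r i = r' i) \<Longrightarrow> (\<And>i. i < n \<Longrightarrow> x i = x' i) \<Longrightarrow>
    lin_sum M x r n = lin_sum M x' r' n"
  by (induction n) auto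

lemma lin_sum_submodule:
  assumes "module R M" "submodule W R M"
    "\<And>i. i < n \<Longrightarrow> x i \<in> W" "\<And>i. i < n \<Longrightarrow> r i \<in> carrier R"
  shows "lin_sum M x r n \<in> W"
  using assms(3,4) by (induction n) (auto simp: submoduleD[OF assms(1,2)])

lemma lin_sum_closed:
  assumes "module R M" "\<And>i. i < n \<Longrightarrow> x i \<in> carrier M" "\<And>i. i < n \<Longrightarrow> r i \<in> carrier R"
  shows "lin_sum M x r n \<in> carrier M"
  by (rule lin_sum_submodule[OF assms(1) submodule_carrier]) (use assms in auto)

lemma lin_sum_add:
  assumes "module R M" "\<And>i. i < n \<Longrightarrow> x i \<in> carrier M"
    "\<And>i. i < n \<Longrightarrow> r i \<in> carrier R" "\<And>i. i < n \<Longrightarrow> s i \<in> carrier R"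
  shows "lin_sum M x (\<lambda>i. r i \<oplus>\<^bsub>R\<^esub> s i) n = lin_sum M x r n \<oplus>\<^bsub>M\<^esub> lin_sum M x s n"
  using assms(2-)
proof (induction n)
  interpret module R M by fact
  case 0 then show ?case by simp
next
  interpret module R M by fact
  case (Suc n)
  have "lin_sum M x r n \<in> carrier M" "lin_sum M x s n \<in> carrier M"
    by (rule lin_sum_closed[OF assms(1)]; use Suc.prems in simp)+
  then show ?case using Suc by (simp add: smult_l_distr M.a_ac)
qed

lemma lin_sum_smult:
  assumes "module R M" "\<And>i. i < n \<Longrightarrow> x i \<in> carrier M"
    "\<And>i. i < n \<Longrightarrow> r i \<in> carrier R" "a \<in> carrier R"
  shows "lin_sum M x (\<lambda>i. a \<otimes>\<^bsub>R\<^esub> r i) n = a \<odot>\<^bsub>M\<^esub> lin_sum M x r n"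
  using assms(2-3)
proof (induction n)
  interpret module R M by fact
  case 0 then show ?case using assms(4) by simp
next
  interpret module R M by fact
  case (Suc n)
  have "lin_sum M x r n \<in> carrier M"
    by (rule lin_sum_closed[OF assms(1)]; use Suc.prems in simp)
  then show ?case using Suc assms(4) by (simp add: smult_r_distr smult_assoc1)
qed

lemma hom_lin_sum:
  assumes "module R M" "module R N" "f \<in> mod_hom R M N"
    "\<And>i. i < n \<Longrightarrow> x i \<in> carrier M" "\<And>i. i < n \<Longrightarrow> r i \<in> carrier R"
  shows "f (lin_sum M x r n) = lin_sum N (\<lambda>i. f (x i)) r n"
  using assms(4-)
proof (induction n)
  case 0 then show ?case using hom_0[OF assms(1-3)] by simp
next
  interpret module R M by fact
  case (Suc n)
  have "lin_sum M x r n \<in> carrier M"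
    by (rule lin_sum_closed[OF assms(1)]; use Suc.prems in simp)
  then show ?case using Suc by (simp add: mod_homD[OF assms(3)])
qed

lemma lin_map_hom:
  assumes "module R M" "\<And>i. i < n \<Longrightarrow> x i \<in> carrier M"
  shows "lin_map R M x n \<in> mod_hom R (free_module R n) M"
proof -
  interpret module R M by fact
  have R: "cring R" ..
  have c: "r i \<in> carrier R" if "r \<in> carrier (free_module R n)" "i < n" for r i
    using that by (auto simp: free_module_simps)
  show ?thesis unfolding lin_map_def
  proof (rule mod_homI[OF module_free[OF R]])
    fix r s assume rs: "r \<in> carrier (free_module R n)" "s \<in> carrier (free_module R n)"
    have "lin_sum M x (r \<oplus>\<^bsub>free_module R n\<^esub> s) n = lin_sum M x (\<lambda>i. r i \<oplus>\<^bsub>R\<^esub> s i) n"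
      by (rule lin_sum_cong) (auto simp: free_module_simps)
    also have "\<dots> = lin_sum M x r n \<oplus>\<^bsub>M\<^esub> lin_sum M x s n"
      by (rule lin_sum_add[OF assms]) (use rs c in auto)
    finally show "lin_sum M x (r \<oplus>\<^bsub>free_module R n\<^esub> s) n = lin_sum M x r n \<oplus>\<^bsub>M\<^esub> lin_sum M x s n" .
  next
    fix a s assume rs: "a \<in> carrier R" "s \<in> carrier (free_module R n)"
    have "lin_sum M x (a \<odot>\<^bsub>free_module R n\<^esub> s) n = lin_sum M x (\<lambda>i. a \<otimes>\<^bsub>R\<^esub> s i) n"
      by (rule lin_sum_cong) (auto simp: free_module_simps)
    also have "\<dots> = a \<odot>\<^bsub>M\<^esub> lin_sum M x s n"
      by (rule lin_sum_smult[OF assms]) (use rs c in auto)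
    finally show "lin_sum M x (a \<odot>\<^bsub>free_module R n\<^esub> s) n = a \<odot>\<^bsub>M\<^esub> lin_sum M x s n" .
  qed (use c assms in \<open>auto intro: lin_sum_closed\<close>)
qed

lemma lin_sum_unit_vec:
  assumes "module R M" "\<And>i. i < n \<Longrightarrow> x i \<in> carrier M" "k < n"
  shows "lin_sum M x (unit_vec R n k) n = x k"
proof -
  interpret module R M by fact
  have "lin_sum M x (unit_vec R n k) j = (if k < j then x k else \<zero>\<^bsub>M\<^esub>)" if "j \<le> n" for j
    using that assms(2,3)
    by (induction j) (auto simp: unit_vec_def less_Suc_eq)
  from this[of n] assms(3) show ?thesis by simp
qed

lemma lin_sum_expand:
  assumes "cring R" "r \<in> carrier (free_module R n)"
  shows "lin_sum (free_module R n) (unit_vec R n) r n = r"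
proof -
  interpret cring R by fact
  have r: "\<And>i. i < n \<Longrightarrow> r i \<in> carrier R" using assms(2) by (auto simp: free_module_simps)
  have "lin_sum (free_module R n) (unit_vec R n) r k = (\<lambda>j\<in>{..<n}. if j < k then r j else \<zero>\<^bsub>R\<^esub>)" if "k \<le> n" for k
    using that
  proof (induction k)
    case 0 then show ?case by (simp add: free_module_simps)
  next
    case (Suc k)
    then show ?case using r by (auto simp: free_module_simps unit_vec_def fun_eq_iff less_Suc_eq)
  qed
  from this[of n] have "lin_sum (free_module R n) (unit_vec R n) r n = (\<lambda>j\<in>{..<n}. r j)"
    by (simp cong: restrict_cong)
  then show ?thesis using assms(2) by (simp add: free_module_simps PiE_restrict)
qed

lemma hom_free_eq:
  assumes "module R M" "f \<in> mod_hom R (free_module R n) M" "r \<in> carrier (free_module R n)"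
  shows "f r = lin_sum M (\<lambda>i. f (unit_vec R n i)) r n"
proof -
  interpret module R M by fact
  have R: "cring R" ..
  have "f r = f (lin_sum (free_module R n) (unit_vec R n) r n)"
    using lin_sum_expand[OF R assms(3)] by simp
  also have "\<dots> = lin_sum M (\<lambda>i. f (unit_vec R n i)) r n"
    by (rule hom_lin_sum[OF module_free[OF R] assms(1,2)])
      (use assms(3) unit_vec_closed[OF R] in \<open>auto simp: free_module_simps\<close>)
  finally show ?thesis .
qed

lemma hom_free_eqI:
  assumes "module R M" "f \<in> mod_hom R (free_module R n) M" "g \<in> mod_hom R (free_module R n) M"
    "\<And>i. i < n \<Longrightarrow> f (unit_vec R n i) = g (unit_vec R n i)"
  shows "f = g"
  by (rule hom_eqI[OF assms(2,3)])
    (simp add: hom_free_eq[OF assms(1,2)] hom_free_eq[OF assms(1,3)] assms(4) cong: lin_sum_cong)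

lemma spanned_finite_image:
  assumes "module R M" "finite A" "A \<subseteq> carrier M"
  obtains n g where "g \<in> mod_hom R (free_module R n) M" "g ` carrier (free_module R n) = spanned R M A"
proof -
  interpret module R M by fact
  have R: "cring R" ..
  obtain n and x :: "nat \<Rightarrow> _" where x: "A = x ` {i. i < n}"
    using assms(2) unfolding finite_conv_nat_seg_image by auto
  have xc: "\<And>i. i < n \<Longrightarrow> x i \<in> carrier M" using x assms(3) by auto
  let ?g = "lin_map R M x n"
  have g: "?g \<in> mod_hom R (free_module R n) M" by (rule lin_map_hom[OF assms(1) xc])
  have "?g ` carrier (free_module R n) \<subseteq> spanned R M A"
  proof (clarsimp simp: lin_map_def)
    fix r assume r: "r \<in> carrier (free_module R n)"
    show "lin_sum M x r n \<in> spanned R M A"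
      by (rule lin_sum_submodule[OF assms(1) submodule_spanned[OF assms(1,3)]])
        (use x spanned_subset[of A R M] r in \<open>auto simp: free_module_simps\<close>)
  qed
  moreover have "spanned R M A \<subseteq> ?g ` carrier (free_module R n)"
  proof (rule spanned_least[OF submodule_image[OF module_free[OF R] assms(1) g submodule_carrier[OF module_free[OF R]]]])
    show "A \<subseteq> ?g ` carrier (free_module R n)"
    proof
      fix a assume "a \<in> A"
      then obtain i where i: "i < n" "a = x i" using x by auto
      then have "a = ?g (unit_vec R n i)"
        using lin_sum_unit_vec[OF assms(1) xc i(1)] unit_vec_closed[OF R] by (simp add: lin_map_def)
      then show "a \<in> ?g ` carrier (free_module R n)" using unit_vec_closed[OF R] by blast
    qed
  qed
  ultimately show ?thesis using that g by blast
qed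

lemma fg_surj:
  assumes "fg_module R M"
  obtains n g where "g \<in> mod_hom R (free_module R n) M" "g ` carrier (free_module R n) = carrier M"
proof -
  obtain A where "module R M" "A \<subseteq> carrier M" "finite A" "carrier M = spanned R M A"
    using assms unfolding fg_module_iff by auto
  then show ?thesis using spanned_finite_image[of R M A] that by metis
qed

text \<open>Projectivity of R^m: preimages of the images of the unit vectors may be picked at will,
  and a map out of R^m is determined by its values there.\<close>

lemma free_lift:
  assumes "module R P" "module R N" "q \<in> mod_hom R P N" "carrier N \<subseteq> q ` carrier P"
    "s \<in> mod_hom R (free_module R m) N"
  obtains t where "t \<in> mod_hom R (free_module R m) P"
    "compose (carrier (free_module R m)) q t = s"
proof -
  interpret module R P by fact
  have R: "cring R" ..
  have "\<exists>p. p \<in> carrier P \<and> q p = s (unit_vec R m i)" for i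
    using assms(4) mod_homD(1)[OF assms(5) unit_vec_closed[OF R]] by (metis image_iff subsetD)
  then obtain p where p: "\<And>i. p i \<in> carrier P" "\<And>i. q (p i) = s (unit_vec R m i)" by metis
  let ?t = "lin_map R P p m"
  have t: "?t \<in> mod_hom R (free_module R m) P" by (rule lin_map_hom[OF assms(1) p(1)])
  have "compose (carrier (free_module R m)) q ?t = s"
  proof (rule hom_free_eqI[OF assms(2) compose_hom[OF module_free[OF R] t assms(3)] assms(5)])
    fix i assume "i < m"
    then show "compose (carrier (free_module R m)) q ?t (unit_vec R m i) = s (unit_vec R m i)"
      using p lin_sum_unit_vec[OF assms(1), where x=p and n=m and k=i] unit_vec_closed[OF R]
      by (simp add: compose_def lin_map_def)
  qed
  with t show ?thesis using that by blast
qed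

section \<open>Noetherianness of R^n and of its quotients\<close>

lemma free_module_0_carrier: "carrier (free_module R 0) = {\<zero>\<^bsub>free_module R 0\<^esub>}"
  by (simp add: free_module_simps restrict_def)

lemma noeth_free_0:
  assumes "cring R" shows "noeth R (free_module R 0)"
  unfolding noeth_def
proof (intro allI impI)
  fix W assume W: "submodule W R (free_module R 0)"
  note M = module_free[OF assms, of 0]
  have "W = spanned R (free_module R 0) {}"
    using submoduleD(1,2)[OF M W] submoduleD(1,2)[OF M submodule_spanned[OF M, of "{}"]]
    unfolding free_module_0_carrier by auto
  then show "\<exists>A\<subseteq>W. finite A \<and> W = spanned R (free_module R 0) A" by blast
qed

text \<open>Forgetting the last coordinate maps R^(n + 1) to R^n with a copy of R as kernel, and the
  submodules of that copy are the ideals of R.\<close>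

lemma noeth_free:
  fixes R :: "'a ring" (structure)
  assumes "cring R" "noetherian_ring R" shows "noeth R (free_module R n)"
proof (induction n)
  case 0 show ?case by (rule noeth_free_0[OF assms(1)])
next
  case (Suc n)
  interpret cring R by fact
  let ?F = "free_module R (Suc n)" and ?G = "free_module R n"
  note F = module_free[OF assms(1), of "Suc n"] and G = module_free[OF assms(1), of n]
  let ?f = "\<lambda>r\<in>carrier ?F. \<lambda>i\<in>{..<n}. r i"
  have f: "?f \<in> mod_hom R ?F ?G"
  proof (rule mod_homI[OF F])
    fix x assume x: "x \<in> carrier ?F"
    show "(\<lambda>i\<in>{..<n}. x i) \<in> carrier ?G" using free_memD[OF x] by (simp add: free_module_simps)
    fix y assume "y \<in> carrier ?F"
    show "(\<lambda>i\<in>{..<n}. (x \<oplus>\<^bsub>?F\<^esub> y) i) = (\<lambda>i\<in>{..<n}. x i) \<oplus>\<^bsub>?G\<^esub> (\<lambda>i\<in>{..<n}. y i)"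
      by (simp add: free_module_simps cong: restrict_cong)
  next
    fix a x
    show "(\<lambda>i\<in>{..<n}. (a \<odot>\<^bsub>?F\<^esub> x) i) = a \<odot>\<^bsub>?G\<^esub> (\<lambda>i\<in>{..<n}. x i)"
      by (simp add: free_module_simps cong: restrict_cong)
  qed
  show ?case
  proof (rule noeth_extension[OF F G f Suc])
    fix W assume W: "submodule W R ?F" and ker: "W \<subseteq> {x \<in> carrier ?F. ?f x = \<zero>\<^bsub>?G\<^esub>}"
    note D = submoduleD[OF F W]
    \<comment> \<open>\<open>v\<close> puts a scalar into the last coordinate. Pulling back along
      \<open>v\<close> turns submodules into ideals, to which the Noetherian hypothesis on R
      applies.\<close>
    define v where "v a = (\<lambda>i\<in>{..<Suc n}. if i = n then a else \<zero>)" for a :: 'a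
    have v_eq: "w = v (w n)" if "w \<in> W" for w
    proof
      fix i
      have w: "w \<in> carrier ?F" "?f w = \<zero>\<^bsub>?G\<^esub>" using ker that by auto
      have "w i = \<zero>" if "i < n" using fun_cong[OF w(2), of i] w(1) that by (simp add: free_module_simps)
      moreover have "w i = undefined" if "\<not> i < Suc n" using free_mem_arb[OF w(1) that] .
      ultimately show "w i = v (w n) i" unfolding v_def by (cases "i < n"; cases "i = n") simp_all
    qed
    have wn: "w n \<in> carrier R" if "w \<in> W" for w using free_memD[OF subsetD[OF D(1) that]] by simp
    have v_add: "v (a \<oplus> b) = v a \<oplus>\<^bsub>?F\<^esub> v b" if "a \<in> carrier R" "b \<in> carrier R" for a b
      unfolding v_def free_module_simps by (rule restrict_ext) (use that in simp)
    have v_smult: "v (a \<otimes> b) = a \<odot>\<^bsub>?F\<^esub> v b" if "a \<in> carrier R" "b \<in> carrier R" for a b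
      unfolding v_def free_module_simps by (rule restrict_ext) (use that in simp)
    have v_closed: "v a \<in> carrier ?F" if "a \<in> carrier R" for a
      unfolding v_def free_module_simps by (rule restrict_PiE_iff[THEN iffD2]) (use that in simp)
    note v_hom = v_add v_smult v_closed
    have v_ideal: "ideal {a \<in> carrier R. v a \<in> V} R" if V: "submodule V R ?F" for V
    proof (rule idealI)
      note E = submoduleD[OF F V]
      show "ring R" by (rule ring_axioms)
      have v0: "v \<zero> = \<zero>\<^bsub>?F\<^esub>" by (auto simp: v_def free_module_simps)
      have vm: "v (\<ominus> a) \<in> V" if "a \<in> carrier R" "v a \<in> V" for a
      proof -
        have "v ((\<ominus> \<one>) \<otimes> a) = (\<ominus> \<one>) \<odot>\<^bsub>?F\<^esub> v a" using that by (intro v_smult) auto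
        moreover have "(\<ominus> \<one>) \<otimes> a = \<ominus> a" using that by (simp add: l_minus)
        ultimately show ?thesis using E(6)[of "\<ominus> \<one>" "v a"] that by simp
      qed
      show "\<And>a x. \<lbrakk>a \<in> {a \<in> carrier R. v a \<in> V}; x \<in> carrier R\<rbrakk> \<Longrightarrow> x \<otimes> a \<in> {a \<in> carrier R. v a \<in> V}"
        using E v_hom by auto
      show "a \<otimes> x \<in> {a \<in> carrier R. v a \<in> V}"
        if "a \<in> {a \<in> carrier R. v a \<in> V}" "x \<in> carrier R" for a x
        using that E(6)[of x "v a"] v_smult[of x a] m_comm[of a x] by auto
      show "subgroup {a \<in> carrier R. v a \<in> V} (add_monoid R)"
      proof (rule add.subgroupI)
        show "{a \<in> carrier R. v a \<in> V} \<noteq> {}" using v0 E(2) zero_closed by auto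
        show "\<And>a. a \<in> {a \<in> carrier R. v a \<in> V} \<Longrightarrow> \<ominus> a \<in> {a \<in> carrier R. v a \<in> V}"
          using vm by auto
      qed (use E v_hom in auto)
    qed
    have "ideal {a \<in> carrier R. v a \<in> W} R" by (rule v_ideal[OF W])
    then obtain A where A: "A \<subseteq> carrier R" "finite A" "{a \<in> carrier R. v a \<in> W} = Idl\<^bsub>R\<^esub> A"
      using noetherian_ring.finetely_gen[OF assms(2)] by blast
    have AW: "v ` A \<subseteq> W" using A(3) genideal_self[OF A(1)] by auto
    then have AF: "v ` A \<subseteq> carrier ?F" using D(1) by auto
    let ?S = "spanned R ?F (v ` A)"
    have le: "Idl\<^bsub>R\<^esub> A \<subseteq> {a \<in> carrier R. v a \<in> ?S}"
      by (rule genideal_minimal[OF v_ideal[OF submodule_spanned[OF F AF]]])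
        (use A(1) spanned_subset[of "v ` A" R ?F] in auto)
    have "W \<subseteq> ?S"
    proof
      fix w assume w: "w \<in> W"
      then have "w n \<in> {a \<in> carrier R. v a \<in> W}" using wn[OF w] v_eq[OF w] by simp
      then have "v (w n) \<in> ?S" using le unfolding A(3) by blast
      then show "w \<in> ?S" using v_eq[OF w] by simp
    qed
    moreover have "?S \<subseteq> W" by (rule spanned_least[OF W AW])
    ultimately show "\<exists>A\<subseteq>W. finite A \<and> W = spanned R ?F A"
      using AW A(2) by (intro exI[of _ "v ` A"]) auto
  qed
qed

lemma fg_imp_noeth:
  assumes "noetherian_ring R" "fg_module R M" shows "noeth R M"
proof -
  have M: "module R M" using assms(2) by (simp add: fg_module_def)
  then have R: "cring R" by (simp add: module_def)
  obtain n g where "g \<in> mod_hom R (free_module R n) M" "g ` carrier (free_module R n) = carrier M"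
    by (rule fg_surj[OF assms(2)])
  then show ?thesis using noeth_image[OF module_free[OF R] M _ _ noeth_free[OF R assms(1)]] by blast
qed

section \<open>Existence of free resolutions\<close>

lemma noeth_kernel_image:
  assumes "module R M" "module R N" "noeth R M" "f \<in> mod_hom R M N"
  obtains n g where "g \<in> mod_hom R (free_module R n) M"
    "g ` carrier (free_module R n) = {x \<in> carrier M. f x = \<zero>\<^bsub>N\<^esub>}"
proof -
  have K: "submodule {x \<in> carrier M. f x = \<zero>\<^bsub>N\<^esub>} R M" (is "submodule ?K R M")
    by (rule submodule_kernel[OF assms(1,2,4)])
  obtain A where "A \<subseteq> ?K" "finite A" "?K = spanned R M A" by (rule noethD[OF assms(3) K])
  then show ?thesis using spanned_finite_image[OF assms(1), of A] that by (metis (no_types, lifting) mem_Collect_eq subset_iff)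
qed

lemma a_kernel_eq: "a_kernel M N f = {x \<in> carrier M. f x = \<zero>\<^bsub>N\<^esub>}"
  by (simp add: a_kernel_def kernel_def)

lemma free_resolution_exists:
  fixes R :: "'a ring"
  assumes "noetherian_ring R" "fg_module R K"
  shows "\<exists>res. free_resolution R K res"
proof -
  have K: "module R K" using assms(2) by (simp add: fg_module_def)
  then have R: "cring R" by (simp add: module_def)
  let ?F = "free_module R"
  note F = module_free[OF R] and N = noeth_free[OF R assms(1)]
  obtain n0 e where e: "e \<in> mod_hom R (?F n0) K" "e ` carrier (?F n0) = carrier K"
    by (rule fg_surj[OF assms(2)])
  obtain n1 d0 where d0: "d0 \<in> mod_hom R (?F n1) (?F n0)"
    "d0 ` carrier (?F n1) = {x \<in> carrier (?F n0). e x = \<zero>\<^bsub>K\<^esub>}"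
    by (rule noeth_kernel_image[OF F K N e(1)])
  \<comment> \<open>A state (n, m, g) of the recursion is a map g from R^n to R^m; \<open>Q\<close>
    says that the next map ends in R^n and covers the kernel of g.\<close>
  define P where "P = (\<lambda>(n, m, g). g \<in> mod_hom R (?F n) (?F m))"
  define Q where "Q = (\<lambda>(n, m, g) (n', m', g'). m' = n \<and>
    g' ` carrier (?F n') = {x \<in> carrier (?F n). g x = \<zero>\<^bsub>?F m\<^esub>})"
  have "\<exists>s. \<forall>i. (P (s i) \<and> (i = 0 \<longrightarrow> s i = (n1, n0, d0))) \<and> Q (s i) (s (Suc i))"
  proof (rule dependent_nat_choice[where P = "\<lambda>i x. P x \<and> (i = 0 \<longrightarrow> x = (n1, n0, d0))" and Q = "\<lambda>i. Q"])
    show "\<exists>x. P x \<and> (0 = (0::nat) \<longrightarrow> x = (n1, n0, d0))" using d0 by (auto simp: P_def)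
    fix x and i :: nat assume "P x \<and> (i = 0 \<longrightarrow> x = (n1, n0, d0))"
    then obtain n m g where x: "x = (n, m, g)" "g \<in> mod_hom R (?F n) (?F m)" by (auto simp: P_def)
    obtain n' g' where "g' \<in> mod_hom R (?F n') (?F n)"
      "g' ` carrier (?F n') = {x \<in> carrier (?F n). g x = \<zero>\<^bsub>?F m\<^esub>}"
      by (rule noeth_kernel_image[OF F F N x(2)])
    then show "\<exists>y. (P y \<and> (Suc i = 0 \<longrightarrow> y = (n1, n0, d0))) \<and> Q x y"
      using x by (intro exI[of _ "(n', n, g')"]) (auto simp: P_def Q_def)
  qed
  then obtain s where s: "\<And>i. P (s i)" "s 0 = (n1, n0, d0)" "\<And>i. Q (s i) (s (Suc i))" by blast
  \<comment> \<open>The state \<open>s i\<close> starts at the module of degree i + 1. The ranks are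
    therefore shifted by one, and degree 0 receives \<open>n0\<close>, the rank of the source of the
    augmentation.\<close>
  define n where "n = case_nat n0 (\<lambda>i. fst (s i))"
  define d where "d i = snd (snd (s i))" for i
  have m: "fst (snd (s i)) = n i" for i
    using s(2) s(3)[of "i - 1"] by (cases i) (auto simp: n_def Q_def split: prod.splits)
  have d: "d i \<in> mod_hom R (?F (n (Suc i))) (?F (n i))" for i
    using s(1)[of i] m[of i] by (auto simp: P_def d_def n_def split: prod.splits)
  have ex: "d (Suc i) ` carrier (?F (n (Suc (Suc i)))) = {x \<in> carrier (?F (n (Suc i))). d i x = \<zero>\<^bsub>?F (n i)\<^esub>}" for i
    using s(3)[of i] m[of i] unfolding Q_def d_def n_def by (simp split: prod.splits)
  have "free_resolution R K (n, d, e)"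
    unfolding free_resolution_def
    using e d d0(2) ex s(2) by (auto simp: a_kernel_eq n_def d_def)
  then show ?thesis by blast
qed

section \<open>Maximal Cohen--Macaulay modules\<close>

lemma comm_group_hom_group:
  assumes "module R M" "module R N"
  shows "comm_group (hom_group R M N)"
proof -
  interpret M: module R M by fact
  interpret N: module R N by fact
  show ?thesis
  proof (rule comm_groupI)
    fix f g assume "f \<in> carrier (hom_group R M N)" "g \<in> carrier (hom_group R M N)"
    then show "f \<otimes>\<^bsub>hom_group R M N\<^esub> g \<in> carrier (hom_group R M N)"
      using hom_plus_closed[OF assms, of f g] by (simp add: hom_group_def hom_plus_def)
    show "f \<otimes>\<^bsub>hom_group R M N\<^esub> g = g \<otimes>\<^bsub>hom_group R M N\<^esub> f"
      using \<open>f \<in> _\<close> \<open>g \<in> _\<close> by (auto simp: hom_group_def N.a_comm mod_homD(1) intro!: restrict_ext)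
  next
    show "\<one>\<^bsub>hom_group R M N\<^esub> \<in> carrier (hom_group R M N)"
      using hom_zero_closed[OF assms] by (simp add: hom_group_def hom_zero_def)
  next
    fix f assume "f \<in> carrier (hom_group R M N)"
    then have f: "f \<in> mod_hom R M N" by (simp add: hom_group_def)
    show "\<one>\<^bsub>hom_group R M N\<^esub> \<otimes>\<^bsub>hom_group R M N\<^esub> f = f"
      by (rule hom_eqI[OF hom_plus_closed[OF assms hom_zero_closed[OF assms] f, unfolded hom_plus_def hom_zero_def, folded hom_group_def] f, THEN trans[rotated]])
        (use f in \<open>simp_all add: hom_group_def mod_homD(1)\<close>)
    have g: "hom_diff M N (hom_zero M N) f \<in> mod_hom R M N"
      by (rule hom_diff_closed[OF assms hom_zero_closed[OF assms] f])
    have "hom_diff M N (hom_zero M N) f \<otimes>\<^bsub>hom_group R M N\<^esub> f = \<one>\<^bsub>hom_group R M N\<^esub>"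
      using f by (auto simp: hom_group_def hom_diff_def hom_zero_def a_minus_def N.l_neg mod_homD(1) intro!: restrict_ext)
    then show "\<exists>g\<in>carrier (hom_group R M N). g \<otimes>\<^bsub>hom_group R M N\<^esub> f = \<one>\<^bsub>hom_group R M N\<^esub>"
      using g by (auto simp: hom_group_def)
  next
    fix f g h assume "f \<in> carrier (hom_group R M N)" "g \<in> carrier (hom_group R M N)" "h \<in> carrier (hom_group R M N)"
    then show "f \<otimes>\<^bsub>hom_group R M N\<^esub> g \<otimes>\<^bsub>hom_group R M N\<^esub> h = f \<otimes>\<^bsub>hom_group R M N\<^esub> (g \<otimes>\<^bsub>hom_group R M N\<^esub> h)"
      by (auto simp: hom_group_def N.a_assoc mod_homD(1) intro!: restrict_ext)
  qed
qed

lemma hom_group_simps: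
  "carrier (hom_group R M N) = mod_hom R M N"
  "f \<otimes>\<^bsub>hom_group R M N\<^esub> g = hom_plus M N f g"
  "\<one>\<^bsub>hom_group R M N\<^esub> = hom_zero M N"
  by (simp_all add: hom_group_def hom_plus_def hom_zero_def)

lemma inv_hom_group:
  assumes "module R M" "module R N" "f \<in> mod_hom R M N"
  shows "inv\<^bsub>hom_group R M N\<^esub> f = hom_diff M N (hom_zero M N) f"
proof -
  interpret N: module R N by fact
  interpret comm_group "hom_group R M N" by (rule comm_group_hom_group[OF assms(1,2)])
  show ?thesis
  proof (rule inv_equality)
    show "hom_diff M N (hom_zero M N) f \<otimes>\<^bsub>hom_group R M N\<^esub> f = \<one>\<^bsub>hom_group R M N\<^esub>"
      using assms(3) by (auto simp: hom_group_def hom_diff_def hom_zero_def a_minus_def N.l_neg mod_homD(1) intro!: restrict_ext)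
  qed (use assms hom_diff_closed[OF assms(1,2) hom_zero_closed[OF assms(1,2)]] in \<open>simp_all add: hom_group_simps\<close>)
qed

lemma subgroup_hom_groupI:
  assumes "module R M" "module R N" "H \<subseteq> mod_hom R M N" "hom_zero M N \<in> H"
    and "\<And>f g. f \<in> H \<Longrightarrow> g \<in> H \<Longrightarrow> hom_plus M N f g \<in> H"
    and "\<And>f. f \<in> H \<Longrightarrow> hom_diff M N (hom_zero M N) f \<in> H"
  shows "subgroup H (hom_group R M N)"
proof -
  interpret comm_group "hom_group R M N" by (rule comm_group_hom_group[OF assms(1,2)])
  show ?thesis
    by (rule subgroupI)
      (use assms in \<open>auto simp: hom_group_simps inv_hom_group[OF assms(1,2)] subset_iff\<close>)
qed

lemma compose_hom_plus_left:
  assumes "f \<in> mod_hom R M N"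
  shows "compose (carrier M) (hom_plus N L g h) f =
    hom_plus M L (compose (carrier M) g f) (compose (carrier M) h f)"
  using mod_homD(1)[OF assms] by (auto simp: compose_def hom_plus_def intro!: restrict_ext)

lemma compose_hom_diff_left:
  assumes "f \<in> mod_hom R M N"
  shows "compose (carrier M) (hom_diff N L g h) f =
    hom_diff M L (compose (carrier M) g f) (compose (carrier M) h f)"
  using mod_homD(1)[OF assms] by (auto simp: compose_def hom_diff_def intro!: restrict_ext)

lemma compose_hom_plus_right:
  assumes "f \<in> mod_hom R M N" "g \<in> mod_hom R M N" "h \<in> mod_hom R N L"
  shows "compose (carrier M) h (hom_plus M N f g) =
    hom_plus M L (compose (carrier M) h f) (compose (carrier M) h g)"
  using mod_homD(1)[OF assms(1)] mod_homD(1)[OF assms(2)] mod_homD(2)[OF assms(3)]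
  by (auto simp: compose_def hom_plus_def intro!: restrict_ext)

lemma compose_hom_diff_right:
  assumes "module R N" "module R L" "f \<in> mod_hom R M N" "g \<in> mod_hom R M N" "h \<in> mod_hom R N L"
  shows "compose (carrier M) h (hom_diff M N f g) =
    hom_diff M L (compose (carrier M) h f) (compose (carrier M) h g)"
  using mod_homD(1)[OF assms(3)] mod_homD(1)[OF assms(4)] hom_minus[OF assms(1,2,5)]
  by (auto simp: compose_def hom_diff_def intro!: restrict_ext)

lemma compose_hom_zero_left:
  assumes "f \<in> mod_hom R M N"
  shows "compose (carrier M) (hom_zero N L) f = hom_zero M L"
  using mod_homD(1)[OF assms] by (auto simp: compose_def hom_zero_def intro!: restrict_ext)

lemma compose_hom_zero_right:
  assumes "module R M" "module R N" "module R L" "h \<in> mod_hom R N L"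
  shows "compose (carrier M) h (hom_zero M N) = hom_zero M L"
  using hom_0[OF assms(2,3,4)] by (auto simp: compose_def hom_zero_def intro!: restrict_ext)

lemma hom_restrict_target:
  assumes "f \<in> mod_hom R M N" "\<And>x. x \<in> carrier M \<Longrightarrow> f x \<in> K"
  shows "f \<in> mod_hom R M (N\<lparr>carrier := K\<rparr>)"
  using assms by (auto simp: mod_hom_def)

lemma hom_extend_target:
  assumes "f \<in> mod_hom R M (N\<lparr>carrier := K\<rparr>)" "K \<subseteq> carrier N"
  shows "f \<in> mod_hom R M N"
  using assms by (auto simp: mod_hom_def)

section \<open>Cocycles on the resolution of the residue field\<close>

lemma max_ideal_maximal: "local_ring R \<Longrightarrow> maximalideal (max_ideal R) R"
  unfolding local_ring_def max_ideal_def by (rule theI') simp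

lemma local_ring_cring: "local_ring R \<Longrightarrow> cring R"
  by (simp add: local_ring_def)

text \<open>Free resolutions of finite rank exist for finitely generated modules; this legitimates
  the choice made in \<open>Ext\<close> for the residue field, which is generated by the class of
  1.\<close>

lemma fg_residue_module:
  fixes R :: "'a ring"
  assumes "local_ring R"
  shows "fg_module R (residue_module R)"
proof -
  interpret cring R by (rule local_ring_cring[OF assms])
  interpret I: maximalideal "max_ideal R" R by (rule max_ideal_maximal[OF assms])
  let ?I = "max_ideal R" let ?k = "R Quot ?I" let ?K = "residue_module R"
  interpret k: cring ?k by (rule I.quotient_is_cring) (rule is_cring)
  interpret h: ring_hom_ring R ?k "(+>\<^bsub>R\<^esub>) ?I" by (rule I.rcos_ring_hom_ring)
  have s: "carrier ?K = carrier ?k" "\<zero>\<^bsub>?K\<^esub> = \<zero>\<^bsub>?k\<^esub>" "x \<oplus>\<^bsub>?K\<^esub> y = x \<oplus>\<^bsub>?k\<^esub> y"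
    "r \<odot>\<^bsub>?K\<^esub> x = (?I +>\<^bsub>R\<^esub> r) \<otimes>\<^bsub>?k\<^esub> x" for x y r
    by (simp_all add: residue_module_def Let_def)
  have c: "?I +>\<^bsub>R\<^esub> r \<in> carrier ?k" if "r \<in> carrier R" for r using that by (rule h.hom_closed)
  have ag: "abelian_group ?K"
  proof (rule abelian_groupI)
    fix x assume "x \<in> carrier ?K"
    then show "\<exists>y\<in>carrier ?K. y \<oplus>\<^bsub>?K\<^esub> x = \<zero>\<^bsub>?K\<^esub>" unfolding s
      by (intro bexI[of _ "\<ominus>\<^bsub>?k\<^esub> x"]) (simp_all add: k.l_neg)
  qed (simp_all add: s k.a_ac)
  have M: "module R ?K"
  proof (rule moduleI[OF is_cring ag])
    show "\<And>a x. \<lbrakk>a \<in> carrier R; x \<in> carrier ?K\<rbrakk> \<Longrightarrow> a \<odot>\<^bsub>?K\<^esub> x \<in> carrier ?K"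
      unfolding s using c k.m_closed by blast
    show "\<And>a b x. \<lbrakk>a \<in> carrier R; b \<in> carrier R; x \<in> carrier ?K\<rbrakk> \<Longrightarrow>
        (a \<oplus>\<^bsub>R\<^esub> b) \<odot>\<^bsub>?K\<^esub> x = a \<odot>\<^bsub>?K\<^esub> x \<oplus>\<^bsub>?K\<^esub> b \<odot>\<^bsub>?K\<^esub> x"
      unfolding s using c h.hom_add k.l_distr by metis
    show "\<And>a x y. \<lbrakk>a \<in> carrier R; x \<in> carrier ?K; y \<in> carrier ?K\<rbrakk> \<Longrightarrow>
        a \<odot>\<^bsub>?K\<^esub> (x \<oplus>\<^bsub>?K\<^esub> y) = a \<odot>\<^bsub>?K\<^esub> x \<oplus>\<^bsub>?K\<^esub> a \<odot>\<^bsub>?K\<^esub> y"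
      unfolding s using c k.r_distr by metis
    show "\<And>a b x. \<lbrakk>a \<in> carrier R; b \<in> carrier R; x \<in> carrier ?K\<rbrakk> \<Longrightarrow>
        (a \<otimes>\<^bsub>R\<^esub> b) \<odot>\<^bsub>?K\<^esub> x = a \<odot>\<^bsub>?K\<^esub> (b \<odot>\<^bsub>?K\<^esub> x)"
      unfolding s using c h.hom_mult k.m_assoc by metis
    show "\<And>x. x \<in> carrier ?K \<Longrightarrow> \<one>\<^bsub>R\<^esub> \<odot>\<^bsub>?K\<^esub> x = x"
      unfolding s using h.hom_one k.l_one by metis
  qed
  have "carrier ?K \<subseteq> spanned R ?K {\<one>\<^bsub>?k\<^esub>}"
  proof
    fix x assume "x \<in> carrier ?K"
    then obtain r where r: "r \<in> carrier R" "x = ?I +>\<^bsub>R\<^esub> r"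
      unfolding s FactRing_def A_RCOSETS_def' by auto
    have "x = r \<odot>\<^bsub>?K\<^esub> \<one>\<^bsub>?k\<^esub>" unfolding s using k.r_one[OF c[OF r(1)]] r(2) by metis
    moreover have "\<one>\<^bsub>?k\<^esub> \<in> spanned R ?K {\<one>\<^bsub>?k\<^esub>}"
      using spanned_subset[of "{\<one>\<^bsub>?k\<^esub>}" R ?K] by simp
    moreover have "submodule (spanned R ?K {\<one>\<^bsub>?k\<^esub>}) R ?K"
      by (rule submodule_spanned[OF M]) (simp add: s k.one_closed)
    ultimately show "x \<in> spanned R ?K {\<one>\<^bsub>?k\<^esub>}" using submoduleD(6)[OF M] r(1) by metis
  qed
  moreover have "spanned R ?K {\<one>\<^bsub>?k\<^esub>} \<subseteq> carrier ?K"
    by (rule spanned_least[OF submodule_carrier[OF M]]) (simp add: s k.one_closed)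
  ultimately show ?thesis unfolding fg_module_iff using M k.one_closed
    by (intro conjI exI[of _ "{\<one>\<^bsub>?k\<^esub>}"]) (auto simp: s)
qed

text \<open>The resolution in \<open>Ext\<close> is chosen from the ring and the first module alone.
  Hence one fixed complex serves all coefficient modules, and no comparison of resolutions
  arises.\<close>

definition res_rank :: "'a ring \<Rightarrow> nat \<Rightarrow> nat" where
  "res_rank R = fst (SOME res. free_resolution R (residue_module R) res)"

definition res_diff :: "'a ring \<Rightarrow> nat \<Rightarrow> (nat \<Rightarrow> 'a) \<Rightarrow> nat \<Rightarrow> 'a" where
  "res_diff R = fst (snd (SOME res. free_resolution R (residue_module R) res))"

locale noetherian_local =
  fixes R :: "'a ring" (structure)
  assumes local: "local_ring R" and noetherian: "noetherian_ring R"
begin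

lemma cring: "cring R" by (rule local_ring_cring[OF local])

abbreviation "Res i \<equiv> free_module R (res_rank R i)"
abbreviation "Cyc \<equiv> cocycles R (res_rank R) (res_diff R)"
abbreviation "Bdr \<equiv> coboundaries R (res_rank R) (res_diff R)"

lemma Res: "module R (Res i)" by (rule module_free[OF cring])

lemma some_resolution:
  "res_diff R i \<in> mod_hom R (Res (Suc i)) (Res i)"
  "compose (carrier (Res (Suc (Suc i)))) (res_diff R i) (res_diff R (Suc i)) = hom_zero (Res (Suc (Suc i))) (Res i)"
proof -
  define r where "r = (SOME res. free_resolution R (residue_module R) res)"
  obtain n d e where r3: "r = (n, d, e)" by (cases r) auto
  have "free_resolution R (residue_module R) r"
    unfolding r_def by (rule someI_ex[OF free_resolution_exists[OF noetherian fg_residue_module[OF local]]])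
  then have *: "d i \<in> mod_hom R (free_module R (n (Suc i))) (free_module R (n i))"
    "a_kernel (free_module R (n (Suc i))) (free_module R (n i)) (d i) =
            d (Suc i) ` carrier (free_module R (n (Suc (Suc i))))"
    unfolding r3 free_resolution_def by auto
  have nd: "res_rank R = n" "res_diff R = d" unfolding res_rank_def res_diff_def r_def[symmetric] r3 by auto
  show "res_diff R i \<in> mod_hom R (Res (Suc i)) (Res i)" unfolding nd by (rule *(1))
  show "compose (carrier (Res (Suc (Suc i)))) (res_diff R i) (res_diff R (Suc i)) = hom_zero (Res (Suc (Suc i))) (Res i)"
    unfolding nd compose_def hom_zero_def
  proof (rule restrict_ext)
    fix x assume "x \<in> carrier (free_module R (n (Suc (Suc i))))"
    then have "d (Suc i) x \<in> a_kernel (free_module R (n (Suc i))) (free_module R (n i)) (d i)"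
      unfolding *(2) by auto
    then show "d i (d (Suc i) x) = \<zero>\<^bsub>free_module R (n i)\<^esub>" unfolding a_kernel_eq by auto
  qed
qed

lemma Z_iff: "f \<in> Cyc M i \<longleftrightarrow> f \<in> mod_hom R (Res i) M \<and>
    compose (carrier (Res (Suc i))) f (res_diff R i) = hom_zero (Res (Suc i)) M"
  by (simp add: cocycles_def hom_group_simps)

lemma Bdr_0: "Bdr M 0 = {hom_zero (Res 0) M}"
  by (simp add: hom_group_simps)

lemma subgroup_Z:
  assumes "module R M" shows "subgroup (Cyc M i) (hom_group R (Res i) M)"
proof -
  interpret module R M by fact
  note d = some_resolution(1)[of i]
  note z = hom_zero_closed[OF Res[of i] assms]
  show ?thesis
  proof (rule subgroup_hom_groupI[OF Res assms])
    show "Cyc M i \<subseteq> mod_hom R (Res i) M" by (auto simp: Z_iff)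
    show 0: "hom_zero (Res i) M \<in> Cyc M i" using z compose_hom_zero_left[OF d] by (simp add: Z_iff)
    have zz: "hom_plus (Res (Suc i)) M (hom_zero (Res (Suc i)) M) (hom_zero (Res (Suc i)) M) = hom_zero (Res (Suc i)) M"
      "hom_diff (Res (Suc i)) M (hom_zero (Res (Suc i)) M) (hom_zero (Res (Suc i)) M) = hom_zero (Res (Suc i)) M"
      by (auto simp: hom_plus_def hom_diff_def hom_zero_def a_minus_def intro!: restrict_ext)
    show "hom_plus (Res i) M f g \<in> Cyc M i" if "f \<in> Cyc M i" "g \<in> Cyc M i" for f g
      using that hom_plus_closed[OF Res assms, of f _ g] compose_hom_plus_left[OF d, of M f g] zz by (simp add: Z_iff)
    show "hom_diff (Res i) M (hom_zero (Res i) M) f \<in> Cyc M i" if "f \<in> Cyc M i" for f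
      using that hom_diff_closed[OF Res assms z, of f] compose_hom_diff_left[OF d, of M "hom_zero (Res i) M" f]
        compose_hom_zero_left[OF d, of M] zz by (simp add: Z_iff)
  qed
qed

lemma subgroup_B:
  assumes "module R M" shows "subgroup (Bdr M i) (hom_group R (Res i) M)"
proof (cases i)
  case 0
  interpret comm_group "hom_group R (Res 0) M" by (rule comm_group_hom_group[OF Res assms])
  show ?thesis unfolding 0 Bdr_0 using triv_subgroup by (simp add: hom_group_simps)
next
  case (Suc j)
  note d = some_resolution(1)[of j]
  note z = hom_zero_closed[OF Res assms]
  show ?thesis unfolding Suc
  proof (rule subgroup_hom_groupI[OF Res assms])
    show "Bdr M (Suc j) \<subseteq> mod_hom R (Res (Suc j)) M" using compose_hom[OF Res d] by auto
    show "hom_zero (Res (Suc j)) M \<in> Bdr M (Suc j)"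
      using compose_hom_zero_left[OF d, of M] z[of j] by (force simp: image_iff)
    show "hom_plus (Res (Suc j)) M f g \<in> Bdr M (Suc j)" if "f \<in> Bdr M (Suc j)" "g \<in> Bdr M (Suc j)" for f g
    proof -
      obtain f' g' where fg: "f' \<in> mod_hom R (Res j) M" "g' \<in> mod_hom R (Res j) M"
        "f = compose (carrier (Res (Suc j))) f' (res_diff R j)" "g = compose (carrier (Res (Suc j))) g' (res_diff R j)"
        using \<open>f \<in> _\<close> \<open>g \<in> _\<close> by auto
      show ?thesis unfolding coboundaries.simps
        by (rule image_eqI[OF _ hom_plus_closed[OF Res assms fg(1,2)]]) (simp add: compose_hom_plus_left[OF d] fg(3,4))
    qed
    show "hom_diff (Res (Suc j)) M (hom_zero (Res (Suc j)) M) f \<in> Bdr M (Suc j)" if "f \<in> Bdr M (Suc j)" for f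
    proof -
      obtain f' where f: "f' \<in> mod_hom R (Res j) M" "f = compose (carrier (Res (Suc j))) f' (res_diff R j)"
        using \<open>f \<in> _\<close> by auto
      show ?thesis unfolding coboundaries.simps
        by (rule image_eqI[OF _ hom_diff_closed[OF Res assms z f(1)]])
          (simp add: compose_hom_diff_left[OF d] compose_hom_zero_left[OF d] f(2))
    qed
  qed
qed

lemma B_subset_Z:
  assumes "module R M" shows "Bdr M i \<subseteq> Cyc M i"
proof (cases i)
  case 0
  then show ?thesis using subgroup.one_closed[OF subgroup_Z[OF assms, of 0]] by (simp add: hom_group_simps)
next
  case (Suc j)
  show ?thesis
  proof
    fix f assume "f \<in> Bdr M i"
    then obtain f' where f: "f' \<in> mod_hom R (Res j) M" "f = compose (carrier (Res (Suc j))) f' (res_diff R j)"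
      using Suc by auto
    have "f \<in> mod_hom R (Res (Suc j)) M" unfolding f(2) by (rule compose_hom[OF Res some_resolution(1) f(1)])
    moreover have "compose (carrier (Res (Suc (Suc j)))) f (res_diff R (Suc j)) = hom_zero (Res (Suc (Suc j))) M"
      unfolding f(2) compose_hom_assoc[OF some_resolution(1)[of "Suc j"], symmetric] some_resolution(2)
      by (rule compose_hom_zero_right[OF Res Res assms f(1)])
    ultimately show "f \<in> Cyc M i" by (simp add: Z_iff Suc)
  qed
qed

text \<open>From here on the vanishing of \<open>Ext\<close> reads as an inclusion of cocycles in
  coboundaries, and quotient groups disappear from the arguments about maximal Cohen-Macaulay
  modules.\<close>

lemma trivial_Ext_iff:
  assumes "module R M"
  shows "trivial_group (Ext R i (residue_module R) M) \<longleftrightarrow> Cyc M i \<subseteq> Bdr M i"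
proof -
  let ?G = "hom_group R (Res i) M\<lparr>carrier := Cyc M i\<rparr>"
  interpret H: comm_group "hom_group R (Res i) M" by (rule comm_group_hom_group[OF Res assms])
  have G: "comm_group ?G"
  proof (rule group.group_comm_groupI[OF H.subgroup_imp_group[OF subgroup_Z[OF assms]]])
    fix x y assume "x \<in> carrier ?G" "y \<in> carrier ?G"
    then have "x \<in> carrier (hom_group R (Res i) M)" "y \<in> carrier (hom_group R (Res i) M)"
      using subgroup.subset[OF subgroup_Z[OF assms, of i]] by auto
    then show "x \<otimes>\<^bsub>?G\<^esub> y = y \<otimes>\<^bsub>?G\<^esub> x" using H.m_comm by simp
  qed
  interpret G: comm_group ?G by (rule G)
  have sub: "subgroup (Bdr M i) ?G"
    by (rule H.subgroup_incl[OF subgroup_B[OF assms] subgroup_Z[OF assms] B_subset_Z[OF assms]])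
  interpret N: normal "Bdr M i" ?G using sub G.normal_iff_subgroup by blast
  have E: "Ext R i (residue_module R) M = ?G Mod Bdr M i"
    unfolding Ext_def res_rank_def res_diff_def by (simp split: prod.split)
  have "trivial_group (?G Mod Bdr M i) \<longleftrightarrow> (\<forall>x\<in>Cyc M i. Bdr M i #>\<^bsub>?G\<^esub> x = Bdr M i)"
    unfolding trivial_group_def carrier_FactGroup one_FactGroup
    using N.factorgroup_is_group N.one_closed N.subset G.one_closed by auto
  also have "\<dots> \<longleftrightarrow> Cyc M i \<subseteq> Bdr M i"
    using G.coset_join1[OF _ _ sub] G.coset_join2[OF _ sub] N.subset by auto
  finally show ?thesis unfolding E .
qed

lemma mcm_iff: "mcm_module R M \<longleftrightarrow> fg_module R M \<and> (\<forall>i. enat i < krull_dim R \<longrightarrow> Cyc M i \<subseteq> Bdr M i)"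
  unfolding mcm_module_def using trivial_Ext_iff by (auto simp: fg_module_def)

section \<open>Retracts, sums and kernels of maximal Cohen-Macaulay modules\<close>

lemma compose_Z:
  assumes "module R M" "module R N" "f \<in> Cyc M i" "p \<in> mod_hom R M N"
  shows "compose (carrier (Res i)) p f \<in> Cyc N i"
proof -
  have f: "f \<in> mod_hom R (Res i) M" "compose (carrier (Res (Suc i))) f (res_diff R i) = hom_zero (Res (Suc i)) M"
    using assms(3) by (auto simp: Z_iff)
  show ?thesis unfolding Z_iff
    using compose_hom[OF Res f(1) assms(4)] compose_hom_assoc[OF some_resolution(1)[of i], of p f, symmetric] f(2)
      compose_hom_zero_right[OF Res assms(1,2,4)] by simp
qed

lemma compose_B:
  assumes "module R M" "module R N" "f \<in> Bdr M i" "p \<in> mod_hom R M N"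
  shows "compose (carrier (Res i)) p f \<in> Bdr N i"
proof (cases i)
  case 0
  then show ?thesis using assms compose_hom_zero_right[OF Res assms(1,2,4)] by (simp add: hom_group_simps)
next
  case (Suc j)
  then obtain f' where f: "f' \<in> mod_hom R (Res j) M" "f = compose (carrier (Res (Suc j))) f' (res_diff R j)"
    using assms(3) by auto
  show ?thesis
    using compose_hom[OF Res f(1) assms(4)] compose_hom_assoc[OF some_resolution(1)[of j], of p f'] f(2) Suc
    by (auto simp: image_iff)
qed

text \<open>Push a cocycle into \<open>M\<close> by \<open>s\<close>, bound it there and come back
  by \<open>p\<close>; since p s is the identity, the original cocycle bounds.\<close>

lemma mcm_retract:
  assumes "mcm_module R M" "module R A" "s \<in> mod_hom R A M" "p \<in> mod_hom R M A"
    "compose (carrier A) p s = id_hom A"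
  shows "mcm_module R A"
proof -
  have fg: "fg_module R M" using assms(1) by (simp add: mcm_iff)
  then have M: "module R M" by (simp add: fg_module_def)
  have ps: "p (s x) = x" if "x \<in> carrier A" for x
    using fun_cong[OF assms(5), of x] that by (simp add: compose_def)
  have "p ` carrier M = carrier A"
    using mod_homD(1)[OF assms(3)] mod_homD(1)[OF assms(4)] ps by (force simp: image_iff)
  then have "fg_module R A" by (rule fg_image[OF fg assms(2,4)])
  moreover have "Cyc A i \<subseteq> Bdr A i" if "enat i < krull_dim R" for i
  proof
    fix f assume f: "f \<in> Cyc A i"
    have fh: "f \<in> mod_hom R (Res i) A" using f by (simp add: Z_iff)
    have "compose (carrier (Res i)) s f \<in> Cyc M i" by (rule compose_Z[OF assms(2) M f assms(3)])
    then have "compose (carrier (Res i)) s f \<in> Bdr M i" using assms(1) that unfolding mcm_iff by blast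
    then have "compose (carrier (Res i)) p (compose (carrier (Res i)) s f) \<in> Bdr A i"
      by (rule compose_B[OF M assms(2) _ assms(4)])
    then show "f \<in> Bdr A i" using compose_hom_assoc[OF fh, of p s] assms(5) compose_id_hom(2)[OF fh] by simp
  qed
  ultimately show ?thesis by (simp add: mcm_iff)
qed

text \<open>A cocycle with values in \<open>P\<close> is the sum of its two components, and each
  component bounds in its own summand.\<close>

lemma mcm_sum:
  assumes "mcm_module R L" "mcm_module R M" "module R P"
    "i1 \<in> mod_hom R L P" "i2 \<in> mod_hom R M P" "p1 \<in> mod_hom R P L" "p2 \<in> mod_hom R P M"
    and sum: "\<And>x. x \<in> carrier P \<Longrightarrow> i1 (p1 x) \<oplus>\<^bsub>P\<^esub> i2 (p2 x) = x"
  shows "mcm_module R P"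
proof -
  have fg: "fg_module R L" "fg_module R M" using assms(1,2) by (simp_all add: mcm_iff)
  then have L: "module R L" and M: "module R M" by (simp_all add: fg_module_def)
  interpret P: module R P by fact
  have "fg_module R P"
  proof -
    obtain A where A: "A \<subseteq> carrier L" "finite A" "carrier L = spanned R L A"
      using fg(1) unfolding fg_module_iff by auto
    obtain C where C: "C \<subseteq> carrier M" "finite C" "carrier M = spanned R M C"
      using fg(2) unfolding fg_module_iff by auto
    let ?A = "i1 ` A \<union> i2 ` C"
    have sub: "?A \<subseteq> carrier P" using A(1) C(1) mod_homD(1)[OF assms(4)] mod_homD(1)[OF assms(5)] by auto
    note S = submoduleD[OF assms(3) submodule_spanned[OF assms(3) sub]]
    have 1: "i1 ` carrier L \<subseteq> spanned R P ?A"
      using spanned_image[OF L assms(3,4) A(1)] A(3) spanned_mono[of "i1 ` A" ?A R P] by auto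
    have 2: "i2 ` carrier M \<subseteq> spanned R P ?A"
      using spanned_image[OF M assms(3,5) C(1)] C(3) spanned_mono[of "i2 ` C" ?A R P] by auto
    have "carrier P \<subseteq> spanned R P ?A"
    proof
      fix x assume x: "x \<in> carrier P"
      have "i1 (p1 x) \<oplus>\<^bsub>P\<^esub> i2 (p2 x) \<in> spanned R P ?A"
        using 1 2 mod_homD(1)[OF assms(6) x] mod_homD(1)[OF assms(7) x] by (intro S(3)) auto
      then show "x \<in> spanned R P ?A" using sum[OF x] by simp
    qed
    then have "carrier P = spanned R P ?A" using S(1) by blast
    then show ?thesis unfolding fg_module_iff using assms(3) sub A(2) C(2)
      by (intro conjI exI[of _ ?A]) auto
  qed
  moreover have "Cyc P i \<subseteq> Bdr P i" if i: "enat i < krull_dim R" for i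
  proof
    fix f assume f: "f \<in> Cyc P i"
    have fh: "f \<in> mod_hom R (Res i) P" using f by (simp add: Z_iff)
    let ?c = "compose (carrier (Res i))"
    have "?c p1 f \<in> Bdr L i" using compose_Z[OF assms(3) L f assms(6)] assms(1) i unfolding mcm_iff by blast
    then have 1: "?c i1 (?c p1 f) \<in> Bdr P i" by (rule compose_B[OF L assms(3) _ assms(4)])
    have "?c p2 f \<in> Bdr M i" using compose_Z[OF assms(3) M f assms(7)] assms(2) i unfolding mcm_iff by blast
    then have 2: "?c i2 (?c p2 f) \<in> Bdr P i" by (rule compose_B[OF M assms(3) _ assms(5)])
    have "hom_plus (Res i) P (?c i1 (?c p1 f)) (?c i2 (?c p2 f)) \<in> Bdr P i"
      using subgroup.m_closed[OF subgroup_B[OF assms(3)] 1 2] by (simp add: hom_group_simps)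
    moreover have "hom_plus (Res i) P (?c i1 (?c p1 f)) (?c i2 (?c p2 f)) = restrict f (carrier (Res i))"
      unfolding hom_plus_def compose_def by (rule restrict_ext) (simp add: sum mod_homD(1)[OF fh])
    moreover have "restrict f (carrier (Res i)) = f" using mod_homD(4)[OF fh] by (rule extensional_restrict)
    ultimately show "f \<in> Bdr P i" by simp
  qed
  ultimately show ?thesis by (simp add: mcm_iff)
qed

text \<open>The long exact sequence around the connecting map, done by hand. A cocycle f of degree i
  in the kernel bounds in \<open>P\<close>, say f = g d. Then q g is a cocycle of degree i - 1 in
  \<open>N\<close>, hence bounds, and subtracting a suitable lift from g moves g into the kernel of
  \<open>q\<close> without changing g d.\<close>

lemma mcm_kernel:
  assumes "mcm_module R P" "mcm_module R N" "q \<in> mod_hom R P N" "carrier N \<subseteq> q ` carrier P"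
  shows "mcm_module R (P\<lparr>carrier := {x \<in> carrier P. q x = \<zero>\<^bsub>N\<^esub>}\<rparr>)" (is "mcm_module R ?K")
proof -
  have fg: "fg_module R P" "fg_module R N" using assms(1,2) by (simp_all add: mcm_iff)
  then have P: "module R P" and N: "module R N" by (simp_all add: fg_module_def)
  interpret N: module R N by fact
  have sub: "submodule {x \<in> carrier P. q x = \<zero>\<^bsub>N\<^esub>} R P" by (rule submodule_kernel[OF P N assms(3)])
  have K: "module R ?K" by (rule submodule.submodule_is_module[OF sub P])
  have sK: "carrier ?K = {x \<in> carrier P. q x = \<zero>\<^bsub>N\<^esub>}" "\<zero>\<^bsub>?K\<^esub> = \<zero>\<^bsub>P\<^esub>" by simp_all
  have KP: "{x \<in> carrier P. q x = \<zero>\<^bsub>N\<^esub>} \<subseteq> carrier P" by auto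
  have "id_hom ?K \<in> mod_hom R ?K P" using hom_extend_target[OF id_hom_closed[OF K] KP] .
  then have "noeth R ?K"
    by (rule noeth_inj[OF K P]) (auto intro: inj_onI fg_imp_noeth[OF noetherian fg(1)])
  then have "fg_module R ?K" by (rule noeth_imp_fg[OF K])
  moreover have "Cyc ?K i \<subseteq> Bdr ?K i" if i: "enat i < krull_dim R" for i
  proof
    fix f assume f: "f \<in> Cyc ?K i"
    have fK: "f \<in> mod_hom R (Res i) ?K" using f by (simp add: Z_iff)
    have fh: "f \<in> mod_hom R (Res i) P" by (rule hom_extend_target[OF fK KP])
    have qf: "q (f x) = \<zero>\<^bsub>N\<^esub>" if "x \<in> carrier (Res i)" for x using mod_homD(1)[OF fK that] by simp
    have "f \<in> Cyc P i" using f fh by (simp add: Z_iff hom_zero_def)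
    then have fB: "f \<in> Bdr P i" using assms(1) i unfolding mcm_iff by blast
    show "f \<in> Bdr ?K i"
    proof (cases i)
      case 0
      \<comment> \<open>In degree 0 the only coboundary is zero, so f itself vanishes.\<close>
      then show ?thesis using fB unfolding 0 Bdr_0 by (simp add: hom_zero_def)
    next
      case (Suc j)
      let ?d = "res_diff R j" and ?c = "compose (carrier (Res j))"
      note d = some_resolution(1)[of j]
      obtain g where g: "g \<in> mod_hom R (Res j) P" "f = compose (carrier (Res (Suc j))) g ?d"
        using fB Suc by auto
      have gd: "g (?d x) = f x" if "x \<in> carrier (Res (Suc j))" for x using g(2) that by (simp add: compose_def)
      have qg: "?c q g \<in> mod_hom R (Res j) N" by (rule compose_hom[OF Res g(1) assms(3)])
      \<comment> \<open>f takes values in the kernel of \<open>q\<close>, so q g kills the image of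
        the differential.\<close>
      have "?c q g \<in> Cyc N j" unfolding Z_iff
      proof (intro conjI qg)
        show "compose (carrier (Res (Suc j))) (?c q g) ?d = hom_zero (Res (Suc j)) N"
          unfolding hom_zero_def compose_def
          by (rule restrict_ext) (use gd qf Suc mod_homD(1)[OF d] in simp)
      qed
      moreover have "enat j < krull_dim R" using i Suc by (metis enat_ord_simps(2) lessI less_trans)
      ultimately have qB: "?c q g \<in> Bdr N j" using assms(2) unfolding mcm_iff by blast
      \<comment> \<open>The map g' is a cocycle of \<open>P\<close> with the same image in
        \<open>N\<close> as g. For j = 0 the coboundary q g is zero and g' = 0 serves; otherwise q g
        = h d, and h lifts along the surjection \<open>q\<close> because \<open>Res l\<close> is
        free.\<close>
      have "\<exists>g'. g' \<in> mod_hom R (Res j) P \<and> ?c q g' = ?c q g \<and>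
          compose (carrier (Res (Suc j))) g' ?d = hom_zero (Res (Suc j)) P"
      proof (cases j)
        case 0
        show ?thesis
          using qB hom_zero_closed[OF Res P] compose_hom_zero_right[OF Res P N assms(3)] compose_hom_zero_left[OF d, of P]
          unfolding 0 Bdr_0 by (intro exI[of _ "hom_zero (Res 0) P"]) auto
      next
        case (Suc l)
        then obtain h where h: "h \<in> mod_hom R (Res l) N" "?c q g = ?c h (res_diff R l)" using qB by auto
        obtain h' where h': "h' \<in> mod_hom R (Res l) P" "compose (carrier (Res l)) q h' = h"
          by (rule free_lift[OF P N assms(3,4) h(1)])
        have dl: "res_diff R l \<in> mod_hom R (Res j) (Res l)" using some_resolution(1)[of l] Suc by simp
        let ?g = "?c h' (res_diff R l)"
        have "?c h' (res_diff R l) \<in> Bdr P j" using h'(1) Suc by auto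
        then have "?g \<in> Cyc P j" using B_subset_Z[OF P] by blast
        moreover have "?c q ?g = ?c q g" using compose_hom_assoc[OF dl, of q h'] h'(2) h(2) by simp
        ultimately show ?thesis unfolding Z_iff by blast
      qed
      then obtain g' where g': "g' \<in> mod_hom R (Res j) P" "?c q g' = ?c q g"
        "compose (carrier (Res (Suc j))) g' ?d = hom_zero (Res (Suc j)) P" by blast
      let ?g = "hom_diff (Res j) P g g'"
      have gg: "?g \<in> mod_hom R (Res j) P" by (rule hom_diff_closed[OF Res P g(1) g'(1)])
      have "?g \<in> mod_hom R (Res j) ?K"
      proof (rule hom_restrict_target[OF gg])
        fix x assume x: "x \<in> carrier (Res j)"
        have "q (g' x) = q (g x)" using fun_cong[OF g'(2), of x] x by (simp add: compose_def)
        then have "q (?g x) = \<zero>\<^bsub>N\<^esub>"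
          using hom_minus[OF P N assms(3) mod_homD(1)[OF g(1) x] mod_homD(1)[OF g'(1) x]] x
            mod_homD(1)[OF assms(3) mod_homD(1)[OF g(1) x]]
          by (simp add: hom_diff_def a_minus_def N.r_neg)
        then show "?g x \<in> {x \<in> carrier P. q x = \<zero>\<^bsub>N\<^esub>}" using mod_homD(1)[OF gg x] by simp
      qed
      moreover have "f = compose (carrier (Res (Suc j))) ?g ?d"
      proof -
        interpret P: module R P by fact
        have "hom_diff (Res (Suc j)) P f (hom_zero (Res (Suc j)) P) = restrict f (carrier (Res (Suc j)))"
          unfolding hom_diff_def hom_zero_def
          by (rule restrict_ext) (use mod_homD(1)[OF fh] Suc in \<open>simp add: a_minus_def\<close>)
        then show ?thesis using compose_hom_diff_left[OF d, of P g g'] g(2) g'(3)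
            extensional_restrict[OF mod_homD(4)[OF fh]] Suc by simp
      qed
      ultimately show ?thesis using Suc by auto
    qed
  qed
  ultimately show ?thesis by (simp add: mcm_iff)
qed

end

section \<open>Direct sums, maps factoring through free modules, weak pullbacks\<close>

text \<open>Interleaving two sequences keeps a direct sum on the type
  \<open>nat \<Rightarrow> 'a\<close>, on which all objects of \<open>CM R\<close> have to
  live.\<close>

definition pair_seq :: "(nat \<Rightarrow> 'a) \<Rightarrow> (nat \<Rightarrow> 'a) \<Rightarrow> nat \<Rightarrow> 'a" where
  "pair_seq x y = (\<lambda>n. if even n then x (n div 2) else y (n div 2))"

definition fst_seq :: "(nat \<Rightarrow> 'a) \<Rightarrow> nat \<Rightarrow> 'a" where "fst_seq z = (\<lambda>n. z (2 * n))"
definition snd_seq :: "(nat \<Rightarrow> 'a) \<Rightarrow> nat \<Rightarrow> 'a" where "snd_seq z = (\<lambda>n. z (2 * n + 1))"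

lemma pair_seq_simps [simp]:
  "fst_seq (pair_seq x y) = x" "snd_seq (pair_seq x y) = y"
  by (auto simp: pair_seq_def fst_seq_def snd_seq_def fun_eq_iff)

lemma pair_seq_surj [simp]: "pair_seq (fst_seq z) (snd_seq z) = z"
proof
  fix n show "pair_seq (fst_seq z) (snd_seq z) n = z n"
    by (cases "even n") (auto simp: pair_seq_def fst_seq_def snd_seq_def)
qed

definition dsum :: "'a rmod \<Rightarrow> 'a rmod \<Rightarrow> 'a rmod" where
  "dsum L M = \<lparr>carrier = {z. fst_seq z \<in> carrier L \<and> snd_seq z \<in> carrier M},
     monoid.mult = (\<lambda>z w. z), one = pair_seq \<zero>\<^bsub>L\<^esub> \<zero>\<^bsub>M\<^esub>,
     ring.zero = pair_seq \<zero>\<^bsub>L\<^esub> \<zero>\<^bsub>M\<^esub>,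
     ring.add = (\<lambda>z w. pair_seq (fst_seq z \<oplus>\<^bsub>L\<^esub> fst_seq w) (snd_seq z \<oplus>\<^bsub>M\<^esub> snd_seq w)),
     smult = (\<lambda>r z. pair_seq (r \<odot>\<^bsub>L\<^esub> fst_seq z) (r \<odot>\<^bsub>M\<^esub> snd_seq z))\<rparr>"

lemma dsum_simps:
  "z \<in> carrier (dsum L M) \<longleftrightarrow> fst_seq z \<in> carrier L \<and> snd_seq z \<in> carrier M"
  "\<zero>\<^bsub>dsum L M\<^esub> = pair_seq \<zero>\<^bsub>L\<^esub> \<zero>\<^bsub>M\<^esub>"
  "z \<oplus>\<^bsub>dsum L M\<^esub> w = pair_seq (fst_seq z \<oplus>\<^bsub>L\<^esub> fst_seq w) (snd_seq z \<oplus>\<^bsub>M\<^esub> snd_seq w)"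
  "r \<odot>\<^bsub>dsum L M\<^esub> z = pair_seq (r \<odot>\<^bsub>L\<^esub> fst_seq z) (r \<odot>\<^bsub>M\<^esub> snd_seq z)"
  by (simp_all add: dsum_def)

lemma module_dsum:
  assumes "module R L" "module R M"
  shows "module R (dsum L M)"
proof -
  interpret L: module R L by fact
  interpret M: module R M by fact
  have ag: "abelian_group (dsum L M)"
  proof (rule abelian_groupI)
    fix x assume "x \<in> carrier (dsum L M)"
    then show "\<exists>y\<in>carrier (dsum L M). y \<oplus>\<^bsub>dsum L M\<^esub> x = \<zero>\<^bsub>dsum L M\<^esub>"
      by (intro bexI[of _ "pair_seq (\<ominus>\<^bsub>L\<^esub> fst_seq x) (\<ominus>\<^bsub>M\<^esub> snd_seq x)"])
        (auto simp: dsum_simps L.l_neg M.l_neg)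
  qed (auto simp: dsum_simps L.a_ac M.a_ac)
  show ?thesis
    by (rule moduleI[OF _ ag])
      (auto simp: dsum_simps L.smult_l_distr M.smult_l_distr L.smult_r_distr M.smult_r_distr
        L.smult_assoc1 M.smult_assoc1 intro: L.R.is_cring)
qed

lemma dsum_homs:
  assumes "module R L" "module R M"
  shows "(\<lambda>z\<in>carrier (dsum L M). fst_seq z) \<in> mod_hom R (dsum L M) L"
    and "(\<lambda>z\<in>carrier (dsum L M). snd_seq z) \<in> mod_hom R (dsum L M) M"
    and "(\<lambda>x\<in>carrier L. pair_seq x \<zero>\<^bsub>M\<^esub>) \<in> mod_hom R L (dsum L M)"
    and "(\<lambda>y\<in>carrier M. pair_seq \<zero>\<^bsub>L\<^esub> y) \<in> mod_hom R M (dsum L M)"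
proof -
  interpret L: module R L by fact
  interpret M: module R M by fact
  note D = module_dsum[OF assms]
  show "(\<lambda>z\<in>carrier (dsum L M). fst_seq z) \<in> mod_hom R (dsum L M) L"
    by (rule mod_homI[OF D]) (auto simp: dsum_simps)
  show "(\<lambda>z\<in>carrier (dsum L M). snd_seq z) \<in> mod_hom R (dsum L M) M"
    by (rule mod_homI[OF D]) (auto simp: dsum_simps)
  show "(\<lambda>x\<in>carrier L. pair_seq x \<zero>\<^bsub>M\<^esub>) \<in> mod_hom R L (dsum L M)"
    by (rule mod_homI[OF assms(1)]) (auto simp: dsum_simps)
  show "(\<lambda>y\<in>carrier M. pair_seq \<zero>\<^bsub>L\<^esub> y) \<in> mod_hom R M (dsum L M)"
    by (rule mod_homI[OF assms(2)]) (auto simp: dsum_simps)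
qed

lemma hom_pair:
  assumes "module R U" "f \<in> mod_hom R U L" "g \<in> mod_hom R U M"
  shows "(\<lambda>x\<in>carrier U. pair_seq (f x) (g x)) \<in> mod_hom R U (dsum L M)"
  by (rule mod_homI[OF assms(1)])
    (auto simp: dsum_simps mod_homD[OF assms(2)] mod_homD[OF assms(3)])

lemma hom_copair:
  assumes "module R L" "module R M" "module R N" "f \<in> mod_hom R L N" "g \<in> mod_hom R M N"
  shows "(\<lambda>z\<in>carrier (dsum L M). f (fst_seq z) \<oplus>\<^bsub>N\<^esub> g (snd_seq z)) \<in> mod_hom R (dsum L M) N"
proof -
  interpret N: module R N by fact
  show ?thesis
    by (rule mod_homI[OF module_dsum[OF assms(1,2)]])
      (auto simp: dsum_simps mod_homD[OF assms(4)] mod_homD[OF assms(5)] N.a_ac N.smult_r_distr)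
qed

lemma (in noetherian_local) mcm_dsum:
  assumes "mcm_module R L" "mcm_module R M"
  shows "mcm_module R (dsum L M)"
proof -
  have L: "module R L" and M: "module R M" using assms by (simp_all add: mcm_iff fg_module_def)
  interpret L: module R L by fact
  interpret M: module R M by fact
  note h = dsum_homs[OF L M]
  show ?thesis
    by (rule mcm_sum[OF assms module_dsum[OF L M] h(3,4,1,2)]) (auto simp: dsum_simps)
qed

text \<open>Here the sum of R^n and R^m is the literal module \<open>free_module R (n + m)\<close>,
  as \<open>free_factoring\<close> demands; \<open>dsum\<close> would give only an isomorphic
  copy.\<close>

definition cat_vec :: "nat \<Rightarrow> nat \<Rightarrow> (nat \<Rightarrow> 'a) \<Rightarrow> (nat \<Rightarrow> 'a) \<Rightarrow> nat \<Rightarrow> 'a" where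
  "cat_vec n m x y = (\<lambda>i\<in>{..<n + m}. if i < n then x i else y (i - n))"

definition take_vec :: "nat \<Rightarrow> (nat \<Rightarrow> 'a) \<Rightarrow> nat \<Rightarrow> 'a" where
  "take_vec n z = (\<lambda>i\<in>{..<n}. z i)"

definition drop_vec :: "nat \<Rightarrow> nat \<Rightarrow> (nat \<Rightarrow> 'a) \<Rightarrow> nat \<Rightarrow> 'a" where
  "drop_vec n m z = (\<lambda>i\<in>{..<m}. z (n + i))"

lemma free_module_memI:
  "(\<And>i. i < n \<Longrightarrow> x i \<in> carrier R) \<Longrightarrow> (\<lambda>i\<in>{..<n}. x i) \<in> carrier (free_module R n)"
  by (simp add: free_module_simps)

lemma vec_homs:
  assumes "cring R"
  shows "(\<lambda>z\<in>carrier (free_module R (n + m)). take_vec n z) \<in> mod_hom R (free_module R (n + m)) (free_module R n)"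
    and "(\<lambda>z\<in>carrier (free_module R (n + m)). drop_vec n m z) \<in> mod_hom R (free_module R (n + m)) (free_module R m)"
proof -
  note D = module_free[OF assms, of "n + m"]
  show "(\<lambda>z\<in>carrier (free_module R (n + m)). take_vec n z) \<in> mod_hom R (free_module R (n + m)) (free_module R n)"
  proof (rule mod_homI[OF D])
    fix x assume "x \<in> carrier (free_module R (n + m))"
    then show "take_vec n x \<in> carrier (free_module R n)"
      unfolding take_vec_def by (intro free_module_memI) (simp add: free_memD)
  qed (simp_all add: take_vec_def free_module_simps(3,4) cong: restrict_cong)
  show "(\<lambda>z\<in>carrier (free_module R (n + m)). drop_vec n m z) \<in> mod_hom R (free_module R (n + m)) (free_module R m)"
  proof (rule mod_homI[OF D])
    fix x assume "x \<in> carrier (free_module R (n + m))"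
    then show "drop_vec n m x \<in> carrier (free_module R m)"
      unfolding drop_vec_def by (intro free_module_memI) (simp add: free_memD)
  qed (simp_all add: drop_vec_def free_module_simps(3,4) cong: restrict_cong)
qed

lemma cat_vec_closed:
  assumes "x \<in> carrier (free_module R n)" "y \<in> carrier (free_module R m)"
  shows "cat_vec n m x y \<in> carrier (free_module R (n + m))"
  unfolding cat_vec_def by (rule free_module_memI) (use assms in \<open>auto simp: free_memD\<close>)

lemma free_module_ext:
  assumes "x \<in> carrier (free_module R n)" "y \<in> carrier (free_module R n)" "\<And>i. i < n \<Longrightarrow> x i = y i"
  shows "x = y"
proof
  fix i show "x i = y i"
    using assms(3)[of i] free_mem_arb[OF assms(1), of i] free_mem_arb[OF assms(2), of i] by (cases "i < n") auto
qed

lemma take_drop_cat_vec: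
  assumes "x \<in> carrier (free_module R n)" "y \<in> carrier (free_module R m)"
  shows "take_vec n (cat_vec n m x y) = x" "drop_vec n m (cat_vec n m x y) = y"
proof -
  have "take_vec n (cat_vec n m x y) = restrict x {..<n}"
    unfolding take_vec_def cat_vec_def by (rule restrict_ext) simp
  then show "take_vec n (cat_vec n m x y) = x"
    using assms(1) by (simp add: free_module_simps PiE_restrict)
  have "drop_vec n m (cat_vec n m x y) = restrict y {..<m}"
    unfolding drop_vec_def cat_vec_def by (rule restrict_ext) simp
  then show "drop_vec n m (cat_vec n m x y) = y"
    using assms(2) by (simp add: free_module_simps PiE_restrict)
qed

lemma cat_vec_hom:
  assumes "module R U" "f \<in> mod_hom R U (free_module R n)" "g \<in> mod_hom R U (free_module R m)"
  shows "(\<lambda>x\<in>carrier U. cat_vec n m (f x) (g x)) \<in> mod_hom R U (free_module R (n + m))"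
proof (rule mod_homI[OF assms(1)])
  show "\<And>x. x \<in> carrier U \<Longrightarrow> cat_vec n m (f x) (g x) \<in> carrier (free_module R (n + m))"
    using mod_homD(1)[OF assms(2)] mod_homD(1)[OF assms(3)] by (intro cat_vec_closed) auto
  fix x y assume "x \<in> carrier U" "y \<in> carrier U"
  then show "cat_vec n m (f (x \<oplus>\<^bsub>U\<^esub> y)) (g (x \<oplus>\<^bsub>U\<^esub> y)) =
      cat_vec n m (f x) (g x) \<oplus>\<^bsub>free_module R (n + m)\<^esub> cat_vec n m (f y) (g y)"
    unfolding free_module_simps(3) cat_vec_def
    by (intro restrict_ext)
      (auto simp: mod_homD(2)[OF assms(2)] mod_homD(2)[OF assms(3)] free_module_simps(3))
next
  fix r x assume "r \<in> carrier R" "x \<in> carrier U"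
  then show "cat_vec n m (f (r \<odot>\<^bsub>U\<^esub> x)) (g (r \<odot>\<^bsub>U\<^esub> x)) =
      r \<odot>\<^bsub>free_module R (n + m)\<^esub> cat_vec n m (f x) (g x)"
    unfolding free_module_simps(4) cat_vec_def
    by (intro restrict_ext)
      (auto simp: mod_homD(3)[OF assms(2)] mod_homD(3)[OF assms(3)] free_module_simps(4))
qed

section \<open>The ideal of maps through free modules\<close>

lemma free_factoringI:
  assumes "f \<in> mod_hom R M (free_module R n)" "g \<in> mod_hom R (free_module R n) N"
  shows "compose (carrier M) g f \<in> free_factoring R M N"
  using assms unfolding free_factoring_def by blast

lemma free_factoringE:
  assumes "h \<in> free_factoring R M N"
  obtains n f g where "f \<in> mod_hom R M (free_module R n)" "g \<in> mod_hom R (free_module R n) N"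
    "h = compose (carrier M) g f"
  using assms unfolding free_factoring_def by blast

lemma free_factoring_hom:
  assumes "module R M" shows "free_factoring R M N \<subseteq> mod_hom R M N"
  by (auto elim!: free_factoringE intro: compose_hom[OF assms])

lemma free_factoring_compose:
  assumes "module R M" "module R N" "h \<in> free_factoring R M N"
  shows "k \<in> mod_hom R N L \<Longrightarrow> compose (carrier M) k h \<in> free_factoring R M L"
    and "k \<in> mod_hom R L M \<Longrightarrow> module R L \<Longrightarrow> compose (carrier L) h k \<in> free_factoring R L N"
proof -
  have R: "cring R" using assms(1) by (simp add: module_def)
  obtain n f g where h: "f \<in> mod_hom R M (free_module R n)" "g \<in> mod_hom R (free_module R n) N"
    "h = compose (carrier M) g f" by (rule free_factoringE[OF assms(3)])
  show "compose (carrier M) k h \<in> free_factoring R M L" if "k \<in> mod_hom R N L"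
    unfolding h(3) compose_hom_assoc[OF h(1)]
    by (rule free_factoringI[OF h(1) compose_hom[OF module_free[OF R] h(2) that]])
  show "compose (carrier L) h k \<in> free_factoring R L N" if k: "k \<in> mod_hom R L M" and L: "module R L"
    unfolding h(3) compose_hom_assoc[OF k, symmetric]
    by (rule free_factoringI[OF compose_hom[OF L k h(1)] h(2)])
qed

text \<open>If h factors through R^n and h' through R^m, then their sum factors through R^(n + m):
  pair the first factors and add the second ones.\<close>

lemma subgroup_free_factoring:
  fixes R :: "'a ring"
  assumes "module R M" "module R N"
  shows "subgroup (free_factoring R M N) (hom_group R M N)"
proof (rule subgroup_hom_groupI[OF assms free_factoring_hom[OF assms(1)]])
  have R: "cring R" using assms(1) by (simp add: module_def)
  note F = module_free[OF R]
  interpret N: module R N by fact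
  show "hom_zero M N \<in> free_factoring R M N"
    using free_factoringI[OF hom_zero_closed[OF assms(1) F] hom_zero_closed[OF F assms(2)]]
      compose_hom_zero_left[OF hom_zero_closed[OF assms(1) F], where L = N] by metis
  fix h assume "h \<in> free_factoring R M N"
  then obtain n f g where h: "f \<in> mod_hom R M (free_module R n)" "g \<in> mod_hom R (free_module R n) N"
    "h = compose (carrier M) g f" by (rule free_factoringE)
  show "hom_diff M N (hom_zero M N) h \<in> free_factoring R M N"
    using free_factoringI[OF h(1) hom_diff_closed[OF F assms(2) hom_zero_closed[OF F assms(2)] h(2)]]
    unfolding compose_hom_diff_left[OF h(1)] compose_hom_zero_left[OF h(1)] h(3) .
  fix h' assume "h' \<in> free_factoring R M N"
  then obtain m f' g' where h': "f' \<in> mod_hom R M (free_module R m)" "g' \<in> mod_hom R (free_module R m) N"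
    "h' = compose (carrier M) g' f'" by (rule free_factoringE)
  let ?F = "free_module R (n + m)"
  let ?f = "\<lambda>x\<in>carrier M. cat_vec n m (f x) (f' x)"
  let ?g = "hom_plus ?F N (compose (carrier ?F) g (\<lambda>z\<in>carrier ?F. take_vec n z))
    (compose (carrier ?F) g' (\<lambda>z\<in>carrier ?F. drop_vec n m z))"
  have f: "?f \<in> mod_hom R M ?F" by (rule cat_vec_hom[OF assms(1) h(1) h'(1)])
  have g: "?g \<in> mod_hom R ?F N"
    by (intro hom_plus_closed[OF F assms(2)] compose_hom[OF F vec_homs(1)[OF R] h(2)]
        compose_hom[OF F vec_homs(2)[OF R] h'(2)])
  have "compose (carrier M) ?g ?f = hom_plus M N h h'"
    unfolding h(3) h'(3) compose_def hom_plus_def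
  proof (rule restrict_ext)
    fix x assume x: "x \<in> carrier M"
    have "cat_vec n m (f x) (f' x) \<in> carrier ?F"
      by (rule cat_vec_closed[OF mod_homD(1)[OF h(1) x] mod_homD(1)[OF h'(1) x]])
    then show "(\<lambda>x\<in>carrier ?F. (\<lambda>x\<in>carrier ?F. g ((\<lambda>z\<in>carrier ?F. take_vec n z) x)) x \<oplus>\<^bsub>N\<^esub>
         (\<lambda>x\<in>carrier ?F. g' ((\<lambda>z\<in>carrier ?F. drop_vec n m z) x)) x) (?f x) =
       (\<lambda>x\<in>carrier M. g (f x)) x \<oplus>\<^bsub>N\<^esub> (\<lambda>x\<in>carrier M. g' (f' x)) x"
      using x take_drop_cat_vec[OF mod_homD(1)[OF h(1) x] mod_homD(1)[OF h'(1) x]] by simp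
  qed
  then show "hom_plus M N h h' \<in> free_factoring R M N" using free_factoringI[OF f g] by metis
qed

section \<open>Free modules as maximal Cohen-Macaulay modules; weak pullbacks\<close>

locale cm_local = noetherian_local +
  assumes cm: "cohen_macaulay_ring R"
begin

text \<open>The case n = 1 is the hypothesis on R. The zero module is a retract of R^1, and R^(n +
  1) is the sum of R^n and R^1.\<close>

lemma mcm_free: "mcm_module R (free_module R n)"
proof (induction n)
  note F = module_free[OF cring]
  have 1: "mcm_module R (free_module R 1)" using cm by (simp add: cohen_macaulay_ring_def)
  {
    case 0
    have "compose (carrier (free_module R 0)) (hom_zero (free_module R 1) (free_module R 0))
      (hom_zero (free_module R 0) (free_module R 1)) = id_hom (free_module R 0)"
      unfolding compose_hom_zero_left[OF hom_zero_closed[OF F F]] unfolding hom_zero_def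
      by (rule restrict_ext) (simp add: free_module_0_carrier)
    then show ?case by (rule mcm_retract[OF 1 F hom_zero_closed[OF F F] hom_zero_closed[OF F F]])
  next
    case (Suc n)
    let ?F = "free_module R (n + 1)"
    let ?p = "\<lambda>z\<in>carrier ?F. take_vec n z" let ?q = "\<lambda>z\<in>carrier ?F. drop_vec n 1 z"
    let ?i = "\<lambda>x\<in>carrier (free_module R n). cat_vec n 1 (id_hom (free_module R n) x) (hom_zero (free_module R n) (free_module R 1) x)"
    let ?j = "\<lambda>x\<in>carrier (free_module R 1). cat_vec n 1 (hom_zero (free_module R 1) (free_module R n) x) (id_hom (free_module R 1) x)"
    note p = vec_homs(1)[OF cring, of n 1] and q = vec_homs(2)[OF cring, of n 1]
    have i: "?i \<in> mod_hom R (free_module R n) ?F"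
      by (rule cat_vec_hom[OF F id_hom_closed[OF F] hom_zero_closed[OF F F]])
    have j: "?j \<in> mod_hom R (free_module R 1) ?F"
      by (rule cat_vec_hom[OF F hom_zero_closed[OF F F] id_hom_closed[OF F]])
    have "?i (?p x) \<oplus>\<^bsub>?F\<^esub> ?j (?q x) = x" if x: "x \<in> carrier ?F" for x
    proof (rule free_module_ext)
      interpret M: module R ?F by (rule F)
      have px: "?p x \<in> carrier (free_module R n)" "?q x \<in> carrier (free_module R 1)"
        using mod_homD(1)[OF p x] mod_homD(1)[OF q x] .
      show "?i (?p x) \<oplus>\<^bsub>?F\<^esub> ?j (?q x) \<in> carrier ?F"
        by (intro M.a_closed mod_homD(1)[OF i] mod_homD(1)[OF j] px)
      interpret cring R by (rule cring)
      fix k assume k: "k < n + 1"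
      have xk: "x k \<in> carrier R" by (rule free_memD[OF x k])
      have "take_vec n x \<in> carrier (free_module R n)" "drop_vec n 1 x \<in> carrier (free_module R 1)"
        using px x by simp_all
      then show "(?i (?p x) \<oplus>\<^bsub>?F\<^esub> ?j (?q x)) k = x k"
        using x k xk unfolding free_module_simps(3)
        by (simp add: cat_vec_def hom_zero_def free_module_simps(2)) (auto simp: take_vec_def drop_vec_def less_Suc_eq)
    qed (rule x)
    then have "mcm_module R ?F" by (intro mcm_sum[OF Suc 1 F i j p q]) auto
    then show ?case by simp
  }
qed

lemma CM_module: "M \<in> CM R \<Longrightarrow> module R M"
  by (simp add: CM_def mcm_iff fg_module_def)

lemma CM_free: "free_module R n \<in> CM R"
  using mcm_free by (simp add: CM_def)

lemma CM_dsum: "L \<in> CM R \<Longrightarrow> M \<in> CM R \<Longrightarrow> dsum L M \<in> CM R"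
  using mcm_dsum by (simp add: CM_def)

lemma CM_noeth: "M \<in> CM R \<Longrightarrow> noeth R M"
  by (auto simp: CM_def mcm_iff intro: fg_imp_noeth[OF noetherian])

text \<open>After adding a free module mapping onto \<open>P\<close> the pullback is the kernel of an epimorphism,
  so it is maximal Cohen--Macaulay; the free summand makes it only a weak pullback.\<close>

lemma weak_pullback:
  assumes M: "M \<in> CM R" and L: "L \<in> CM R" and P: "P \<in> CM R"
    and f: "f \<in> mod_hom R M P" and g: "g \<in> mod_hom R L P"
  obtains E a b where "E \<in> CM R" "a \<in> mod_hom R E M" "b \<in> mod_hom R E L"
    "hom_diff E P (compose (carrier E) f a) (compose (carrier E) g b) \<in> free_factoring R E P"
    "\<And>U u v. \<lbrakk>U \<in> CM R; u \<in> mod_hom R U M; v \<in> mod_hom R U L;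
       hom_diff U P (compose (carrier U) f u) (compose (carrier U) g v) \<in> free_factoring R U P\<rbrakk> \<Longrightarrow>
       \<exists>w\<in>mod_hom R U E. compose (carrier U) a w = u \<and> compose (carrier U) b w = v"
proof -
  note mM = CM_module[OF M] and mL = CM_module[OF L] and mP = CM_module[OF P]
  interpret P: module R P by (rule mP)
  interpret M: module R M by (rule mM)
  interpret L: module R L by (rule mL)
  obtain n q where q: "q \<in> mod_hom R (free_module R n) P" "q ` carrier (free_module R n) = carrier P"
    using P by (auto simp: CM_def mcm_iff elim!: fg_surj)
  let ?F = "free_module R n" let ?S = "dsum M L" let ?D = "dsum ?S ?F"
  have mF: "module R ?F" by (rule module_free[OF cring])
  note mML = module_dsum[OF mM mL] note mD = module_dsum[OF mML mF]
  \<comment> \<open>The sign makes \<open>h\<close> below the map sending (m, l, r) to f m - g l + q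
    r. It is onto already because of \<open>q\<close>, so \<open>mcm_kernel\<close> applies to its
    kernel \<open>?E\<close>.\<close>
  let ?g = "hom_diff L P (hom_zero L P) g"
  have g': "?g \<in> mod_hom R L P" by (rule hom_diff_closed[OF mL mP hom_zero_closed[OF mL mP] g])
  define k where "k = (\<lambda>z\<in>carrier ?S. f (fst_seq z) \<oplus>\<^bsub>P\<^esub> ?g (snd_seq z))"
  have k: "k \<in> mod_hom R ?S P" unfolding k_def by (rule hom_copair[OF mM mL mP f g'])
  define h where "h = (\<lambda>z\<in>carrier ?D. k (fst_seq z) \<oplus>\<^bsub>P\<^esub> q (snd_seq z))"
  have h: "h \<in> mod_hom R ?D P" unfolding h_def by (rule hom_copair[OF mML mF mP k q(1)])
  have h_surj: "carrier P \<subseteq> h ` carrier ?D"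
  proof
    fix p assume "p \<in> carrier P"
    then obtain r where r: "r \<in> carrier ?F" "p = q r" using q(2) by blast
    interpret S: module R ?S by (rule mML)
    have "pair_seq \<zero>\<^bsub>?S\<^esub> r \<in> carrier ?D"
      using r(1) S.zero_closed unfolding dsum_simps(1)[of _ ?S] by simp
    moreover have "h (pair_seq \<zero>\<^bsub>?S\<^esub> r) = p"
      using calculation r mod_homD(1)[OF q(1) r(1)] hom_0[OF mML mP k] by (simp add: h_def)
    ultimately show "p \<in> h ` carrier ?D" by blast
  qed
  let ?E = "?D\<lparr>carrier := {z \<in> carrier ?D. h z = \<zero>\<^bsub>P\<^esub>}\<rparr>"
  have D: "?D \<in> CM R" by (intro CM_dsum M L CM_free)
  have E: "?E \<in> CM R" using mcm_kernel[of ?D P h] D P h h_surj by (simp add: CM_def)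
  have mE: "module R ?E" by (rule CM_module[OF E])
  have incl: "id_hom ?E \<in> mod_hom R ?E ?D"
    by (rule hom_extend_target[OF id_hom_closed[OF mE]]) auto
  have Ez: "z \<in> carrier ?E \<longleftrightarrow> fst_seq (fst_seq z) \<in> carrier M \<and> snd_seq (fst_seq z) \<in> carrier L \<and>
      snd_seq z \<in> carrier ?F \<and> h z = \<zero>\<^bsub>P\<^esub>" for z
    by (simp add: dsum_simps(1))
  have hz: "h z = (f (fst_seq (fst_seq z)) \<ominus>\<^bsub>P\<^esub> g (snd_seq (fst_seq z))) \<oplus>\<^bsub>P\<^esub> q (snd_seq z)"
    if "fst_seq (fst_seq z) \<in> carrier M" "snd_seq (fst_seq z) \<in> carrier L" "snd_seq z \<in> carrier ?F" for z
    using that mod_homD(1)[OF g that(2)]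
    by (simp add: h_def k_def dsum_simps(1) hom_diff_def hom_zero_def a_minus_def)
  define a where "a = (\<lambda>z\<in>carrier ?E. fst_seq (fst_seq z))"
  define b where "b = (\<lambda>z\<in>carrier ?E. snd_seq (fst_seq z))"
  define c where "c = (\<lambda>z\<in>carrier ?E. snd_seq z)"
  have a: "a \<in> mod_hom R ?E M" unfolding a_def
    by (rule mod_homI[OF mE]) (auto simp: dsum_simps)
  have b: "b \<in> mod_hom R ?E L" unfolding b_def
    by (rule mod_homI[OF mE]) (auto simp: dsum_simps)
  have c: "c \<in> mod_hom R ?E ?F" unfolding c_def
    by (rule mod_homI[OF mE]) (auto simp: dsum_simps)
  \<comment> \<open>On \<open>?E\<close> the difference f m - g l equals - q r, which factors
    through the coordinate r in R^n.\<close>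
  have ff: "hom_diff ?E P (compose (carrier ?E) f a) (compose (carrier ?E) g b) \<in> free_factoring R ?E P"
  proof -
    have "hom_diff ?E P (compose (carrier ?E) f a) (compose (carrier ?E) g b) =
      compose (carrier ?E) (hom_diff ?F P (hom_zero ?F P) q) c"
      unfolding hom_diff_def[of ?E] compose_def
    proof (rule restrict_ext)
      fix z assume z: "z \<in> carrier ?E"
      then have zc: "fst_seq (fst_seq z) \<in> carrier M" "snd_seq (fst_seq z) \<in> carrier L"
        "snd_seq z \<in> carrier ?F" "h z = \<zero>\<^bsub>P\<^esub>" unfolding Ez by auto
      have pc: "f (fst_seq (fst_seq z)) \<ominus>\<^bsub>P\<^esub> g (snd_seq (fst_seq z)) \<in> carrier P" "q (snd_seq z) \<in> carrier P"
        using mod_homD(1)[OF f zc(1)] mod_homD(1)[OF g zc(2)] mod_homD(1)[OF q(1) zc(3)] by auto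
      have "(f (fst_seq (fst_seq z)) \<ominus>\<^bsub>P\<^esub> g (snd_seq (fst_seq z))) \<oplus>\<^bsub>P\<^esub> q (snd_seq z) = \<zero>\<^bsub>P\<^esub>"
        using hz[OF zc(1-3)] zc(4) by simp
      then have "f (fst_seq (fst_seq z)) \<ominus>\<^bsub>P\<^esub> g (snd_seq (fst_seq z)) = \<ominus>\<^bsub>P\<^esub> q (snd_seq z)"
        using P.minus_equality[OF _ pc(2,1)] by simp
      then show "(\<lambda>x\<in>carrier ?E. f (a x)) z \<ominus>\<^bsub>P\<^esub> (\<lambda>x\<in>carrier ?E. g (b x)) z =
          hom_diff ?F P (hom_zero ?F P) q (c z)"
        using z zc(3) pc(2) by (simp add: a_def b_def c_def hom_diff_def hom_zero_def a_minus_def)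
    qed
    then show ?thesis
      using free_factoringI[OF c hom_diff_closed[OF mF mP hom_zero_closed[OF mF mP] q(1)]] by simp
  qed
  have univ: "\<exists>w\<in>mod_hom R U ?E. compose (carrier U) a w = u \<and> compose (carrier U) b w = v"
    if U: "U \<in> CM R" and u: "u \<in> mod_hom R U M" and v: "v \<in> mod_hom R U L"
      and uv: "hom_diff U P (compose (carrier U) f u) (compose (carrier U) g v) \<in> free_factoring R U P"
    for U u v
  proof -
    note mU = CM_module[OF U]
    obtain m t s where ts: "t \<in> mod_hom R U (free_module R m)" "s \<in> mod_hom R (free_module R m) P"
      "hom_diff U P (compose (carrier U) f u) (compose (carrier U) g v) = compose (carrier U) s t"
      by (rule free_factoringE[OF uv])
    have mFm: "module R (free_module R m)" by (rule module_free[OF cring])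
    \<comment> \<open>By projectivity the given factorization s t of f u - g v becomes q s' t. The
      last coordinate - s' t then makes (u, v, - s' t) land in the kernel of
      \<open>h\<close>.\<close>
    obtain s' where s': "s' \<in> mod_hom R (free_module R m) ?F" "compose (carrier (free_module R m)) q s' = s"
      by (rule free_lift[OF mF mP q(1) _ ts(2)]) (use q(2) in simp)
    let ?x = "compose (carrier U) s' t"
    have x: "?x \<in> mod_hom R U ?F" by (rule compose_hom[OF mU ts(1) s'(1)])
    let ?y = "hom_diff U ?F (hom_zero U ?F) ?x"
    have y: "?y \<in> mod_hom R U ?F" by (rule hom_diff_closed[OF mU mF hom_zero_closed[OF mU mF] x])
    define w where "w = (\<lambda>z\<in>carrier U. pair_seq ((\<lambda>z\<in>carrier U. pair_seq (u z) (v z)) z) (?y z))"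
    have w: "w \<in> mod_hom R U ?D" unfolding w_def
      by (rule hom_pair[OF mU hom_pair[OF mU u v] y])
    interpret F: module R ?F by (rule mF)
    have "w \<in> mod_hom R U ?E"
    proof (rule hom_restrict_target[OF w])
      fix z assume z: "z \<in> carrier U"
      note zc = mod_homD(1)[OF u z] mod_homD(1)[OF v z] mod_homD(1)[OF y z] mod_homD(1)[OF x z]
      have yz: "?y z = \<ominus>\<^bsub>?F\<^esub> ?x z" using z zc(4) by (simp add: hom_diff_def hom_zero_def a_minus_def)
      have qx: "q (?x z) = s (t z)"
        using fun_cong[OF s'(2), of "t z"] z mod_homD(1)[OF ts(1) z] by (simp add: compose_def)
      have st: "s (t z) = f (u z) \<ominus>\<^bsub>P\<^esub> g (v z)"
        using fun_cong[OF ts(3), of z] z by (simp add: compose_def hom_diff_def)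
      have wz: "fst_seq (fst_seq (w z)) = u z" "snd_seq (fst_seq (w z)) = v z" "snd_seq (w z) = ?y z"
        using z by (simp_all add: w_def)
      have "h (w z) = (f (u z) \<ominus>\<^bsub>P\<^esub> g (v z)) \<oplus>\<^bsub>P\<^esub> q (?y z)"
        using hz[of "w z"] zc unfolding wz by simp
      also have "q (?y z) = \<ominus>\<^bsub>P\<^esub> (f (u z) \<ominus>\<^bsub>P\<^esub> g (v z))"
        unfolding yz hom_neg[OF mF mP q(1) zc(4)] qx st ..
      also have "(f (u z) \<ominus>\<^bsub>P\<^esub> g (v z)) \<oplus>\<^bsub>P\<^esub> \<ominus>\<^bsub>P\<^esub> (f (u z) \<ominus>\<^bsub>P\<^esub> g (v z)) = \<zero>\<^bsub>P\<^esub>"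
        using mod_homD(1)[OF f zc(1)] mod_homD(1)[OF g zc(2)] by (simp add: P.r_neg)
      finally show "w z \<in> {z \<in> carrier ?D. h z = \<zero>\<^bsub>P\<^esub>}" using mod_homD(1)[OF w z] by simp
    qed
    moreover have "compose (carrier U) a w = u"
    proof (rule hom_eqI[OF compose_hom[OF mU calculation a] u])
      fix z assume z: "z \<in> carrier U"
      then show "compose (carrier U) a w z = u z"
        using mod_homD(1)[OF \<open>w \<in> mod_hom R U ?E\<close> z] by (simp add: compose_def a_def) (simp add: w_def)
    qed
    moreover have "compose (carrier U) b w = v"
    proof (rule hom_eqI[OF compose_hom[OF mU \<open>w \<in> mod_hom R U ?E\<close> b] v])
      fix z assume z: "z \<in> carrier U"
      then show "compose (carrier U) b w z = v z"
        using mod_homD(1)[OF \<open>w \<in> mod_hom R U ?E\<close> z] by (simp add: compose_def b_def) (simp add: w_def)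
    qed
    ultimately show ?thesis by blast
  qed
  show ?thesis by (rule that[OF E a b ff univ])
qed

end

section \<open>Nakayama's lemma and lifting of idempotents\<close>

context noetherian_local
begin

abbreviation "\<mm> \<equiv> max_ideal R"

lemma max_ideal_ideal: "ideal \<mm> R"
  using max_ideal_maximal[OF local] by (rule maximalideal.axioms(1))

text \<open>A nonunit generates a proper ideal. A proper ideal that is largest among those
  containing \<open>a\<close> is maximal, hence equals \<mm> by locality.\<close>

lemma unitI:
  assumes "a \<in> carrier R" "a \<notin> \<mm>" shows "a \<in> Units R"
proof (rule ccontr)
  interpret cring R by (rule cring)
  interpret N: noetherian_ring R by (rule noetherian)
  assume nu: "a \<notin> Units R"
  let ?Z = "{I. ideal I R \<and> a \<in> I \<and> \<one> \<notin> I}"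
  have "PIdl a \<in> ?Z"
    using cgenideal_ideal[OF assms(1)] cgenideal_self[OF assms(1)] nu assms(1) m_comm
    by (auto simp: cgenideal_def Units_def)
  then have ne: "?Z \<noteq> {}" by blast
  have "\<exists>W\<in>?Z. \<forall>V\<in>?Z. W \<subseteq> V \<longrightarrow> V = W"
  proof (rule subset_Zorn_nonempty[OF ne])
    fix C assume C: "C \<noteq> {}" "subset.chain ?Z C"
    have "subset.chain {I. ideal I R} C" using C(2) by (auto simp: subset.chain_def)
    from N.ideal_chain_is_trivial[OF C(1) this] show "\<Union>C \<in> ?Z" using C(2) by (auto simp: subset.chain_def)
  qed
  then obtain W where W: "ideal W R" "a \<in> W" "\<one> \<notin> W"
    "\<And>V. ideal V R \<Longrightarrow> \<one> \<notin> V \<Longrightarrow> W \<subseteq> V \<Longrightarrow> V = W" by (auto 4 4)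
  have "maximalideal W R"
  proof (rule maximalidealI[OF W(1)])
    show "carrier R \<noteq> W" using W(3) one_closed by auto
    show "J = W \<or> J = carrier R" if "ideal J R" "W \<subseteq> J" for J
      using W(4)[OF that(1) _ that(2)] ideal.one_imp_carrier[OF that(1)] by auto
  qed
  then have "W = \<mm>" using max_ideal_maximal[OF local] local by (auto simp: local_ring_def)
  then show False using W(2) assms(2) by simp
qed

lemma one_notin_max_ideal: "\<one> \<notin> \<mm>"
  using maximalideal.I_notcarr[OF max_ideal_maximal[OF local]] ideal.one_imp_carrier[OF max_ideal_ideal] by auto

lemma one_minus_unit:
  assumes "a \<in> \<mm>" shows "\<one> \<ominus> a \<in> Units R"
proof -
  interpret cring R by (rule cring)
  interpret I: ideal \<mm> R by (rule max_ideal_ideal)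
  have a: "a \<in> carrier R" by (rule I.Icarr[OF assms])
  have "\<one> \<ominus> a \<notin> \<mm>"
  proof
    assume "\<one> \<ominus> a \<in> \<mm>"
    then have "(\<one> \<ominus> a) \<oplus> a \<in> \<mm>" using assms I.a_closed by blast
    moreover have "(\<one> \<ominus> a) \<oplus> a = \<one>" using a by (simp add: a_minus_def a_assoc l_neg)
    ultimately show False using one_notin_max_ideal by simp
  qed
  then show ?thesis using a by (intro unitI) auto
qed

text \<open>The hypothesis on \<open>W'\<close> expresses that \<open>N = W + \<mm> N\<close> without mentioning \<open>\<mm> N\<close>.\<close>

lemma nakayama:
  assumes N: "module R N" "noeth R N" and W: "submodule W R N"
    and gen: "\<And>W'. \<lbrakk>submodule W' R N; W \<subseteq> W'; \<And>a x. a \<in> \<mm> \<Longrightarrow> x \<in> carrier N \<Longrightarrow> a \<odot>\<^bsub>N\<^esub> x \<in> W'\<rbrakk> \<Longrightarrow>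
      W' = carrier N"
  shows "W = carrier N"
proof (rule ccontr)
  interpret cring R by (rule cring)
  interpret N: module R N by fact
  interpret I: ideal \<mm> R by (rule max_ideal_ideal)
  assume ne: "W \<noteq> carrier N"
  let ?Z = "{V. submodule V R N \<and> W \<subseteq> V \<and> V \<noteq> carrier N}"
  have "?Z \<noteq> {}" using W ne by blast
  then obtain V where V: "V \<in> ?Z" "\<And>V'. V' \<in> ?Z \<Longrightarrow> V \<subseteq> V' \<Longrightarrow> V' = V"
    by (rule noeth_maximal[OF N]) auto
  then have sV: "submodule V R N" and WV: "W \<subseteq> V" and nV: "V \<noteq> carrier N" by auto
  note D = submoduleD[OF N(1) sV]
  \<comment> \<open>Otherwise R a x + V is all of \<open>N\<close> by maximality of
    \<open>V\<close>. Then x = b x + w with b in \<mm> and w in \<open>V\<close>, and inverting 1 -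
    b puts x, hence a x, into \<open>V\<close>.\<close>
  have "a \<odot>\<^bsub>N\<^esub> x \<in> V" if a: "a \<in> \<mm>" and x: "x \<in> carrier N" for a x
  proof (rule ccontr)
    assume ax: "a \<odot>\<^bsub>N\<^esub> x \<notin> V"
    have aR: "a \<in> carrier R" by (rule I.Icarr[OF a])
    have axc: "a \<odot>\<^bsub>N\<^esub> x \<in> carrier N" using aR x by simp
    let ?S = "{(r \<odot>\<^bsub>N\<^esub> (a \<odot>\<^bsub>N\<^esub> x)) \<oplus>\<^bsub>N\<^esub> w | r w. r \<in> carrier R \<and> w \<in> V}"
    note S = submodule_add_cyclic[OF N(1) sV axc]
    have "?S = carrier N"
    proof (rule ccontr)
      assume "?S \<noteq> carrier N"
      then have "?S = V" using V(2)[of ?S] S(1,3) WV by auto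
      then show False using S(2) ax by simp
    qed
    then obtain r w where rw: "r \<in> carrier R" "w \<in> V" "x = (r \<odot>\<^bsub>N\<^esub> (a \<odot>\<^bsub>N\<^esub> x)) \<oplus>\<^bsub>N\<^esub> w" using x by blast
    have wN: "w \<in> carrier N" using D(1) rw(2) by auto
    define b where "b = r \<otimes> a"
    have b: "b \<in> \<mm>" unfolding b_def by (rule I.I_l_closed[OF a rw(1)])
    then have bR: "b \<in> carrier R" by (rule I.Icarr)
    have xw: "x = (b \<odot>\<^bsub>N\<^esub> x) \<oplus>\<^bsub>N\<^esub> w" using rw(3) N.smult_assoc1[OF rw(1) aR x] by (simp add: b_def)
    have "(\<one> \<ominus> b) \<odot>\<^bsub>N\<^esub> x = x \<oplus>\<^bsub>N\<^esub> \<ominus>\<^bsub>N\<^esub> (b \<odot>\<^bsub>N\<^esub> x)"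
      using bR x by (simp add: a_minus_def N.smult_l_distr N.smult_l_minus)
    also have "\<dots> = w"
    proof -
      have "x \<oplus>\<^bsub>N\<^esub> \<ominus>\<^bsub>N\<^esub> (b \<odot>\<^bsub>N\<^esub> x) = (w \<oplus>\<^bsub>N\<^esub> (b \<odot>\<^bsub>N\<^esub> x)) \<oplus>\<^bsub>N\<^esub> \<ominus>\<^bsub>N\<^esub> (b \<odot>\<^bsub>N\<^esub> x)"
        using xw N.a_comm[OF wN, of "b \<odot>\<^bsub>N\<^esub> x"] bR x by simp
      also have "\<dots> = w" using wN bR x by (simp add: N.a_assoc N.r_neg)
      finally show ?thesis .
    qed
    finally have eq: "(\<one> \<ominus> b) \<odot>\<^bsub>N\<^esub> x = w" .
    have u: "\<one> \<ominus> b \<in> Units R" by (rule one_minus_unit[OF b])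
    have "x = (inv (\<one> \<ominus> b) \<otimes> (\<one> \<ominus> b)) \<odot>\<^bsub>N\<^esub> x" using Units_l_inv[OF u] x by simp
    also have "\<dots> = inv (\<one> \<ominus> b) \<odot>\<^bsub>N\<^esub> w"
      using N.smult_assoc1[of "inv (\<one> \<ominus> b)" "\<one> \<ominus> b" x] u x bR eq by simp
    also have "\<dots> \<in> V" using D(6) u rw(2) by simp
    finally show False using D(6)[OF aR] ax by blast
  qed
  then have "V = carrier N" using gen[OF sV WV] by blast
  then show False using nV by blast
qed

end

section \<open>Surjective endomorphisms of Noetherian modules\<close>

lemma funpow_hom_closed:
  "f \<in> mod_hom R M M \<Longrightarrow> x \<in> carrier M \<Longrightarrow> (f ^^ n) x \<in> carrier M"
  by (induction n) (auto simp: mod_homD(1))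

text \<open>The kernels of the powers of f ascend and become stationary, say at n. By surjectivity
  an element of the kernel of f has the form f^n y; then f^(n + 1) y = 0, so already f^n y =
  0.\<close>

lemma surjective_endo_inj:
  assumes M: "module R M" "noeth R M" and f: "f \<in> mod_hom R M M" "f ` carrier M = carrier M"
  shows "bij_betw f (carrier M) (carrier M)"
proof -
  interpret M: module R M by fact
  define K where "K n = {x \<in> carrier M. (f ^^ n) x = \<zero>\<^bsub>M\<^esub>}" for n
  have f0: "f \<zero>\<^bsub>M\<^esub> = \<zero>\<^bsub>M\<^esub>" by (rule hom_0[OF M(1) M(1) f(1)])
  have K_sub: "submodule (K n) R M" for n
  proof (induction n)
    case 0 show ?case using submodule_zero[OF M(1)] by (auto simp: K_def cong: conj_cong)
  next
    case (Suc n)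
    have "K (Suc n) = {x \<in> carrier M. f x \<in> K n}"
      using mod_homD(1)[OF f(1)] by (auto simp: K_def funpow_swap1)
    then show ?case using submodule_vimage[OF M(1) M(1) f(1) Suc] by simp
  qed
  have K_mono: "K n \<subseteq> K (Suc n)" for n using f0 by (auto simp: K_def)
  obtain W where W: "W \<in> range K" "\<And>V. V \<in> range K \<Longrightarrow> W \<subseteq> V \<Longrightarrow> V = W"
    by (rule noeth_maximal[OF M, of "range K"]) (use K_sub in auto)
  then obtain n where n: "W = K n" by auto
  have Kn: "K (Suc n) = K n" using W(2)[of "K (Suc n)"] K_mono[of n] n by auto
  have surj: "(f ^^ j) ` carrier M = carrier M" for j
  proof (induction j)
    case (Suc j)
    have "(f ^^ Suc j) ` carrier M = f ` ((f ^^ j) ` carrier M)" by (simp add: image_comp)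
    then show ?case using Suc f(2) by simp
  qed simp
  have ker: "x = \<zero>\<^bsub>M\<^esub>" if x: "x \<in> carrier M" "f x = \<zero>\<^bsub>M\<^esub>" for x
  proof -
    obtain y where y: "y \<in> carrier M" "x = (f ^^ n) y" using surj[of n] x(1) by auto
    then have "y \<in> K (Suc n)" using x(2) by (simp add: K_def)
    then have "y \<in> K n" using Kn by simp
    then show ?thesis using y by (simp add: K_def)
  qed
  have "inj_on f (carrier M)"
  proof (rule inj_onI)
    fix x y assume xy: "x \<in> carrier M" "y \<in> carrier M" "f x = f y"
    have "f (x \<ominus>\<^bsub>M\<^esub> y) = \<zero>\<^bsub>M\<^esub>"
      using hom_minus[OF M(1) M(1) f(1) xy(1,2)] xy mod_homD(1)[OF f(1)] by (simp add: a_minus_def M.r_neg)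
    then have "x \<ominus>\<^bsub>M\<^esub> y = \<zero>\<^bsub>M\<^esub>" using ker[of "x \<ominus>\<^bsub>M\<^esub> y"] xy by simp
    moreover have "x = (x \<ominus>\<^bsub>M\<^esub> y) \<oplus>\<^bsub>M\<^esub> y" using xy(1,2) by (simp add: a_minus_def M.a_assoc M.l_neg)
    ultimately show "x = y" using xy(2) by simp
  qed
  then show ?thesis using f(2) by (simp add: bij_betw_def)
qed

text \<open>E' is 3 E^2 - 2 E^3, Newton's iteration for X^2 - X with the inverse of the derivative 2
  E - 1 replaced by 2 E - 1 itself, whose square is 1 + 4 \<delta>. The first-order terms cancel,
  and the new defect is \<delta>^2 (w^2 - 4).\<close>

lemma (in cring) newton_step:
  assumes E: "E \<in> carrier R" and \<delta>: "\<delta> = E \<otimes> E \<ominus> E" and w: "w = \<one> \<ominus> (E \<oplus> E)"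
    and E': "E' = E \<oplus> \<delta> \<otimes> w"
  shows "E' \<otimes> E' \<ominus> E' = \<delta> \<otimes> (\<delta> \<otimes> (w \<otimes> w \<ominus> (\<one> \<oplus> \<one> \<oplus> \<one> \<oplus> \<one>)))"
proof -
  have d: "\<delta> \<in> carrier R" "w \<in> carrier R" using E by (simp_all add: \<delta> w)
  define Z where "Z = \<delta> \<otimes> w"
  have Z: "Z \<in> carrier R" using d by (simp add: Z_def)
  have "(E \<oplus> Z) \<otimes> (E \<oplus> Z) \<ominus> (E \<oplus> Z) = ((E \<otimes> E \<ominus> E) \<ominus> (\<one> \<ominus> (E \<oplus> E)) \<otimes> Z) \<oplus> Z \<otimes> Z"
    using E Z by algebra
  then have 1: "E' \<otimes> E' \<ominus> E' = (\<delta> \<ominus> w \<otimes> Z) \<oplus> Z \<otimes> Z" by (simp only: E' Z_def[symmetric] \<delta>[symmetric] w[symmetric])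
  have "(\<one> \<ominus> (E \<oplus> E)) \<otimes> (\<one> \<ominus> (E \<oplus> E)) =
      \<one> \<oplus> ((E \<otimes> E \<ominus> E) \<oplus> (E \<otimes> E \<ominus> E) \<oplus> (E \<otimes> E \<ominus> E) \<oplus> (E \<otimes> E \<ominus> E))"
    using E by (algebra; simp add: a_ac)
  then have ww: "w \<otimes> w = \<one> \<oplus> (\<delta> \<oplus> \<delta> \<oplus> \<delta> \<oplus> \<delta>)" by (simp only: \<delta>[symmetric] w[symmetric])
  have wZ: "w \<otimes> Z = \<delta> \<otimes> (w \<otimes> w)" unfolding Z_def using d by algebra
  have 2: "\<delta> \<ominus> w \<otimes> Z = \<ominus> (\<delta> \<otimes> (\<delta> \<oplus> \<delta> \<oplus> \<delta> \<oplus> \<delta>))"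
    unfolding wZ ww using d by algebra
  have 3: "Z \<otimes> Z = \<delta> \<otimes> (\<delta> \<otimes> (w \<otimes> w))" unfolding Z_def using d by algebra
  show ?thesis unfolding 1 2 3 using d by algebra
qed

section \<open>Powers of the maximal ideal and adic limits\<close>

locale complete_local = noetherian_local +
  assumes complete: "adically_complete R (max_ideal R)"
begin

abbreviation "P k \<equiv> ideal_pow R \<mm> k"

lemma P_ideal: "ideal (P k) R"
proof (induction k)
  interpret cring R by (rule cring)
  {
    case 0 show ?case by (simp add: oneideal)
  next
    case (Suc k) then show ?case using ideal_prod_is_ideal[OF max_ideal_ideal] by simp
  }
qed

lemma P_Suc: "P (Suc k) \<subseteq> P k"
proof -
  interpret cring R by (rule cring)
  show ?thesis using ideal_prod_inter[OF max_ideal_ideal P_ideal[of k]] by simp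
qed

lemma P_antimono: "j \<le> k \<Longrightarrow> P k \<subseteq> P j"
  by (induction rule: dec_induct) (use P_Suc in blast)+

lemma P_1: "P 1 = \<mm>"
proof
  interpret cring R by (rule cring)
  interpret I: ideal \<mm> R by (rule max_ideal_ideal)
  show "P 1 \<subseteq> \<mm>" using ideal_prod_inter[OF max_ideal_ideal oneideal] by simp
  show "\<mm> \<subseteq> P 1"
  proof
    fix a assume a: "a \<in> \<mm>"
    have "a \<otimes> \<one> \<in> ideal_prod R \<mm> (carrier R)" by (rule ideal_prod.prod[OF a one_closed])
    then show "a \<in> P 1" using I.Icarr[OF a] by simp
  qed
qed

lemma P_mult: "a \<in> \<mm> \<Longrightarrow> b \<in> P k \<Longrightarrow> a \<otimes> b \<in> P (Suc k)"
  by (simp add: ideal_prod.prod)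

lemma P_Inter: "(\<And>k. a \<in> P k) \<Longrightarrow> a = \<zero>"
  using complete by (auto simp: adically_complete_def)

text \<open>Completeness bounds \<open>x n \<ominus> l\<close> only for large n, depending on k.
  Passing through a far term \<open>x ?q\<close> gives the bound from n = k on.\<close>

lemma P_limit:
  assumes "\<And>n. x n \<in> carrier R" "\<And>k. x (Suc k) \<ominus> x k \<in> P k"
  obtains l where "l \<in> carrier R" "\<And>k n. k \<le> n \<Longrightarrow> x n \<ominus> l \<in> P k"
proof -
  interpret cring R by (rule cring)
  have tele: "x n \<ominus> x k \<in> P j" if "j \<le> k" "k \<le> n" for j k n
    using that(2)
  proof (induction rule: dec_induct)
    case base
    show ?case using assms(1) ideal.axioms(1)[OF P_ideal[of j]] by (simp add: a_minus_def r_neg additive_subgroup.zero_closed)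
  next
    case (step n)
    interpret I: ideal "P j" R by (rule P_ideal)
    have "x (Suc n) \<ominus> x n \<in> P j" using assms(2)[of n] P_antimono[of j n] step that(1) by auto
    then have "(x (Suc n) \<ominus> x n) \<oplus> (x n \<ominus> x k) \<in> P j" using step I.a_closed by blast
    moreover have "(x (Suc n) \<ominus> x n) \<oplus> (x n \<ominus> x k) = x (Suc n) \<ominus> x k"
      using assms(1)[of n] assms(1)[of "Suc n"] assms(1)[of k] by algebra
    ultimately show ?case by simp
  qed
  have cauchy: "x m \<ominus> x n \<in> P k" if "k \<le> m" "k \<le> n" for m n k
  proof (cases "n \<le> m")
    case True then show ?thesis using tele[OF that(2)] by simp
  next
    case False
    interpret I: ideal "P k" R by (rule P_ideal)
    have "x n \<ominus> x m \<in> P k" using tele[OF that(1)] False by simp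
    then have "\<ominus> (x n \<ominus> x m) \<in> P k" by (rule I.a_inv_closed)
    moreover have "\<ominus> (x n \<ominus> x m) = x m \<ominus> x n" using assms(1)[of n] assms(1)[of m] by algebra
    ultimately show ?thesis by simp
  qed
  have "range x \<subseteq> carrier R" using assms(1) by auto
  moreover have "\<forall>k. \<exists>N. \<forall>m\<ge>N. \<forall>n\<ge>N. x m \<ominus> x n \<in> P k" using cauchy by blast
  ultimately obtain l where l: "l \<in> carrier R" "\<And>k. \<exists>N. \<forall>n\<ge>N. x n \<ominus> l \<in> P k"
    using complete unfolding adically_complete_def by blast
  have "x n \<ominus> l \<in> P k" if "k \<le> n" for k n
  proof -
    obtain N where N: "\<And>n. n \<ge> N \<Longrightarrow> x n \<ominus> l \<in> P k" using l(2) by blast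
    let ?q = "max N k"
    interpret I: ideal "P k" R by (rule P_ideal)
    have "(x n \<ominus> x ?q) \<oplus> (x ?q \<ominus> l) \<in> P k" using cauchy[OF that, of ?q] N[of ?q] by (intro I.a_closed) auto
    moreover have "(x n \<ominus> x ?q) \<oplus> (x ?q \<ominus> l) = x n \<ominus> l"
      using assms(1)[of n] assms(1)[of ?q] l(1) by algebra
    ultimately show ?thesis by simp
  qed
  then show ?thesis using that l(1) by blast
qed

lemma P_vectors: "submodule {c \<in> carrier (free_module R n). \<forall>i<n. c i \<in> P k} R (free_module R n)"
proof -
  have F: "module R (free_module R n)" by (rule module_free[OF cring])
  show ?thesis
  proof (rule submoduleI'[OF F])
  interpret I: ideal "P k" R by (rule P_ideal)
  interpret D: module R "free_module R n" by (rule F)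
  show "\<zero>\<^bsub>free_module R n\<^esub> \<in> {c \<in> carrier (free_module R n). \<forall>i<n. c i \<in> P k}"
    using D.zero_closed I.zero_closed by (simp add: free_module_simps(2))
  show "x \<oplus>\<^bsub>free_module R n\<^esub> y \<in> {c \<in> carrier (free_module R n). \<forall>i<n. c i \<in> P k}"
    if "x \<in> {c \<in> carrier (free_module R n). \<forall>i<n. c i \<in> P k}"
      "y \<in> {c \<in> carrier (free_module R n). \<forall>i<n. c i \<in> P k}" for x y
    using that D.a_closed I.a_closed by (simp add: free_module_simps(3))
  show "r \<odot>\<^bsub>free_module R n\<^esub> x \<in> {c \<in> carrier (free_module R n). \<forall>i<n. c i \<in> P k}"
    if "r \<in> carrier R" "x \<in> {c \<in> carrier (free_module R n). \<forall>i<n. c i \<in> P k}" for r x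
    using that D.smult_closed I.I_l_closed by (simp add: free_module_simps(4))
  qed auto
qed

end

section \<open>Finite commutative algebras over a complete local ring\<close>

locale finite_algebra = complete_local +
  fixes S :: "('a, 's) module" and d :: nat and g :: "(nat \<Rightarrow> 'a) \<Rightarrow> 's"
  assumes S_cring: "cring S" and S_module: "module R S"
    and S_assoc: "\<And>a x y. \<lbrakk>a \<in> carrier R; x \<in> carrier S; y \<in> carrier S\<rbrakk> \<Longrightarrow>
      (a \<odot>\<^bsub>S\<^esub> x) \<otimes>\<^bsub>S\<^esub> y = a \<odot>\<^bsub>S\<^esub> (x \<otimes>\<^bsub>S\<^esub> y)"
    and g: "g \<in> mod_hom R (free_module R d) S" "g ` carrier (free_module R d) = carrier S"
begin

sublocale A: cring S by (rule S_cring)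
sublocale M: module R S by (rule S_module)

text \<open>\<open>J k\<close> is the ideal \<open>\<mm>\<^sup>k S\<close>.\<close>

definition "J k = g ` {c \<in> carrier (free_module R d). \<forall>i<d. c i \<in> P k}"

lemma Fd: "module R (free_module R d)" by (rule module_free[OF cring])

lemma J_carrier: "x \<in> J k \<Longrightarrow> x \<in> carrier S"
  using mod_homD(1)[OF g(1)] by (auto simp: J_def)

lemma J_submodule: "submodule (J k) R S"
  unfolding J_def by (rule submodule_image[OF Fd S_module g(1) P_vectors])

lemma J_smult:
  assumes "c \<in> P k" "v \<in> carrier S" shows "c \<odot>\<^bsub>S\<^esub> v \<in> J k"
proof -
  interpret I: ideal "P k" R by (rule P_ideal)
  obtain r where r: "r \<in> carrier (free_module R d)" "v = g r" using assms(2) g(2) by auto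
  have c: "c \<in> carrier R" by (rule I.Icarr[OF assms(1)])
  have "c \<odot>\<^bsub>free_module R d\<^esub> r \<in> {c \<in> carrier (free_module R d). \<forall>i<d. c i \<in> P k}"
    using module.smult_closed[OF Fd c r(1)] I.I_r_closed[OF assms(1)] free_memD[OF r(1)]
    by (simp add: free_module_simps(4))
  moreover have "c \<odot>\<^bsub>S\<^esub> v = g (c \<odot>\<^bsub>free_module R d\<^esub> r)" using mod_homD(3)[OF g(1) c r(1)] r(2) by simp
  ultimately show ?thesis unfolding J_def by blast
qed

lemma J_antimono: "j \<le> k \<Longrightarrow> J k \<subseteq> J j"
  using P_antimono[of j k] unfolding J_def by blast

lemma lin_sum_mem:
  assumes "\<zero>\<^bsub>N\<^esub> \<in> W" "\<And>x y. x \<in> W \<Longrightarrow> y \<in> W \<Longrightarrow> x \<oplus>\<^bsub>N\<^esub> y \<in> W" "\<And>i. i < n \<Longrightarrow> r i \<odot>\<^bsub>N\<^esub> x i \<in> W"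
  shows "lin_sum N x r n \<in> W"
  using assms(3) by (induction n) (use assms(1,2) in auto)

lemma g_expand:
  assumes "c \<in> carrier (free_module R d)"
  shows "g c = lin_sum S (\<lambda>i. g (unit_vec R d i)) c d"
  by (rule hom_free_eq[OF S_module g(1) assms])

lemma gen_closed: "g (unit_vec R d i) \<in> carrier S"
  by (rule mod_homD(1)[OF g(1) unit_vec_closed[OF cring]])

lemma mult_hom:
  assumes "w \<in> carrier S" shows "(\<lambda>v\<in>carrier S. v \<otimes>\<^bsub>S\<^esub> w) \<in> mod_hom R S S"
  by (rule mod_homI[OF S_module]) (use assms in \<open>auto simp: A.l_distr S_assoc\<close>)

lemma g_mult:
  assumes "c \<in> carrier (free_module R d)" "w \<in> carrier S"
  shows "g c \<otimes>\<^bsub>S\<^esub> w = lin_sum S (\<lambda>i. g (unit_vec R d i) \<otimes>\<^bsub>S\<^esub> w) c d"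
proof -
  have "(\<lambda>v\<in>carrier S. v \<otimes>\<^bsub>S\<^esub> w) (lin_sum S (\<lambda>i. g (unit_vec R d i)) c d) =
      lin_sum S (\<lambda>i. (\<lambda>v\<in>carrier S. v \<otimes>\<^bsub>S\<^esub> w) (g (unit_vec R d i))) c d"
    by (rule hom_lin_sum[OF S_module S_module mult_hom[OF assms(2)] gen_closed]) (rule free_memD[OF assms(1)])
  moreover have "g c \<in> carrier S" by (rule mod_homD(1)[OF g(1) assms(1)])
  ultimately show ?thesis using gen_closed by (simp add: g_expand[OF assms(1), symmetric])
qed

lemma J_ideal: "ideal (J k) S"
proof (rule idealI)
  note D = submoduleD[OF S_module J_submodule[of k]]
  have r: "v \<otimes>\<^bsub>S\<^esub> w \<in> J k" if v: "v \<in> J k" and w: "w \<in> carrier S" for v w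
  proof -
    obtain c where c: "c \<in> carrier (free_module R d)" "\<And>i. i < d \<Longrightarrow> c i \<in> P k" "v = g c" using v by (auto simp: J_def)
    show ?thesis unfolding c(3) g_mult[OF c(1) w]
      by (rule lin_sum_mem[OF D(2,3)]) (use c(2) J_smult gen_closed w in auto)
  qed
  show "ring S" by (rule A.ring_axioms)
  show "subgroup (J k) (add_monoid S)" using J_submodule by (rule submodule.axioms(1))
  show "\<And>v w. v \<in> J k \<Longrightarrow> w \<in> carrier S \<Longrightarrow> v \<otimes>\<^bsub>S\<^esub> w \<in> J k" by (rule r)
  show "\<And>v w. v \<in> J k \<Longrightarrow> w \<in> carrier S \<Longrightarrow> w \<otimes>\<^bsub>S\<^esub> v \<in> J k" using r J_carrier A.m_comm by metis
qed

lemma J_mult: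
  assumes v: "v \<in> J 1" and w: "w \<in> J k"
  shows "v \<otimes>\<^bsub>S\<^esub> w \<in> J (Suc k)"
proof -
  interpret I: ideal "J k" S by (rule J_ideal)
  note D = submoduleD[OF S_module J_submodule[of "Suc k"]]
  have sm: "a \<odot>\<^bsub>S\<^esub> Z \<in> J (Suc k)" if a: "a \<in> \<mm>" and Z: "Z \<in> J k" for a Z
  proof -
    interpret m: ideal \<mm> R by (rule max_ideal_ideal)
    have aR: "a \<in> carrier R" by (rule m.Icarr[OF a])
    obtain c where c: "c \<in> carrier (free_module R d)" "\<And>i. i < d \<Longrightarrow> c i \<in> P k" "Z = g c" using Z by (auto simp: J_def)
    have "a \<odot>\<^bsub>free_module R d\<^esub> c \<in> {c \<in> carrier (free_module R d). \<forall>i<d. c i \<in> P (Suc k)}"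
      using module.smult_closed[OF Fd aR c(1)] P_mult[OF a c(2)] by (simp add: free_module_simps(4))
    moreover have "a \<odot>\<^bsub>S\<^esub> Z = g (a \<odot>\<^bsub>free_module R d\<^esub> c)" using mod_homD(3)[OF g(1) aR c(1)] c(3) by simp
    ultimately show ?thesis unfolding J_def by blast
  qed
  obtain c where c: "c \<in> carrier (free_module R d)" "\<And>i. i < d \<Longrightarrow> c i \<in> \<mm>" "v = g c"
    using v P_1 by (auto simp: J_def)
  show ?thesis unfolding c(3) g_mult[OF c(1) J_carrier[OF w]]
    by (rule lin_sum_mem[OF D(2,3)]) (use c(2) sm I.I_l_closed[OF w] gen_closed in auto)
qed

text \<open>A polynomial in \<open>a\<close>, its coefficients listed from the constant term on,
  with the remainder \<open>y\<close> in place of further terms. This order lets the lowest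
  coefficients be stripped off one at a time.\<close>

primrec horner :: "'s \<Rightarrow> 's \<Rightarrow> 'a list \<Rightarrow> 's" where
  "horner a y [] = y"
| "horner a y (c # cs) = (c \<odot>\<^bsub>S\<^esub> \<one>\<^bsub>S\<^esub>) \<oplus>\<^bsub>S\<^esub> a \<otimes>\<^bsub>S\<^esub> horner a y cs"

lemma horner_closed: "a \<in> carrier S \<Longrightarrow> y \<in> carrier S \<Longrightarrow> set cs \<subseteq> carrier R \<Longrightarrow> horner a y cs \<in> carrier S"
  by (induction cs) auto

lemma horner_snoc: "horner a y (cs @ [c]) = horner a ((c \<odot>\<^bsub>S\<^esub> \<one>\<^bsub>S\<^esub>) \<oplus>\<^bsub>S\<^esub> a \<otimes>\<^bsub>S\<^esub> y) cs"
  by (induction cs) auto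

lemma lin_sum_horner:
  fixes k :: nat
  assumes "a \<in> carrier S" "y \<in> carrier S" "\<And>i. i < k \<Longrightarrow> r i \<in> carrier R"
  shows "lin_sum S (\<lambda>i. a [^]\<^bsub>S\<^esub> i) r k \<oplus>\<^bsub>S\<^esub> (a [^]\<^bsub>S\<^esub> k) \<otimes>\<^bsub>S\<^esub> y = horner a y (map r [0..<k])"
  using assms(2,3)
proof (induction k arbitrary: y)
  case 0 then show ?case by simp
next
  case (Suc k)
  let ?y = "(r k \<odot>\<^bsub>S\<^esub> \<one>\<^bsub>S\<^esub>) \<oplus>\<^bsub>S\<^esub> a \<otimes>\<^bsub>S\<^esub> y"
  have rk: "r k \<in> carrier R" using Suc by simp
  have y: "?y \<in> carrier S" using Suc.prems(1) assms(1) rk by simp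
  have L: "lin_sum S (\<lambda>i. a [^]\<^bsub>S\<^esub> i) r k \<in> carrier S"
    by (rule lin_sum_closed[OF S_module]) (use assms(1) Suc.prems in auto)
  have ak: "a [^]\<^bsub>S\<^esub> k \<in> carrier S" using assms(1) by simp
  have "(a [^]\<^bsub>S\<^esub> k) \<otimes>\<^bsub>S\<^esub> ?y = (r k \<odot>\<^bsub>S\<^esub> (a [^]\<^bsub>S\<^esub> k)) \<oplus>\<^bsub>S\<^esub> (a [^]\<^bsub>S\<^esub> Suc k) \<otimes>\<^bsub>S\<^esub> y"
  proof -
    have "(a [^]\<^bsub>S\<^esub> k) \<otimes>\<^bsub>S\<^esub> (r k \<odot>\<^bsub>S\<^esub> \<one>\<^bsub>S\<^esub>) = (r k \<odot>\<^bsub>S\<^esub> \<one>\<^bsub>S\<^esub>) \<otimes>\<^bsub>S\<^esub> (a [^]\<^bsub>S\<^esub> k)"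
      using rk ak by (intro A.m_comm) auto
    also have "\<dots> = r k \<odot>\<^bsub>S\<^esub> (a [^]\<^bsub>S\<^esub> k)" using rk ak by (simp add: S_assoc)
    finally show ?thesis using rk ak assms(1) Suc.prems(1) by (simp add: A.r_distr A.m_assoc)
  qed
  then have "lin_sum S (\<lambda>i. a [^]\<^bsub>S\<^esub> i) r (Suc k) \<oplus>\<^bsub>S\<^esub> (a [^]\<^bsub>S\<^esub> Suc k) \<otimes>\<^bsub>S\<^esub> y =
      lin_sum S (\<lambda>i. a [^]\<^bsub>S\<^esub> i) r k \<oplus>\<^bsub>S\<^esub> (a [^]\<^bsub>S\<^esub> k) \<otimes>\<^bsub>S\<^esub> ?y"
    using L rk ak assms(1) Suc.prems(1) by (simp add: A.a_assoc)
  also have "\<dots> = horner a ?y (map r [0..<k])" by (rule Suc.IH) (use y Suc.prems in auto)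
  finally show ?case by (simp add: horner_snoc)
qed

text \<open>The spans of 1, a, ..., a^(k - 1) form an ascending chain in a Noetherian module, so
  some power lies in the span of the lower ones. This is an integral equation for \<open>a\<close>,
  obtained without determinants.\<close>

lemma pow_in_lower_span:
  assumes a: "a \<in> carrier S"
  obtains k :: nat and r where "\<And>i. i < k \<Longrightarrow> r i \<in> carrier R" "a [^]\<^bsub>S\<^esub> k = lin_sum S (\<lambda>i. a [^]\<^bsub>S\<^esub> i) r k"
proof -
  have F: "module R (free_module R k)" for k by (rule module_free[OF cring])
  let ?l = "\<lambda>k. lin_map R S (\<lambda>i. a [^]\<^bsub>S\<^esub> i) k"
  have l: "?l k \<in> mod_hom R (free_module R k) S" for k by (rule lin_map_hom[OF S_module]) (use a in auto)
  define W where "W k = ?l k ` carrier (free_module R k)" for k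
  have W: "submodule (W k) R S" for k
    unfolding W_def by (rule submodule_image[OF F S_module l submodule_carrier[OF F]])
  have mono: "W k \<subseteq> W (Suc k)" for k
  proof
    fix x assume "x \<in> W k"
    then obtain r where r: "r \<in> carrier (free_module R k)" "x = lin_sum S (\<lambda>i. a [^]\<^bsub>S\<^esub> i) r k"
      by (auto simp: W_def lin_map_def)
    let ?r = "\<lambda>i\<in>{..<Suc k}. if i < k then r i else \<zero>"
    have r': "?r \<in> carrier (free_module R (Suc k))"
      by (rule free_module_memI) (use free_memD[OF r(1)] M.R.zero_closed in auto)
    have "lin_sum S (\<lambda>i. a [^]\<^bsub>S\<^esub> i) ?r k = x" unfolding r(2) by (rule lin_sum_cong) auto
    moreover have "x \<in> carrier S" unfolding r(2)
      by (rule lin_sum_closed[OF S_module]) (use a free_memD[OF r(1)] in auto)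
    ultimately have "lin_sum S (\<lambda>i. a [^]\<^bsub>S\<^esub> i) ?r (Suc k) = x" using a by simp
    then show "x \<in> W (Suc k)" using r' unfolding W_def lin_map_def by force
  qed
  have pw: "a [^]\<^bsub>S\<^esub> k \<in> W (Suc k)" for k
    using lin_sum_unit_vec[OF S_module, where n = "Suc k" and k = k and x = "\<lambda>i. a [^]\<^bsub>S\<^esub> i"] a
      unit_vec_closed[OF cring, of "Suc k" k]
    unfolding W_def lin_map_def by (intro image_eqI[of _ _ "unit_vec R (Suc k) k"]) (auto simp del: lin_sum.simps)
  have nS: "noeth R S" by (rule noeth_image[OF Fd S_module g noeth_free[OF cring noetherian]])
  obtain V where V: "V \<in> range W" "\<And>V'. V' \<in> range W \<Longrightarrow> V \<subseteq> V' \<Longrightarrow> V' = V"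
    by (rule noeth_maximal[OF S_module nS, of "range W"]) (use W in auto)
  then obtain k where k: "V = W k" by auto
  have "a [^]\<^bsub>S\<^esub> k \<in> W k" using V(2)[of "W (Suc k)"] mono[of k] pw[of k] k by auto
  then obtain r where "r \<in> carrier (free_module R k)" "a [^]\<^bsub>S\<^esub> k = lin_sum S (\<lambda>i. a [^]\<^bsub>S\<^esub> i) r k"
    by (auto simp: W_def lin_map_def)
  then show ?thesis using that free_memD by metis
qed

text \<open>Read the equation modulo \<mm> S from its lowest coefficient. A coefficient in \<mm>
  disappears and the power of \<open>a\<close> in front grows by one; the first unit coefficient can
  be divided out and expresses a^n as a multiple of a^(n + 1).\<close>

lemma horner_step:
  fixes n :: nat
  assumes "a \<in> carrier S" "set cs \<subseteq> carrier R" "(a [^]\<^bsub>S\<^esub> n) \<otimes>\<^bsub>S\<^esub> horner a (\<ominus>\<^bsub>S\<^esub> \<one>\<^bsub>S\<^esub>) cs \<in> J 1"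
  shows "\<exists>(n::nat) s. s \<in> carrier S \<and> (a [^]\<^bsub>S\<^esub> n) \<ominus>\<^bsub>S\<^esub> ((a [^]\<^bsub>S\<^esub> Suc n) \<otimes>\<^bsub>S\<^esub> s) \<in> J (1::nat)"
  using assms(2,3)
proof (induction cs arbitrary: n)
  interpret I: ideal "J 1" S by (rule J_ideal)
  {
    case Nil
    \<comment> \<open>Only the remainder -1 is left, so a^n itself lies in \<open>J 1\<close> and s
      = 0 works.\<close>
    have "\<ominus>\<^bsub>S\<^esub> ((a [^]\<^bsub>S\<^esub> n) \<otimes>\<^bsub>S\<^esub> (\<ominus>\<^bsub>S\<^esub> \<one>\<^bsub>S\<^esub>)) \<in> J 1" using Nil by (intro I.a_inv_closed) simp
    moreover have "\<ominus>\<^bsub>S\<^esub> ((a [^]\<^bsub>S\<^esub> n) \<otimes>\<^bsub>S\<^esub> (\<ominus>\<^bsub>S\<^esub> \<one>\<^bsub>S\<^esub>)) = (a [^]\<^bsub>S\<^esub> n) \<ominus>\<^bsub>S\<^esub> ((a [^]\<^bsub>S\<^esub> Suc n) \<otimes>\<^bsub>S\<^esub> \<zero>\<^bsub>S\<^esub>)"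
      using assms(1) by (simp add: A.r_minus A.minus_minus a_minus_def)
    ultimately show ?case using A.zero_closed by metis
  next
    case (Cons c cs)
    let ?h = "horner a (\<ominus>\<^bsub>S\<^esub> \<one>\<^bsub>S\<^esub>) cs"
    have c: "c \<in> carrier R" and cs: "set cs \<subseteq> carrier R" using Cons.prems by auto
    have h: "?h \<in> carrier S" by (rule horner_closed) (use assms(1) cs in auto)
    have an: "a [^]\<^bsub>S\<^esub> n \<in> carrier S" using assms(1) by simp
    have ca: "c \<odot>\<^bsub>S\<^esub> (a [^]\<^bsub>S\<^esub> n) \<in> carrier S" using c an by simp
    have ah: "(a [^]\<^bsub>S\<^esub> Suc n) \<otimes>\<^bsub>S\<^esub> ?h \<in> carrier S" using assms(1) h by simp
    have "(a [^]\<^bsub>S\<^esub> n) \<otimes>\<^bsub>S\<^esub> (c \<odot>\<^bsub>S\<^esub> \<one>\<^bsub>S\<^esub>) = (c \<odot>\<^bsub>S\<^esub> \<one>\<^bsub>S\<^esub>) \<otimes>\<^bsub>S\<^esub> (a [^]\<^bsub>S\<^esub> n)"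
      using c an by (intro A.m_comm) auto
    also have "\<dots> = c \<odot>\<^bsub>S\<^esub> (a [^]\<^bsub>S\<^esub> n)" using c an by (simp add: S_assoc)
    finally have "(a [^]\<^bsub>S\<^esub> n) \<otimes>\<^bsub>S\<^esub> horner a (\<ominus>\<^bsub>S\<^esub> \<one>\<^bsub>S\<^esub>) (c # cs) = (c \<odot>\<^bsub>S\<^esub> (a [^]\<^bsub>S\<^esub> n)) \<oplus>\<^bsub>S\<^esub> (a [^]\<^bsub>S\<^esub> Suc n) \<otimes>\<^bsub>S\<^esub> ?h"
      using c an h assms(1) by (simp add: A.r_distr A.m_assoc)
    then have mem: "(c \<odot>\<^bsub>S\<^esub> (a [^]\<^bsub>S\<^esub> n)) \<oplus>\<^bsub>S\<^esub> (a [^]\<^bsub>S\<^esub> Suc n) \<otimes>\<^bsub>S\<^esub> ?h \<in> J 1" using Cons.prems(2) by simp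
    show ?case
    proof (cases "c \<in> \<mm>")
      case True
      have "\<ominus>\<^bsub>S\<^esub> (c \<odot>\<^bsub>S\<^esub> (a [^]\<^bsub>S\<^esub> n)) \<in> J 1"
        by (rule I.a_inv_closed[OF J_smult[OF _ an]]) (use True P_1 in simp)
      from I.a_closed[OF this mem] have "(a [^]\<^bsub>S\<^esub> Suc n) \<otimes>\<^bsub>S\<^esub> ?h \<in> J 1"
        using ca ah by (simp add: A.a_assoc[symmetric] A.l_neg del: A.nat_pow_Suc)
      then show ?thesis by (rule Cons.IH[OF cs])
    next
      case False
      have u: "c \<in> Units R" by (rule unitI[OF c False])
      let ?i = "inv c"
      have i: "?i \<in> carrier R" "?i \<otimes> c = \<one>" using u by auto
      \<comment> \<open>Dividing c a^n + a^(n + 1) h by the unit c gives a^n = a^(n + 1) (- h / c)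
        modulo \<mm> S, which is the witness.\<close>
      have s: "\<ominus>\<^bsub>S\<^esub> (?i \<odot>\<^bsub>S\<^esub> ?h) \<in> carrier S" using i h by simp
      have "?i \<odot>\<^bsub>S\<^esub> ((c \<odot>\<^bsub>S\<^esub> (a [^]\<^bsub>S\<^esub> n)) \<oplus>\<^bsub>S\<^esub> (a [^]\<^bsub>S\<^esub> Suc n) \<otimes>\<^bsub>S\<^esub> ?h) \<in> J 1"
        by (rule submoduleD(6)[OF S_module J_submodule i(1) mem])
      moreover have "?i \<odot>\<^bsub>S\<^esub> ((c \<odot>\<^bsub>S\<^esub> (a [^]\<^bsub>S\<^esub> n)) \<oplus>\<^bsub>S\<^esub> (a [^]\<^bsub>S\<^esub> Suc n) \<otimes>\<^bsub>S\<^esub> ?h) =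
          (a [^]\<^bsub>S\<^esub> n) \<ominus>\<^bsub>S\<^esub> ((a [^]\<^bsub>S\<^esub> Suc n) \<otimes>\<^bsub>S\<^esub> (\<ominus>\<^bsub>S\<^esub> (?i \<odot>\<^bsub>S\<^esub> ?h)))"
      proof -
        have "?i \<odot>\<^bsub>S\<^esub> (c \<odot>\<^bsub>S\<^esub> (a [^]\<^bsub>S\<^esub> n)) = a [^]\<^bsub>S\<^esub> n"
          using M.smult_assoc1[OF i(1) c an] i(2) an by simp
        moreover have "?i \<odot>\<^bsub>S\<^esub> ((a [^]\<^bsub>S\<^esub> Suc n) \<otimes>\<^bsub>S\<^esub> ?h) = (a [^]\<^bsub>S\<^esub> Suc n) \<otimes>\<^bsub>S\<^esub> (?i \<odot>\<^bsub>S\<^esub> ?h)"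
        proof -
          have as: "a [^]\<^bsub>S\<^esub> Suc n \<in> carrier S" using assms(1) by simp
          have "(a [^]\<^bsub>S\<^esub> Suc n) \<otimes>\<^bsub>S\<^esub> (?i \<odot>\<^bsub>S\<^esub> ?h) = (?i \<odot>\<^bsub>S\<^esub> ?h) \<otimes>\<^bsub>S\<^esub> (a [^]\<^bsub>S\<^esub> Suc n)"
            using as i(1) h by (intro A.m_comm) auto
          also have "\<dots> = ?i \<odot>\<^bsub>S\<^esub> (?h \<otimes>\<^bsub>S\<^esub> (a [^]\<^bsub>S\<^esub> Suc n))" by (rule S_assoc[OF i(1) h as])
          also have "?h \<otimes>\<^bsub>S\<^esub> (a [^]\<^bsub>S\<^esub> Suc n) = (a [^]\<^bsub>S\<^esub> Suc n) \<otimes>\<^bsub>S\<^esub> ?h" by (rule A.m_comm[OF h as])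
          finally show ?thesis by simp
        qed
        ultimately show ?thesis using M.smult_r_distr[OF i(1) ca ah] assms(1) i(1) h
          by (simp add: a_minus_def A.r_minus A.minus_minus del: A.nat_pow_Suc)
      qed
      ultimately show ?thesis using s by metis
    qed
  }
qed

text \<open>S / \<mm> S is Artinian, so the ideals generated by the powers of \<open>a\<close>
  become stationary there. The integral equation for \<open>a\<close>, normalised to leading
  coefficient -1, makes this explicit.\<close>

lemma power_stable:
  assumes a: "a \<in> carrier S"
  obtains n :: nat and s where "s \<in> carrier S" "(a [^]\<^bsub>S\<^esub> n) \<ominus>\<^bsub>S\<^esub> ((a [^]\<^bsub>S\<^esub> Suc n) \<otimes>\<^bsub>S\<^esub> s) \<in> J 1"
proof -
  interpret I: ideal "J 1" S by (rule J_ideal)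
  obtain k :: nat and r where r: "\<And>i. i < k \<Longrightarrow> r i \<in> carrier R" "a [^]\<^bsub>S\<^esub> k = lin_sum S (\<lambda>i. a [^]\<^bsub>S\<^esub> i) r k"
    using pow_in_lower_span[OF a] by blast
  have "lin_sum S (\<lambda>i. a [^]\<^bsub>S\<^esub> i) r k \<oplus>\<^bsub>S\<^esub> (a [^]\<^bsub>S\<^esub> k) \<otimes>\<^bsub>S\<^esub> (\<ominus>\<^bsub>S\<^esub> \<one>\<^bsub>S\<^esub>) = horner a (\<ominus>\<^bsub>S\<^esub> \<one>\<^bsub>S\<^esub>) (map r [0..<k])"
    by (rule lin_sum_horner[OF a _ r(1)]) auto
  then have "horner a (\<ominus>\<^bsub>S\<^esub> \<one>\<^bsub>S\<^esub>) (map r [0..<k]) = \<zero>\<^bsub>S\<^esub>"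
    unfolding r(2)[symmetric] using a by (simp add: A.r_minus A.r_neg)
  then have "(a [^]\<^bsub>S\<^esub> (0::nat)) \<otimes>\<^bsub>S\<^esub> horner a (\<ominus>\<^bsub>S\<^esub> \<one>\<^bsub>S\<^esub>) (map r [0..<k]) \<in> J 1"
    using I.zero_closed by simp
  moreover have "set (map r [0..<k]) \<subseteq> carrier R" using r(1) by auto
  ultimately show ?thesis using horner_step[OF a] that by blast
qed

text \<open>Applied to the evaluation at a vector, this converts closeness of endomorphisms into
  closeness of their values.\<close>

lemma J_eval:
  assumes "module R L" "f \<in> mod_hom R S L" "v \<in> J k" "submodule W R L"
    "\<And>b y. b \<in> P k \<Longrightarrow> y \<in> carrier L \<Longrightarrow> b \<odot>\<^bsub>L\<^esub> y \<in> W"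
  shows "f v \<in> W"
proof -
  obtain c where c: "c \<in> carrier (free_module R d)" "\<And>i. i < d \<Longrightarrow> c i \<in> P k" "v = g c"
    using assms(3) by (auto simp: J_def)
  note D = submoduleD[OF assms(1,4)]
  have "f v = lin_sum L (\<lambda>i. f (g (unit_vec R d i))) c d"
    unfolding c(3) g_expand[OF c(1)]
    by (rule hom_lin_sum[OF S_module assms(1,2) gen_closed free_memD[OF c(1)]])
  also have "\<dots> \<in> W"
    by (rule lin_sum_mem[OF D(2,3)]) (use c(2) assms(5) mod_homD(1)[OF assms(2)] gen_closed in auto)
  finally show ?thesis .
qed

end

context finite_algebra
begin

lemma J_ideal_facts:
  "\<zero>\<^bsub>S\<^esub> \<in> J k" "v \<in> J k \<Longrightarrow> w \<in> J k \<Longrightarrow> v \<oplus>\<^bsub>S\<^esub> w \<in> J k" "v \<in> J k \<Longrightarrow> w \<in> J k \<Longrightarrow> v \<ominus>\<^bsub>S\<^esub> w \<in> J k"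
  "v \<in> J k \<Longrightarrow> w \<in> carrier S \<Longrightarrow> v \<otimes>\<^bsub>S\<^esub> w \<in> J k" "v \<in> J k \<Longrightarrow> w \<in> carrier S \<Longrightarrow> w \<otimes>\<^bsub>S\<^esub> v \<in> J k"
proof -
  interpret I: ideal "J k" S by (rule J_ideal)
  show "\<zero>\<^bsub>S\<^esub> \<in> J k" "v \<in> J k \<Longrightarrow> w \<in> J k \<Longrightarrow> v \<oplus>\<^bsub>S\<^esub> w \<in> J k"
    "v \<in> J k \<Longrightarrow> w \<in> J k \<Longrightarrow> v \<ominus>\<^bsub>S\<^esub> w \<in> J k"
    "v \<in> J k \<Longrightarrow> w \<in> carrier S \<Longrightarrow> v \<otimes>\<^bsub>S\<^esub> w \<in> J k" "v \<in> J k \<Longrightarrow> w \<in> carrier S \<Longrightarrow> w \<otimes>\<^bsub>S\<^esub> v \<in> J k"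
    by (auto simp: I.I_l_closed I.I_r_closed a_minus_def)
qed

lemma J_trans:
  assumes "u \<in> carrier S" "v \<in> carrier S" "w \<in> carrier S" "u \<ominus>\<^bsub>S\<^esub> v \<in> J k" "v \<ominus>\<^bsub>S\<^esub> w \<in> J k"
  shows "u \<ominus>\<^bsub>S\<^esub> w \<in> J k"
proof -
  have "u \<ominus>\<^bsub>S\<^esub> w = (u \<ominus>\<^bsub>S\<^esub> v) \<oplus>\<^bsub>S\<^esub> (v \<ominus>\<^bsub>S\<^esub> w)" using assms(1-3) by algebra
  then show ?thesis using J_ideal_facts(2)[OF assms(4,5)] by simp
qed

text \<open>Consequently \<open>a\<^bsup>n + 1\<^esup> s\<close> is idempotent modulo \<open>\<mm> S\<close>, and there it generates the stable power of the
  ideal \<open>a S\<close>.\<close>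

lemma approximate_idempotent:
  assumes a: "a \<in> carrier S"
  obtains n s where "s \<in> carrier S"
    "(a [^]\<^bsub>S\<^esub> Suc n) \<ominus>\<^bsub>S\<^esub> (a [^]\<^bsub>S\<^esub> Suc n) \<otimes>\<^bsub>S\<^esub> ((a [^]\<^bsub>S\<^esub> Suc n) \<otimes>\<^bsub>S\<^esub> s) \<in> J 1"
proof -
  obtain n :: nat and s where s: "s \<in> carrier S" "(a [^]\<^bsub>S\<^esub> n) \<ominus>\<^bsub>S\<^esub> ((a [^]\<^bsub>S\<^esub> Suc n) \<otimes>\<^bsub>S\<^esub> s) \<in> J 1"
    by (rule power_stable[OF a])
  define p where "p = a [^]\<^bsub>S\<^esub> n"
  have p: "p \<in> carrier S" using a by (simp add: p_def)
  have s2: "p \<ominus>\<^bsub>S\<^esub> (p \<otimes>\<^bsub>S\<^esub> a) \<otimes>\<^bsub>S\<^esub> s \<in> J 1" using s(2) by (simp add: p_def)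
  define q where "q = p \<otimes>\<^bsub>S\<^esub> a"
  have q: "q \<in> carrier S" using p a by (simp add: q_def)
  \<comment> \<open>Each round inserts one more factor a s: the congruence of p and p a s modulo
    \<mm> S is multiplied by a b.\<close>
  have step: "q \<ominus>\<^bsub>S\<^esub> q \<otimes>\<^bsub>S\<^esub> ((a [^]\<^bsub>S\<^esub> j) \<otimes>\<^bsub>S\<^esub> (s [^]\<^bsub>S\<^esub> j)) \<in> J 1" for j :: nat
  proof (induction j)
    case 0
    then show ?case using q J_ideal_facts(1) by (simp add: a_minus_def A.r_neg)
  next
    case (Suc j)
    define b where "b = (a [^]\<^bsub>S\<^esub> j) \<otimes>\<^bsub>S\<^esub> (s [^]\<^bsub>S\<^esub> j)"
    have b: "b \<in> carrier S" using a s(1) by (simp add: b_def)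
    have e: "(a [^]\<^bsub>S\<^esub> Suc j) \<otimes>\<^bsub>S\<^esub> (s [^]\<^bsub>S\<^esub> Suc j) = a \<otimes>\<^bsub>S\<^esub> s \<otimes>\<^bsub>S\<^esub> b"
      using a s(1) by (simp add: b_def A.m_ac)
    have "(p \<ominus>\<^bsub>S\<^esub> (p \<otimes>\<^bsub>S\<^esub> a) \<otimes>\<^bsub>S\<^esub> s) \<otimes>\<^bsub>S\<^esub> (a \<otimes>\<^bsub>S\<^esub> b) \<in> J 1"
      using a b by (intro J_ideal_facts(4)[OF s2]) auto
    moreover have "(p \<ominus>\<^bsub>S\<^esub> (p \<otimes>\<^bsub>S\<^esub> a) \<otimes>\<^bsub>S\<^esub> s) \<otimes>\<^bsub>S\<^esub> (a \<otimes>\<^bsub>S\<^esub> b) = q \<otimes>\<^bsub>S\<^esub> b \<ominus>\<^bsub>S\<^esub> q \<otimes>\<^bsub>S\<^esub> (a \<otimes>\<^bsub>S\<^esub> s \<otimes>\<^bsub>S\<^esub> b)"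
      unfolding q_def using p a b s(1) by algebra
    ultimately have "q \<otimes>\<^bsub>S\<^esub> b \<ominus>\<^bsub>S\<^esub> q \<otimes>\<^bsub>S\<^esub> (a \<otimes>\<^bsub>S\<^esub> s \<otimes>\<^bsub>S\<^esub> b) \<in> J 1" by simp
    from J_trans[OF q _ _ Suc[folded b_def] this] show ?case unfolding e using q b a s(1) by simp
  qed
  have "q = a [^]\<^bsub>S\<^esub> Suc n" by (simp add: q_def p_def)
  \<comment> \<open>For j = n + 1 the inserted factor is a^(n + 1) s^(n + 1), so s^(n + 1) is the
    required multiplier.\<close>
  then show ?thesis using step[of "Suc n"] s(1) by (intro that[of "s [^]\<^bsub>S\<^esub> Suc n" n]) auto
qed

section \<open>Newton iteration and its limit\<close>

primrec newton :: "'s \<Rightarrow> nat \<Rightarrow> 's" where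
  "newton e 0 = e"
| "newton e (Suc k) = newton e k \<oplus>\<^bsub>S\<^esub> (newton e k \<otimes>\<^bsub>S\<^esub> newton e k \<ominus>\<^bsub>S\<^esub> newton e k) \<otimes>\<^bsub>S\<^esub>
    (\<one>\<^bsub>S\<^esub> \<ominus>\<^bsub>S\<^esub> (newton e k \<oplus>\<^bsub>S\<^esub> newton e k))"

lemma newton_closed: "e \<in> carrier S \<Longrightarrow> newton e k \<in> carrier S"
  by (induction k) auto

text \<open>The Newton step squares the defect; placing one of the two factors in \<open>J 1\<close>
  already gains one power of \<mm> per step.\<close>

lemma newton_idem:
  assumes e: "e \<in> carrier S" "e \<otimes>\<^bsub>S\<^esub> e \<ominus>\<^bsub>S\<^esub> e \<in> J 1"
  shows "newton e k \<otimes>\<^bsub>S\<^esub> newton e k \<ominus>\<^bsub>S\<^esub> newton e k \<in> J (Suc k)"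
proof (induction k)
  case 0 then show ?case using e(2) by simp
next
  case (Suc k)
  note c = newton_closed[OF e(1), of k]
  let ?d = "newton e k \<otimes>\<^bsub>S\<^esub> newton e k \<ominus>\<^bsub>S\<^esub> newton e k"
  let ?w = "\<one>\<^bsub>S\<^esub> \<ominus>\<^bsub>S\<^esub> (newton e k \<oplus>\<^bsub>S\<^esub> newton e k)"
  let ?z = "?w \<otimes>\<^bsub>S\<^esub> ?w \<ominus>\<^bsub>S\<^esub> (\<one>\<^bsub>S\<^esub> \<oplus>\<^bsub>S\<^esub> \<one>\<^bsub>S\<^esub> \<oplus>\<^bsub>S\<^esub> \<one>\<^bsub>S\<^esub> \<oplus>\<^bsub>S\<^esub> \<one>\<^bsub>S\<^esub>)"
  have "?d \<otimes>\<^bsub>S\<^esub> ?z \<in> J (Suc k)" by (rule J_ideal_facts(4)[OF Suc]) (use c in auto)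
  moreover have "?d \<in> J 1" using Suc J_antimono[of 1 "Suc k"] by auto
  ultimately have "?d \<otimes>\<^bsub>S\<^esub> (?d \<otimes>\<^bsub>S\<^esub> ?z) \<in> J (Suc (Suc k))" by (rule J_mult[rotated])
  moreover have "newton e (Suc k) \<otimes>\<^bsub>S\<^esub> newton e (Suc k) \<ominus>\<^bsub>S\<^esub> newton e (Suc k) = ?d \<otimes>\<^bsub>S\<^esub> (?d \<otimes>\<^bsub>S\<^esub> ?z)"
    by (rule A.newton_step[OF c refl refl]) simp
  ultimately show ?case by simp
qed

lemma newton_diff:
  assumes e: "e \<in> carrier S" "e \<otimes>\<^bsub>S\<^esub> e \<ominus>\<^bsub>S\<^esub> e \<in> J 1"
  shows "newton e (Suc k) \<ominus>\<^bsub>S\<^esub> newton e k \<in> J (Suc k)"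
proof -
  note c = newton_closed[OF e(1), of k]
  let ?d = "newton e k \<otimes>\<^bsub>S\<^esub> newton e k \<ominus>\<^bsub>S\<^esub> newton e k"
  let ?w = "\<one>\<^bsub>S\<^esub> \<ominus>\<^bsub>S\<^esub> (newton e k \<oplus>\<^bsub>S\<^esub> newton e k)"
  have d: "?d \<in> carrier S" "?w \<in> carrier S" using c by auto
  have "newton e (Suc k) \<ominus>\<^bsub>S\<^esub> newton e k = ?d \<otimes>\<^bsub>S\<^esub> ?w"
    using c A.m_closed[OF d] A.a_comm[OF c A.m_closed[OF d]]
    by (simp add: a_minus_def[of S "_ \<oplus>\<^bsub>S\<^esub> _" "newton e k"] A.a_assoc A.r_neg)
  then show ?thesis using J_ideal_facts(4)[OF newton_idem[OF e] d(2)] by simp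
qed

text \<open>Each difference lifts along \<open>g\<close> to a vector with coordinates in \<mm>^k.
  The partial sums of these vectors lift the sequence and converge coordinatewise in R^d, and
  \<open>g\<close> maps their limit to the limit wanted.\<close>

lemma J_limit:
  assumes e: "\<And>k. e k \<in> carrier S" "\<And>k. e (Suc k) \<ominus>\<^bsub>S\<^esub> e k \<in> J k"
  obtains l where "l \<in> carrier S" "\<And>k. e k \<ominus>\<^bsub>S\<^esub> l \<in> J k"
proof -
  interpret D: module R "free_module R d" by (rule Fd)
  obtain r0 where r0: "r0 \<in> carrier (free_module R d)" "g r0 = e 0" using e(1)[of 0] g(2) by (metis imageE)
  have "\<exists>c. c \<in> carrier (free_module R d) \<and> (\<forall>i<d. c i \<in> P k) \<and> e (Suc k) \<ominus>\<^bsub>S\<^esub> e k = g c" for k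
    using e(2)[of k] unfolding J_def by auto
  then obtain c where c: "\<And>k. c k \<in> carrier (free_module R d)" "\<And>k i. i < d \<Longrightarrow> c k i \<in> P k"
    "\<And>k. e (Suc k) \<ominus>\<^bsub>S\<^esub> e k = g (c k)" by metis
  define s where "s = rec_nat r0 (\<lambda>k y. y \<oplus>\<^bsub>free_module R d\<^esub> c k)"
  have s_simps: "s 0 = r0" "\<And>k. s (Suc k) = s k \<oplus>\<^bsub>free_module R d\<^esub> c k" by (simp_all add: s_def)
  have sc: "s k \<in> carrier (free_module R d)" for k by (induction k) (use r0 c(1) in \<open>auto simp: s_simps\<close>)
  have gs: "g (s k) = e k" for k
  proof (induction k)
    case 0 then show ?case using r0 by (simp add: s_simps)
  next
    case (Suc k)
    have "g (s (Suc k)) = e k \<oplus>\<^bsub>S\<^esub> (e (Suc k) \<ominus>\<^bsub>S\<^esub> e k)"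
      using mod_homD(2)[OF g(1) sc c(1)] Suc c(3) by (simp add: s_simps)
    also have "\<dots> = e (Suc k)" using e(1)[of k] e(1)[of "Suc k"] by algebra
    finally show ?case .
  qed
  have "\<exists>l. l \<in> carrier R \<and> (\<forall>k. s k i \<ominus> l \<in> P k)" if i: "i < d" for i
  proof -
    interpret cring R by (rule cring)
    have si: "s n i \<in> carrier R" for n by (rule free_memD[OF sc i])
    have "s (Suc n) i \<ominus> s n i = c n i" for n
      using si[of n] free_memD[OF c(1) i, of n] i by (simp add: s_simps free_module_simps(3)) algebra
    then have "s (Suc n) i \<ominus> s n i \<in> P n" for n using c(2)[OF i] by simp
    then show ?thesis using P_limit[of "\<lambda>n. s n i", OF si] by (metis order_refl)
  qed
  then obtain l where l: "\<And>i. i < d \<Longrightarrow> l i \<in> carrier R" "\<And>i k. i < d \<Longrightarrow> s k i \<ominus> l i \<in> P k" by metis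
  let ?l = "\<lambda>i\<in>{..<d}. l i"
  have lc: "?l \<in> carrier (free_module R d)" by (rule free_module_memI[OF l(1)])
  have minus: "(x \<ominus>\<^bsub>free_module R d\<^esub> y) i = x i \<ominus> y i"
    if "x \<in> carrier (free_module R d)" "y \<in> carrier (free_module R d)" "i < d" for x y i
  proof -
    interpret cring R by (rule cring)
    have xm: "x \<ominus>\<^bsub>free_module R d\<^esub> y \<in> carrier (free_module R d)" using that by simp
    have "x = (x \<ominus>\<^bsub>free_module R d\<^esub> y) \<oplus>\<^bsub>free_module R d\<^esub> y"
      using that(1,2) by (simp add: a_minus_def D.a_assoc D.l_neg)
    then have "x i = (x \<ominus>\<^bsub>free_module R d\<^esub> y) i \<oplus> y i"
      using that(3) by (metis (no_types, lifting) free_module_simps(3) lessThan_iff restrict_apply')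
    then show ?thesis using free_memD[OF xm that(3)] free_memD[OF that(2,3)] by (simp add: a_minus_def M.R.a_assoc M.R.r_neg)
  qed
  have "e k \<ominus>\<^bsub>S\<^esub> g ?l \<in> J k" for k
  proof -
    have "e k \<ominus>\<^bsub>S\<^esub> g ?l = g (s k \<ominus>\<^bsub>free_module R d\<^esub> ?l)"
      using hom_minus[OF Fd S_module g(1) sc lc] gs by simp
    moreover have "s k \<ominus>\<^bsub>free_module R d\<^esub> ?l \<in> {c \<in> carrier (free_module R d). \<forall>i<d. c i \<in> P k}"
      using sc lc l(2) by (simp add: minus del: restrict_apply) simp
    ultimately show ?thesis unfolding J_def by blast
  qed
  then show ?thesis using that mod_homD(1)[OF g(1) lc] by blast
qed

text \<open>The defect of the limit of the Newton iterates lies in every \<mm>^k S, and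
  \<open>sep\<close> turns this into exact idempotence. The limit stays congruent to
  \<open>e\<close> because every Newton correction lies in \<mm> S.\<close>

theorem lift_idempotent:
  assumes sep: "\<And>v. (\<And>k. v \<in> J k) \<Longrightarrow> v = \<zero>\<^bsub>S\<^esub>"
    and e: "e \<in> carrier S" "e \<otimes>\<^bsub>S\<^esub> e \<ominus>\<^bsub>S\<^esub> e \<in> J 1"
  obtains f where "f \<in> carrier S" "f \<otimes>\<^bsub>S\<^esub> f = f" "f \<ominus>\<^bsub>S\<^esub> e \<in> J 1"
proof -
  note c = newton_closed[OF e(1)]
  have "newton e (Suc (Suc k)) \<ominus>\<^bsub>S\<^esub> newton e (Suc k) \<in> J k" for k
    using newton_diff[OF e, of "Suc k"] J_antimono[of k "Suc (Suc k)"] by auto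
  then obtain l where l: "l \<in> carrier S" "\<And>k. newton e (Suc k) \<ominus>\<^bsub>S\<^esub> l \<in> J k"
    using J_limit[of "\<lambda>k. newton e (Suc k)", OF c] by blast
  have "l \<otimes>\<^bsub>S\<^esub> l \<ominus>\<^bsub>S\<^esub> l \<in> J k" for k
  proof -
    define x where "x = newton e (Suc k)"
    have x: "x \<in> carrier S" unfolding x_def by (rule c)
    have xl: "x \<ominus>\<^bsub>S\<^esub> l \<in> J k" unfolding x_def by (rule l(2))
    have xx: "x \<otimes>\<^bsub>S\<^esub> x \<ominus>\<^bsub>S\<^esub> x \<in> J k"
      using newton_idem[OF e, of "Suc k"] J_antimono[of k "Suc (Suc k)"] unfolding x_def by auto
    have "(x \<otimes>\<^bsub>S\<^esub> x \<ominus>\<^bsub>S\<^esub> x) \<ominus>\<^bsub>S\<^esub> (x \<ominus>\<^bsub>S\<^esub> l) \<otimes>\<^bsub>S\<^esub> (x \<oplus>\<^bsub>S\<^esub> l) \<in> J k"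
      using x l(1) by (intro J_ideal_facts(3)[OF xx] J_ideal_facts(4)[OF xl]) auto
    then have "((x \<otimes>\<^bsub>S\<^esub> x \<ominus>\<^bsub>S\<^esub> x) \<ominus>\<^bsub>S\<^esub> (x \<ominus>\<^bsub>S\<^esub> l) \<otimes>\<^bsub>S\<^esub> (x \<oplus>\<^bsub>S\<^esub> l)) \<oplus>\<^bsub>S\<^esub> (x \<ominus>\<^bsub>S\<^esub> l) \<in> J k"
      using xl by (rule J_ideal_facts(2))
    moreover have "((x \<otimes>\<^bsub>S\<^esub> x \<ominus>\<^bsub>S\<^esub> x) \<ominus>\<^bsub>S\<^esub> (x \<ominus>\<^bsub>S\<^esub> l) \<otimes>\<^bsub>S\<^esub> (x \<oplus>\<^bsub>S\<^esub> l)) \<oplus>\<^bsub>S\<^esub> (x \<ominus>\<^bsub>S\<^esub> l) = l \<otimes>\<^bsub>S\<^esub> l \<ominus>\<^bsub>S\<^esub> l"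
      using x l(1) by algebra
    ultimately show ?thesis by simp
  qed
  then have "l \<otimes>\<^bsub>S\<^esub> l \<ominus>\<^bsub>S\<^esub> l = \<zero>\<^bsub>S\<^esub>" by (rule sep)
  moreover have "l \<otimes>\<^bsub>S\<^esub> l = (l \<otimes>\<^bsub>S\<^esub> l \<ominus>\<^bsub>S\<^esub> l) \<oplus>\<^bsub>S\<^esub> l" using l(1) by algebra
  ultimately have idem: "l \<otimes>\<^bsub>S\<^esub> l = l" using l(1) by simp
  have "newton e k \<ominus>\<^bsub>S\<^esub> e \<in> J 1" for k
  proof (induction k)
    case 0 then show ?case using e(1) J_ideal_facts(1) by (simp add: a_minus_def A.r_neg)
  next
    case (Suc k)
    have "newton e (Suc k) \<ominus>\<^bsub>S\<^esub> newton e k \<in> J 1"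
      using newton_diff[OF e, of k] J_antimono[of 1 "Suc k"] by auto
    then show ?case by (rule J_trans[OF c c e(1) _ Suc])
  qed
  then have ne: "newton e (Suc 1) \<ominus>\<^bsub>S\<^esub> e \<in> J 1" .
  have "(newton e (Suc 1) \<ominus>\<^bsub>S\<^esub> e) \<ominus>\<^bsub>S\<^esub> (newton e (Suc 1) \<ominus>\<^bsub>S\<^esub> l) \<in> J 1"
    by (rule J_ideal_facts(3)[OF ne l(2)])
  moreover have "(newton e (Suc 1) \<ominus>\<^bsub>S\<^esub> e) \<ominus>\<^bsub>S\<^esub> (newton e (Suc 1) \<ominus>\<^bsub>S\<^esub> l) = l \<ominus>\<^bsub>S\<^esub> e"
    using c[of "Suc 1"] l(1) e(1) by algebra
  ultimately show ?thesis using that[OF l(1) idem] by simp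
qed

text \<open>Fitting's lemma modulo \<mm> S with an exact idempotent: on the part cut out by
  \<open>f\<close> the element \<open>a\<close> is invertible modulo \<mm>, and on the complement it
  is nilpotent modulo \<mm>.\<close>

lemma stable_idempotent:
  assumes sep: "\<And>v. (\<And>k. v \<in> J k) \<Longrightarrow> v = \<zero>\<^bsub>S\<^esub>" and a: "a \<in> carrier S"
  obtains f n s where "f \<in> carrier S" "f \<otimes>\<^bsub>S\<^esub> f = f" "s \<in> carrier S"
    "f \<ominus>\<^bsub>S\<^esub> (a [^]\<^bsub>S\<^esub> Suc n) \<otimes>\<^bsub>S\<^esub> s \<in> J 1" "(a [^]\<^bsub>S\<^esub> Suc n) \<ominus>\<^bsub>S\<^esub> (a [^]\<^bsub>S\<^esub> Suc n) \<otimes>\<^bsub>S\<^esub> f \<in> J 1"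
proof -
  obtain n :: nat and s where s: "s \<in> carrier S"
    "(a [^]\<^bsub>S\<^esub> Suc n) \<ominus>\<^bsub>S\<^esub> (a [^]\<^bsub>S\<^esub> Suc n) \<otimes>\<^bsub>S\<^esub> ((a [^]\<^bsub>S\<^esub> Suc n) \<otimes>\<^bsub>S\<^esub> s) \<in> J 1"
    by (rule approximate_idempotent[OF a])
  define q where "q = a [^]\<^bsub>S\<^esub> Suc n"
  have q: "q \<in> carrier S" using a by (simp add: q_def)
  have qs: "q \<ominus>\<^bsub>S\<^esub> q \<otimes>\<^bsub>S\<^esub> (q \<otimes>\<^bsub>S\<^esub> s) \<in> J 1" using s(2) unfolding q_def .
  let ?e = "q \<otimes>\<^bsub>S\<^esub> s"
  have e: "?e \<in> carrier S" using q s(1) by simp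
  \<comment> \<open>With e = q s, multiplying q - q e by - s gives e^2 - e, so e is idempotent
    modulo \<mm> S.\<close>
  have "(\<zero>\<^bsub>S\<^esub> \<ominus>\<^bsub>S\<^esub> s) \<in> carrier S" using s(1) by simp
  from J_ideal_facts(4)[OF qs this] have "(q \<ominus>\<^bsub>S\<^esub> q \<otimes>\<^bsub>S\<^esub> (q \<otimes>\<^bsub>S\<^esub> s)) \<otimes>\<^bsub>S\<^esub> (\<zero>\<^bsub>S\<^esub> \<ominus>\<^bsub>S\<^esub> s) \<in> J 1" .
  moreover have "(q \<ominus>\<^bsub>S\<^esub> q \<otimes>\<^bsub>S\<^esub> (q \<otimes>\<^bsub>S\<^esub> s)) \<otimes>\<^bsub>S\<^esub> (\<zero>\<^bsub>S\<^esub> \<ominus>\<^bsub>S\<^esub> s) = ?e \<otimes>\<^bsub>S\<^esub> ?e \<ominus>\<^bsub>S\<^esub> ?e"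
    using q s(1) by algebra
  ultimately have ee: "?e \<otimes>\<^bsub>S\<^esub> ?e \<ominus>\<^bsub>S\<^esub> ?e \<in> J 1" by simp
  obtain f where f: "f \<in> carrier S" "f \<otimes>\<^bsub>S\<^esub> f = f" "f \<ominus>\<^bsub>S\<^esub> ?e \<in> J 1"
    by (rule lift_idempotent[OF sep e ee])
  have "(q \<ominus>\<^bsub>S\<^esub> q \<otimes>\<^bsub>S\<^esub> ?e) \<ominus>\<^bsub>S\<^esub> q \<otimes>\<^bsub>S\<^esub> (f \<ominus>\<^bsub>S\<^esub> ?e) \<in> J 1"
    by (intro J_ideal_facts(3)[OF qs] J_ideal_facts(5)[OF f(3) q])
  moreover have "(q \<ominus>\<^bsub>S\<^esub> q \<otimes>\<^bsub>S\<^esub> ?e) \<ominus>\<^bsub>S\<^esub> q \<otimes>\<^bsub>S\<^esub> (f \<ominus>\<^bsub>S\<^esub> ?e) = q \<ominus>\<^bsub>S\<^esub> q \<otimes>\<^bsub>S\<^esub> f"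
    using q f(1) e by algebra
  ultimately have "q \<ominus>\<^bsub>S\<^esub> q \<otimes>\<^bsub>S\<^esub> f \<in> J 1" by simp
  then show ?thesis using that[OF f(1,2) s(1), of n] f(3) unfolding q_def by blast
qed

end

section \<open>Endomorphisms of indecomposable modules\<close>

text \<open>One record serves both as a ring and as an R-module: its multiplicative fields hold
  composition and identity.\<close>

definition endo :: "'a ring \<Rightarrow> ('a, 'm) module \<Rightarrow> ('a, 'm \<Rightarrow> 'm) module" where
  "endo R M = \<lparr>carrier = mod_hom R M M, monoid.mult = compose (carrier M), one = id_hom M,
     ring.zero = hom_zero M M, ring.add = hom_plus M M, smult = (\<lambda>r f. \<lambda>x\<in>carrier M. r \<odot>\<^bsub>M\<^esub> f x)\<rparr>"

lemma endo_simps: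
  "carrier (endo R M) = mod_hom R M M" "f \<otimes>\<^bsub>endo R M\<^esub> g = compose (carrier M) f g"
  "\<one>\<^bsub>endo R M\<^esub> = id_hom M" "\<zero>\<^bsub>endo R M\<^esub> = hom_zero M M" "f \<oplus>\<^bsub>endo R M\<^esub> g = hom_plus M M f g"
  "r \<odot>\<^bsub>endo R M\<^esub> f = (\<lambda>x\<in>carrier M. r \<odot>\<^bsub>M\<^esub> f x)"
  by (simp_all add: endo_def)

lemma endo_smult_closed:
  assumes "module R M" "r \<in> carrier R" "f \<in> mod_hom R M M"
  shows "(\<lambda>x\<in>carrier M. r \<odot>\<^bsub>M\<^esub> f x) \<in> mod_hom R M M"
proof -
  interpret M: module R M by fact
  have "r \<odot>\<^bsub>M\<^esub> (a \<odot>\<^bsub>M\<^esub> f x) = a \<odot>\<^bsub>M\<^esub> (r \<odot>\<^bsub>M\<^esub> f x)" if "a \<in> carrier R" "x \<in> carrier M" for a x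
    using that assms(2) mod_homD(1)[OF assms(3)] M.R.m_comm by (simp add: M.smult_assoc1[symmetric])
  then show ?thesis
    by (intro mod_homI[OF assms(1)]) (use assms(2) in \<open>auto simp: mod_homD[OF assms(3)] M.smult_r_distr\<close>)
qed

lemma abelian_group_endo:
  assumes M: "module R M" shows "abelian_group (endo R M)"
proof -
  interpret H: comm_group "hom_group R M M" by (rule comm_group_hom_group[OF M M])
  show ?thesis
  proof (rule abelian_groupI)
    fix x assume "x \<in> carrier (endo R M)"
    then show "\<exists>y\<in>carrier (endo R M). y \<oplus>\<^bsub>endo R M\<^esub> x = \<zero>\<^bsub>endo R M\<^esub>"
      using H.l_inv_ex[of x] by (simp add: endo_simps hom_group_simps)
  next
    fix x y z assume "x \<in> carrier (endo R M)" "y \<in> carrier (endo R M)" "z \<in> carrier (endo R M)"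
    then show "x \<oplus>\<^bsub>endo R M\<^esub> y \<oplus>\<^bsub>endo R M\<^esub> z = x \<oplus>\<^bsub>endo R M\<^esub> (y \<oplus>\<^bsub>endo R M\<^esub> z)"
      using H.m_assoc[of x y z] by (simp add: endo_simps hom_group_simps)
  next
    fix x y assume "x \<in> carrier (endo R M)" "y \<in> carrier (endo R M)"
    then show "x \<oplus>\<^bsub>endo R M\<^esub> y = y \<oplus>\<^bsub>endo R M\<^esub> x" "x \<oplus>\<^bsub>endo R M\<^esub> y \<in> carrier (endo R M)"
      using H.m_comm[of x y] H.m_closed[of x y] by (simp_all add: endo_simps hom_group_simps)
  next
    show "\<zero>\<^bsub>endo R M\<^esub> \<in> carrier (endo R M)" using H.one_closed by (simp add: endo_simps hom_group_simps)
    fix x assume "x \<in> carrier (endo R M)"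
    then show "\<zero>\<^bsub>endo R M\<^esub> \<oplus>\<^bsub>endo R M\<^esub> x = x" using H.l_one[of x] by (simp add: endo_simps hom_group_simps)
  qed
qed

lemma ring_endo:
  assumes M: "module R M" shows "ring (endo R M)"
proof (rule ringI[OF abelian_group_endo[OF M]])
  show "monoid (endo R M)"
    by (rule monoidI) (auto simp: endo_simps compose_hom[OF M] id_hom_closed[OF M]
      compose_hom_assoc[symmetric] compose_id_hom)
  fix x y z assume "x \<in> carrier (endo R M)" "y \<in> carrier (endo R M)" "z \<in> carrier (endo R M)"
  then show "(x \<oplus>\<^bsub>endo R M\<^esub> y) \<otimes>\<^bsub>endo R M\<^esub> z = x \<otimes>\<^bsub>endo R M\<^esub> z \<oplus>\<^bsub>endo R M\<^esub> y \<otimes>\<^bsub>endo R M\<^esub> z"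
    "z \<otimes>\<^bsub>endo R M\<^esub> (x \<oplus>\<^bsub>endo R M\<^esub> y) = z \<otimes>\<^bsub>endo R M\<^esub> x \<oplus>\<^bsub>endo R M\<^esub> z \<otimes>\<^bsub>endo R M\<^esub> y"
    by (simp_all add: endo_simps compose_hom_plus_left compose_hom_plus_right)
qed

lemma module_endo:
  assumes M: "module R M" shows "module R (endo R M)"
proof -
  interpret M: module R M by fact
  show ?thesis
  proof (rule moduleI[OF M.R.is_cring abelian_group_endo[OF M]])
    fix a f assume "a \<in> carrier R" "f \<in> carrier (endo R M)"
    then show "a \<odot>\<^bsub>endo R M\<^esub> f \<in> carrier (endo R M)" by (simp add: endo_simps endo_smult_closed[OF M])
  next
    fix f assume f: "f \<in> carrier (endo R M)"
    then have f: "f \<in> mod_hom R M M" by (simp add: endo_simps)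
    have "\<one>\<^bsub>R\<^esub> \<odot>\<^bsub>endo R M\<^esub> f = restrict f (carrier M)"
      unfolding endo_simps by (rule restrict_ext) (simp add: mod_homD(1)[OF f])
    then show "\<one>\<^bsub>R\<^esub> \<odot>\<^bsub>endo R M\<^esub> f = f" using extensional_restrict[OF mod_homD(4)[OF f]] by simp
  next
    fix a b f assume "a \<in> carrier R" "b \<in> carrier R" "f \<in> carrier (endo R M)"
    then show "(a \<oplus>\<^bsub>R\<^esub> b) \<odot>\<^bsub>endo R M\<^esub> f = a \<odot>\<^bsub>endo R M\<^esub> f \<oplus>\<^bsub>endo R M\<^esub> b \<odot>\<^bsub>endo R M\<^esub> f"
      "(a \<otimes>\<^bsub>R\<^esub> b) \<odot>\<^bsub>endo R M\<^esub> f = a \<odot>\<^bsub>endo R M\<^esub> (b \<odot>\<^bsub>endo R M\<^esub> f)"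
      by (auto simp: endo_simps hom_plus_def M.smult_l_distr M.smult_assoc1 mod_homD(1) intro!: restrict_ext)
  next
    fix a f g assume "a \<in> carrier R" "f \<in> carrier (endo R M)" "g \<in> carrier (endo R M)"
    then show "a \<odot>\<^bsub>endo R M\<^esub> (f \<oplus>\<^bsub>endo R M\<^esub> g) = a \<odot>\<^bsub>endo R M\<^esub> f \<oplus>\<^bsub>endo R M\<^esub> a \<odot>\<^bsub>endo R M\<^esub> g"
      by (auto simp: endo_simps hom_plus_def M.smult_r_distr mod_homD(1) intro!: restrict_ext)
  qed
qed

text \<open>The image and the kernel of an idempotent are complementary submodules, so one of them
  is zero.\<close>

lemma indecomposable_idempotent:
  assumes N: "module R N" and ind: "indecomposable R N"
    and e: "e \<in> mod_hom R N N" "\<And>x. x \<in> carrier N \<Longrightarrow> e (e x) = e x"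
  shows "(\<forall>x\<in>carrier N. e x = \<zero>\<^bsub>N\<^esub>) \<or> (\<forall>x\<in>carrier N. e x = x)"
proof -
  interpret N: module R N by fact
  let ?A = "e ` carrier N" and ?B = "{x \<in> carrier N. e x = \<zero>\<^bsub>N\<^esub>}"
  have A: "submodule ?A R N" by (rule submodule_image[OF N N e(1) submodule_carrier[OF N]])
  have B: "submodule ?B R N" by (rule submodule_kernel[OF N N e(1)])
  have ex: "x \<ominus>\<^bsub>N\<^esub> e x \<in> ?B" if "x \<in> carrier N" for x
    using that mod_homD(1)[OF e(1) that] e(2)[OF that] hom_minus[OF N N e(1) that mod_homD(1)[OF e(1) that]]
    by (simp add: N.r_neg a_minus_def[of N "e x" "e x"])
  have "?A <+>\<^bsub>N\<^esub> ?B = carrier N"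
  proof
    show "?A <+>\<^bsub>N\<^esub> ?B \<subseteq> carrier N"
      using mod_homD(1)[OF e(1)] by (auto simp: set_add_def set_mult_def)
    show "carrier N \<subseteq> ?A <+>\<^bsub>N\<^esub> ?B"
    proof
      fix x assume x: "x \<in> carrier N"
      have eq: "x = e x \<oplus>\<^bsub>N\<^esub> (x \<ominus>\<^bsub>N\<^esub> e x)"
        using x mod_homD(1)[OF e(1) x] by (simp add: a_minus_def N.a_lcomm[of "e x" x] N.r_neg)
      have add: "a \<oplus>\<^bsub>N\<^esub> b \<in> ?A <+>\<^bsub>N\<^esub> ?B" if "a \<in> ?A" "b \<in> ?B" for a b
        using that unfolding set_add_def set_mult_def by auto
      have "e x \<oplus>\<^bsub>N\<^esub> (x \<ominus>\<^bsub>N\<^esub> e x) \<in> ?A <+>\<^bsub>N\<^esub> ?B" by (rule add[OF imageI[OF x] ex[OF x]])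
      then show "x \<in> ?A <+>\<^bsub>N\<^esub> ?B" using eq by simp
    qed
  qed
  moreover have "?A \<inter> ?B = {\<zero>\<^bsub>N\<^esub>}"
  proof
    show "?A \<inter> ?B \<subseteq> {\<zero>\<^bsub>N\<^esub>}" using e(2) by auto
    show "{\<zero>\<^bsub>N\<^esub>} \<subseteq> ?A \<inter> ?B" using submoduleD(2)[OF N A] submoduleD(2)[OF N B] by simp
  qed
  ultimately have "?A = {\<zero>\<^bsub>N\<^esub>} \<or> ?B = {\<zero>\<^bsub>N\<^esub>}"
    using ind A B unfolding indecomposable_def by blast
  then show ?thesis
  proof
    assume "?A = {\<zero>\<^bsub>N\<^esub>}" then show ?thesis by auto
  next
    assume B0: "?B = {\<zero>\<^bsub>N\<^esub>}"
    have "e x = x" if x: "x \<in> carrier N" for x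
    proof -
      have "x \<ominus>\<^bsub>N\<^esub> e x = \<zero>\<^bsub>N\<^esub>" using ex[OF x] B0 by auto
      moreover have "x = (x \<ominus>\<^bsub>N\<^esub> e x) \<oplus>\<^bsub>N\<^esub> e x"
        using x mod_homD(1)[OF e(1) x] by (simp add: a_minus_def N.a_assoc N.l_neg)
      ultimately show ?thesis using mod_homD(1)[OF e(1) x] by simp
    qed
    then show ?thesis by blast
  qed
qed

text \<open>An endomorphism of a quotient \<open>N\<close> of \<open>R\<^sup>n\<close> lifts to some \<open>A\<close> in the double commutant of \<open>A\<close>,
  taken among the endomorphisms of \<open>R\<^sup>n\<close> that preserve the kernel of the projection.  This is a
  finite commutative algebra, and it is separated because \<open>R\<^sup>n\<close> is; so no intersection theorem
  for \<open>N\<close> is needed.\<close>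

locale double_commutant = complete_local +
  fixes N :: "('a, 'm) module" and n :: nat and \<pi> :: "(nat \<Rightarrow> 'a) \<Rightarrow> 'm" and A :: "(nat \<Rightarrow> 'a) \<Rightarrow> nat \<Rightarrow> 'a"
    and \<phi> :: "'m \<Rightarrow> 'm"
  assumes N: "module R N" "noeth R N"
    and \<pi>: "\<pi> \<in> mod_hom R (free_module R n) N" "\<pi> ` carrier (free_module R n) = carrier N"
    and \<phi>: "\<phi> \<in> mod_hom R N N"
    and A: "A \<in> mod_hom R (free_module R n) (free_module R n)"
    and lift: "\<And>x. x \<in> carrier (free_module R n) \<Longrightarrow> \<pi> (A x) = \<phi> (\<pi> x)"
begin

abbreviation "V \<equiv> free_module R n"
abbreviation "E \<equiv> endo R V"

lemma V: "module R V" by (rule module_free[OF cring])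

definition "C = {h \<in> mod_hom R V V. (\<forall>x\<in>carrier V. \<pi> x = \<zero>\<^bsub>N\<^esub> \<longrightarrow> \<pi> (h x) = \<zero>\<^bsub>N\<^esub>) \<and>
  (\<forall>k\<in>carrier E. k \<otimes>\<^bsub>E\<^esub> A = A \<otimes>\<^bsub>E\<^esub> k \<longrightarrow> h \<otimes>\<^bsub>E\<^esub> k = k \<otimes>\<^bsub>E\<^esub> h)}"

definition "S = E\<lparr>carrier := C\<rparr>"

lemma endo_smult_compose:
  assumes "r \<in> carrier R" "h \<in> mod_hom R V V" "k \<in> mod_hom R V V"
  shows "(r \<odot>\<^bsub>E\<^esub> h) \<otimes>\<^bsub>E\<^esub> k = r \<odot>\<^bsub>E\<^esub> (h \<otimes>\<^bsub>E\<^esub> k)" "k \<otimes>\<^bsub>E\<^esub> (r \<odot>\<^bsub>E\<^esub> h) = r \<odot>\<^bsub>E\<^esub> (k \<otimes>\<^bsub>E\<^esub> h)"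
proof -
  show "(r \<odot>\<^bsub>E\<^esub> h) \<otimes>\<^bsub>E\<^esub> k = r \<odot>\<^bsub>E\<^esub> (h \<otimes>\<^bsub>E\<^esub> k)"
    unfolding endo_simps compose_def by (rule restrict_ext) (simp add: mod_homD(1)[OF assms(3)])
  show "k \<otimes>\<^bsub>E\<^esub> (r \<odot>\<^bsub>E\<^esub> h) = r \<odot>\<^bsub>E\<^esub> (k \<otimes>\<^bsub>E\<^esub> h)"
    unfolding endo_simps compose_def
    by (rule restrict_ext) (simp add: mod_homD(1)[OF assms(2)] mod_homD(3)[OF assms(3) assms(1)])
qed

lemma C_submodule: "submodule C R E"
proof (rule submoduleI'[OF module_endo[OF V]])
  interpret N: module R N by (rule N(1))
  interpret E: ring E by (rule ring_endo[OF V])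
  show "C \<subseteq> carrier E" by (auto simp: C_def endo_simps)
  show "\<zero>\<^bsub>E\<^esub> \<in> C"
    using E.zero_closed hom_0[OF V N(1) \<pi>(1)] by (auto simp: C_def endo_simps(1)[symmetric]) (simp add: endo_simps hom_zero_def)
  show "h \<oplus>\<^bsub>E\<^esub> k \<in> C" if hk: "h \<in> C" "k \<in> C" for h k
  proof -
    have c: "h \<in> carrier E" "k \<in> carrier E" using hk by (auto simp: C_def endo_simps)
    have "(h \<oplus>\<^bsub>E\<^esub> k) \<in> mod_hom R V V" using E.a_closed[OF c] by (simp add: endo_simps)
    moreover have "\<pi> ((h \<oplus>\<^bsub>E\<^esub> k) x) = \<zero>\<^bsub>N\<^esub>" if x: "x \<in> carrier V" "\<pi> x = \<zero>\<^bsub>N\<^esub>" for x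
      using hk x mod_homD(1)[of h R V V] mod_homD(1)[of k R V V] mod_homD(2)[OF \<pi>(1)]
      by (simp add: C_def endo_simps hom_plus_def)
    moreover have "(h \<oplus>\<^bsub>E\<^esub> k) \<otimes>\<^bsub>E\<^esub> l = l \<otimes>\<^bsub>E\<^esub> (h \<oplus>\<^bsub>E\<^esub> k)" if l: "l \<in> carrier E" "l \<otimes>\<^bsub>E\<^esub> A = A \<otimes>\<^bsub>E\<^esub> l" for l
      using hk l c by (simp add: C_def E.l_distr E.r_distr)
    ultimately show ?thesis unfolding C_def by blast
  qed
  show "r \<odot>\<^bsub>E\<^esub> h \<in> C" if r: "r \<in> carrier R" and h: "h \<in> C" for r h
  proof -
    have c: "h \<in> mod_hom R V V" using h by (auto simp: C_def)
    have "r \<odot>\<^bsub>E\<^esub> h \<in> mod_hom R V V" using endo_smult_closed[OF V r c] by (simp add: endo_simps)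
    moreover have "\<pi> ((r \<odot>\<^bsub>E\<^esub> h) x) = \<zero>\<^bsub>N\<^esub>" if x: "x \<in> carrier V" "\<pi> x = \<zero>\<^bsub>N\<^esub>" for x
      using h x mod_homD(1)[OF c] mod_homD(3)[OF \<pi>(1) r] r by (simp add: C_def endo_simps)
    moreover have "(r \<odot>\<^bsub>E\<^esub> h) \<otimes>\<^bsub>E\<^esub> l = l \<otimes>\<^bsub>E\<^esub> (r \<odot>\<^bsub>E\<^esub> h)" if l: "l \<in> carrier E" "l \<otimes>\<^bsub>E\<^esub> A = A \<otimes>\<^bsub>E\<^esub> l" for l
      using endo_smult_compose[OF r c, of l] l h by (simp add: C_def endo_simps(1))
    ultimately show ?thesis unfolding C_def by blast
  qed
qed

lemma A_in_C: "A \<in> C"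
  unfolding C_def using A lift hom_0[OF N(1) N(1) \<phi>] by auto

text \<open>\<open>C\<close> is commutative because \<open>A\<close> commutes with itself: a member
  k of \<open>C\<close> therefore commutes with \<open>A\<close>, so it is one of the maps with
  which every member of \<open>C\<close> has to commute.\<close>

lemma S_cring': "cring S"
proof -
  interpret E: ring E by (rule ring_endo[OF V])
  note D = submoduleD[OF module_endo[OF V] C_submodule]
  have CE: "h \<in> carrier E" if "h \<in> C" for h using that D(1) by auto
  have "subring C E"
  proof (rule E.subringI[OF D(1) _ D(4) _ D(3)])
    show "\<one>\<^bsub>E\<^esub> \<in> C" using E.one_closed by (auto simp: C_def endo_simps(1)[symmetric]) (simp add: endo_simps)
    show "h \<otimes>\<^bsub>E\<^esub> k \<in> C" if hk: "h \<in> C" "k \<in> C" for h k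
    proof -
      have c: "h \<in> carrier E" "k \<in> carrier E" using hk CE by auto
      have "h \<otimes>\<^bsub>E\<^esub> k \<in> mod_hom R V V" using E.m_closed[OF c] by (simp add: endo_simps)
      moreover have "\<pi> ((h \<otimes>\<^bsub>E\<^esub> k) x) = \<zero>\<^bsub>N\<^esub>" if x: "x \<in> carrier V" "\<pi> x = \<zero>\<^bsub>N\<^esub>" for x
        using hk x mod_homD(1)[of k R V V] by (simp add: C_def endo_simps compose_def)
      moreover have "(h \<otimes>\<^bsub>E\<^esub> k) \<otimes>\<^bsub>E\<^esub> l = l \<otimes>\<^bsub>E\<^esub> (h \<otimes>\<^bsub>E\<^esub> k)" if l: "l \<in> carrier E" "l \<otimes>\<^bsub>E\<^esub> A = A \<otimes>\<^bsub>E\<^esub> l" for l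
      proof -
        have 1: "k \<otimes>\<^bsub>E\<^esub> l = l \<otimes>\<^bsub>E\<^esub> k" "h \<otimes>\<^bsub>E\<^esub> l = l \<otimes>\<^bsub>E\<^esub> h" using hk l by (auto simp: C_def)
        have "(h \<otimes>\<^bsub>E\<^esub> k) \<otimes>\<^bsub>E\<^esub> l = h \<otimes>\<^bsub>E\<^esub> (l \<otimes>\<^bsub>E\<^esub> k)" using E.m_assoc[OF c l(1)] 1(1) by simp
        also have "\<dots> = (l \<otimes>\<^bsub>E\<^esub> h) \<otimes>\<^bsub>E\<^esub> k" using E.m_assoc[OF c(1) l(1) c(2)] 1(2) by simp
        also have "\<dots> = l \<otimes>\<^bsub>E\<^esub> (h \<otimes>\<^bsub>E\<^esub> k)" by (rule E.m_assoc[OF l(1) c])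
        finally show ?thesis .
      qed
      ultimately show ?thesis unfolding C_def by blast
    qed
  qed
  then have "subcring C E"
  proof (rule E.subcringI)
    fix h k assume hk: "h \<in> C" "k \<in> C"
    have "A \<in> carrier E" using A_in_C CE by auto
    then have "k \<otimes>\<^bsub>E\<^esub> A = A \<otimes>\<^bsub>E\<^esub> k" using hk(2) by (auto simp: C_def)
    then show "h \<otimes>\<^bsub>E\<^esub> k = k \<otimes>\<^bsub>E\<^esub> h" using hk(1) CE[OF hk(2)] by (auto simp: C_def)
  qed
  then show ?thesis unfolding S_def using E.subcring_iff[OF D(1)] by simp
qed

lemma S_module': "module R S"
  unfolding S_def by (rule submodule.submodule_is_module[OF C_submodule module_endo[OF V]])

lemma S_simps: "carrier S = C" "h \<otimes>\<^bsub>S\<^esub> k = compose (carrier V) h k" "\<one>\<^bsub>S\<^esub> = id_hom V" "\<zero>\<^bsub>S\<^esub> = hom_zero V V"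
  "h \<oplus>\<^bsub>S\<^esub> k = hom_plus V V h k" "r \<odot>\<^bsub>S\<^esub> h = (\<lambda>x\<in>carrier V. r \<odot>\<^bsub>V\<^esub> h x)"
  by (simp_all add: S_def endo_simps)

lemma C_hom: "h \<in> C \<Longrightarrow> h \<in> mod_hom R V V" by (simp add: C_def)

lemma eval_hom:
  assumes "module R L" "p \<in> mod_hom R V L" "x \<in> carrier V"
  shows "(\<lambda>h\<in>carrier S. p (h x)) \<in> mod_hom R S L"
  by (rule mod_homI[OF S_module'])
    (use assms(3) mod_homD(1)[OF C_hom] mod_homD[OF assms(2)] in \<open>auto simp: S_simps hom_plus_def\<close>)

text \<open>The matrix of an endomorphism of R^n, read as a vector of length n^2 with index i n + j,
  embeds \<open>S\<close> in a Noetherian module.\<close>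

lemma S_noeth: "noeth R S"
proof -
  let ?W = "free_module R (n * n)"
  let ?f = "\<lambda>h\<in>carrier S. \<lambda>k\<in>{..<n * n}. h (unit_vec R n (k div n)) (k mod n)"
  have u: "unit_vec R n i \<in> carrier V" for i by (rule unit_vec_closed[OF cring])
  have md: "k mod n < n" if "k < n * n" for k using that by (cases n) auto
  have f: "?f \<in> mod_hom R S ?W"
  proof (rule mod_homI[OF S_module'])
    show "(\<lambda>k\<in>{..<n * n}. h (unit_vec R n (k div n)) (k mod n)) \<in> carrier ?W" if "h \<in> carrier S" for h
      by (rule free_module_memI) (rule free_memD[OF mod_homD(1)[OF C_hom u] md], use that in \<open>simp_all add: S_simps\<close>)
  qed (auto simp: S_simps hom_plus_def u md free_module_simps(3,4) intro!: restrict_ext)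
  have inj: "inj_on ?f (carrier S)"
  proof (rule inj_onI)
    fix h k assume hk: "h \<in> carrier S" "k \<in> carrier S" "?f h = ?f k"
    then have c: "h \<in> mod_hom R V V" "k \<in> mod_hom R V V" by (auto simp: S_simps C_hom)
    show "h = k"
    proof (rule hom_free_eqI[OF V c])
      fix i assume i: "i < n"
      show "h (unit_vec R n i) = k (unit_vec R n i)"
      proof (rule free_module_ext[OF mod_homD(1)[OF c(1) u] mod_homD(1)[OF c(2) u]])
        fix j assume j: "j < n"
        have "i * n + j < n * n"
        proof -
          have "i * n + j < Suc i * n" using j by simp
          also have "\<dots> \<le> n * n" using i by (intro mult_le_mono1) simp
          finally show ?thesis .
        qed
        moreover have "(i * n + j) div n = i" "(i * n + j) mod n = j" using j by auto
        ultimately show "h (unit_vec R n i) j = k (unit_vec R n i) j"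
          using fun_cong[OF hk(3), of "i * n + j"] hk(1,2) by simp
      qed
    qed
  qed
  show ?thesis by (rule noeth_inj[OF S_module' module_free[OF cring] f inj noeth_free[OF cring noetherian]])
qed

lemma A_pow:
  fixes k :: nat
  assumes "x \<in> carrier V"
  shows "(A [^]\<^bsub>S\<^esub> k) x \<in> carrier V \<and> \<pi> ((A [^]\<^bsub>S\<^esub> k) x) = (\<phi> ^^ k) (\<pi> x)"
  using assms
proof (induction k arbitrary: x)
  case 0 then show ?case by (simp add: S_simps nat_pow_def)
next
  case (Suc k)
  have "A [^]\<^bsub>S\<^esub> Suc k = compose (carrier V) (A [^]\<^bsub>S\<^esub> k) A" by (simp add: nat_pow_def S_simps)
  then show ?case using Suc.IH[OF mod_homD(1)[OF A Suc.prems]] Suc.prems lift[OF Suc.prems]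
    by (simp add: compose_def funpow_swap1)
qed

text \<open>Members of \<open>C\<close> preserve the kernel of \<pi> and hence descend along \<pi>;
  \<sigma> is a set-theoretic section of \<pi>.\<close>

lemma induced_endo:
  assumes "f \<in> C"
  obtains e where "e \<in> mod_hom R N N" "\<And>x. x \<in> carrier V \<Longrightarrow> e (\<pi> x) = \<pi> (f x)"
proof -
  interpret N: module R N by (rule N(1))
  interpret V: module R V by (rule V)
  have f: "f \<in> mod_hom R V V" by (rule C_hom[OF assms])
  have "\<exists>x. x \<in> carrier V \<and> \<pi> x = y" if "y \<in> carrier N" for y using \<pi>(2) that by (metis imageE)
  then obtain \<sigma> where \<sigma>: "\<And>y. y \<in> carrier N \<Longrightarrow> \<sigma> y \<in> carrier V" "\<And>y. y \<in> carrier N \<Longrightarrow> \<pi> (\<sigma> y) = y" by metis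
  define e where "e = (\<lambda>y\<in>carrier N. \<pi> (f (\<sigma> y)))"
  have e: "e (\<pi> x) = \<pi> (f x)" if x: "x \<in> carrier V" for x
  proof -
    have px: "\<pi> x \<in> carrier N" by (rule mod_homD(1)[OF \<pi>(1) x])
    note s = \<sigma>(1)[OF px]
    have "\<pi> (\<sigma> (\<pi> x) \<ominus>\<^bsub>V\<^esub> x) = \<zero>\<^bsub>N\<^esub>"
      using hom_minus[OF V N(1) \<pi>(1) s x] \<sigma>(2)[OF px] px by (simp add: a_minus_def N.r_neg)
    then have "\<pi> (f (\<sigma> (\<pi> x) \<ominus>\<^bsub>V\<^esub> x)) = \<zero>\<^bsub>N\<^esub>" using assms s x by (simp add: C_def)
    then have z: "\<pi> (f (\<sigma> (\<pi> x))) \<ominus>\<^bsub>N\<^esub> \<pi> (f x) = \<zero>\<^bsub>N\<^esub>"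
      using hom_minus[OF V V f s x] hom_minus[OF V N(1) \<pi>(1) mod_homD(1)[OF f s] mod_homD(1)[OF f x]] by simp
    have c: "\<pi> (f (\<sigma> (\<pi> x))) \<in> carrier N" "\<pi> (f x) \<in> carrier N"
      using mod_homD(1)[OF \<pi>(1)] mod_homD(1)[OF f] s x by auto
    have "\<pi> (f (\<sigma> (\<pi> x))) = (\<pi> (f (\<sigma> (\<pi> x))) \<ominus>\<^bsub>N\<^esub> \<pi> (f x)) \<oplus>\<^bsub>N\<^esub> \<pi> (f x)"
      using c by (simp add: a_minus_def N.a_assoc N.l_neg)
    then have "\<pi> (f (\<sigma> (\<pi> x))) = \<pi> (f x)" unfolding z using c by simp
    then show ?thesis using px by (simp add: e_def)
  qed
  have "e \<in> mod_hom R N N" unfolding e_def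
  proof (rule mod_homI[OF N(1)])
    note ee = e[unfolded e_def]
    show cl: "\<pi> (f (\<sigma> y)) \<in> carrier N" if "y \<in> carrier N" for y
      using that mod_homD(1)[OF \<pi>(1)] mod_homD(1)[OF f] \<sigma> by auto
    fix y z assume yz: "y \<in> carrier N" "z \<in> carrier N"
    note s = \<sigma>(1)[OF yz(1)] \<sigma>(1)[OF yz(2)]
    have "e (\<pi> (\<sigma> y \<oplus>\<^bsub>V\<^esub> \<sigma> z)) = \<pi> (f (\<sigma> y)) \<oplus>\<^bsub>N\<^esub> \<pi> (f (\<sigma> z))"
      using e[of "\<sigma> y \<oplus>\<^bsub>V\<^esub> \<sigma> z"] s mod_homD(2)[OF f s] mod_homD(2)[OF \<pi>(1)] mod_homD(1)[OF f] by simp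
    moreover have "\<pi> (\<sigma> y \<oplus>\<^bsub>V\<^esub> \<sigma> z) = y \<oplus>\<^bsub>N\<^esub> z" using mod_homD(2)[OF \<pi>(1) s] \<sigma>(2) yz by simp
    ultimately show "\<pi> (f (\<sigma> (y \<oplus>\<^bsub>N\<^esub> z))) = \<pi> (f (\<sigma> y)) \<oplus>\<^bsub>N\<^esub> \<pi> (f (\<sigma> z))"
      using yz by (simp add: e_def)
  next
    fix r y assume ry: "r \<in> carrier R" "y \<in> carrier N"
    note s = \<sigma>(1)[OF ry(2)]
    have "e (\<pi> (r \<odot>\<^bsub>V\<^esub> \<sigma> y)) = r \<odot>\<^bsub>N\<^esub> \<pi> (f (\<sigma> y))"
      using e[of "r \<odot>\<^bsub>V\<^esub> \<sigma> y"] s ry mod_homD(3)[OF f ry(1) s] mod_homD(3)[OF \<pi>(1) ry(1)] mod_homD(1)[OF f s] by simp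
    moreover have "\<pi> (r \<odot>\<^bsub>V\<^esub> \<sigma> y) = r \<odot>\<^bsub>N\<^esub> y" using mod_homD(3)[OF \<pi>(1) ry(1) s] \<sigma>(2) ry by simp
    ultimately show "\<pi> (f (\<sigma> (r \<odot>\<^bsub>N\<^esub> y))) = r \<odot>\<^bsub>N\<^esub> \<pi> (f (\<sigma> y))"
      using ry by (simp add: e_def)
  qed
  with e show ?thesis using that by blast
qed

text \<open>Stabilising the powers of \<open>A\<close> yields an idempotent f in \<open>S\<close>,
  and the idempotent e that it induces on \<open>N\<close> is 0 or 1. If e = 1, then \<phi> is onto
  modulo \<mm> N. If e = 0, then a power of \<phi> maps \<open>N\<close> into \<mm> N, and 1 -
  \<phi> is onto modulo \<mm> N. In both cases Nakayama's lemma removes the \<mm> N.\<close>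

lemma local_endo:
  assumes ind: "indecomposable R N"
  shows "\<phi> ` carrier N = carrier N \<or> hom_diff N N (id_hom N) \<phi> ` carrier N = carrier N"
proof -
  interpret N: module R N by (rule N(1))
  obtain d g where g: "g \<in> mod_hom R (free_module R d) S" "g ` carrier (free_module R d) = carrier S"
    by (rule fg_surj[OF noeth_imp_fg[OF S_module' S_noeth]])
  interpret FA: finite_algebra R S d g
  proof (rule finite_algebra.intro[OF complete_local_axioms], rule finite_algebra_axioms.intro)
    show "cring S" by (rule S_cring')
    show "module R S" by (rule S_module')
    show "(a \<odot>\<^bsub>S\<^esub> x) \<otimes>\<^bsub>S\<^esub> y = a \<odot>\<^bsub>S\<^esub> (x \<otimes>\<^bsub>S\<^esub> y)"
      if "a \<in> carrier R" "x \<in> carrier S" "y \<in> carrier S" for a x y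
      using endo_smult_compose(1)[OF that(1) C_hom C_hom, of x y] that(2,3) by (simp add: S_simps endo_simps)
  qed (rule g)+
  \<comment> \<open>An endomorphism lying in every \<mm>^k S has values with coordinates in every
    \<mm>^k, so it is zero because R is separated.\<close>
  have sep: "v = \<zero>\<^bsub>S\<^esub>" if v: "\<And>k. v \<in> FA.J k" for v
  proof -
    have vS: "v \<in> carrier S" using FA.J_carrier[OF v[of 0]] .
    have vh: "v \<in> mod_hom R V V" using vS by (simp add: S_simps C_hom)
    have "v x = \<zero>\<^bsub>V\<^esub>" if x: "x \<in> carrier V" for x
    proof (rule free_module_ext[OF mod_homD(1)[OF vh x]])
      interpret V: module R V by (rule V)
      show "\<zero>\<^bsub>V\<^esub> \<in> carrier V" by simp
      fix i assume i: "i < n"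
      have "v x i \<in> P k" for k
      proof -
        have ev: "(\<lambda>h\<in>carrier S. id_hom V (h x)) \<in> mod_hom R S V" by (rule eval_hom[OF V id_hom_closed[OF V] x])
        have "(\<lambda>h\<in>carrier S. id_hom V (h x)) v \<in> {c \<in> carrier V. \<forall>i<n. c i \<in> P k}"
        proof (rule FA.J_eval[OF V ev v P_vectors])
          interpret I: ideal "P k" R by (rule P_ideal)
          show "b \<odot>\<^bsub>V\<^esub> y \<in> {c \<in> carrier V. \<forall>i<n. c i \<in> P k}" if "b \<in> P k" "y \<in> carrier V" for b y
            using V.smult_closed[OF I.Icarr[OF that(1)] that(2)] I.I_r_closed[OF that(1)] free_memD[OF that(2)]
            by (simp add: free_module_simps(4))
        qed
        then show ?thesis using vS mod_homD(1)[OF vh x] i by simp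
      qed
      then have "v x i = \<zero>" by (rule P_Inter)
      then show "v x i = \<zero>\<^bsub>V\<^esub> i" using i by (simp add: free_module_simps(2))
    qed
    then show ?thesis unfolding S_simps using hom_eqI[OF vh hom_zero_closed[OF V V]] by (simp add: hom_zero_def)
  qed
  obtain f k s where f: "f \<in> carrier S" "f \<otimes>\<^bsub>S\<^esub> f = f" "s \<in> carrier S"
    "f \<ominus>\<^bsub>S\<^esub> (A [^]\<^bsub>S\<^esub> Suc k) \<otimes>\<^bsub>S\<^esub> s \<in> FA.J 1" "(A [^]\<^bsub>S\<^esub> Suc k) \<ominus>\<^bsub>S\<^esub> (A [^]\<^bsub>S\<^esub> Suc k) \<otimes>\<^bsub>S\<^esub> f \<in> FA.J 1"
    using FA.stable_idempotent[OF sep] A_in_C by (metis S_simps(1))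
  have fC: "f \<in> C" "s \<in> C" using f(1,3) by (simp_all add: S_simps)
  note fh = C_hom[OF fC(1)] and sh = C_hom[OF fC(2)]
  obtain e where e: "e \<in> mod_hom R N N" "\<And>x. x \<in> carrier V \<Longrightarrow> e (\<pi> x) = \<pi> (f x)"
    using induced_endo[OF fC(1)] by blast
  have lift_y: "\<exists>x\<in>carrier V. y = \<pi> x" if "y \<in> carrier N" for y using \<pi>(2) that by blast
  have ff: "f (f x) = f x" if "x \<in> carrier V" for x
    using fun_cong[OF f(2), of x] that by (simp add: S_simps compose_def)
  have "e (e y) = e y" if y: "y \<in> carrier N" for y
  proof -
    obtain x where x: "x \<in> carrier V" "y = \<pi> x" using lift_y[OF y] by blast
    show ?thesis using e(2)[OF x(1)] e(2)[OF mod_homD(1)[OF fh x(1)]] ff[OF x(1)] x(2) by simp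
  qed
  note dich = indecomposable_idempotent[OF N(1) ind e(1) this]
  have ap: "A [^]\<^bsub>S\<^esub> Suc k \<in> carrier S" using A_in_C FA.A.nat_pow_closed[of A "Suc k"] by (simp only: S_simps)
  \<comment> \<open>Here \<open>W'\<close> contains \<mm> N, so congruence modulo \<mm> S passes to
    congruence modulo \<open>W'\<close> of the values in \<open>N\<close>.\<close>
  have ev: "\<pi> (u x) \<ominus>\<^bsub>N\<^esub> \<pi> (w x) \<in> W'"
    if "u \<in> carrier S" "w \<in> carrier S" "u \<ominus>\<^bsub>S\<^esub> w \<in> FA.J 1" "x \<in> carrier V" "submodule W' R N"
      "\<And>a x. a \<in> \<mm> \<Longrightarrow> x \<in> carrier N \<Longrightarrow> a \<odot>\<^bsub>N\<^esub> x \<in> W'" for u w x W'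
  proof -
    note h = eval_hom[OF N(1) \<pi>(1) that(4)]
    have "(\<lambda>h\<in>carrier S. \<pi> (h x)) (u \<ominus>\<^bsub>S\<^esub> w) \<in> W'"
      by (rule FA.J_eval[OF N(1) h that(3,5)]) (use that(6) P_1 in auto)
    then show ?thesis using hom_minus[OF S_module' N(1) h that(1,2)] that(1,2) by simp
  qed
  from dich show ?thesis
  proof
    assume e0: "\<forall>x\<in>carrier N. e x = \<zero>\<^bsub>N\<^esub>"
    let ?\<psi> = "hom_diff N N (id_hom N) \<phi>"
    have \<psi>: "?\<psi> \<in> mod_hom R N N" by (rule hom_diff_closed[OF N(1) N(1) id_hom_closed[OF N(1)] \<phi>])
    have "?\<psi> ` carrier N = carrier N"
    proof (rule nakayama[OF N submodule_image[OF N(1) N(1) \<psi> submodule_carrier[OF N(1)]]])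
      fix W' assume W': "submodule W' R N" "?\<psi> ` carrier N \<subseteq> W'"
        "\<And>a x. a \<in> \<mm> \<Longrightarrow> x \<in> carrier N \<Longrightarrow> a \<odot>\<^bsub>N\<^esub> x \<in> W'"
      note D = submoduleD[OF N(1) W'(1)]
      have "carrier N \<subseteq> W'"
      proof
        fix y assume y: "y \<in> carrier N"
        obtain x where x: "x \<in> carrier V" "y = \<pi> x" using lift_y[OF y] by blast
        have pc: "(\<phi> ^^ j) y \<in> carrier N" for j by (rule funpow_hom_closed[OF \<phi> y])
        \<comment> \<open>Telescoping: y - \<phi>^j y is the sum of the (1 - \<phi>) \<phi>^i y with
          i < j.\<close>
        have tele: "y \<ominus>\<^bsub>N\<^esub> (\<phi> ^^ j) y \<in> W'" for j
        proof (induction j)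
          case 0 show ?case using D(2) y by (simp add: a_minus_def N.r_neg)
        next
          case (Suc j)
          have "?\<psi> ((\<phi> ^^ j) y) \<in> W'" using W'(2) pc by blast
          then have "(\<phi> ^^ j) y \<ominus>\<^bsub>N\<^esub> \<phi> ((\<phi> ^^ j) y) \<in> W'" using pc by (simp add: hom_diff_def)
          from D(3)[OF Suc this] show ?case using y pc[of j] mod_homD(1)[OF \<phi> pc[of j]]
            by (simp add: a_minus_def N.a_assoc N.r_neg1 N.r_neg2)
        qed
        have fx: "f x \<in> carrier V" by (rule mod_homD(1)[OF fh x(1)])
        \<comment> \<open>A^(k + 1) agrees with A^(k + 1) f modulo \<mm> S, and f induces 0 on
          \<open>N\<close>, so \<phi>^(k + 1) y lies in \<open>W'\<close>.\<close>
        have "\<pi> ((A [^]\<^bsub>S\<^esub> Suc k) x) \<ominus>\<^bsub>N\<^esub> \<pi> (((A [^]\<^bsub>S\<^esub> Suc k) \<otimes>\<^bsub>S\<^esub> f) x) \<in> W'"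
          by (rule ev[OF ap FA.A.m_closed[OF ap f(1)] f(5) x(1) W'(1,3)])
        moreover have "\<pi> (((A [^]\<^bsub>S\<^esub> Suc k) \<otimes>\<^bsub>S\<^esub> f) x) = \<zero>\<^bsub>N\<^esub>"
        proof -
          have "((A [^]\<^bsub>S\<^esub> Suc k) \<otimes>\<^bsub>S\<^esub> f) x = (A [^]\<^bsub>S\<^esub> Suc k) (f x)" using x(1) by (simp only: S_simps compose_eq)
          then have "\<pi> (((A [^]\<^bsub>S\<^esub> Suc k) \<otimes>\<^bsub>S\<^esub> f) x) = (\<phi> ^^ Suc k) (\<pi> (f x))" using A_pow[OF fx, of "Suc k"] by simp
          also have "\<pi> (f x) = \<zero>\<^bsub>N\<^esub>" using e(2)[OF x(1)] e0 y x(2) by simp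
          also have "(\<phi> ^^ j) \<zero>\<^bsub>N\<^esub> = \<zero>\<^bsub>N\<^esub>" for j by (induction j) (use hom_0[OF N(1) N(1) \<phi>] in auto)
          finally show ?thesis .
        qed
        ultimately have "\<pi> ((A [^]\<^bsub>S\<^esub> Suc k) x) \<ominus>\<^bsub>N\<^esub> \<zero>\<^bsub>N\<^esub> \<in> W'" by simp
        moreover have "\<pi> ((A [^]\<^bsub>S\<^esub> Suc k) x) = (\<phi> ^^ Suc k) y" using A_pow[OF x(1), of "Suc k"] x(2) by blast
        ultimately have "(\<phi> ^^ Suc k) y \<in> W'" using pc[of "Suc k"] N.minus_equality[of "\<zero>\<^bsub>N\<^esub>" "\<zero>\<^bsub>N\<^esub>"]
          by (simp add: a_minus_def)
        from D(3)[OF tele[of "Suc k"] this] show "y \<in> W'"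
          using y pc[of "Suc k"] by (simp add: a_minus_def N.a_assoc N.l_neg del: funpow.simps)
      qed
      then show "W' = carrier N" using D(1) by blast
    qed
    then show ?thesis by blast
  next
    assume e1: "\<forall>x\<in>carrier N. e x = x"
    have "\<phi> ` carrier N = carrier N"
    proof (rule nakayama[OF N submodule_image[OF N(1) N(1) \<phi> submodule_carrier[OF N(1)]]])
      fix W' assume W': "submodule W' R N" "\<phi> ` carrier N \<subseteq> W'"
        "\<And>a x. a \<in> \<mm> \<Longrightarrow> x \<in> carrier N \<Longrightarrow> a \<odot>\<^bsub>N\<^esub> x \<in> W'"
      note D = submoduleD[OF N(1) W'(1)]
      have "carrier N \<subseteq> W'"
      proof
        fix y assume y: "y \<in> carrier N"
        obtain x where x: "x \<in> carrier V" "y = \<pi> x" using lift_y[OF y] by blast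
        have sx: "s x \<in> carrier V" by (rule mod_homD(1)[OF sh x(1)])
        \<comment> \<open>f agrees with A^(k + 1) s modulo \<mm> S and induces the identity on
          \<open>N\<close>, so y is a value of \<phi> up to an element of \<open>W'\<close>.\<close>
        have "\<pi> (f x) \<ominus>\<^bsub>N\<^esub> \<pi> (((A [^]\<^bsub>S\<^esub> Suc k) \<otimes>\<^bsub>S\<^esub> s) x) \<in> W'"
          by (rule ev[OF f(1) FA.A.m_closed[OF ap f(3)] f(4) x(1) W'(1,3)])
        moreover have "\<pi> (f x) = y" using e(2)[OF x(1)] e1 y x(2) by simp
        moreover have "\<pi> (((A [^]\<^bsub>S\<^esub> Suc k) \<otimes>\<^bsub>S\<^esub> s) x) = \<phi> ((\<phi> ^^ k) (\<pi> (s x)))"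
        proof -
          have "((A [^]\<^bsub>S\<^esub> Suc k) \<otimes>\<^bsub>S\<^esub> s) x = (A [^]\<^bsub>S\<^esub> Suc k) (s x)" using x(1) by (simp only: S_simps compose_eq)
          then show ?thesis using A_pow[OF sx, of "Suc k"] by simp
        qed
        ultimately have 1: "y \<ominus>\<^bsub>N\<^esub> \<phi> ((\<phi> ^^ k) (\<pi> (s x))) \<in> W'" by simp
        have c: "(\<phi> ^^ k) (\<pi> (s x)) \<in> carrier N" by (rule funpow_hom_closed[OF \<phi> mod_homD(1)[OF \<pi>(1) sx]])
        then have 2: "\<phi> ((\<phi> ^^ k) (\<pi> (s x))) \<in> W'" using W'(2) by blast
        from D(3)[OF 1 2] show "y \<in> W'" using y mod_homD(1)[OF \<phi> c] by (simp add: a_minus_def N.a_assoc N.l_neg)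
      qed
      then show "W' = carrier N" using D(1) by blast
    qed
    then show ?thesis by blast
  qed
qed

end

context complete_local
begin

text \<open>By projectivity the composite of \<pi> and \<phi> lifts along \<pi> to an endomorphism
  of R^n, which puts \<phi> into the setting of the double commutant. Surjectivity is then upgraded
  to bijectivity by the chain condition.\<close>

theorem indecomposable_endo_local:
  assumes fg: "fg_module R N" and ind: "indecomposable R N" and \<phi>: "\<phi> \<in> mod_hom R N N"
  shows "bij_betw \<phi> (carrier N) (carrier N) \<or> bij_betw (hom_diff N N (id_hom N) \<phi>) (carrier N) (carrier N)"
proof -
  have mN: "module R N" using fg by (simp add: fg_module_def)
  have nN: "noeth R N" by (rule fg_imp_noeth[OF noetherian fg])
  obtain n \<pi> where \<pi>: "\<pi> \<in> mod_hom R (free_module R n) N" "\<pi> ` carrier (free_module R n) = carrier N"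
    by (rule fg_surj[OF fg])
  have V: "module R (free_module R n)" by (rule module_free[OF cring])
  obtain A where A: "A \<in> mod_hom R (free_module R n) (free_module R n)"
    "compose (carrier (free_module R n)) \<pi> A = compose (carrier (free_module R n)) \<phi> \<pi>"
    by (rule free_lift[OF V mN \<pi>(1) _ compose_hom[OF V \<pi>(1) \<phi>]]) (use \<pi>(2) in simp)
  interpret double_commutant R N n \<pi> A \<phi>
  proof (rule double_commutant.intro[OF complete_local_axioms], rule double_commutant_axioms.intro)
    show "\<pi> (A x) = \<phi> (\<pi> x)" if "x \<in> carrier (free_module R n)" for x
      using fun_cong[OF A(2), of x] that by (simp add: compose_def)
  qed (fact mN nN \<pi> \<phi> A(1))+
  show ?thesis
    using local_endo[OF ind] surjective_endo_inj[OF mN nN \<phi>]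
      surjective_endo_inj[OF mN nN hom_diff_closed[OF mN mN id_hom_closed[OF mN] \<phi>]] by blast
qed

end

section \<open>Finitely presented functors\<close>

text \<open>The subgroup \<open>I\<close> is arbitrary because cosets occur twice: modulo maps
  through free modules, and modulo the right ideals that define quotient functors.\<close>

lemma coset_eq_iff:
  assumes "module R U" "module R V" "subgroup I (hom_group R U V)"
    "f \<in> mod_hom R U V" "g \<in> mod_hom R U V"
  shows "I #>\<^bsub>hom_group R U V\<^esub> f = I #>\<^bsub>hom_group R U V\<^esub> g \<longleftrightarrow> hom_diff U V f g \<in> I"
proof -
  interpret G: comm_group "hom_group R U V" by (rule comm_group_hom_group[OF assms(1,2)])
  interpret I: subgroup I "hom_group R U V" by (rule assms(3))
  interpret V: module R V by (rule assms(2))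
  have fg: "f \<in> carrier (hom_group R U V)" "g \<in> carrier (hom_group R U V)"
    using assms(4,5) by (simp_all add: hom_group_simps)
  have "f \<otimes>\<^bsub>hom_group R U V\<^esub> inv\<^bsub>hom_group R U V\<^esub> g = hom_diff U V f g"
    unfolding inv_hom_group[OF assms(1,2,5)] hom_group_simps
    by (auto simp: hom_plus_def hom_diff_def hom_zero_def a_minus_def mod_homD(1)[OF assms(4)]
        mod_homD(1)[OF assms(5)] intro!: restrict_ext)
  moreover have "f \<in> I #>\<^bsub>hom_group R U V\<^esub> g \<longleftrightarrow> f \<otimes>\<^bsub>hom_group R U V\<^esub> inv\<^bsub>hom_group R U V\<^esub> g \<in> I"
    using I.rcos_module[OF G.is_group fg(2,1)] .
  moreover have "I #>\<^bsub>hom_group R U V\<^esub> f = I #>\<^bsub>hom_group R U V\<^esub> g \<longleftrightarrow> f \<in> I #>\<^bsub>hom_group R U V\<^esub> g"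
    using G.repr_independence[OF _ fg(2) assms(3), of f] G.rcos_self[OF fg(1) assms(3)] by auto
  ultimately show ?thesis by simp
qed

lemma coset_mult:
  assumes "module R U" "module R V" "subgroup I (hom_group R U V)"
    "f \<in> mod_hom R U V" "g \<in> mod_hom R U V"
  shows "(I #>\<^bsub>hom_group R U V\<^esub> f) <#>\<^bsub>hom_group R U V\<^esub> (I #>\<^bsub>hom_group R U V\<^esub> g) =
    I #>\<^bsub>hom_group R U V\<^esub> hom_plus U V f g"
proof -
  interpret G: comm_group "hom_group R U V" by (rule comm_group_hom_group[OF assms(1,2)])
  interpret I: normal I "hom_group R U V" using assms(3) G.normal_iff_subgroup by blast
  show ?thesis using I.rcos_sum[of f g] assms(4,5) by (simp add: hom_group_simps)
qed

lemma coset_mem: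
  assumes "module R U" "module R V" "subgroup I (hom_group R U V)"
    "f \<in> mod_hom R U V" "g \<in> I #>\<^bsub>hom_group R U V\<^esub> f"
  shows "g \<in> mod_hom R U V" "I #>\<^bsub>hom_group R U V\<^esub> g = I #>\<^bsub>hom_group R U V\<^esub> f"
proof -
  interpret G: comm_group "hom_group R U V" by (rule comm_group_hom_group[OF assms(1,2)])
  have f: "f \<in> carrier (hom_group R U V)" using assms(4) by (simp add: hom_group_simps)
  have "I #>\<^bsub>hom_group R U V\<^esub> f \<subseteq> carrier (hom_group R U V)"
    using G.r_coset_subset_G[OF subgroup.subset[OF assms(3)] f] .
  then show "g \<in> mod_hom R U V" using assms(5) by (auto simp: hom_group_simps)
  show "I #>\<^bsub>hom_group R U V\<^esub> g = I #>\<^bsub>hom_group R U V\<^esub> f"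
    using G.repr_independence[OF assms(5) f assms(3)] by simp
qed

lemma coset_self:
  assumes "module R U" "module R V" "subgroup I (hom_group R U V)" "f \<in> mod_hom R U V"
  shows "f \<in> I #>\<^bsub>hom_group R U V\<^esub> f"
proof -
  interpret G: comm_group "hom_group R U V" by (rule comm_group_hom_group[OF assms(1,2)])
  show ?thesis using G.rcos_self[OF _ assms(3), of f] assms(4) by (simp add: hom_group_simps)
qed

text \<open>Functors act through honest homomorphisms instead of stable classes, so that composites
  and sums are computed in the module category and only congruence modulo
  \<open>free_factoring\<close> has to be watched.\<close>

definition act :: "'a ring \<Rightarrow> ('a, 'v) sfunctor \<Rightarrow> 'a rmod \<Rightarrow> 'a rmod \<Rightarrow> ((nat \<Rightarrow> 'a) \<Rightarrow> nat \<Rightarrow> 'a) \<Rightarrow> 'v \<Rightarrow> 'v" where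
  "act R F U V f = fun_mor F U V (stable_class R U V f)"

text \<open>In Yoneda's terms, an epimorphism onto \<open>F\<close> from the functor represented by
  \<open>M\<close>, encoded by the image \<open>h\<close> of the identity.\<close>

definition generated_by :: "'a ring \<Rightarrow> ('a, 'v) sfunctor \<Rightarrow> 'a rmod \<Rightarrow> 'v \<Rightarrow> bool" where
  "generated_by R F M h \<longleftrightarrow> M \<in> CM R \<and> h \<in> carrier (fun_ob F M) \<and>
     (\<forall>U\<in>CM R. \<forall>x\<in>carrier (fun_ob F U). \<exists>f\<in>mod_hom R U M. x = act R F U M f h)"

text \<open>Elementwise form of the statement that \<open>F\<close> is the cokernel of the map of
  represented functors induced by \<gamma>.\<close>

definition presented_by :: "'a ring \<Rightarrow> ('a, 'v) sfunctor \<Rightarrow> 'a rmod \<Rightarrow> 'a rmod \<Rightarrow>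
    ((nat \<Rightarrow> 'a) \<Rightarrow> nat \<Rightarrow> 'a) \<Rightarrow> 'v \<Rightarrow> bool" where
  "presented_by R F M N \<gamma> h \<longleftrightarrow> generated_by R F M h \<and> N \<in> CM R \<and> \<gamma> \<in> mod_hom R N M \<and>
     (\<forall>U\<in>CM R. \<forall>f\<in>mod_hom R U M. act R F U M f h = \<one>\<^bsub>fun_ob F U\<^esub> \<longleftrightarrow>
        (\<exists>u\<in>mod_hom R U N. hom_diff U M f (compose (carrier U) \<gamma> u) \<in> free_factoring R U M))"

context cm_local
begin

abbreviation "Hom \<equiv> mod_hom R"
abbreviation "cls \<equiv> stable_class R"
abbreviation "ff \<equiv> free_factoring R"

lemma ff_subgroup: "U \<in> CM R \<Longrightarrow> V \<in> CM R \<Longrightarrow> subgroup (ff U V) (hom_group R U V)"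
  by (rule subgroup_free_factoring[OF CM_module CM_module])

lemma comp_closed:
  "U \<in> CM R \<Longrightarrow> f \<in> Hom U V \<Longrightarrow> g \<in> Hom V W \<Longrightarrow> compose (carrier U) g f \<in> Hom U W"
  by (rule compose_hom[OF CM_module])

lemma id_closed: "U \<in> CM R \<Longrightarrow> id_hom U \<in> Hom U U"
  by (rule id_hom_closed[OF CM_module])

lemma plus_closed: "U \<in> CM R \<Longrightarrow> V \<in> CM R \<Longrightarrow> f \<in> Hom U V \<Longrightarrow> g \<in> Hom U V \<Longrightarrow> hom_plus U V f g \<in> Hom U V"
  by (rule hom_plus_closed[OF CM_module CM_module])

lemma diff_closed: "U \<in> CM R \<Longrightarrow> V \<in> CM R \<Longrightarrow> f \<in> Hom U V \<Longrightarrow> g \<in> Hom U V \<Longrightarrow> hom_diff U V f g \<in> Hom U V"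
  by (rule hom_diff_closed[OF CM_module CM_module])

lemma zero_closed: "U \<in> CM R \<Longrightarrow> V \<in> CM R \<Longrightarrow> hom_zero U V \<in> Hom U V"
  by (rule hom_zero_closed[OF CM_module CM_module])

lemma cls_carrier: "carrier (stable_hom R U V) = cls U V ` Hom U V"
  by (simp add: stable_hom_def carrier_FactGroup stable_class_def hom_group_simps)

lemma cls_eq_iff:
  "U \<in> CM R \<Longrightarrow> V \<in> CM R \<Longrightarrow> f \<in> Hom U V \<Longrightarrow> g \<in> Hom U V \<Longrightarrow> cls U V f = cls U V g \<longleftrightarrow> hom_diff U V f g \<in> ff U V"
  unfolding stable_class_def by (rule coset_eq_iff[OF CM_module CM_module ff_subgroup])

lemma cls_mult:
  "U \<in> CM R \<Longrightarrow> V \<in> CM R \<Longrightarrow> f \<in> Hom U V \<Longrightarrow> g \<in> Hom U V \<Longrightarrow>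
    cls U V f \<otimes>\<^bsub>stable_hom R U V\<^esub> cls U V g = cls U V (hom_plus U V f g)"
  unfolding stable_class_def stable_hom_def by (simp add: coset_mult[OF CM_module CM_module ff_subgroup])

text \<open>Right ideals of the category of maximal Cohen--Macaulay modules containing the maps that factor
  through free modules; they correspond to the subfunctors of a representable functor.\<close>

definition right_ideal :: "'a rmod \<Rightarrow> ('a rmod \<Rightarrow> ((nat \<Rightarrow> 'a) \<Rightarrow> nat \<Rightarrow> 'a) set) \<Rightarrow> bool" where
  "right_ideal M I \<longleftrightarrow> M \<in> CM R \<and>
     (\<forall>U\<in>CM R. subgroup (I U) (hom_group R U M) \<and> ff U M \<subseteq> I U) \<and>
     (\<forall>U\<in>CM R. \<forall>V\<in>CM R. \<forall>f\<in>I V. \<forall>g\<in>Hom U V. compose (carrier U) f g \<in> I U)"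

lemma ff_right_ideal: "M \<in> CM R \<Longrightarrow> right_ideal M (\<lambda>U. ff U M)"
  unfolding right_ideal_def using ff_subgroup free_factoring_compose(2)[OF CM_module CM_module] CM_module by blast

text \<open>All members of the union coincide. A change of v costs an element of \<open>I V\<close>
  composed with u, a change of u costs f composed with a map through a free module, and both lie in
  \<open>I U\<close>.\<close>

lemma coset_comp:
  assumes I: "right_ideal M I" and U: "U \<in> CM R" and V: "V \<in> CM R" and f: "f \<in> Hom V M" and c: "c \<in> Hom U V"
  shows "(\<Union>v\<in>I V #>\<^bsub>hom_group R V M\<^esub> f. \<Union>u\<in>cls U V c. I U #>\<^bsub>hom_group R U M\<^esub> compose (carrier U) v u) =
    I U #>\<^bsub>hom_group R U M\<^esub> compose (carrier U) f c"
proof -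
  have M: "M \<in> CM R" using I by (simp add: right_ideal_def)
  have IU: "subgroup (I U) (hom_group R U M)" and IV: "subgroup (I V) (hom_group R V M)"
    and ffI: "ff U M \<subseteq> I U" using I U V by (auto simp: right_ideal_def)
  note mU = CM_module[OF U] and mV = CM_module[OF V] and mM = CM_module[OF M]
  have "I U #>\<^bsub>hom_group R U M\<^esub> compose (carrier U) v u = I U #>\<^bsub>hom_group R U M\<^esub> compose (carrier U) f c"
    if v: "v \<in> I V #>\<^bsub>hom_group R V M\<^esub> f" and u: "u \<in> cls U V c" for v u
  proof -
    note v' = coset_mem[OF mV mM IV f v]
    note u' = coset_mem[OF mU mV ff_subgroup[OF U V] c u[unfolded stable_class_def]]
    have "hom_diff V M v f \<in> I V" using v'(2) coset_eq_iff[OF mV mM IV v'(1) f] by simp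
    then have 1: "compose (carrier U) (hom_diff V M v f) u \<in> I U" using I U V u'(1) unfolding right_ideal_def by blast
    have "hom_diff U V u c \<in> ff U V" using u'(2) coset_eq_iff[OF mU mV ff_subgroup[OF U V] u'(1) c] by simp
    then have 2: "compose (carrier U) f (hom_diff U V u c) \<in> I U"
      using free_factoring_compose(1)[OF mU mV _ f] ffI by blast
    have "I U #>\<^bsub>hom_group R U M\<^esub> compose (carrier U) v u = I U #>\<^bsub>hom_group R U M\<^esub> compose (carrier U) f u"
      using coset_eq_iff[OF mU mM IU comp_closed[OF U u'(1) v'(1)] comp_closed[OF U u'(1) f]]
        compose_hom_diff_left[OF u'(1), of M v f] 1 by simp
    also have "\<dots> = I U #>\<^bsub>hom_group R U M\<^esub> compose (carrier U) f c"
      using coset_eq_iff[OF mU mM IU comp_closed[OF U u'(1) f] comp_closed[OF U c f]]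
        compose_hom_diff_right[OF mV mM u'(1) c f] 2 by simp
    finally show ?thesis .
  qed
  moreover have "f \<in> I V #>\<^bsub>hom_group R V M\<^esub> f" by (rule coset_self[OF mV mM IV f])
  moreover have "c \<in> cls U V c" unfolding stable_class_def by (rule coset_self[OF mU mV ff_subgroup[OF U V] c])
  ultimately show ?thesis by blast
qed

lemma stable_comp_cls:
  assumes "U \<in> CM R" "V \<in> CM R" "W \<in> CM R" "f \<in> Hom U V" "g \<in> Hom V W"
  shows "stable_comp R U W (cls V W g) (cls U V f) = cls U W (compose (carrier U) g f)"
  using coset_comp[OF ff_right_ideal[OF assms(3)] assms(1,2,5,4)]
  unfolding stable_comp_def stable_class_def[of R V W] stable_class_def[of R U W] .

lemma cls_mem: "f \<in> Hom U V \<Longrightarrow> cls U V f \<in> carrier (stable_hom R U V)"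
  by (simp add: cls_carrier)

lemma stable_id_cls: "stable_id R U = cls U U (id_hom U)"
  by (simp add: stable_id_def)

section \<open>Additive functors acted on by homomorphisms\<close>

lemma additive_functorD:
  assumes "additive_functor R F"
  shows "U \<in> CM R \<Longrightarrow> comm_group (fun_ob F U)"
    and "\<lbrakk>U \<in> CM R; V \<in> CM R; f \<in> Hom U V\<rbrakk> \<Longrightarrow> act R F U V f \<in> hom (fun_ob F V) (fun_ob F U)"
    and "\<lbrakk>U \<in> CM R; x \<in> carrier (fun_ob F U)\<rbrakk> \<Longrightarrow> act R F U U (id_hom U) x = x"
    and "\<lbrakk>U \<in> CM R; V \<in> CM R; W \<in> CM R; f \<in> Hom U V; g \<in> Hom V W; x \<in> carrier (fun_ob F W)\<rbrakk> \<Longrightarrow>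
      act R F U W (compose (carrier U) g f) x = act R F U V f (act R F V W g x)"
    and "\<lbrakk>U \<in> CM R; V \<in> CM R; f \<in> Hom U V; g \<in> Hom U V; x \<in> carrier (fun_ob F V)\<rbrakk> \<Longrightarrow>
      act R F U V (hom_plus U V f g) x = act R F U V f x \<otimes>\<^bsub>fun_ob F U\<^esub> act R F U V g x"
proof -
  note A = assms[unfolded additive_functor_def]
  show "U \<in> CM R \<Longrightarrow> comm_group (fun_ob F U)" using A by blast
  show "\<lbrakk>U \<in> CM R; V \<in> CM R; f \<in> Hom U V\<rbrakk> \<Longrightarrow> act R F U V f \<in> hom (fun_ob F V) (fun_ob F U)"
    using A cls_mem unfolding act_def by blast
  show "\<lbrakk>U \<in> CM R; x \<in> carrier (fun_ob F U)\<rbrakk> \<Longrightarrow> act R F U U (id_hom U) x = x"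
    using A unfolding act_def stable_id_cls[symmetric] by blast
  show "act R F U W (compose (carrier U) g f) x = act R F U V f (act R F V W g x)"
    if h: "U \<in> CM R" "V \<in> CM R" "W \<in> CM R" "f \<in> Hom U V" "g \<in> Hom V W" "x \<in> carrier (fun_ob F W)"
  proof -
    have "fun_mor F U W (stable_comp R U W (cls V W g) (cls U V f)) x = fun_mor F U V (cls U V f) (fun_mor F V W (cls V W g) x)"
      using A h(1-3,6) cls_mem[OF h(4)] cls_mem[OF h(5)] by blast
    then show ?thesis unfolding act_def stable_comp_cls[OF h(1-5)] .
  qed
  show "act R F U V (hom_plus U V f g) x = act R F U V f x \<otimes>\<^bsub>fun_ob F U\<^esub> act R F U V g x"
    if h: "U \<in> CM R" "V \<in> CM R" "f \<in> Hom U V" "g \<in> Hom U V" "x \<in> carrier (fun_ob F V)"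
  proof -
    have "fun_mor F U V (cls U V f \<otimes>\<^bsub>stable_hom R U V\<^esub> cls U V g) x = fun_mor F U V (cls U V f) x \<otimes>\<^bsub>fun_ob F U\<^esub> fun_mor F U V (cls U V g) x"
      using A h(1,2,5) cls_mem[OF h(3)] cls_mem[OF h(4)] by blast
    then show ?thesis unfolding act_def cls_mult[OF h(1-4)] .
  qed
qed

lemma additive_functorI:
  assumes "\<And>U. U \<in> CM R \<Longrightarrow> comm_group (fun_ob F U)"
    and "\<And>U V f. \<lbrakk>U \<in> CM R; V \<in> CM R; f \<in> Hom U V\<rbrakk> \<Longrightarrow> act R F U V f \<in> hom (fun_ob F V) (fun_ob F U)"
    and "\<And>U x. \<lbrakk>U \<in> CM R; x \<in> carrier (fun_ob F U)\<rbrakk> \<Longrightarrow> act R F U U (id_hom U) x = x"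
    and "\<And>U V W f g x. \<lbrakk>U \<in> CM R; V \<in> CM R; W \<in> CM R; f \<in> Hom U V; g \<in> Hom V W; x \<in> carrier (fun_ob F W)\<rbrakk> \<Longrightarrow>
      act R F U W (compose (carrier U) g f) x = act R F U V f (act R F V W g x)"
    and "\<And>U V f g x. \<lbrakk>U \<in> CM R; V \<in> CM R; f \<in> Hom U V; g \<in> Hom U V; x \<in> carrier (fun_ob F V)\<rbrakk> \<Longrightarrow>
      act R F U V (hom_plus U V f g) x = act R F U V f x \<otimes>\<^bsub>fun_ob F U\<^esub> act R F U V g x"
  shows "additive_functor R F"
  unfolding additive_functor_def
proof (intro conjI ballI)
  show "comm_group (fun_ob F U)" if "U \<in> CM R" for U by (rule assms(1)[OF that])
  show "fun_mor F U V c \<in> hom (fun_ob F V) (fun_ob F U)" if "U \<in> CM R" "V \<in> CM R" "c \<in> carrier (stable_hom R U V)" for U V c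
    using assms(2)[OF that(1,2)] that(3) unfolding act_def cls_carrier by auto
  show "fun_mor F U U (stable_id R U) x = x" if "U \<in> CM R" "x \<in> carrier (fun_ob F U)" for U x
    using assms(3)[OF that] unfolding act_def stable_id_cls .
  show "fun_mor F U W (stable_comp R U W c' c) x = fun_mor F U V c (fun_mor F V W c' x)"
    if h: "U \<in> CM R" "V \<in> CM R" "W \<in> CM R" "c \<in> carrier (stable_hom R U V)" "c' \<in> carrier (stable_hom R V W)"
      "x \<in> carrier (fun_ob F W)" for U V W c c' x
  proof -
    obtain f g where fg: "f \<in> Hom U V" "c = cls U V f" "g \<in> Hom V W" "c' = cls V W g" using h(4,5) unfolding cls_carrier by auto
    show ?thesis using assms(4)[OF h(1-3) fg(1,3) h(6)] unfolding fg(2,4) act_def stable_comp_cls[OF h(1-3) fg(1,3)] .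
  qed
  show "fun_mor F U V (c \<otimes>\<^bsub>stable_hom R U V\<^esub> c') x = fun_mor F U V c x \<otimes>\<^bsub>fun_ob F U\<^esub> fun_mor F U V c' x"
    if h: "U \<in> CM R" "V \<in> CM R" "c \<in> carrier (stable_hom R U V)" "c' \<in> carrier (stable_hom R U V)"
      "x \<in> carrier (fun_ob F V)" for U V c c' x
  proof -
    obtain f g where fg: "f \<in> Hom U V" "c = cls U V f" "g \<in> Hom U V" "c' = cls U V g" using h(3,4) unfolding cls_carrier by auto
    show ?thesis using assms(5)[OF h(1,2) fg(1,3) h(5)] unfolding fg(2,4) act_def cls_mult[OF h(1,2) fg(1,3)] .
  qed
qed

lemma act_mem:
  "\<lbrakk>additive_functor R F; U \<in> CM R; V \<in> CM R; f \<in> Hom U V; x \<in> carrier (fun_ob F V)\<rbrakk> \<Longrightarrow>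
    act R F U V f x \<in> carrier (fun_ob F U)"
  using additive_functorD(2)[of F U V f] by (auto dest: hom_in_carrier)

lemma act_one:
  assumes "additive_functor R F" "U \<in> CM R" "V \<in> CM R" "f \<in> Hom U V"
  shows "act R F U V f \<one>\<^bsub>fun_ob F V\<^esub> = \<one>\<^bsub>fun_ob F U\<^esub>"
  using hom_one[OF additive_functorD(2)[OF assms]] additive_functorD(1)[OF assms(1)] assms(2,3)
  by (simp add: comm_group_def)

lemma act_zero:
  assumes F: "additive_functor R F" and U: "U \<in> CM R" and V: "V \<in> CM R" and x: "x \<in> carrier (fun_ob F V)"
  shows "act R F U V (hom_zero U V) x = \<one>\<^bsub>fun_ob F U\<^esub>"
proof -
  interpret FU: comm_group "fun_ob F U" by (rule additive_functorD(1)[OF F U])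
  interpret V: module R V by (rule CM_module[OF V])
  note z = zero_closed[OF U V]
  have "hom_plus U V (hom_zero U V) (hom_zero U V) = hom_zero U V"
    unfolding hom_plus_def hom_zero_def by (rule restrict_ext) simp
  then have "act R F U V (hom_zero U V) x \<otimes>\<^bsub>fun_ob F U\<^esub> act R F U V (hom_zero U V) x = act R F U V (hom_zero U V) x"
    using additive_functorD(5)[OF F U V z z x] by simp
  then show ?thesis using act_mem[OF F U V z x] by (metis FU.l_cancel_one)
qed

text \<open>A map through a free module has the same stable class as the zero map.\<close>

lemma act_ff:
  assumes F: "additive_functor R F" and U: "U \<in> CM R" and V: "V \<in> CM R" and x: "x \<in> carrier (fun_ob F V)"
    and f: "f \<in> ff U V"
  shows "act R F U V f x = \<one>\<^bsub>fun_ob F U\<^esub>"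
proof -
  interpret V: module R V by (rule CM_module[OF V])
  have fh: "f \<in> Hom U V" using free_factoring_hom[OF CM_module[OF U]] f by blast
  have "hom_diff U V f (hom_zero U V) = restrict f (carrier U)"
    unfolding hom_diff_def hom_zero_def
    by (rule restrict_ext) (use mod_homD(1)[OF fh] V.minus_equality[of "\<zero>\<^bsub>V\<^esub>" "\<zero>\<^bsub>V\<^esub>"] in \<open>simp add: a_minus_def\<close>)
  also have "\<dots> = f" by (rule extensional_restrict[OF mod_homD(4)[OF fh]])
  finally have "cls U V f = cls U V (hom_zero U V)" using cls_eq_iff[OF U V fh zero_closed[OF U V]] f by simp
  then show ?thesis using act_zero[OF F U V x] by (simp add: act_def)
qed

lemma plus_diff:
  assumes U: "U \<in> CM R" and V: "V \<in> CM R" and f: "f \<in> Hom U V" and g: "g \<in> Hom U V"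
  shows "hom_plus U V (hom_diff U V f g) g = f"
proof -
  interpret V: module R V by (rule CM_module[OF V])
  have "hom_plus U V (hom_diff U V f g) g = restrict f (carrier U)"
    unfolding hom_diff_def hom_plus_def
    by (rule restrict_ext) (use mod_homD(1)[OF f] mod_homD(1)[OF g] in \<open>simp add: a_minus_def V.a_assoc V.l_neg\<close>)
  then show ?thesis using extensional_restrict[OF mod_homD(4)[OF f]] by simp
qed

lemma act_eq_iff:
  assumes F: "additive_functor R F" and U: "U \<in> CM R" and V: "V \<in> CM R" and x: "x \<in> carrier (fun_ob F V)"
    and f: "f \<in> Hom U V" and g: "g \<in> Hom U V"
  shows "act R F U V f x = act R F U V g x \<longleftrightarrow> act R F U V (hom_diff U V f g) x = \<one>\<^bsub>fun_ob F U\<^esub>"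
proof -
  interpret FU: comm_group "fun_ob F U" by (rule additive_functorD(1)[OF F U])
  note d = diff_closed[OF U V f g]
  have "act R F U V f x = act R F U V (hom_diff U V f g) x \<otimes>\<^bsub>fun_ob F U\<^esub> act R F U V g x"
    using additive_functorD(5)[OF F U V d g x] plus_diff[OF U V f g] by simp
  then show ?thesis using act_mem[OF F U V d x] act_mem[OF F U V g x] by (metis FU.l_one FU.r_cancel FU.one_closed)
qed

lemma act_ff_cong:
  assumes "additive_functor R F" "U \<in> CM R" "V \<in> CM R" "x \<in> carrier (fun_ob F V)"
    "f \<in> Hom U V" "g \<in> Hom U V" "hom_diff U V f g \<in> ff U V"
  shows "act R F U V f x = act R F U V g x"
  using act_eq_iff[OF assms(1-6)] act_ff[OF assms(1-4,7)] by simp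

lemma nat_trans_act:
  assumes "nat_trans R F G \<eta>"
  shows "U \<in> CM R \<Longrightarrow> \<eta> U \<in> hom (fun_ob F U) (fun_ob G U)"
    and "\<lbrakk>U \<in> CM R; V \<in> CM R; f \<in> Hom U V; x \<in> carrier (fun_ob F V)\<rbrakk> \<Longrightarrow>
      \<eta> U (act R F U V f x) = act R G U V f (\<eta> V x)"
  using assms cls_mem unfolding nat_trans_def act_def by blast+

lemma nat_transI:
  assumes "\<And>U. U \<in> CM R \<Longrightarrow> \<eta> U \<in> hom (fun_ob F U) (fun_ob G U)"
    and "\<And>U V f x. \<lbrakk>U \<in> CM R; V \<in> CM R; f \<in> Hom U V; x \<in> carrier (fun_ob F V)\<rbrakk> \<Longrightarrow>
      \<eta> U (act R F U V f x) = act R G U V f (\<eta> V x)"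
  shows "nat_trans R F G \<eta>"
  using assms unfolding nat_trans_def act_def cls_carrier by auto

lemma generated_byD:
  assumes "generated_by R F M h"
  shows "M \<in> CM R" "h \<in> carrier (fun_ob F M)"
    "\<lbrakk>U \<in> CM R; x \<in> carrier (fun_ob F U)\<rbrakk> \<Longrightarrow> \<exists>f\<in>Hom U M. x = act R F U M f h"
  using assms by (auto simp: generated_by_def)

text \<open>The universal property of a cyclic functor: a transformation may send the generator
  \<open>h\<close> to any \<open>y\<close> that satisfies the relations of \<open>h\<close>. Two
  maps f representing the same element differ by such a relation, so the choice in \<theta> is
  harmless.\<close>

lemma nat_trans_exists:
  assumes F: "additive_functor R F" and G: "additive_functor R G" and gen: "generated_by R F M h"
    and y: "y \<in> carrier (fun_ob G M)"
    and rel: "\<And>U f. \<lbrakk>U \<in> CM R; f \<in> Hom U M; act R F U M f h = \<one>\<^bsub>fun_ob F U\<^esub>\<rbrakk> \<Longrightarrow> act R G U M f y = \<one>\<^bsub>fun_ob G U\<^esub>"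
  obtains \<theta> where "nat_trans R F G \<theta>" "\<And>U f. \<lbrakk>U \<in> CM R; f \<in> Hom U M\<rbrakk> \<Longrightarrow> \<theta> U (act R F U M f h) = act R G U M f y"
proof -
  note g = generated_byD[OF gen] and M = generated_byD(1)[OF gen]
  define \<theta> where "\<theta> U x = act R G U M (SOME f. f \<in> Hom U M \<and> x = act R F U M f h) y" for U x
  have \<theta>: "\<theta> U (act R F U M f h) = act R G U M f y" if U: "U \<in> CM R" and f: "f \<in> Hom U M" for U f
  proof -
    let ?f = "SOME f'. f' \<in> Hom U M \<and> act R F U M f h = act R F U M f' h"
    have s: "?f \<in> Hom U M \<and> act R F U M f h = act R F U M ?f h" by (rule someI[of _ f]) (use f in simp)
    then have s1: "?f \<in> Hom U M" and "act R F U M (hom_diff U M f ?f) h = \<one>\<^bsub>fun_ob F U\<^esub>"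
      using act_eq_iff[OF F U M g(2) f] by auto
    then have "act R G U M (hom_diff U M f ?f) y = \<one>\<^bsub>fun_ob G U\<^esub>" by (intro rel[OF U diff_closed[OF U M f]])
    then show ?thesis using act_eq_iff[OF G U M y f s1] by (simp add: \<theta>_def)
  qed
  have "nat_trans R F G \<theta>"
  proof (rule nat_transI)
    fix U assume U: "U \<in> CM R"
    show "\<theta> U \<in> hom (fun_ob F U) (fun_ob G U)"
    proof (rule homI)
      fix x assume "x \<in> carrier (fun_ob F U)"
      then obtain f where f: "f \<in> Hom U M" "x = act R F U M f h" using g(3)[OF U] by blast
      show "\<theta> U x \<in> carrier (fun_ob G U)" unfolding f(2) \<theta>[OF U f(1)] by (rule act_mem[OF G U M f(1) y])
      fix x' assume "x' \<in> carrier (fun_ob F U)"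
      then obtain f' where f': "f' \<in> Hom U M" "x' = act R F U M f' h" using g(3)[OF U] by blast
      have "x \<otimes>\<^bsub>fun_ob F U\<^esub> x' = act R F U M (hom_plus U M f f') h"
        using additive_functorD(5)[OF F U M f(1) f'(1) g(2)] f(2) f'(2) by simp
      then show "\<theta> U (x \<otimes>\<^bsub>fun_ob F U\<^esub> x') = \<theta> U x \<otimes>\<^bsub>fun_ob G U\<^esub> \<theta> U x'"
        using \<theta>[OF U plus_closed[OF U M f(1) f'(1)]] additive_functorD(5)[OF G U M f(1) f'(1) y]
          \<theta>[OF U f(1)] \<theta>[OF U f'(1)] f(2) f'(2) by simp
    qed
  next
    fix U V c x assume h: "U \<in> CM R" "V \<in> CM R" "c \<in> Hom U V" "x \<in> carrier (fun_ob F V)"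
    obtain f where f: "f \<in> Hom V M" "x = act R F V M f h" using g(3)[OF h(2,4)] by blast
    have "\<theta> U (act R F U V c x) = \<theta> U (act R F U M (compose (carrier U) f c) h)"
      using additive_functorD(4)[OF F h(1,2) M h(3) f(1) g(2)] f(2) by simp
    also have "\<dots> = act R G U V c (act R G V M f y)"
      using \<theta>[OF h(1) comp_closed[OF h(1,3) f(1)]] additive_functorD(4)[OF G h(1,2) M h(3) f(1) y] by simp
    also have "\<dots> = act R G U V c (\<theta> V x)" using \<theta>[OF h(2) f(1)] f(2) by simp
    finally show "\<theta> U (act R F U V c x) = act R G U V c (\<theta> V x)" .
  qed
  with \<theta> show ?thesis using that by blast
qed

section \<open>Quotients of represented functors by right ideals\<close>

definition quo_class :: "'a rmod \<Rightarrow> ('a rmod \<Rightarrow> ((nat \<Rightarrow> 'a) \<Rightarrow> nat \<Rightarrow> 'a) set) \<Rightarrow> 'a rmod \<Rightarrow>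
    ((nat \<Rightarrow> 'a) \<Rightarrow> nat \<Rightarrow> 'a) \<Rightarrow> 'a smor set" where
  "quo_class M I U f = {I U #>\<^bsub>hom_group R U M\<^esub> f}"

text \<open>The cosets are wrapped in singletons only to obtain values of the type required of objects of
  \<open>mod_CM\<close>.\<close>

definition quo :: "'a rmod \<Rightarrow> ('a rmod \<Rightarrow> ((nat \<Rightarrow> 'a) \<Rightarrow> nat \<Rightarrow> 'a) set) \<Rightarrow> 'a fp_functor" where
  "quo M I = \<lparr>fun_ob = (\<lambda>U. \<lparr>carrier = quo_class M I U ` Hom U M,
       monoid.mult = (\<lambda>x y. {the_elem x <#>\<^bsub>hom_group R U M\<^esub> the_elem y}),
       one = quo_class M I U (hom_zero U M)\<rparr>),
     fun_mor = (\<lambda>U V c x. {\<Union>v\<in>the_elem x. \<Union>u\<in>c. I U #>\<^bsub>hom_group R U M\<^esub> compose (carrier U) v u})\<rparr>"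

context
  fixes M I assumes I: "right_ideal M I"
begin

lemma I_facts: "M \<in> CM R" "U \<in> CM R \<Longrightarrow> subgroup (I U) (hom_group R U M)" "U \<in> CM R \<Longrightarrow> ff U M \<subseteq> I U"
  using I by (auto simp: right_ideal_def)

lemma quo_class_eq_iff:
  "U \<in> CM R \<Longrightarrow> f \<in> Hom U M \<Longrightarrow> g \<in> Hom U M \<Longrightarrow> quo_class M I U f = quo_class M I U g \<longleftrightarrow> hom_diff U M f g \<in> I U"
  unfolding quo_class_def using coset_eq_iff[OF CM_module CM_module[OF I_facts(1)] I_facts(2)] by simp

lemma quo_carrier: "carrier (fun_ob (quo M I) U) = quo_class M I U ` Hom U M"
  by (simp add: quo_def)

lemma quo_mult:
  "U \<in> CM R \<Longrightarrow> f \<in> Hom U M \<Longrightarrow> g \<in> Hom U M \<Longrightarrow>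
    quo_class M I U f \<otimes>\<^bsub>fun_ob (quo M I) U\<^esub> quo_class M I U g = quo_class M I U (hom_plus U M f g)"
  using coset_mult[OF CM_module CM_module[OF I_facts(1)] I_facts(2)] by (simp add: quo_def quo_class_def)

lemma quo_one: "\<one>\<^bsub>fun_ob (quo M I) U\<^esub> = quo_class M I U (hom_zero U M)"
  by (simp add: quo_def)

lemma quo_act:
  "U \<in> CM R \<Longrightarrow> V \<in> CM R \<Longrightarrow> c \<in> Hom U V \<Longrightarrow> f \<in> Hom V M \<Longrightarrow>
    act R (quo M I) U V c (quo_class M I V f) = quo_class M I U (compose (carrier U) f c)"
  using coset_comp[OF I, of U V f c] by (simp add: quo_def quo_class_def act_def)

lemma quo_additive: "additive_functor R (quo M I)"
proof (rule additive_functorI)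
  note M = I_facts(1)
  fix U assume U: "U \<in> CM R"
  interpret G: comm_group "hom_group R U M" by (rule comm_group_hom_group[OF CM_module[OF U] CM_module[OF M]])
  show "comm_group (fun_ob (quo M I) U)"
  proof (rule comm_groupI)
    show "\<one>\<^bsub>fun_ob (quo M I) U\<^esub> \<in> carrier (fun_ob (quo M I) U)"
      using zero_closed[OF U M] by (simp add: quo_one quo_carrier)
    fix x assume "x \<in> carrier (fun_ob (quo M I) U)"
    then obtain f where f: "f \<in> Hom U M" "x = quo_class M I U f" by (auto simp: quo_carrier)
    show "\<one>\<^bsub>fun_ob (quo M I) U\<^esub> \<otimes>\<^bsub>fun_ob (quo M I) U\<^esub> x = x"
      using G.l_one[of f] f zero_closed[OF U M] by (simp add: quo_one quo_mult[OF U] hom_group_simps)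
    obtain g where "g \<in> Hom U M" "hom_plus U M g f = hom_zero U M"
      using G.l_inv_ex[of f] f(1) by (auto simp: hom_group_simps)
    then show "\<exists>y\<in>carrier (fun_ob (quo M I) U). y \<otimes>\<^bsub>fun_ob (quo M I) U\<^esub> x = \<one>\<^bsub>fun_ob (quo M I) U\<^esub>"
      using f by (intro bexI[of _ "quo_class M I U g"]) (simp_all add: quo_one quo_mult[OF U] quo_carrier)
    fix y assume "y \<in> carrier (fun_ob (quo M I) U)"
    then obtain g where g: "g \<in> Hom U M" "y = quo_class M I U g" by (auto simp: quo_carrier)
    show "x \<otimes>\<^bsub>fun_ob (quo M I) U\<^esub> y \<in> carrier (fun_ob (quo M I) U)"
      using f g plus_closed[OF U M f(1) g(1)] by (simp add: quo_mult[OF U] quo_carrier)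
    show "x \<otimes>\<^bsub>fun_ob (quo M I) U\<^esub> y = y \<otimes>\<^bsub>fun_ob (quo M I) U\<^esub> x"
      using f g G.m_comm[of f g] by (simp add: quo_mult[OF U] hom_group_simps)
    fix z assume "z \<in> carrier (fun_ob (quo M I) U)"
    then obtain h where h: "h \<in> Hom U M" "z = quo_class M I U h" by (auto simp: quo_carrier)
    show "x \<otimes>\<^bsub>fun_ob (quo M I) U\<^esub> y \<otimes>\<^bsub>fun_ob (quo M I) U\<^esub> z = x \<otimes>\<^bsub>fun_ob (quo M I) U\<^esub> (y \<otimes>\<^bsub>fun_ob (quo M I) U\<^esub> z)"
      using f g h G.m_assoc[of f g h] plus_closed[OF U M f(1) g(1)] plus_closed[OF U M g(1) h(1)]
      by (simp add: quo_mult[OF U] hom_group_simps)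
  qed
  {
    fix x assume "x \<in> carrier (fun_ob (quo M I) U)"
    then obtain f where f: "f \<in> Hom U M" "x = quo_class M I U f" by (auto simp: quo_carrier)
    show "act R (quo M I) U U (id_hom U) x = x"
      unfolding f(2) quo_act[OF U U id_closed[OF U] f(1)] compose_id_hom(1)[OF f(1)] ..
  }
  fix V assume V: "V \<in> CM R"
  {
    fix c assume c: "c \<in> Hom U V"
    show "act R (quo M I) U V c \<in> hom (fun_ob (quo M I) V) (fun_ob (quo M I) U)"
    proof (rule homI)
      fix x assume "x \<in> carrier (fun_ob (quo M I) V)"
      then obtain f where f: "f \<in> Hom V M" "x = quo_class M I V f" by (auto simp: quo_carrier)
      show "act R (quo M I) U V c x \<in> carrier (fun_ob (quo M I) U)"
        unfolding f(2) quo_act[OF U V c f(1)] quo_carrier using comp_closed[OF U c f(1)] by blast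
      fix y assume "y \<in> carrier (fun_ob (quo M I) V)"
      then obtain g where g: "g \<in> Hom V M" "y = quo_class M I V g" by (auto simp: quo_carrier)
      show "act R (quo M I) U V c (x \<otimes>\<^bsub>fun_ob (quo M I) V\<^esub> y) =
          act R (quo M I) U V c x \<otimes>\<^bsub>fun_ob (quo M I) U\<^esub> act R (quo M I) U V c y"
        unfolding f(2) g(2) quo_mult[OF V f(1) g(1)] quo_act[OF U V c f(1)] quo_act[OF U V c g(1)]
          quo_act[OF U V c plus_closed[OF V M f(1) g(1)]] quo_mult[OF U comp_closed[OF U c f(1)] comp_closed[OF U c g(1)]]
          compose_hom_plus_left[OF c] ..
    qed
  }
  {
    fix f g x assume h: "f \<in> Hom U V" "g \<in> Hom U V" "x \<in> carrier (fun_ob (quo M I) V)"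
    then obtain k where k: "k \<in> Hom V M" "x = quo_class M I V k" by (auto simp: quo_carrier)
    show "act R (quo M I) U V (hom_plus U V f g) x = act R (quo M I) U V f x \<otimes>\<^bsub>fun_ob (quo M I) U\<^esub> act R (quo M I) U V g x"
      unfolding k(2) quo_act[OF U V h(1) k(1)] quo_act[OF U V h(2) k(1)] quo_act[OF U V plus_closed[OF U V h(1,2)] k(1)]
        quo_mult[OF U comp_closed[OF U h(1) k(1)] comp_closed[OF U h(2) k(1)]] compose_hom_plus_right[OF h(1,2) k(1)] ..
  }
  fix W f g x assume W: "W \<in> CM R" and h: "f \<in> Hom U V" "g \<in> Hom V W" "x \<in> carrier (fun_ob (quo M I) W)"
  then obtain k where k: "k \<in> Hom W M" "x = quo_class M I W k" by (auto simp: quo_carrier)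
  show "act R (quo M I) U W (compose (carrier U) g f) x = act R (quo M I) U V f (act R (quo M I) V W g x)"
    unfolding k(2) quo_act[OF V W h(2) k(1)] quo_act[OF U V h(1) comp_closed[OF V h(2) k(1)]]
      quo_act[OF U W comp_closed[OF U h(1,2)] k(1)] compose_hom_assoc[OF h(1)] ..
qed

lemma quo_gen_act: "U \<in> CM R \<Longrightarrow> f \<in> Hom U M \<Longrightarrow> act R (quo M I) U M f (quo_class M I M (id_hom M)) = quo_class M I U f"
  using quo_act[of U M f "id_hom M"] id_closed[OF I_facts(1)] compose_id_hom(2)[of f R U M] I_facts(1) by simp

lemma quo_generated: "generated_by R (quo M I) M (quo_class M I M (id_hom M))"
  unfolding generated_by_def quo_carrier using I_facts(1) id_closed[OF I_facts(1)] quo_gen_act by force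

lemma quo_one_iff: "U \<in> CM R \<Longrightarrow> f \<in> Hom U M \<Longrightarrow>
    act R (quo M I) U M f (quo_class M I M (id_hom M)) = \<one>\<^bsub>fun_ob (quo M I) U\<^esub> \<longleftrightarrow> f \<in> I U"
proof -
  assume U: "U \<in> CM R" and f: "f \<in> Hom U M"
  interpret M: module R M by (rule CM_module[OF I_facts(1)])
  have "hom_diff U M f (hom_zero U M) = restrict f (carrier U)"
    unfolding hom_diff_def hom_zero_def
    by (rule restrict_ext) (use mod_homD(1)[OF f] M.minus_equality[of "\<zero>\<^bsub>M\<^esub>" "\<zero>\<^bsub>M\<^esub>"] in \<open>simp add: a_minus_def\<close>)
  also have "\<dots> = f" by (rule extensional_restrict[OF mod_homD(4)[OF f]])
  finally show ?thesis
    unfolding quo_gen_act[OF U f] quo_one quo_class_eq_iff[OF U f zero_closed[OF U I_facts(1)]] by simp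
qed

end

end

context cm_local
begin

section \<open>Presentations by elements and Yoneda's lemma\<close>

lemma rep_act:
  "U \<in> CM R \<Longrightarrow> V \<in> CM R \<Longrightarrow> M \<in> CM R \<Longrightarrow> f \<in> Hom U V \<Longrightarrow> g \<in> Hom V M \<Longrightarrow>
    act R (representable R M) U V f (cls V M g) = cls U M (compose (carrier U) g f)"
  by (simp add: act_def representable_def stable_comp_cls)

lemma rep_ob: "fun_ob (representable R M) U = stable_hom R U M"
  by (simp add: representable_def)

lemma diff_self_ff:
  assumes "U \<in> CM R" "V \<in> CM R" "f \<in> Hom U V" shows "hom_diff U V f f \<in> ff U V"
proof -
  interpret V: module R V by (rule CM_module[OF assms(2)])
  have "hom_diff U V f f = hom_zero U V"
    unfolding hom_diff_def hom_zero_def by (rule restrict_ext) (simp add: a_minus_def V.r_neg mod_homD(1)[OF assms(3)])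
  then show ?thesis using subgroup.one_closed[OF ff_subgroup[OF assms(1,2)]] by (simp add: hom_group_simps)
qed

lemma presented_byD:
  assumes "presented_by R F M N \<gamma> h"
  shows "generated_by R F M h" "M \<in> CM R" "N \<in> CM R" "\<gamma> \<in> Hom N M" "h \<in> carrier (fun_ob F M)"
    "\<lbrakk>U \<in> CM R; f \<in> Hom U M\<rbrakk> \<Longrightarrow> act R F U M f h = \<one>\<^bsub>fun_ob F U\<^esub> \<longleftrightarrow>
      (\<exists>u\<in>Hom U N. hom_diff U M f (compose (carrier U) \<gamma> u) \<in> ff U M)"
  using assms by (auto simp: presented_by_def generated_by_def)

text \<open>The two transformations are the ones that Yoneda's lemma attaches to the data: \<alpha>
  composes with \<gamma>, and \<beta> lets a stable class act on \<open>h\<close>.\<close>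

lemma presented_imp_fin_presented:
  assumes F: "additive_functor R F" and P: "presented_by R F M N \<gamma> h"
  shows "fin_presented R F"
proof -
  note M = presented_byD(2)[OF P] and N = presented_byD(3)[OF P] and \<gamma> = presented_byD(4)[OF P] and h = presented_byD(5)[OF P]
  define \<alpha> where "\<alpha> U c = stable_comp R U M (cls N M \<gamma>) c" for U c
  define \<beta> where "\<beta> U c = fun_mor F U M c h" for U c
  have \<alpha>: "\<alpha> U (cls U N u) = cls U M (compose (carrier U) \<gamma> u)" if "U \<in> CM R" "u \<in> Hom U N" for U u
    unfolding \<alpha>_def by (rule stable_comp_cls[OF that(1) N M that(2) \<gamma>])
  have \<beta>: "\<beta> U (cls U M f) = act R F U M f h" for U f by (simp add: \<beta>_def act_def)
  have 1: "nat_trans R (representable R N) (representable R M) \<alpha>"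
  proof (rule nat_transI)
    fix U assume U: "U \<in> CM R"
    show "\<alpha> U \<in> hom (fun_ob (representable R N) U) (fun_ob (representable R M) U)"
      unfolding rep_ob
    proof (rule homI)
      fix x assume "x \<in> carrier (stable_hom R U N)"
      then obtain u where u: "u \<in> Hom U N" "x = cls U N u" by (auto simp: cls_carrier)
      show "\<alpha> U x \<in> carrier (stable_hom R U M)"
        unfolding u(2) \<alpha>[OF U u(1)] by (rule cls_mem[OF comp_closed[OF U u(1) \<gamma>]])
      fix y assume "y \<in> carrier (stable_hom R U N)"
      then obtain v where v: "v \<in> Hom U N" "y = cls U N v" by (auto simp: cls_carrier)
      show "\<alpha> U (x \<otimes>\<^bsub>stable_hom R U N\<^esub> y) = \<alpha> U x \<otimes>\<^bsub>stable_hom R U M\<^esub> \<alpha> U y"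
        unfolding u(2) v(2) cls_mult[OF U N u(1) v(1)] \<alpha>[OF U u(1)] \<alpha>[OF U v(1)] \<alpha>[OF U plus_closed[OF U N u(1) v(1)]]
          cls_mult[OF U M comp_closed[OF U u(1) \<gamma>] comp_closed[OF U v(1) \<gamma>]] compose_hom_plus_right[OF u(1) v(1) \<gamma>] ..
    qed
  next
    fix U V f x assume a: "U \<in> CM R" "V \<in> CM R" "f \<in> Hom U V" "x \<in> carrier (fun_ob (representable R N) V)"
    then obtain v where v: "v \<in> Hom V N" "x = cls V N v" by (auto simp: rep_ob cls_carrier)
    show "\<alpha> U (act R (representable R N) U V f x) = act R (representable R M) U V f (\<alpha> V x)"
      unfolding v(2) rep_act[OF a(1,2) N a(3) v(1)] \<alpha>[OF a(2) v(1)] \<alpha>[OF a(1) comp_closed[OF a(1,3) v(1)]]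
        rep_act[OF a(1,2) M a(3) comp_closed[OF a(2) v(1) \<gamma>]] compose_hom_assoc[OF a(3)] ..
  qed
  have 2: "nat_trans R (representable R M) F \<beta>"
  proof (rule nat_transI)
    fix U assume U: "U \<in> CM R"
    show "\<beta> U \<in> hom (fun_ob (representable R M) U) (fun_ob F U)"
      unfolding rep_ob
    proof (rule homI)
      fix x assume "x \<in> carrier (stable_hom R U M)"
      then obtain u where u: "u \<in> Hom U M" "x = cls U M u" by (auto simp: cls_carrier)
      show "\<beta> U x \<in> carrier (fun_ob F U)" unfolding u(2) \<beta> by (rule act_mem[OF F U M u(1) h])
      fix y assume "y \<in> carrier (stable_hom R U M)"
      then obtain v where v: "v \<in> Hom U M" "y = cls U M v" by (auto simp: cls_carrier)
      show "\<beta> U (x \<otimes>\<^bsub>stable_hom R U M\<^esub> y) = \<beta> U x \<otimes>\<^bsub>fun_ob F U\<^esub> \<beta> U y"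
        unfolding u(2) v(2) cls_mult[OF U M u(1) v(1)] \<beta> by (rule additive_functorD(5)[OF F U M u(1) v(1) h])
    qed
  next
    fix U V f x assume a: "U \<in> CM R" "V \<in> CM R" "f \<in> Hom U V" "x \<in> carrier (fun_ob (representable R M) V)"
    then obtain v where v: "v \<in> Hom V M" "x = cls V M v" by (auto simp: rep_ob cls_carrier)
    show "\<beta> U (act R (representable R M) U V f x) = act R F U V f (\<beta> V x)"
      unfolding v(2) rep_act[OF a(1,2) M a(3) v(1)] \<beta> by (rule additive_functorD(4)[OF F a(1,2) M a(3) v(1) h])
  qed
  have 3: "\<alpha> U ` carrier (stable_hom R U N) = kernel (stable_hom R U M) (fun_ob F U) (\<beta> U)" if U: "U \<in> CM R" for U
  proof (intro equalityI subsetI)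
    fix x assume "x \<in> \<alpha> U ` carrier (stable_hom R U N)"
    then obtain u where u: "u \<in> Hom U N" "x = cls U M (compose (carrier U) \<gamma> u)" using \<alpha>[OF U] by (auto simp: cls_carrier)
    note c = comp_closed[OF U u(1) \<gamma>]
    have "act R F U M (compose (carrier U) \<gamma> u) h = \<one>\<^bsub>fun_ob F U\<^esub>"
      using presented_byD(6)[OF P U c] diff_self_ff[OF U M c] u(1) by blast
    then show "x \<in> kernel (stable_hom R U M) (fun_ob F U) (\<beta> U)" using cls_mem[OF c] by (simp add: kernel_def u(2) \<beta>)
  next
    fix x assume "x \<in> kernel (stable_hom R U M) (fun_ob F U) (\<beta> U)"
    then obtain f where f: "f \<in> Hom U M" "x = cls U M f" "act R F U M f h = \<one>\<^bsub>fun_ob F U\<^esub>"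
      by (auto simp: kernel_def cls_carrier \<beta>)
    then obtain u where u: "u \<in> Hom U N" "hom_diff U M f (compose (carrier U) \<gamma> u) \<in> ff U M"
      using presented_byD(6)[OF P U f(1)] by blast
    then have "x = \<alpha> U (cls U N u)"
      using cls_eq_iff[OF U M f(1) comp_closed[OF U u(1) \<gamma>]] \<alpha>[OF U u(1)] f(2) by simp
    then show "x \<in> \<alpha> U ` carrier (stable_hom R U N)" using cls_mem[OF u(1)] by blast
  qed
  have 4: "\<beta> U ` carrier (stable_hom R U M) = carrier (fun_ob F U)" if U: "U \<in> CM R" for U
  proof (intro equalityI subsetI)
    fix x assume "x \<in> \<beta> U ` carrier (stable_hom R U M)"
    then show "x \<in> carrier (fun_ob F U)" using act_mem[OF F U M _ h] by (auto simp: cls_carrier \<beta>)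
  next
    fix x assume "x \<in> carrier (fun_ob F U)"
    then obtain f where "f \<in> Hom U M" "x = act R F U M f h" using generated_byD(3)[OF presented_byD(1)[OF P] U] by blast
    then show "x \<in> \<beta> U ` carrier (stable_hom R U M)" using cls_mem \<beta> by (metis image_eqI)
  qed
  show ?thesis unfolding fin_presented_def using M N 1 2 3 4 by blast
qed

text \<open>By Yoneda's lemma \<gamma> and h are read off from \<alpha> and \<beta> at the
  identities, and naturality recovers the transformations from them.\<close>

lemma fin_presented_imp_presented:
  assumes F: "additive_functor R F" and fp: "fin_presented R F"
  obtains M N \<gamma> h where "presented_by R F M N \<gamma> h"
proof -
  obtain M N \<alpha> \<beta> where MN: "M \<in> CM R" "N \<in> CM R" and \<alpha>: "nat_trans R (representable R N) (representable R M) \<alpha>"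
    and \<beta>: "nat_trans R (representable R M) F \<beta>"
    and exact: "\<forall>U\<in>CM R. \<alpha> U ` carrier (stable_hom R U N) = kernel (stable_hom R U M) (fun_ob F U) (\<beta> U) \<and>
      \<beta> U ` carrier (stable_hom R U M) = carrier (fun_ob F U)"
    using fp[unfolded fin_presented_def] by (elim bexE exE conjE) (rule that, assumption+)
  note ex = exact[THEN bspec, THEN conjunct1] exact[THEN bspec, THEN conjunct2]
  note M = MN(1) and N = MN(2)
  have "\<alpha> N (cls N N (id_hom N)) \<in> carrier (stable_hom R N M)"
    using ex(1)[OF N] cls_mem[OF id_closed[OF N]] by (auto simp: kernel_def)
  then obtain \<gamma> where \<gamma>: "\<gamma> \<in> Hom N M" "\<alpha> N (cls N N (id_hom N)) = cls N M \<gamma>" by (auto simp: cls_carrier)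
  define h where "h = \<beta> M (cls M M (id_hom M))"
  have h: "h \<in> carrier (fun_ob F M)" unfolding h_def using ex(2)[OF M] cls_mem[OF id_closed[OF M]] by blast
  have al: "\<alpha> U (cls U N u) = cls U M (compose (carrier U) \<gamma> u)" if U: "U \<in> CM R" and u: "u \<in> Hom U N" for U u
  proof -
    have "cls U N u = act R (representable R N) U N u (cls N N (id_hom N))"
      using rep_act[OF U N N u id_closed[OF N]] compose_id_hom(2)[OF u] by simp
    then have "\<alpha> U (cls U N u) = act R (representable R M) U N u (cls N M \<gamma>)"
      using nat_trans_act(2)[OF \<alpha> U N u] cls_mem[OF id_closed[OF N]] \<gamma>(2) by (simp add: rep_ob)
    then show ?thesis using rep_act[OF U N M u \<gamma>(1)] by simp
  qed
  have be: "\<beta> U (cls U M f) = act R F U M f h" if U: "U \<in> CM R" and f: "f \<in> Hom U M" for U f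
  proof -
    have "cls U M f = act R (representable R M) U M f (cls M M (id_hom M))"
      using rep_act[OF U M M f id_closed[OF M]] compose_id_hom(2)[OF f] by simp
    then show ?thesis using nat_trans_act(2)[OF \<beta> U M f] cls_mem[OF id_closed[OF M]] by (simp add: rep_ob h_def)
  qed
  have "generated_by R F M h" unfolding generated_by_def
  proof (intro conjI M h ballI)
    fix U x assume U: "U \<in> CM R" and "x \<in> carrier (fun_ob F U)"
    then obtain f where "f \<in> Hom U M" "x = \<beta> U (cls U M f)" using ex(2)[OF U] by (auto simp: cls_carrier)
    then show "\<exists>f\<in>Hom U M. x = act R F U M f h" using be[OF U] by blast
  qed
  moreover have "act R F U M f h = \<one>\<^bsub>fun_ob F U\<^esub> \<longleftrightarrow> (\<exists>u\<in>Hom U N. hom_diff U M f (compose (carrier U) \<gamma> u) \<in> ff U M)"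
    if U: "U \<in> CM R" and f: "f \<in> Hom U M" for U f
  proof -
    have "act R F U M f h = \<one>\<^bsub>fun_ob F U\<^esub> \<longleftrightarrow> cls U M f \<in> kernel (stable_hom R U M) (fun_ob F U) (\<beta> U)"
      using be[OF U f] cls_mem[OF f] by (simp add: kernel_def)
    also have "\<dots> \<longleftrightarrow> (\<exists>u\<in>Hom U N. cls U M f = cls U M (compose (carrier U) \<gamma> u))"
      unfolding ex(1)[OF U, symmetric] cls_carrier using al[OF U] by (auto simp: image_iff)
    also have "\<dots> \<longleftrightarrow> (\<exists>u\<in>Hom U N. hom_diff U M f (compose (carrier U) \<gamma> u) \<in> ff U M)"
      using cls_eq_iff[OF U M f comp_closed[OF U _ \<gamma>(1)]] by auto
    finally show ?thesis .
  qed
  ultimately show ?thesis using that[of M N \<gamma> h] N \<gamma>(1) unfolding presented_by_def by blast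
qed

lemma mod_CM_additive: "F \<in> mod_CM R \<Longrightarrow> additive_functor R F"
  by (simp add: mod_CM_def)

lemma mod_CM_presented:
  assumes "F \<in> mod_CM R" obtains M N \<gamma> h where "presented_by R F M N \<gamma> h"
  by (rule fin_presented_imp_presented[of F]) (use assms that in \<open>auto simp: mod_CM_def\<close>)

lemma quo_in_mod_CM:
  assumes I: "right_ideal M I" and N: "N \<in> CM R" "\<gamma> \<in> Hom N M"
    and iff: "\<And>U f. \<lbrakk>U \<in> CM R; f \<in> Hom U M\<rbrakk> \<Longrightarrow>
      f \<in> I U \<longleftrightarrow> (\<exists>u\<in>Hom U N. hom_diff U M f (compose (carrier U) \<gamma> u) \<in> ff U M)"
  shows "quo M I \<in> mod_CM R"
proof -
  have "presented_by R (quo M I) M N \<gamma> (quo_class M I M (id_hom M))"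
    unfolding presented_by_def using quo_generated[OF I] N quo_one_iff[OF I] iff by simp
  then show ?thesis using quo_additive[OF I] presented_imp_fin_presented by (auto simp: mod_CM_def)
qed

text \<open>A copy of \<open>representable R M\<close> with values of the type required of objects
  of \<open>mod_CM R\<close>.\<close>

definition "rep M = quo M (\<lambda>U. ff U M)"

lemma rep_mod_CM: assumes M: "M \<in> CM R" shows "rep M \<in> mod_CM R"
  unfolding rep_def
\<comment> \<open>The zero endomorphism of \<open>M\<close> serves as presenting map, since the only
  relations are the maps through free modules.\<close>
proof (rule quo_in_mod_CM[OF ff_right_ideal[OF M] M zero_closed[OF M M]])
  fix U f assume U: "U \<in> CM R" and f: "f \<in> Hom U M"
  interpret M: module R M by (rule CM_module[OF M])
  have "hom_diff U M f (compose (carrier U) (hom_zero M M) u) = f" if u: "u \<in> Hom U M" for u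
  proof -
    have "hom_diff U M f (hom_zero U M) = restrict f (carrier U)"
      unfolding hom_diff_def hom_zero_def
      by (rule restrict_ext) (use mod_homD(1)[OF f] M.minus_equality[of "\<zero>\<^bsub>M\<^esub>" "\<zero>\<^bsub>M\<^esub>"] in \<open>simp add: a_minus_def\<close>)
    then show ?thesis using compose_hom_zero_left[OF u, where L = M] extensional_restrict[OF mod_homD(4)[OF f]] by simp
  qed
  then show "f \<in> ff U M \<longleftrightarrow> (\<exists>u\<in>Hom U M. hom_diff U M f (compose (carrier U) (hom_zero M M) u) \<in> ff U M)"
    using zero_closed[OF U M] by auto
qed

lemma trivial_iff:
  assumes "additive_functor R F" "U \<in> CM R"
  shows "trivial_group (fun_ob F U) \<longleftrightarrow> (\<forall>x\<in>carrier (fun_ob F U). x = \<one>\<^bsub>fun_ob F U\<^esub>)"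
proof -
  interpret comm_group "fun_ob F U" by (rule additive_functorD(1)[OF assms])
  show ?thesis unfolding trivial_group_subset by auto
qed

text \<open>Each element of F(U) is the image of the generator under some transformation, and a
  transformation is determined by that image. This is how perpendicular categories come to test
  vanishing at a module.\<close>

lemma yoneda:
  assumes F: "additive_functor R F" and U: "U \<in> CM R"
  shows "(\<forall>\<eta>. nat_trans R (rep U) F \<eta> \<longrightarrow> (\<forall>V\<in>CM R. \<forall>x\<in>carrier (fun_ob (rep U) V). \<eta> V x = \<one>\<^bsub>fun_ob F V\<^esub>)) \<longleftrightarrow>
    trivial_group (fun_ob F U)"
proof
  note I = ff_right_ideal[OF U]
  let ?q = "quo_class U (\<lambda>V. ff V U) U (id_hom U)"
  note gen = quo_generated[OF I, folded rep_def] and A = quo_additive[OF I, folded rep_def]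
  assume *: "\<forall>\<eta>. nat_trans R (rep U) F \<eta> \<longrightarrow> (\<forall>V\<in>CM R. \<forall>x\<in>carrier (fun_ob (rep U) V). \<eta> V x = \<one>\<^bsub>fun_ob F V\<^esub>)"
  show "trivial_group (fun_ob F U)" unfolding trivial_iff[OF F U]
  proof
    fix x assume x: "x \<in> carrier (fun_ob F U)"
    obtain \<theta> where \<theta>: "nat_trans R (rep U) F \<theta>" "\<And>V f. \<lbrakk>V \<in> CM R; f \<in> Hom V U\<rbrakk> \<Longrightarrow> \<theta> V (act R (rep U) V U f ?q) = act R F V U f x"
    proof (rule nat_trans_exists[OF A F gen x])
      fix V f assume "V \<in> CM R" "f \<in> Hom V U" "act R (rep U) V U f ?q = \<one>\<^bsub>fun_ob (rep U) V\<^esub>"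
      then show "act R F V U f x = \<one>\<^bsub>fun_ob F V\<^esub>"
        using quo_one_iff[OF I, folded rep_def] act_ff[OF F _ U x] by simp
    qed blast
    have "\<theta> U (act R (rep U) U U (id_hom U) ?q) = x" using \<theta>(2)[OF U id_closed[OF U]] additive_functorD(3)[OF F U x] by simp
    moreover have "act R (rep U) U U (id_hom U) ?q \<in> carrier (fun_ob (rep U) U)"
      by (rule act_mem[OF A U U id_closed[OF U] generated_byD(2)[OF gen]])
    ultimately show "x = \<one>\<^bsub>fun_ob F U\<^esub>" using * \<theta>(1) U by metis
  qed
next
  note I = ff_right_ideal[OF U]
  let ?q = "quo_class U (\<lambda>V. ff V U) U (id_hom U)"
  note gen = quo_generated[OF I, folded rep_def] and A = quo_additive[OF I, folded rep_def]
  assume t: "trivial_group (fun_ob F U)"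
  show "\<forall>\<eta>. nat_trans R (rep U) F \<eta> \<longrightarrow> (\<forall>V\<in>CM R. \<forall>x\<in>carrier (fun_ob (rep U) V). \<eta> V x = \<one>\<^bsub>fun_ob F V\<^esub>)"
  proof (intro allI impI ballI)
    fix \<eta> V x assume \<eta>: "nat_trans R (rep U) F \<eta>" and V: "V \<in> CM R" and x: "x \<in> carrier (fun_ob (rep U) V)"
    obtain f where f: "f \<in> Hom V U" "x = act R (rep U) V U f ?q" using generated_byD(3)[OF gen V x] by blast
    have "\<eta> U ?q \<in> carrier (fun_ob F U)" using nat_trans_act(1)[OF \<eta> U] generated_byD(2)[OF gen] by (auto dest: hom_in_carrier)
    then have "\<eta> U ?q = \<one>\<^bsub>fun_ob F U\<^esub>" using t trivial_iff[OF F U] by blast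
    then show "\<eta> V x = \<one>\<^bsub>fun_ob F V\<^esub>"
      using nat_trans_act(2)[OF \<eta> V U f(1) generated_byD(2)[OF gen]] act_one[OF F V U f(1)] f(2) by simp
  qed
qed

lemma zero_hom_rep_iff: "F \<in> mod_CM R \<Longrightarrow> U \<in> CM R \<Longrightarrow> zero_hom R (rep U) F \<longleftrightarrow> trivial_group (fun_ob F U)"
  unfolding zero_hom_def by (rule yoneda[OF mod_CM_additive])

text \<open>Write x as f acting on the generator \<open>h\<close>. A map c kills x exactly when f c
  agrees with some \<gamma> u modulo maps through free modules, so the weak pullback of f and
  \<gamma> provides a weakly universal such c.\<close>

lemma weak_kernel:
  assumes F: "F \<in> mod_CM R" and W: "W \<in> CM R" and x: "x \<in> carrier (fun_ob F W)"
  obtains E k where "E \<in> CM R" "k \<in> Hom E W" "act R F E W k x = \<one>\<^bsub>fun_ob F E\<^esub>"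
    "\<And>U c. \<lbrakk>U \<in> CM R; c \<in> Hom U W; act R F U W c x = \<one>\<^bsub>fun_ob F U\<^esub>\<rbrakk> \<Longrightarrow>
      \<exists>c'\<in>Hom U E. compose (carrier U) k c' = c"
proof -
  note A = mod_CM_additive[OF F]
  obtain M N \<gamma> h where P: "presented_by R F M N \<gamma> h" by (rule mod_CM_presented[OF F])
  note M = presented_byD(2)[OF P] and N = presented_byD(3)[OF P] and \<gamma> = presented_byD(4)[OF P] and h = presented_byD(5)[OF P]
  obtain f where f: "f \<in> Hom W M" "x = act R F W M f h" using generated_byD(3)[OF presented_byD(1)[OF P] W x] by blast
  have act: "act R F U W c x = act R F U M (compose (carrier U) f c) h" if "U \<in> CM R" "c \<in> Hom U W" for U c
    using additive_functorD(4)[OF A that(1) W M that(2) f(1) h] f(2) by simp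
  obtain E a b where E: "E \<in> CM R" "a \<in> Hom E W" "b \<in> Hom E N"
    "hom_diff E M (compose (carrier E) f a) (compose (carrier E) \<gamma> b) \<in> ff E M"
    "\<And>U u v. \<lbrakk>U \<in> CM R; u \<in> Hom U W; v \<in> Hom U N;
       hom_diff U M (compose (carrier U) f u) (compose (carrier U) \<gamma> v) \<in> ff U M\<rbrakk> \<Longrightarrow>
       \<exists>w\<in>Hom U E. compose (carrier U) a w = u \<and> compose (carrier U) b w = v"
    using weak_pullback[OF W N M f(1) \<gamma>] by metis
  show ?thesis
  proof (rule that[OF E(1,2)])
    show "act R F E W a x = \<one>\<^bsub>fun_ob F E\<^esub>"
      unfolding act[OF E(1,2)] presented_byD(6)[OF P E(1) comp_closed[OF E(1,2) f(1)]] using E(3,4) by blast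
    fix U c assume U: "U \<in> CM R" and c: "c \<in> Hom U W" "act R F U W c x = \<one>\<^bsub>fun_ob F U\<^esub>"
    then obtain u where "u \<in> Hom U N" "hom_diff U M (compose (carrier U) f c) (compose (carrier U) \<gamma> u) \<in> ff U M"
      using presented_byD(6)[OF P U comp_closed[OF U c(1) f(1)]] act[OF U c(1)] by auto
    then show "\<exists>c'\<in>Hom U E. compose (carrier U) a c' = c" using E(5)[OF U c(1)] by blast
  qed
qed

text \<open>The right ideal is the preimage of a subfunctor \<open>S\<close> of \<open>F\<close>
  under the map that \<open>h\<close> defines on the functor represented by
  \<open>M\<close>.\<close>

lemma right_idealI:
  assumes F: "additive_functor R F" and M: "M \<in> CM R" and h: "h \<in> carrier (fun_ob F M)"
    and S: "\<And>U. U \<in> CM R \<Longrightarrow> subgroup (S U) (fun_ob F U)"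
    and S_act: "\<And>U V c x. \<lbrakk>U \<in> CM R; V \<in> CM R; c \<in> Hom U V; x \<in> S V\<rbrakk> \<Longrightarrow> act R F U V c x \<in> S U"
  shows "right_ideal M (\<lambda>U. {f \<in> Hom U M. act R F U M f h \<in> S U})"
  unfolding right_ideal_def
proof (intro conjI ballI M)
  fix U assume U: "U \<in> CM R"
  interpret S: subgroup "S U" "fun_ob F U" by (rule S[OF U])
  interpret FU: comm_group "fun_ob F U" by (rule additive_functorD(1)[OF F U])
  let ?I = "\<lambda>U. {f \<in> Hom U M. act R F U M f h \<in> S U}"
  show "subgroup (?I U) (hom_group R U M)"
  proof (rule subgroup_hom_groupI[OF CM_module[OF U] CM_module[OF M]])
    show z: "hom_zero U M \<in> ?I U" using zero_closed[OF U M] act_zero[OF F U M h] by simp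
    fix f assume f: "f \<in> ?I U"
    then have f1: "f \<in> Hom U M" "act R F U M f h \<in> S U" by auto
    have d: "hom_diff U M (hom_zero U M) f \<in> Hom U M" by (rule diff_closed[OF U M zero_closed[OF U M] f1(1)])
    have "act R F U M (hom_diff U M (hom_zero U M) f) h \<otimes>\<^bsub>fun_ob F U\<^esub> act R F U M f h = \<one>\<^bsub>fun_ob F U\<^esub>"
      using additive_functorD(5)[OF F U M d f1(1) h] plus_diff[OF U M zero_closed[OF U M] f1(1)] act_zero[OF F U M h] by simp
    then have "act R F U M (hom_diff U M (hom_zero U M) f) h = inv\<^bsub>fun_ob F U\<^esub> act R F U M f h"
      using act_mem[OF F U M d h] act_mem[OF F U M f1(1) h] by (metis FU.inv_equality)
    then show "hom_diff U M (hom_zero U M) f \<in> ?I U" using d f1(2) by simp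
    fix g assume "g \<in> ?I U"
    then show "hom_plus U M f g \<in> ?I U"
      using f1 plus_closed[OF U M f1(1)] additive_functorD(5)[OF F U M f1(1) _ h] by simp
  qed auto
  show "ff U M \<subseteq> ?I U" using free_factoring_hom[OF CM_module[OF U]] act_ff[OF F U M h] by auto
  fix V f g assume V: "V \<in> CM R" and f: "f \<in> ?I V" and g: "g \<in> Hom U V"
  then have f1: "f \<in> Hom V M" "act R F V M f h \<in> S V" by auto
  show "compose (carrier U) f g \<in> ?I U"
    using comp_closed[OF U g f1(1)] additive_functorD(4)[OF F U V M g f1(1) h] S_act[OF U V g f1(2)] by simp
qed

lemma subgroup_cyclic:
  assumes F: "additive_functor R F" and W: "W \<in> CM R" and w: "w \<in> carrier (fun_ob F W)" and U: "U \<in> CM R"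
  shows "subgroup {act R F U W c w | c. c \<in> Hom U W} (fun_ob F U)"
proof -
  interpret FU: comm_group "fun_ob F U" by (rule additive_functorD(1)[OF F U])
  show ?thesis
  proof (rule FU.subgroupI)
    show "{act R F U W c w |c. c \<in> Hom U W} \<subseteq> carrier (fun_ob F U)" using act_mem[OF F U W _ w] by auto
    show "{act R F U W c w |c. c \<in> Hom U W} \<noteq> {}" using zero_closed[OF U W] by blast
    fix x assume "x \<in> {act R F U W c w |c. c \<in> Hom U W}"
    then obtain c where c: "c \<in> Hom U W" "x = act R F U W c w" by auto
    have d: "hom_diff U W (hom_zero U W) c \<in> Hom U W" by (rule diff_closed[OF U W zero_closed[OF U W] c(1)])
    have "act R F U W (hom_diff U W (hom_zero U W) c) w \<otimes>\<^bsub>fun_ob F U\<^esub> x = \<one>\<^bsub>fun_ob F U\<^esub>"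
      using additive_functorD(5)[OF F U W d c(1) w] plus_diff[OF U W zero_closed[OF U W] c(1)] act_zero[OF F U W w] c(2) by simp
    then have "inv\<^bsub>fun_ob F U\<^esub> x = act R F U W (hom_diff U W (hom_zero U W) c) w"
      using act_mem[OF F U W d w] act_mem[OF F U W c(1) w] c(2) by (metis FU.inv_equality)
    then show "inv\<^bsub>fun_ob F U\<^esub> x \<in> {act R F U W c w |c. c \<in> Hom U W}" using d by blast
    fix y assume "y \<in> {act R F U W c w |c. c \<in> Hom U W}"
    then obtain c' where c': "c' \<in> Hom U W" "y = act R F U W c' w" by auto
    have "x \<otimes>\<^bsub>fun_ob F U\<^esub> y = act R F U W (hom_plus U W c c') w"
      using additive_functorD(5)[OF F U W c(1) c'(1) w] c(2) c'(2) by simp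
    then show "x \<otimes>\<^bsub>fun_ob F U\<^esub> y \<in> {act R F U W c w |c. c \<in> Hom U W}" using plus_closed[OF U W c(1) c'(1)] by blast
  qed
qed

text \<open>Here the weak kernels give the finite presentation; the quotient below does not need them.\<close>

lemma cyclic_subfunctor:
  assumes F: "F \<in> mod_CM R" and W: "W \<in> CM R" and w: "w \<in> carrier (fun_ob F W)"
  obtains C \<theta> where "C \<in> mod_CM R" "nat_trans R C F \<theta>"
    "\<And>U. U \<in> CM R \<Longrightarrow> inj_on (\<theta> U) (carrier (fun_ob C U))"
    "\<And>U. U \<in> CM R \<Longrightarrow> \<theta> U ` carrier (fun_ob C U) = {act R F U W c w | c. c \<in> Hom U W}"
proof -
  note A = mod_CM_additive[OF F]
  obtain E k where E: "E \<in> CM R" "k \<in> Hom E W" "act R F E W k w = \<one>\<^bsub>fun_ob F E\<^esub>"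
    "\<And>U c. \<lbrakk>U \<in> CM R; c \<in> Hom U W; act R F U W c w = \<one>\<^bsub>fun_ob F U\<^esub>\<rbrakk> \<Longrightarrow>
      \<exists>c'\<in>Hom U E. compose (carrier U) k c' = c"
    using weak_kernel[OF F W w] by metis
  \<comment> \<open>The annihilator of w, written as the preimage of the zero subfunctor.\<close>
  let ?I = "\<lambda>U. {f \<in> Hom U W. act R F U W f w \<in> {\<one>\<^bsub>fun_ob F U\<^esub>}}"
  have I: "right_ideal W ?I"
  proof (rule right_idealI[OF A W w])
    fix U assume U: "U \<in> CM R"
    interpret FU: comm_group "fun_ob F U" by (rule additive_functorD(1)[OF A U])
    show "subgroup {\<one>\<^bsub>fun_ob F U\<^esub>} (fun_ob F U)" by (rule FU.triv_subgroup)
    show "act R F U V c x \<in> {\<one>\<^bsub>fun_ob F U\<^esub>}" if "V \<in> CM R" "c \<in> Hom U V" "x \<in> {\<one>\<^bsub>fun_ob F V\<^esub>}" for V c x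
      using act_one[OF A U that(1,2)] that(3) by simp
  qed
  let ?C = "quo W ?I" and ?q = "quo_class W ?I W (id_hom W)"
  note gen = quo_generated[OF I] and QA = quo_additive[OF I]
  have C: "?C \<in> mod_CM R"
  proof (rule quo_in_mod_CM[OF I E(1,2)])
    fix U f assume U: "U \<in> CM R" and f: "f \<in> Hom U W"
    show "f \<in> ?I U \<longleftrightarrow> (\<exists>u\<in>Hom U E. hom_diff U W f (compose (carrier U) k u) \<in> ff U W)"
    proof
      assume "f \<in> ?I U"
      then obtain c' where "c' \<in> Hom U E" "compose (carrier U) k c' = f" using E(4)[OF U f] by auto
      then show "\<exists>u\<in>Hom U E. hom_diff U W f (compose (carrier U) k u) \<in> ff U W" using diff_self_ff[OF U W f] by blast
    next
      assume "\<exists>u\<in>Hom U E. hom_diff U W f (compose (carrier U) k u) \<in> ff U W"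
      then obtain u where u: "u \<in> Hom U E" "hom_diff U W f (compose (carrier U) k u) \<in> ff U W" by blast
      have "act R F U W f w = act R F U W (compose (carrier U) k u) w"
        by (rule act_ff_cong[OF A U W w f comp_closed[OF U u(1) E(2)] u(2)])
      also have "\<dots> = act R F U E u (act R F E W k w)" by (rule additive_functorD(4)[OF A U E(1) W u(1) E(2) w])
      also have "\<dots> = \<one>\<^bsub>fun_ob F U\<^esub>" unfolding E(3) by (rule act_one[OF A U E(1) u(1)])
      finally show "f \<in> ?I U" using f by simp
    qed
  qed
  obtain \<theta> where \<theta>: "nat_trans R ?C F \<theta>" "\<And>V f. \<lbrakk>V \<in> CM R; f \<in> Hom V W\<rbrakk> \<Longrightarrow> \<theta> V (act R ?C V W f ?q) = act R F V W f w"
  proof (rule nat_trans_exists[OF QA A gen w])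
    fix V f assume "V \<in> CM R" "f \<in> Hom V W" "act R ?C V W f ?q = \<one>\<^bsub>fun_ob ?C V\<^esub>"
    then show "act R F V W f w = \<one>\<^bsub>fun_ob F V\<^esub>" using quo_one_iff[OF I] by simp
  qed blast
  show ?thesis
  proof (rule that[OF C \<theta>(1)])
    fix U assume U: "U \<in> CM R"
    show "inj_on (\<theta> U) (carrier (fun_ob ?C U))"
    proof (rule inj_onI)
      fix x y assume xy: "x \<in> carrier (fun_ob ?C U)" "y \<in> carrier (fun_ob ?C U)" "\<theta> U x = \<theta> U y"
      obtain f where f: "f \<in> Hom U W" "x = act R ?C U W f ?q" using generated_byD(3)[OF gen U xy(1)] by blast
      obtain g where g: "g \<in> Hom U W" "y = act R ?C U W g ?q" using generated_byD(3)[OF gen U xy(2)] by blast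
      have "act R F U W f w = act R F U W g w" using xy(3) \<theta>(2)[OF U f(1)] \<theta>(2)[OF U g(1)] f(2) g(2) by simp
      then have "hom_diff U W f g \<in> ?I U" using act_eq_iff[OF A U W w f(1) g(1)] diff_closed[OF U W f(1) g(1)] by simp
      then show "x = y" unfolding f(2) g(2) act_eq_iff[OF QA U W generated_byD(2)[OF gen] f(1) g(1)]
        using quo_one_iff[OF I U diff_closed[OF U W f(1) g(1)]] by simp
    qed
    show "\<theta> U ` carrier (fun_ob ?C U) = {act R F U W c w | c. c \<in> Hom U W}"
    proof (intro equalityI subsetI)
      fix y assume "y \<in> \<theta> U ` carrier (fun_ob ?C U)"
      then obtain x where x: "x \<in> carrier (fun_ob ?C U)" "y = \<theta> U x" by auto
      obtain f where "f \<in> Hom U W" "x = act R ?C U W f ?q" using generated_byD(3)[OF gen U x(1)] by blast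
      then show "y \<in> {act R F U W c w | c. c \<in> Hom U W}" using \<theta>(2)[OF U] x(2) by auto
    next
      fix y assume "y \<in> {act R F U W c w | c. c \<in> Hom U W}"
      then obtain c where c: "c \<in> Hom U W" "y = act R F U W c w" by auto
      have "act R ?C U W c ?q \<in> carrier (fun_ob ?C U)" by (rule act_mem[OF QA U W c(1) generated_byD(2)[OF gen]])
      then show "y \<in> \<theta> U ` carrier (fun_ob ?C U)" unfolding c(2) \<theta>(2)[OF U c(1), symmetric] by (rule imageI)
    qed
  qed
qed

text \<open>If w = p h, then dividing by w adds the single relation p to the relations \<gamma> of
  \<open>F\<close>; the quotient is therefore presented by the map (\<gamma>, p) from the direct sum
  of \<open>N\<close> and \<open>W\<close>.\<close>

lemma cyclic_quotient:
  assumes F: "F \<in> mod_CM R" and W: "W \<in> CM R" and w: "w \<in> carrier (fun_ob F W)"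
  obtains Q \<theta> where "Q \<in> mod_CM R" "nat_trans R F Q \<theta>"
    "\<And>U. U \<in> CM R \<Longrightarrow> \<theta> U ` carrier (fun_ob F U) = carrier (fun_ob Q U)"
    "\<And>U x. \<lbrakk>U \<in> CM R; x \<in> carrier (fun_ob F U)\<rbrakk> \<Longrightarrow>
      \<theta> U x = \<one>\<^bsub>fun_ob Q U\<^esub> \<longleftrightarrow> (\<exists>c\<in>Hom U W. x = act R F U W c w)"
proof -
  note A = mod_CM_additive[OF F]
  obtain M N \<gamma> h where P: "presented_by R F M N \<gamma> h" by (rule mod_CM_presented[OF F])
  note Fgen = presented_byD(1)[OF P] and M = presented_byD(2)[OF P] and N = presented_byD(3)[OF P]
    and \<gamma> = presented_byD(4)[OF P] and h = presented_byD(5)[OF P]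
  obtain p where p: "p \<in> Hom W M" "w = act R F W M p h" using generated_byD(3)[OF Fgen W w] by blast
  have actw: "act R F U W c w = act R F U M (compose (carrier U) p c) h" if "U \<in> CM R" "c \<in> Hom U W" for U c
    using additive_functorD(4)[OF A that(1) W M that(2) p(1) h] p(2) by simp
  let ?I = "\<lambda>U. {f \<in> Hom U M. act R F U M f h \<in> {act R F U W c w | c. c \<in> Hom U W}}"
  have I: "right_ideal M ?I"
  proof (rule right_idealI[OF A M h subgroup_cyclic[OF A W w]])
    fix U V c x assume U: "U \<in> CM R" and V: "V \<in> CM R" and c: "c \<in> Hom U V" and x: "x \<in> {act R F V W c w | c. c \<in> Hom V W}"
    obtain c' where c': "c' \<in> Hom V W" "x = act R F V W c' w" using x by auto
    have "act R F U V c x = act R F U W (compose (carrier U) c' c) w"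
      using additive_functorD(4)[OF A U V W c c'(1) w] c'(2) by simp
    then show "act R F U V c x \<in> {act R F U W c w | c. c \<in> Hom U W}" using comp_closed[OF U c c'(1)] by blast
  qed
  let ?Q = "quo M ?I" and ?q = "quo_class M ?I M (id_hom M)"
  note gen = quo_generated[OF I] and QA = quo_additive[OF I]
  let ?N = "dsum N W"
  let ?g = "\<lambda>z\<in>carrier ?N. \<gamma> (fst_seq z) \<oplus>\<^bsub>M\<^esub> p (snd_seq z)"
  interpret M: module R M by (rule CM_module[OF M])
  have g: "?g \<in> Hom ?N M" by (rule hom_copair[OF CM_module[OF N] CM_module[OF W] CM_module[OF M] \<gamma> p(1)])
  have Q: "?Q \<in> mod_CM R"
  proof (rule quo_in_mod_CM[OF I CM_dsum[OF N W] g])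
    fix U f assume U: "U \<in> CM R" and f: "f \<in> Hom U M"
    have gu: "compose (carrier U) ?g (\<lambda>x\<in>carrier U. pair_seq (u x) (c x)) =
        hom_plus U M (compose (carrier U) \<gamma> u) (compose (carrier U) p c)"
      if "u \<in> Hom U N" "c \<in> Hom U W" for u c
      unfolding compose_def hom_plus_def
      by (rule restrict_ext) (simp add: dsum_simps(1) mod_homD(1)[OF that(1)] mod_homD(1)[OF that(2)])
    show "f \<in> ?I U \<longleftrightarrow> (\<exists>u\<in>Hom U ?N. hom_diff U M f (compose (carrier U) ?g u) \<in> ff U M)"
    proof
      assume "f \<in> ?I U"
      then obtain c where c: "c \<in> Hom U W" "act R F U M f h = act R F U W c w" by auto
      note pc = comp_closed[OF U c(1) p(1)]
      have "act R F U M (hom_diff U M f (compose (carrier U) p c)) h = \<one>\<^bsub>fun_ob F U\<^esub>"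
        using act_eq_iff[OF A U M h f pc] c(2) actw[OF U c(1)] by simp
      then obtain u where u: "u \<in> Hom U N" "hom_diff U M (hom_diff U M f (compose (carrier U) p c)) (compose (carrier U) \<gamma> u) \<in> ff U M"
        using presented_byD(6)[OF P U diff_closed[OF U M f pc]] by blast
      note gc = comp_closed[OF U u(1) \<gamma>]
      have "hom_diff U M f (hom_plus U M (compose (carrier U) \<gamma> u) (compose (carrier U) p c)) =
          hom_diff U M (hom_diff U M f (compose (carrier U) p c)) (compose (carrier U) \<gamma> u)"
        unfolding hom_diff_def hom_plus_def
        by (rule restrict_ext)
          (use mod_homD(1)[OF f] mod_homD(1)[OF gc] mod_homD(1)[OF pc] in \<open>simp add: a_minus_def M.minus_add M.a_ac\<close>)
      then have "hom_diff U M f (compose (carrier U) ?g (\<lambda>x\<in>carrier U. pair_seq (u x) (c x))) \<in> ff U M"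
        unfolding gu[OF u(1) c(1)] using u(2) by simp
      then show "\<exists>u\<in>Hom U ?N. hom_diff U M f (compose (carrier U) ?g u) \<in> ff U M"
        using hom_pair[OF CM_module[OF U] u(1) c(1)] by blast
    next
      assume "\<exists>u\<in>Hom U ?N. hom_diff U M f (compose (carrier U) ?g u) \<in> ff U M"
      then obtain v where v: "v \<in> Hom U ?N" "hom_diff U M f (compose (carrier U) ?g v) \<in> ff U M" by blast
      note D = dsum_homs[OF CM_module[OF N] CM_module[OF W]]
      define u where "u = compose (carrier U) (\<lambda>z\<in>carrier ?N. fst_seq z) v"
      define c where "c = compose (carrier U) (\<lambda>z\<in>carrier ?N. snd_seq z) v"
      have u: "u \<in> Hom U N" unfolding u_def by (rule comp_closed[OF U v(1) D(1)])
      have c: "c \<in> Hom U W" unfolding c_def by (rule comp_closed[OF U v(1) D(2)])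
      have vg: "compose (carrier U) ?g v = hom_plus U M (compose (carrier U) \<gamma> u) (compose (carrier U) p c)"
        unfolding hom_plus_def compose_def
        by (rule restrict_ext) (simp add: mod_homD(1)[OF v(1)] u_def c_def compose_def)
      note gu' = comp_closed[OF U u \<gamma>] and pc = comp_closed[OF U c p(1)]
      have "act R F U M f h = act R F U M (compose (carrier U) ?g v) h"
        by (rule act_ff_cong[OF A U M h f comp_closed[OF U v(1) g] v(2)])
      also have "\<dots> = act R F U M (compose (carrier U) \<gamma> u) h \<otimes>\<^bsub>fun_ob F U\<^esub> act R F U M (compose (carrier U) p c) h"
        unfolding vg by (rule additive_functorD(5)[OF A U M gu' pc h])
      also have "act R F U M (compose (carrier U) \<gamma> u) h = \<one>\<^bsub>fun_ob F U\<^esub>"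
        using presented_byD(6)[OF P U gu'] diff_self_ff[OF U M gu'] u by blast
      also have "\<one>\<^bsub>fun_ob F U\<^esub> \<otimes>\<^bsub>fun_ob F U\<^esub> act R F U M (compose (carrier U) p c) h = act R F U W c w"
      proof -
        interpret FU: comm_group "fun_ob F U" by (rule additive_functorD(1)[OF A U])
        show ?thesis using act_mem[OF A U M pc h] actw[OF U c] by simp
      qed
      finally show "f \<in> ?I U" using f c by blast
    qed
  qed
  obtain \<theta> where \<theta>: "nat_trans R F ?Q \<theta>" "\<And>V f. \<lbrakk>V \<in> CM R; f \<in> Hom V M\<rbrakk> \<Longrightarrow> \<theta> V (act R F V M f h) = act R ?Q V M f ?q"
  proof (rule nat_trans_exists[OF A QA Fgen generated_byD(2)[OF gen]])
    fix V f assume V: "V \<in> CM R" and f: "f \<in> Hom V M" "act R F V M f h = \<one>\<^bsub>fun_ob F V\<^esub>"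
    then have "f \<in> ?I V" using zero_closed[OF V W] act_zero[OF A V W w] by force
    then show "act R ?Q V M f ?q = \<one>\<^bsub>fun_ob ?Q V\<^esub>" using quo_one_iff[OF I V f(1)] by simp
  qed blast
  show ?thesis
  proof (rule that[OF Q \<theta>(1)])
    fix U assume U: "U \<in> CM R"
    show "\<theta> U ` carrier (fun_ob F U) = carrier (fun_ob ?Q U)"
    proof (intro equalityI subsetI)
      fix y assume "y \<in> \<theta> U ` carrier (fun_ob F U)"
      then show "y \<in> carrier (fun_ob ?Q U)" using nat_trans_act(1)[OF \<theta>(1) U] by (auto dest: hom_in_carrier)
    next
      fix y assume "y \<in> carrier (fun_ob ?Q U)"
      then obtain f where f: "f \<in> Hom U M" "y = act R ?Q U M f ?q" using generated_byD(3)[OF gen U] by blast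
      show "y \<in> \<theta> U ` carrier (fun_ob F U)"
        unfolding f(2) \<theta>(2)[OF U f(1), symmetric] by (rule imageI[OF act_mem[OF A U M f(1) h]])
    qed
    fix x assume "x \<in> carrier (fun_ob F U)"
    then obtain f where f: "f \<in> Hom U M" "x = act R F U M f h" using generated_byD(3)[OF Fgen U] by blast
    have "\<theta> U x = \<one>\<^bsub>fun_ob ?Q U\<^esub> \<longleftrightarrow> f \<in> ?I U" unfolding f(2) \<theta>(2)[OF U f(1)] by (rule quo_one_iff[OF I U f(1)])
    then show "\<theta> U x = \<one>\<^bsub>fun_ob ?Q U\<^esub> \<longleftrightarrow> (\<exists>c\<in>Hom U W. x = act R F U W c w)" using f by auto
  qed
qed

text \<open>Closure under quotients is available only along short exact sequences inside
  \<open>mod_CM R\<close>; hence the cyclic subfunctor, too, has to be finitely presented.\<close>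

lemma serre_cyclic_quotient:
  assumes FF: "serre_subcategory R FF" and F: "F \<in> FF" and W: "W \<in> CM R" and w: "w \<in> carrier (fun_ob F W)"
  obtains Q \<theta> where "Q \<in> FF" "nat_trans R F Q \<theta>"
    "\<And>U x. \<lbrakk>U \<in> CM R; x \<in> carrier (fun_ob F U)\<rbrakk> \<Longrightarrow>
      \<theta> U x = \<one>\<^bsub>fun_ob Q U\<^esub> \<longleftrightarrow> (\<exists>c\<in>Hom U W. x = act R F U W c w)"
proof -
  have Fm: "F \<in> mod_CM R" using FF F by (auto simp: serre_subcategory_def iso_closed_subcategory_def)
  obtain C \<psi> where C: "C \<in> mod_CM R" "nat_trans R C F \<psi>"
    "\<And>U. U \<in> CM R \<Longrightarrow> inj_on (\<psi> U) (carrier (fun_ob C U))"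
    "\<And>U. U \<in> CM R \<Longrightarrow> \<psi> U ` carrier (fun_ob C U) = {act R F U W c w | c. c \<in> Hom U W}"
    by (rule cyclic_subfunctor[OF Fm W w]) (rule that, assumption+)
  obtain Q \<theta> where Q: "Q \<in> mod_CM R" "nat_trans R F Q \<theta>"
    "\<And>U. U \<in> CM R \<Longrightarrow> \<theta> U ` carrier (fun_ob F U) = carrier (fun_ob Q U)"
    "\<And>U x. \<lbrakk>U \<in> CM R; x \<in> carrier (fun_ob F U)\<rbrakk> \<Longrightarrow>
      \<theta> U x = \<one>\<^bsub>fun_ob Q U\<^esub> \<longleftrightarrow> (\<exists>c\<in>Hom U W. x = act R F U W c w)"
    by (rule cyclic_quotient[OF Fm W w]) (rule that, assumption+)
  have "\<psi> U ` carrier (fun_ob C U) = kernel (fun_ob F U) (fun_ob Q U) (\<theta> U)" if U: "U \<in> CM R" for U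
    unfolding C(4)[OF U] kernel_def using Q(4)[OF U] act_mem[OF mod_CM_additive[OF Fm] U W _ w] by auto
  then have "short_exact R C F Q" unfolding short_exact_def using C(2,3) Q(2,3) by blast
  then have "Q \<in> FF" using FF F C(1) Fm Q(1) unfolding serre_subcategory_def by blast
  then show ?thesis using that Q(2,4) by blast
qed

end

section \<open>Idempotent endomorphisms and indecomposable summands\<close>

definition idem_endo :: "'a ring \<Rightarrow> ('a, 'm) module \<Rightarrow> ('m \<Rightarrow> 'm) \<Rightarrow> bool" where
  "idem_endo R M e \<longleftrightarrow> e \<in> mod_hom R M M \<and> (\<forall>x\<in>carrier M. e (e x) = e x)"

definition orth_endo :: "('a, 'm) module \<Rightarrow> ('m \<Rightarrow> 'm) \<Rightarrow> ('m \<Rightarrow> 'm) \<Rightarrow> bool" where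
  "orth_endo M e f \<longleftrightarrow> (\<forall>x\<in>carrier M. e (f x) = \<zero>\<^bsub>M\<^esub> \<and> f (e x) = \<zero>\<^bsub>M\<^esub>)"

lemma orth_plus:
  assumes M: "module R M" and e: "idem_endo R M e" and f: "idem_endo R M f" and o: "orth_endo M e f"
  shows "idem_endo R M (hom_plus M M e f)"
    and "x \<in> carrier M \<Longrightarrow> hom_plus M M e f (e x) = e x"
    and "x \<in> carrier M \<Longrightarrow> hom_plus M M e f (f x) = f x"
    and "x \<in> carrier M \<Longrightarrow> e (hom_plus M M e f x) = e x"
proof -
  interpret M: module R M by fact
  have eh: "e \<in> mod_hom R M M" and fh: "f \<in> mod_hom R M M" using e f by (auto simp: idem_endo_def)
  note ec = mod_homD(1)[OF eh] and fc = mod_homD(1)[OF fh]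
  have ef: "hom_plus M M e f \<in> mod_hom R M M" by (rule hom_plus_closed[OF M M eh fh])
  show 1: "hom_plus M M e f (e x) = e x" if "x \<in> carrier M" for x
    using that e o ec by (simp add: hom_plus_def idem_endo_def orth_endo_def)
  show 2: "hom_plus M M e f (f x) = f x" if "x \<in> carrier M" for x
    using that f o fc by (simp add: hom_plus_def idem_endo_def orth_endo_def)
  show "e (hom_plus M M e f x) = e x" if "x \<in> carrier M" for x
    using that e o ec fc mod_homD(2)[OF eh ec[OF that] fc[OF that]] by (simp add: hom_plus_def idem_endo_def orth_endo_def)
  have "hom_plus M M e f (hom_plus M M e f x) = hom_plus M M e f x" if x: "x \<in> carrier M" for x
  proof -
    have "hom_plus M M e f (hom_plus M M e f x) = hom_plus M M e f (e x \<oplus>\<^bsub>M\<^esub> f x)"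
      using x by (simp add: hom_plus_def[of M M e f])
    also have "\<dots> = e x \<oplus>\<^bsub>M\<^esub> f x" using mod_homD(2)[OF ef ec[OF x] fc[OF x]] 1[OF x] 2[OF x] by simp
    finally show ?thesis using x by (simp add: hom_plus_def)
  qed
  then show "idem_endo R M (hom_plus M M e f)" using ef by (simp add: idem_endo_def)
qed

text \<open>Images of idempotents satisfy the ascending chain condition. For f orthogonal to e the
  image of e + f contains the images of both. Were it equal to the image of e, then f x = e z for
  some z and f x = f (f x) = f (e z) = 0.\<close>

lemma maximal_idempotent:
  assumes M: "module R M" "noeth R M" and Q: "Q e0" "\<And>e. Q e \<Longrightarrow> idem_endo R M e"
  obtains e where "Q e"
    "\<And>f x. \<lbrakk>idem_endo R M f; orth_endo M e f; x \<in> carrier M; f x \<noteq> \<zero>\<^bsub>M\<^esub>\<rbrakk> \<Longrightarrow> \<not> Q (hom_plus M M e f)"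
proof -
  let ?Z = "(\<lambda>e. e ` carrier M) ` Collect Q"
  have "submodule W R M" if "W \<in> ?Z" for W
    using that Q(2) submodule_image[OF M(1) M(1) _ submodule_carrier[OF M(1)]] by (auto simp: idem_endo_def)
  then obtain W where W: "W \<in> ?Z" "\<And>V. V \<in> ?Z \<Longrightarrow> W \<subseteq> V \<Longrightarrow> V = W"
    using noeth_maximal[OF M, of ?Z] Q(1) by (metis (no_types, lifting) empty_iff image_eqI mem_Collect_eq)
  then obtain e where e: "Q e" "W = e ` carrier M" by auto
  have "\<not> Q (hom_plus M M e f)"
    if f: "idem_endo R M f" "orth_endo M e f" "x \<in> carrier M" "f x \<noteq> \<zero>\<^bsub>M\<^esub>" for f x
  proof
    assume q: "Q (hom_plus M M e f)"
    note P = orth_plus[OF M(1) Q(2)[OF e(1)] f(1,2)]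
    have ec: "e y \<in> carrier M" if "y \<in> carrier M" for y
      using Q(2)[OF e(1)] mod_homD(1) that by (auto simp: idem_endo_def)
    have fc: "f y \<in> carrier M" if "y \<in> carrier M" for y
      using f(1) mod_homD(1) that by (auto simp: idem_endo_def)
    have "W \<subseteq> hom_plus M M e f ` carrier M"
      unfolding e(2) using P(2) ec by (metis image_eqI image_subsetI)
    then have "hom_plus M M e f ` carrier M = W" using W(2) q by blast
    then have "f x \<in> e ` carrier M" using P(3)[OF f(3)] fc[OF f(3)] e(2) by (metis image_eqI)
    then obtain z where z: "z \<in> carrier M" "f x = e z" by auto
    have "f x = f (f x)" using f(1,3) by (simp add: idem_endo_def)
    also have "\<dots> = \<zero>\<^bsub>M\<^esub>" unfolding z(2) using f(2) z(1) by (simp add: orth_endo_def)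
    finally show False using f(4) by simp
  qed
  then show ?thesis using that e(1) by blast
qed

lemma direct_sum_projection:
  assumes M: "module R M" and A: "submodule A R M" and B: "submodule B R M"
    and AB: "A <+>\<^bsub>M\<^esub> B = carrier M" "A \<inter> B = {\<zero>\<^bsub>M\<^esub>}"
  obtains p where "p \<in> mod_hom R M M" "\<And>x. x \<in> A \<Longrightarrow> p x = x" "\<And>x. x \<in> B \<Longrightarrow> p x = \<zero>\<^bsub>M\<^esub>"
    "\<And>x. x \<in> carrier M \<Longrightarrow> p x \<in> A"
proof -
  interpret M: module R M by fact
  note DA = submoduleD[OF M A] and DB = submoduleD[OF M B]
  have Ac: "a \<in> carrier M" if "a \<in> A" for a using that DA(1) by auto
  have Bc: "b \<in> carrier M" if "b \<in> B" for b using that DB(1) by auto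
  have ex: "\<exists>a b. a \<in> A \<and> b \<in> B \<and> x = a \<oplus>\<^bsub>M\<^esub> b" if "x \<in> carrier M" for x
  proof -
    have "x \<in> A <+>\<^bsub>M\<^esub> B" using that AB(1) by simp
    then show ?thesis unfolding set_add_def set_mult_def by auto
  qed
  have uniq: "a = a'" if "a \<in> A" "b \<in> B" "a' \<in> A" "b' \<in> B" "a \<oplus>\<^bsub>M\<^esub> b = a' \<oplus>\<^bsub>M\<^esub> b'" for a b a' b'
  proof -
    note c = Ac[OF that(1)] Bc[OF that(2)] Ac[OF that(3)] Bc[OF that(4)]
    have d: "b' \<ominus>\<^bsub>M\<^esub> b \<in> carrier M" using c by simp
    have "a = (a \<oplus>\<^bsub>M\<^esub> b) \<ominus>\<^bsub>M\<^esub> b" using c by (simp add: a_minus_def M.a_assoc M.r_neg)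
    also have "\<dots> = a' \<oplus>\<^bsub>M\<^esub> (b' \<ominus>\<^bsub>M\<^esub> b)" unfolding that(5) using c by (simp add: a_minus_def M.a_assoc)
    also have "\<dots> = (b' \<ominus>\<^bsub>M\<^esub> b) \<oplus>\<^bsub>M\<^esub> a'" by (rule M.a_comm[OF c(3) d])
    finally have "a \<ominus>\<^bsub>M\<^esub> a' = ((b' \<ominus>\<^bsub>M\<^esub> b) \<oplus>\<^bsub>M\<^esub> a') \<ominus>\<^bsub>M\<^esub> a'" by simp
    also have "\<dots> = b' \<ominus>\<^bsub>M\<^esub> b" using d c(3) by (simp add: a_minus_def[of M _ a'] M.a_assoc M.r_neg)
    finally have "a \<ominus>\<^bsub>M\<^esub> a' \<in> A \<inter> B" using DA(5)[OF that(1,3)] DB(5)[OF that(4,2)] by simp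
    then have "a \<ominus>\<^bsub>M\<^esub> a' = \<zero>\<^bsub>M\<^esub>" using AB(2) by auto
    moreover have "a = (a \<ominus>\<^bsub>M\<^esub> a') \<oplus>\<^bsub>M\<^esub> a'" using c by (simp add: a_minus_def M.a_assoc M.l_neg)
    ultimately show "a = a'" using c by simp
  qed
  define p where "p x = (THE a. a \<in> A \<and> (\<exists>b\<in>B. x = a \<oplus>\<^bsub>M\<^esub> b))" for x
  have p: "p (a \<oplus>\<^bsub>M\<^esub> b) = a" if "a \<in> A" "b \<in> B" for a b
    unfolding p_def by (rule the_equality) (use that uniq in blast)+
  have ph: "restrict p (carrier M) \<in> mod_hom R M M"
  proof (rule mod_homI[OF M])
    fix x assume "x \<in> carrier M"
    then obtain a b where ab: "a \<in> A" "b \<in> B" "x = a \<oplus>\<^bsub>M\<^esub> b" using ex by blast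
    show "p x \<in> carrier M" unfolding ab(3) p[OF ab(1,2)] by (rule Ac[OF ab(1)])
    {
      fix r assume r: "r \<in> carrier R"
      have "r \<odot>\<^bsub>M\<^esub> x = r \<odot>\<^bsub>M\<^esub> a \<oplus>\<^bsub>M\<^esub> r \<odot>\<^bsub>M\<^esub> b"
        unfolding ab(3) by (rule M.smult_r_distr[OF r Ac[OF ab(1)] Bc[OF ab(2)]])
      then show "p (r \<odot>\<^bsub>M\<^esub> x) = r \<odot>\<^bsub>M\<^esub> p x" using p[OF DA(6)[OF r ab(1)] DB(6)[OF r ab(2)]] p[OF ab(1,2)] ab(3) by simp
    }
    fix y assume "y \<in> carrier M"
    then obtain a' b' where ab': "a' \<in> A" "b' \<in> B" "y = a' \<oplus>\<^bsub>M\<^esub> b'" using ex by blast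
    have "x \<oplus>\<^bsub>M\<^esub> y = (a \<oplus>\<^bsub>M\<^esub> a') \<oplus>\<^bsub>M\<^esub> (b \<oplus>\<^bsub>M\<^esub> b')"
      unfolding ab(3) ab'(3) using Ac[OF ab(1)] Bc[OF ab(2)] Ac[OF ab'(1)] Bc[OF ab'(2)] by (simp add: M.a_ac)
    then show "p (x \<oplus>\<^bsub>M\<^esub> y) = p x \<oplus>\<^bsub>M\<^esub> p y"
      using p[OF DA(3)[OF ab(1) ab'(1)] DB(3)[OF ab(2) ab'(2)]] p[OF ab(1,2)] p[OF ab'(1,2)] ab(3) ab'(3) by simp
  qed
  show ?thesis
  proof (rule that[OF ph])
    show "restrict p (carrier M) x = x" if "x \<in> A" for x
      using p[OF that DB(2)] Ac[OF that] by simp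
    show "restrict p (carrier M) x = \<zero>\<^bsub>M\<^esub>" if "x \<in> B" for x
      using p[OF DA(2) that] Bc[OF that] by simp
    show "restrict p (carrier M) x \<in> A" if x: "x \<in> carrier M" for x
    proof -
      obtain a b where ab: "a \<in> A" "b \<in> B" "x = a \<oplus>\<^bsub>M\<^esub> b" using ex[OF x] by blast
      then show ?thesis using p[OF ab(1,2)] x by simp
    qed
  qed
qed

text \<open>Let e be an idempotent strictly below \<open>g\<close> with maximal image, and put f = g
  - e. A proper splitting of the image of f would give an idempotent q orthogonal to e with e + q
  still strictly below \<open>g\<close>.\<close>

lemma indecomposable_summand:
  assumes M: "module R M" "noeth R M" and g: "idem_endo R M g" and ne: "x0 \<in> carrier M" "g x0 \<noteq> \<zero>\<^bsub>M\<^esub>"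
  obtains f where "idem_endo R M f" "\<And>x. x \<in> carrier M \<Longrightarrow> g (f x) = f x" "\<And>x. x \<in> carrier M \<Longrightarrow> f (g x) = f x"
    "indecomposable R (M\<lparr>carrier := f ` carrier M\<rparr>)"
proof -
  interpret M: module R M by (rule M(1))
  have gh: "g \<in> mod_hom R M M" and gg: "\<And>x. x \<in> carrier M \<Longrightarrow> g (g x) = g x" using g by (auto simp: idem_endo_def)
  note gc = mod_homD(1)[OF gh]
  define Q where "Q e \<longleftrightarrow> idem_endo R M e \<and> (\<forall>x\<in>carrier M. g (e x) = e x \<and> e (g x) = e x) \<and>
    (\<exists>x\<in>carrier M. e x \<noteq> g x)" for e
  have z: "hom_zero M M \<in> mod_hom R M M" by (rule hom_zero_closed[OF M(1) M(1)])
  have "Q (hom_zero M M)"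
    unfolding Q_def idem_endo_def using z gc hom_0[OF M(1) M(1) gh] by (auto simp: hom_zero_def) (metis ne)
  then obtain e where e: "Q e"
    "\<And>f x. \<lbrakk>idem_endo R M f; orth_endo M e f; x \<in> carrier M; f x \<noteq> \<zero>\<^bsub>M\<^esub>\<rbrakk> \<Longrightarrow> \<not> Q (hom_plus M M e f)"
    using maximal_idempotent[OF M, of Q "hom_zero M M"] unfolding Q_def by blast
  have ei: "idem_endo R M e" and eh: "e \<in> mod_hom R M M" and ge: "\<And>x. x \<in> carrier M \<Longrightarrow> g (e x) = e x"
    "\<And>x. x \<in> carrier M \<Longrightarrow> e (g x) = e x" "\<And>x. x \<in> carrier M \<Longrightarrow> e (e x) = e x"
    using e(1) by (auto simp: Q_def idem_endo_def)
  obtain x1 where x1: "x1 \<in> carrier M" "e x1 \<noteq> g x1" using e(1) by (auto simp: Q_def)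
  note ec = mod_homD(1)[OF eh]
  define f where "f = hom_diff M M g e"
  have fh: "f \<in> mod_hom R M M" unfolding f_def by (rule hom_diff_closed[OF M(1) M(1) gh eh])
  note fc = mod_homD(1)[OF fh]
  have fx: "f x = g x \<ominus>\<^bsub>M\<^esub> e x" if "x \<in> carrier M" for x using that by (simp add: f_def hom_diff_def)
  have gf: "g (f x) = f x" if x: "x \<in> carrier M" for x
    unfolding fx[OF x] hom_minus[OF M(1) M(1) gh gc[OF x] ec[OF x]] gg[OF x] ge(1)[OF x] ..
  have fg: "f (g x) = f x" if x: "x \<in> carrier M" for x
    unfolding fx[OF x] fx[OF gc[OF x]] gg[OF x] ge(2)[OF x] ..
  have ef: "e (f x) = \<zero>\<^bsub>M\<^esub>" if x: "x \<in> carrier M" for x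
    unfolding fx[OF x] hom_minus[OF M(1) M(1) eh gc[OF x] ec[OF x]] ge(2,3)[OF x]
    using ec[OF x] by (simp add: a_minus_def M.r_neg)
  have fe: "f (e x) = \<zero>\<^bsub>M\<^esub>" if x: "x \<in> carrier M" for x
    unfolding fx[OF ec[OF x]] ge(1,3)[OF x] using ec[OF x] by (simp add: a_minus_def M.r_neg)
  have ff: "f (f x) = f x" if x: "x \<in> carrier M" for x
  proof -
    have "f (f x) = g (f x) \<ominus>\<^bsub>M\<^esub> e (f x)" by (rule fx[OF fc[OF x]])
    then have "f (f x) \<oplus>\<^bsub>M\<^esub> \<zero>\<^bsub>M\<^esub> = f x"
      unfolding gf[OF x] ef[OF x] using fc[OF x] by (simp add: a_minus_def M.a_assoc M.l_neg)
    then show ?thesis using fc[OF fc[OF x]] by simp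
  qed
  have fi: "idem_endo R M f" using fh ff by (simp add: idem_endo_def)
  have gx: "e x \<oplus>\<^bsub>M\<^esub> f x = g x" if x: "x \<in> carrier M" for x
    unfolding fx[OF x] using ec[OF x] gc[OF x] by (simp add: a_minus_def M.a_lcomm[of "e x"] M.r_neg)
  let ?N = "M\<lparr>carrier := f ` carrier M\<rparr>"
  have sub: "submodule (f ` carrier M) R M" by (rule submodule_image[OF M(1) M(1) fh submodule_carrier[OF M(1)]])
  have N: "module R ?N" by (rule submodule.submodule_is_module[OF sub M(1)])
  have "f x1 \<noteq> \<zero>\<^bsub>M\<^esub>" using gx[OF x1(1)] ec[OF x1(1)] x1(2) by auto
  then have "carrier ?N \<noteq> {\<zero>\<^bsub>?N\<^esub>}" using x1(1) by auto
  moreover have "A = {\<zero>\<^bsub>?N\<^esub>} \<or> B = {\<zero>\<^bsub>?N\<^esub>}"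
    if A: "submodule A R ?N" and B: "submodule B R ?N" and AB: "A <+>\<^bsub>?N\<^esub> B = carrier ?N" "A \<inter> B = {\<zero>\<^bsub>?N\<^esub>}" for A B
  proof (rule ccontr)
    assume "\<not> (A = {\<zero>\<^bsub>?N\<^esub>} \<or> B = {\<zero>\<^bsub>?N\<^esub>})"
    then have nz: "A \<noteq> {\<zero>\<^bsub>M\<^esub>}" "B \<noteq> {\<zero>\<^bsub>M\<^esub>}" by auto
    note DA = submoduleD[OF N A] and DB = submoduleD[OF N B]
    obtain p where p: "p \<in> mod_hom R ?N ?N" "\<And>x. x \<in> A \<Longrightarrow> p x = x" "\<And>x. x \<in> B \<Longrightarrow> p x = \<zero>\<^bsub>?N\<^esub>"
      "\<And>x. x \<in> carrier ?N \<Longrightarrow> p x \<in> A" by (rule direct_sum_projection[OF N A B AB]) (rule that, assumption+)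
    have Af: "a \<in> f ` carrier M" if "a \<in> A" for a using DA(1) that by auto
    have Bf: "b \<in> f ` carrier M" if "b \<in> B" for b using DB(1) that by auto
    have f_id: "f y = y" if "y \<in> f ` carrier M" for y using that ff by auto
    have im: "f ` carrier M \<subseteq> carrier M" using fc by auto
    have fN: "f \<in> mod_hom R M ?N" using fh by (auto simp: mod_hom_def)
    \<comment> \<open>The projection onto the summand A of the image of f, extended to all of
      \<open>M\<close> by f.\<close>
    define q where "q = compose (carrier M) p f"
    have qN: "q \<in> mod_hom R M ?N" unfolding q_def by (rule compose_hom[OF M(1) fN p(1)])
    have qh: "q \<in> mod_hom R M M" by (rule hom_extend_target[OF qN im])
    have qx: "q x = p (f x)" if "x \<in> carrier M" for x using that by (simp add: q_def compose_def)
    have qA: "q x \<in> A" if "x \<in> carrier M" for x using p(4)[of "f x"] qx[OF that] that by simp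
    have qa: "q a = a" if "a \<in> A" for a
      using qx[of a] f_id[OF Af[OF that]] p(2)[OF that] Af[OF that] im by auto
    have qi: "idem_endo R M q" unfolding idem_endo_def using qh qa qA by simp
    have p0: "p \<zero>\<^bsub>M\<^esub> = \<zero>\<^bsub>M\<^esub>" using hom_0[OF N N p(1)] by simp
    have eA: "e a = \<zero>\<^bsub>M\<^esub>" if "a \<in> A" for a using Af[OF that] ef by auto
    have orth: "orth_endo M e q" unfolding orth_endo_def
      using eA[OF qA] qx[OF ec] fe p0 by simp
    have "\<zero>\<^bsub>M\<^esub> \<in> A" "\<zero>\<^bsub>M\<^esub> \<in> B" using DA(2) DB(2) by simp_all
    then obtain a b where ab: "a \<in> A" "a \<noteq> \<zero>\<^bsub>M\<^esub>" "b \<in> B" "b \<noteq> \<zero>\<^bsub>M\<^esub>" using nz by blast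
    have ac: "a \<in> carrier M" and bc: "b \<in> carrier M" using Af[OF ab(1)] Bf[OF ab(3)] im by auto
    have nQ: "\<not> Q (hom_plus M M e q)" by (rule e(2)[OF qi orth ac]) (use qa[OF ab(1)] ab(2) in simp)
    have gq: "g (q x) = q x" if x: "x \<in> carrier M" for x
      using Af[OF qA[OF x]] gf by auto
    have qg: "q (g x) = q x" if x: "x \<in> carrier M" for x using qx[OF x] qx[OF gc[OF x]] fg[OF x] by simp
    have "Q (hom_plus M M e q)" unfolding Q_def
    proof (intro conjI ballI)
      show "idem_endo R M (hom_plus M M e q)" by (rule orth_plus(1)[OF M(1) ei qi orth])
      show "g (hom_plus M M e q x) = hom_plus M M e q x" if x: "x \<in> carrier M" for x
        using x mod_homD(2)[OF gh ec[OF x] mod_homD(1)[OF qh x]] ge(1)[OF x] gq[OF x] by (simp add: hom_plus_def)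
      show "hom_plus M M e q (g x) = hom_plus M M e q x" if x: "x \<in> carrier M" for x
        using x gc[OF x] ge(2)[OF x] qg[OF x] by (simp add: hom_plus_def)
      \<comment> \<open>A nonzero b in the other summand is fixed by \<open>g\<close> but killed by
        e and q, so e + q differs from \<open>g\<close>.\<close>
      have "f b = b" by (rule f_id[OF Bf[OF ab(3)]])
      then have "q b = \<zero>\<^bsub>M\<^esub>" "e b = \<zero>\<^bsub>M\<^esub>" "g b = b" using qx[OF bc] p(3)[OF ab(3)] ef[OF bc] gf[OF bc] by simp_all
      then show "\<exists>x\<in>carrier M. hom_plus M M e q x \<noteq> g x" using bc ab(4) by (intro bexI[of _ b]) (simp_all add: hom_plus_def)
    qed
    then show False using nQ by simp
  qed
  ultimately have "indecomposable R ?N" unfolding indecomposable_def by blast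
  then show ?thesis using that[OF fi gf fg] by blast
qed

lemma inverse_hom:
  assumes M: "module R M" and N: "module R N" and f: "f \<in> mod_hom R M N" "bij_betw f (carrier M) (carrier N)"
  obtains g where "g \<in> mod_hom R N M" "compose (carrier M) g f = id_hom M" "compose (carrier N) f g = id_hom N"
proof -
  interpret M: module R M by fact
  interpret N: module R N by fact
  let ?i = "inv_into (carrier M) f"
  have inj: "inj_on f (carrier M)" and im: "f ` carrier M = carrier N" using f(2) by (auto simp: bij_betw_def)
  have ic: "?i y \<in> carrier M" if "y \<in> carrier N" for y using inv_into_into[of y f "carrier M"] im that by simp
  have fi: "f (?i y) = y" if "y \<in> carrier N" for y using f_inv_into_f[of y f "carrier M"] im that by simp
  have if1: "?i (f x) = x" if "x \<in> carrier M" for x using inv_into_f_f[OF inj that] .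
  have g: "restrict ?i (carrier N) \<in> mod_hom R N M"
  proof (rule mod_homI[OF N ic])
    fix x y assume "x \<in> carrier N" "y \<in> carrier N"
    then have "f (?i x \<oplus>\<^bsub>M\<^esub> ?i y) = x \<oplus>\<^bsub>N\<^esub> y" using mod_homD(2)[OF f(1) ic ic] fi by simp
    then show "?i (x \<oplus>\<^bsub>N\<^esub> y) = ?i x \<oplus>\<^bsub>M\<^esub> ?i y" using if1[of "?i x \<oplus>\<^bsub>M\<^esub> ?i y"] ic \<open>x \<in> _\<close> \<open>y \<in> _\<close> by simp
  next
    fix r x assume "r \<in> carrier R" "x \<in> carrier N"
    then have "f (r \<odot>\<^bsub>M\<^esub> ?i x) = r \<odot>\<^bsub>N\<^esub> x" using mod_homD(3)[OF f(1) _ ic] fi by simp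
    then show "?i (r \<odot>\<^bsub>N\<^esub> x) = r \<odot>\<^bsub>M\<^esub> ?i x" using if1[of "r \<odot>\<^bsub>M\<^esub> ?i x"] ic \<open>r \<in> _\<close> \<open>x \<in> _\<close> by simp
  qed
  show ?thesis
  proof (rule that[OF g])
    show "compose (carrier M) (restrict ?i (carrier N)) f = id_hom M"
      unfolding compose_def by (rule restrict_ext) (use if1 mod_homD(1)[OF f(1)] in simp)
    show "compose (carrier N) f (restrict ?i (carrier N)) = id_hom N"
      unfolding compose_def by (rule restrict_ext) (use fi in simp)
  qed
qed

section \<open>The correspondence\<close>

context cm_local
begin

lemma CM_summand:
  assumes M: "M \<in> CM R" and f: "idem_endo R M f"
  defines "N \<equiv> M\<lparr>carrier := f ` carrier M\<rparr>"
  shows "N \<in> CM R" "id_hom N \<in> Hom N M" "f \<in> Hom M N"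
    "compose (carrier N) f (id_hom N) = id_hom N" "compose (carrier M) (id_hom N) f = f"
proof -
  note mM = CM_module[OF M]
  have fh: "f \<in> Hom M M" and ff: "\<And>x. x \<in> carrier M \<Longrightarrow> f (f x) = f x" using f by (auto simp: idem_endo_def)
  have sub: "submodule (f ` carrier M) R M" by (rule submodule_image[OF mM mM fh submodule_carrier[OF mM]])
  have mN: "module R N" unfolding N_def by (rule submodule.submodule_is_module[OF sub mM])
  have im: "f ` carrier M \<subseteq> carrier M" using mod_homD(1)[OF fh] by auto
  show i: "id_hom N \<in> Hom N M" using id_hom_closed[OF mN] im by (auto simp: mod_hom_def N_def)
  show p: "f \<in> Hom M N" using fh by (auto simp: mod_hom_def N_def)
  show pi: "compose (carrier N) f (id_hom N) = id_hom N"
    unfolding compose_def by (rule restrict_ext) (use ff in \<open>auto simp: N_def\<close>)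
  have "compose (carrier M) (id_hom N) f = restrict f (carrier M)"
    unfolding compose_def by (rule restrict_ext) (simp add: N_def)
  then show "compose (carrier M) (id_hom N) f = f" using extensional_restrict[OF mod_homD(4)[OF fh]] by simp
  show "N \<in> CM R" using mcm_retract[OF _ mN i p pi] M by (simp add: CM_def)
qed

text \<open>First the summands of the generator \<open>M\<close> of \<open>H\<close> that die in \<open>G\<close> are killed, and then as many further
  summands as is possible without killing \<open>H\<close>.\<close>

lemma cyclic_indecomposable_quotient:
  assumes H: "H \<in> mod_CM R" and G: "additive_functor R G" and \<eta>: "nat_trans R H G \<eta>"
    and U: "U \<in> CM R" and x: "x \<in> carrier (fun_ob H U)" "\<eta> U x \<noteq> \<one>\<^bsub>fun_ob G U\<^esub>"
  obtains N Q \<theta> z where "N \<in> CM R" "indecomposable R N" "\<not> trivial_group (fun_ob G N)"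
    "Q \<in> mod_CM R" "nat_trans R H Q \<theta>" "z \<in> carrier (fun_ob H N)" "\<theta> N z \<noteq> \<one>\<^bsub>fun_ob Q N\<^esub>"
    "generated_by R Q N (\<theta> N z)"
proof -
  note A = mod_CM_additive[OF H]
  obtain M L \<gamma> h where P: "presented_by R H M L \<gamma> h" by (rule mod_CM_presented[OF H])
  note gen = presented_byD(1)[OF P] and M = presented_byD(2)[OF P] and h = presented_byD(5)[OF P]
  note mM = CM_module[OF M] and nM = CM_noeth[OF M]
  interpret M: module R M by (rule mM)
  interpret GM: comm_group "fun_ob G M" by (rule additive_functorD(1)[OF G M])
  define y where "y = \<eta> M h"
  have y: "y \<in> carrier (fun_ob G M)" unfolding y_def using nat_trans_act(1)[OF \<eta> M] h by (auto dest: hom_in_carrier)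
  have \<eta>h: "\<eta> V (act R H V M f h) = act R G V M f y" if "V \<in> CM R" "f \<in> Hom V M" for V f
    using nat_trans_act(2)[OF \<eta> that(1) M that(2) h] by (simp add: y_def)
  obtain f0 where f0: "f0 \<in> Hom U M" "x = act R H U M f0 h" using generated_byD(3)[OF gen U x(1)] by blast
  have y1: "y \<noteq> \<one>\<^bsub>fun_ob G M\<^esub>"
  proof
    assume "y = \<one>\<^bsub>fun_ob G M\<^esub>"
    then show False using x(2) \<eta>h[OF U f0(1)] act_one[OF G U M f0(1)] f0(2) by simp
  qed
  have z0: "idem_endo R M (hom_zero M M)"
    unfolding idem_endo_def using hom_zero_closed[OF mM mM] by (auto simp: hom_zero_def)
  \<comment> \<open>\<open>e\<close> cuts out a summand of \<open>M\<close> on which y, the image of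
    the generator in \<open>G\<close>, restricts to zero; its image is taken maximal.\<close>
  let ?Q1 = "\<lambda>e. idem_endo R M e \<and> act R G M M e y = \<one>\<^bsub>fun_ob G M\<^esub>"
  obtain e where e: "?Q1 e"
    "\<And>f x. \<lbrakk>idem_endo R M f; orth_endo M e f; x \<in> carrier M; f x \<noteq> \<zero>\<^bsub>M\<^esub>\<rbrakk> \<Longrightarrow> \<not> ?Q1 (hom_plus M M e f)"
    by (rule maximal_idempotent[OF mM nM, of ?Q1 "hom_zero M M"]) (use z0 act_zero[OF G M M y] in auto)
  have ei: "idem_endo R M e" and eh: "e \<in> Hom M M" using e(1) by (auto simp: idem_endo_def)
  note ec = mod_homD(1)[OF eh]
  have ee: "e (e v) = e v" if "v \<in> carrier M" for v using ei that by (simp add: idem_endo_def)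
  \<comment> \<open>\<open>d\<close> contains the summand of \<open>e\<close>, and the part d h of
    the generator does not regenerate h. Dividing \<open>H\<close> by d h thus leaves a nonzero
    quotient, and a maximal d makes that quotient as small as possible in this respect.\<close>
  let ?Q2 = "\<lambda>d. idem_endo R M d \<and> (\<forall>v\<in>carrier M. d (e v) = e v \<and> e (d v) = e v) \<and>
    \<not> (\<exists>c\<in>Hom M M. h = act R H M M c (act R H M M d h))"
  have "\<not> (\<exists>c\<in>Hom M M. h = act R H M M c (act R H M M e h))"
  proof
    assume "\<exists>c\<in>Hom M M. h = act R H M M c (act R H M M e h)"
    then obtain c where c: "c \<in> Hom M M" "h = act R H M M c (act R H M M e h)" by blast
    have "y = act R G M M c (act R G M M e y)"
      using nat_trans_act(2)[OF \<eta> M M c(1) act_mem[OF A M M eh h]] \<eta>h[OF M eh] c(2) by (simp add: y_def)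
    then show False using e(1) act_one[OF G M M c(1)] y1 by simp
  qed
  then have Q2e: "?Q2 e" using ei ee by simp
  obtain d where d: "?Q2 d"
    "\<And>f x. \<lbrakk>idem_endo R M f; orth_endo M d f; x \<in> carrier M; f x \<noteq> \<zero>\<^bsub>M\<^esub>\<rbrakk> \<Longrightarrow> \<not> ?Q2 (hom_plus M M d f)"
    by (rule maximal_idempotent[OF mM nM, of ?Q2 e, OF Q2e]) (blast, rule that, assumption+)
  have di: "idem_endo R M d" and dh: "d \<in> Hom M M" using d(1) by (auto simp: idem_endo_def)
  note dc = mod_homD(1)[OF dh]
  have dd: "d (d v) = d v" if "v \<in> carrier M" for v using di that by (simp add: idem_endo_def)
  have de: "d (e v) = e v" "e (d v) = e v" if "v \<in> carrier M" for v using d(1) that by auto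
  define g where "g = hom_diff M M (id_hom M) d"
  have gh: "g \<in> Hom M M" unfolding g_def by (rule diff_closed[OF M M id_closed[OF M] dh])
  note gc = mod_homD(1)[OF gh]
  have gv: "g v = v \<ominus>\<^bsub>M\<^esub> d v" if "v \<in> carrier M" for v using that by (simp add: g_def hom_diff_def)
  have dg: "d (g v) = \<zero>\<^bsub>M\<^esub>" if v: "v \<in> carrier M" for v
    unfolding gv[OF v] hom_minus[OF mM mM dh v dc[OF v]] dd[OF v] using dc[OF v] by (simp add: a_minus_def M.r_neg)
  have gd: "g (d v) = \<zero>\<^bsub>M\<^esub>" if v: "v \<in> carrier M" for v
    unfolding gv[OF dc[OF v]] dd[OF v] using dc[OF v] by (simp add: a_minus_def M.r_neg)
  have eg: "e (g v) = \<zero>\<^bsub>M\<^esub>" if v: "v \<in> carrier M" for v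
    using de(2)[OF gc[OF v]] dg[OF v] hom_0[OF mM mM eh] by simp
  have ge: "g (e v) = \<zero>\<^bsub>M\<^esub>" if v: "v \<in> carrier M" for v
    using gd[OF ec[OF v]] de(1)[OF v] by simp
  have gg: "g (g v) = g v" if v: "v \<in> carrier M" for v
  proof -
    have "g (g v) \<oplus>\<^bsub>M\<^esub> \<zero>\<^bsub>M\<^esub> = g v"
      unfolding gv[OF gc[OF v]] dg[OF v] using gc[OF v] by (simp add: a_minus_def M.a_assoc M.l_neg)
    then show ?thesis using gc[OF gc[OF v]] by simp
  qed
  have gi: "idem_endo R M g" using gh gg by (simp add: idem_endo_def)
  \<comment> \<open>If the complement g of d vanished, d would be the identity and would regenerate
    h.\<close>
  have "\<exists>v\<in>carrier M. g v \<noteq> \<zero>\<^bsub>M\<^esub>"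
  proof (rule ccontr)
    assume "\<not> (\<exists>v\<in>carrier M. g v \<noteq> \<zero>\<^bsub>M\<^esub>)"
    then have g0: "g v = \<zero>\<^bsub>M\<^esub>" if "v \<in> carrier M" for v using that by blast
    have "d v = v" if v: "v \<in> carrier M" for v
    proof -
      have "v = (v \<ominus>\<^bsub>M\<^esub> d v) \<oplus>\<^bsub>M\<^esub> d v" using v dc[OF v] by (simp add: a_minus_def M.a_assoc M.l_neg)
      then show ?thesis unfolding gv[OF v, symmetric] g0[OF v] using dc[OF v] by simp
    qed
    then have "d = id_hom M" by (intro hom_eqI[OF dh id_closed[OF M]]) simp
    then show False using d(1) additive_functorD(3)[OF A M h] id_closed[OF M] by auto
  qed
  then obtain v0 where v0: "v0 \<in> carrier M" "g v0 \<noteq> \<zero>\<^bsub>M\<^esub>" by blast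
  obtain f where f: "idem_endo R M f" "\<And>v. v \<in> carrier M \<Longrightarrow> g (f v) = f v" "\<And>v. v \<in> carrier M \<Longrightarrow> f (g v) = f v"
    "indecomposable R (M\<lparr>carrier := f ` carrier M\<rparr>)"
    by (rule indecomposable_summand[OF mM nM gi v0]) (rule that, assumption+)
  have fh: "f \<in> Hom M M" using f(1) by (simp add: idem_endo_def)
  note fc = mod_homD(1)[OF fh]
  have f0': "f \<zero>\<^bsub>M\<^esub> = \<zero>\<^bsub>M\<^esub>" by (rule hom_0[OF mM mM fh])
  let ?N = "M\<lparr>carrier := f ` carrier M\<rparr>"
  note S = CM_summand[OF M f(1)]
  have odf: "orth_endo M d f" unfolding orth_endo_def
    using dg f(2,3) fc gd f0' dc by metis
  have oef: "orth_endo M e f" unfolding orth_endo_def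
    using eg f(2,3) fc ge f0' ec by metis
  have "f ` carrier M \<noteq> {\<zero>\<^bsub>M\<^esub>}" using f(4) by (simp add: indecomposable_def)
  then obtain v1 where v1: "v1 \<in> carrier M" "f v1 \<noteq> \<zero>\<^bsub>M\<^esub>" using f0' by force
  let ?i = "id_hom ?N"
  \<comment> \<open>The summand \<open>?N\<close> is orthogonal to that of \<open>e\<close>. If y
    restricted to zero on it, then e + f would contradict the maximality of
    \<open>e\<close>.\<close>
  have "act R G ?N M ?i y \<noteq> \<one>\<^bsub>fun_ob G ?N\<^esub>"
  proof
    assume t: "act R G ?N M ?i y = \<one>\<^bsub>fun_ob G ?N\<^esub>"
    have "act R G M M f y = act R G M ?N f (act R G ?N M ?i y)"
      using additive_functorD(4)[OF G M S(1) M S(3,2) y] S(5) by simp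
    then have "act R G M M f y = \<one>\<^bsub>fun_ob G M\<^esub>" using t act_one[OF G M S(1,3)] by simp
    then have "act R G M M (hom_plus M M e f) y = \<one>\<^bsub>fun_ob G M\<^esub>"
      using additive_functorD(5)[OF G M M eh fh y] e(1) by simp
    then show False using e(2)[OF f(1) oef v1] orth_plus(1)[OF mM ei f(1) oef] by blast
  qed
  then have nt: "\<not> trivial_group (fun_ob G ?N)" using trivial_iff[OF G S(1)] act_mem[OF G S(1) M S(2) y] by blast
  define w where "w = act R H M M d h"
  have w: "w \<in> carrier (fun_ob H M)" unfolding w_def by (rule act_mem[OF A M M dh h])
  obtain Q \<theta> where Q: "Q \<in> mod_CM R" "nat_trans R H Q \<theta>"
    "\<And>V. V \<in> CM R \<Longrightarrow> \<theta> V ` carrier (fun_ob H V) = carrier (fun_ob Q V)"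
    "\<And>V u. \<lbrakk>V \<in> CM R; u \<in> carrier (fun_ob H V)\<rbrakk> \<Longrightarrow>
      \<theta> V u = \<one>\<^bsub>fun_ob Q V\<^esub> \<longleftrightarrow> (\<exists>c\<in>Hom V M. u = act R H V M c w)"
    by (rule cyclic_quotient[OF H M w]) (rule that, assumption+)
  note QA = mod_CM_additive[OF Q(1)]
  define q where "q = \<theta> M h"
  have q: "q \<in> carrier (fun_ob Q M)" unfolding q_def using Q(3)[OF M] h by blast
  have \<theta>h: "\<theta> V (act R H V M c h) = act R Q V M c q" if "V \<in> CM R" "c \<in> Hom V M" for V c
    using nat_trans_act(2)[OF Q(2) that(1) M that(2) h] by (simp add: q_def)
  have q1: "q \<noteq> \<one>\<^bsub>fun_ob Q M\<^esub>" unfolding q_def using Q(4)[OF M h] d(1) by (auto simp: w_def)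
  have "w = act R H M M (id_hom M) w" using additive_functorD(3)[OF A M w] by simp
  then have "\<theta> M w = \<one>\<^bsub>fun_ob Q M\<^esub>" using Q(4)[OF M w] id_closed[OF M] by blast
  then have dq: "act R Q M M d q = \<one>\<^bsub>fun_ob Q M\<^esub>" using \<theta>h[OF M dh] by (simp add: w_def)
  define z where "z = act R H ?N M ?i h"
  have z: "z \<in> carrier (fun_ob H ?N)" unfolding z_def by (rule act_mem[OF A S(1) M S(2) h])
  have \<theta>z: "\<theta> ?N z = act R Q ?N M ?i q" unfolding z_def by (rule \<theta>h[OF S(1,2)])
  \<comment> \<open>By maximality of d the generator h is recovered from (d + f) h. In
    \<open>Q\<close> the part d h is zero, so f h alone, and therefore the restriction z to
    \<open>?N\<close>, generates.\<close>
  have "\<not> ?Q2 (hom_plus M M d f)" by (rule d(2)[OF f(1) odf v1])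
  moreover have "idem_endo R M (hom_plus M M d f)" by (rule orth_plus(1)[OF mM di f(1) odf])
  moreover have "hom_plus M M d f (e v) = e v \<and> e (hom_plus M M d f v) = e v" if v: "v \<in> carrier M" for v
  proof
    have "f (e v) = \<zero>\<^bsub>M\<^esub>" "e (f v) = \<zero>\<^bsub>M\<^esub>" using oef v by (auto simp: orth_endo_def)
    then show "hom_plus M M d f (e v) = e v" "e (hom_plus M M d f v) = e v"
      using v ec[OF v] de[OF v] mod_homD(2)[OF eh dc[OF v] fc[OF v]] by (simp_all add: hom_plus_def)
  qed
  ultimately obtain c where c: "c \<in> Hom M M" "h = act R H M M c (act R H M M (hom_plus M M d f) h)" by blast
  have dfh: "hom_plus M M d f \<in> Hom M M" by (rule plus_closed[OF M M dh fh])
  have "q = act R Q M M c (act R Q M M (hom_plus M M d f) q)"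
    using nat_trans_act(2)[OF Q(2) M M c(1) act_mem[OF A M M dfh h]] \<theta>h[OF M dfh] c(2) by (simp add: q_def)
  also have "act R Q M M (hom_plus M M d f) q = act R Q M M f q"
  proof -
    interpret QM: comm_group "fun_ob Q M" by (rule additive_functorD(1)[OF QA M])
    show ?thesis using additive_functorD(5)[OF QA M M dh fh q] dq act_mem[OF QA M M fh q] by simp
  qed
  also have "act R Q M M f q = act R Q M ?N f (\<theta> ?N z)"
    unfolding \<theta>z using additive_functorD(4)[OF QA M S(1) M S(3,2) q] S(5) by simp
  finally have qz: "q = act R Q M M c (act R Q M ?N f (\<theta> ?N z))" .
  have \<theta>zc: "\<theta> ?N z \<in> carrier (fun_ob Q ?N)" using Q(3)[OF S(1)] z by blast
  have cf: "compose (carrier M) f c \<in> Hom M ?N" by (rule comp_closed[OF M c(1) S(3)])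
  have qz': "q = act R Q M ?N (compose (carrier M) f c) (\<theta> ?N z)"
    using additive_functorD(4)[OF QA M M S(1) c(1) S(3) \<theta>zc] qz by simp
  have "\<theta> ?N z \<noteq> \<one>\<^bsub>fun_ob Q ?N\<^esub>" using qz' q1 act_one[OF QA M S(1) cf] by auto
  moreover have "generated_by R Q ?N (\<theta> ?N z)"
    unfolding generated_by_def
  proof (intro conjI ballI S(1) \<theta>zc)
    fix V u assume V: "V \<in> CM R" and "u \<in> carrier (fun_ob Q V)"
    then obtain u' where u': "u' \<in> carrier (fun_ob H V)" "u = \<theta> V u'" using Q(3)[OF V] by auto
    obtain k where k: "k \<in> Hom V M" "u' = act R H V M k h" using generated_byD(3)[OF gen V u'(1)] by blast
    have "u = act R Q V M k q" using \<theta>h[OF V k(1)] k(2) u'(2) by simp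
    also have "\<dots> = act R Q V ?N (compose (carrier V) (compose (carrier M) f c) k) (\<theta> ?N z)"
      using additive_functorD(4)[OF QA V M S(1) k(1) cf \<theta>zc] qz' by simp
    finally show "\<exists>k\<in>Hom V ?N. u = act R Q V ?N k (\<theta> ?N z)" using comp_closed[OF V k(1) cf] by blast
  qed
  ultimately show ?thesis using that[OF S(1) f(4) nt Q(1,2) z] by blast
qed

text \<open>The identity of \<open>M\<close> factors through R^n and therefore acts as zero.\<close>

lemma free_trivial:
  assumes F: "additive_functor R F" and M: "M \<in> CM R" and iso: "mod_iso R M (free_module R n)"
  shows "trivial_group (fun_ob F M)"
proof -
  obtain f where f: "f \<in> Hom M (free_module R n)" "bij_betw f (carrier M) (carrier (free_module R n))"
    using iso by (auto simp: mod_iso_def)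
  obtain g where g: "g \<in> Hom (free_module R n) M" "compose (carrier M) g f = id_hom M"
    using inverse_hom[OF CM_module[OF M] module_free[OF cring] f] by blast
  have "id_hom M \<in> ff M M" using free_factoringI[OF f(1) g(1)] g(2) by simp
  then show ?thesis unfolding trivial_iff[OF F M]
    using act_ff[OF F M M] additive_functorD(3)[OF F M] by metis
qed

lemma iso_trivial:
  assumes F: "additive_functor R F" and M: "M \<in> CM R" and N: "N \<in> CM R" and iso: "mod_iso R M N"
    and t: "trivial_group (fun_ob F M)"
  shows "trivial_group (fun_ob F N)"
proof -
  obtain f where f: "f \<in> Hom M N" "bij_betw f (carrier M) (carrier N)"
    using iso by (auto simp: mod_iso_def)
  obtain g where g: "g \<in> Hom N M" "compose (carrier N) f g = id_hom N"
    using inverse_hom[OF CM_module[OF M] CM_module[OF N] f] by blast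
  have "x = \<one>\<^bsub>fun_ob F N\<^esub>" if x: "x \<in> carrier (fun_ob F N)" for x
  proof -
    have "act R F M N f x = \<one>\<^bsub>fun_ob F M\<^esub>" using act_mem[OF F M N f(1) x] t trivial_iff[OF F M] by blast
    then show ?thesis
      using additive_functorD(4)[OF F N M N g(1) f(1) x] g(2) additive_functorD(3)[OF F N x] act_one[OF F N M g(1)] by simp
  qed
  then show ?thesis using trivial_iff[OF F N] by blast
qed

section \<open>Functors vanishing on a set of modules\<close>

lemma Sp_CM: "c \<in> Sp R \<Longrightarrow> U \<in> c \<Longrightarrow> U \<in> CM R"
  by (auto simp: Sp_def CM_iso_rel_def elim!: quotientE)

lemma Sp_Sigma_mem: "F \<in> Sp_Sigma R \<U> \<longleftrightarrow> F \<in> mod_CM R \<and> (\<forall>c\<in>\<U>. \<forall>U\<in>c. trivial_group (fun_ob F U))"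
  by (simp add: Sp_Sigma_def)

text \<open>Exactness is pointwise, so vanishing at one fixed module is already a Serre
  condition.\<close>

lemma short_exact_trivial_iff:
  assumes H: "additive_functor R H" and G: "additive_functor R G" and F: "additive_functor R F"
    and ex: "short_exact R H G F" and U: "U \<in> CM R"
  shows "trivial_group (fun_ob G U) \<longleftrightarrow> trivial_group (fun_ob H U) \<and> trivial_group (fun_ob F U)"
proof -
  obtain \<alpha> \<beta> where \<alpha>\<beta>: "nat_trans R H G \<alpha>" "nat_trans R G F \<beta>"
    and exact: "\<forall>U\<in>CM R. inj_on (\<alpha> U) (carrier (fun_ob H U)) \<and>
      \<alpha> U ` carrier (fun_ob H U) = kernel (fun_ob G U) (fun_ob F U) (\<beta> U) \<and>
      \<beta> U ` carrier (fun_ob G U) = carrier (fun_ob F U)"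
    using ex[unfolded short_exact_def] by (elim exE conjE) (rule that, assumption+)
  note ab = \<alpha>\<beta> exact[THEN bspec, OF U, THEN conjunct1] exact[THEN bspec, OF U, THEN conjunct2, THEN conjunct1]
    exact[THEN bspec, OF U, THEN conjunct2, THEN conjunct2]
  interpret H: comm_group "fun_ob H U" by (rule additive_functorD(1)[OF H U])
  interpret G: comm_group "fun_ob G U" by (rule additive_functorD(1)[OF G U])
  interpret F: comm_group "fun_ob F U" by (rule additive_functorD(1)[OF F U])
  have \<alpha>: "\<alpha> U \<in> hom (fun_ob H U) (fun_ob G U)" and \<beta>: "\<beta> U \<in> hom (fun_ob G U) (fun_ob F U)"
    using nat_trans_act(1)[OF ab(1) U] nat_trans_act(1)[OF ab(2) U] .
  have \<alpha>1: "\<alpha> U \<one>\<^bsub>fun_ob H U\<^esub> = \<one>\<^bsub>fun_ob G U\<^esub>" using hom_one[OF \<alpha> H.is_group G.is_group] .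
  have \<beta>1: "\<beta> U \<one>\<^bsub>fun_ob G U\<^esub> = \<one>\<^bsub>fun_ob F U\<^esub>" using hom_one[OF \<beta> G.is_group F.is_group] .
  show ?thesis unfolding trivial_iff[OF G U] trivial_iff[OF H U] trivial_iff[OF F U]
  proof (intro iffI conjI ballI)
    fix x assume t: "\<forall>x\<in>carrier (fun_ob G U). x = \<one>\<^bsub>fun_ob G U\<^esub>" and x: "x \<in> carrier (fun_ob H U)"
    have "\<alpha> U x = \<alpha> U \<one>\<^bsub>fun_ob H U\<^esub>" using t hom_in_carrier[OF \<alpha> x] \<alpha>1 by simp
    then show "x = \<one>\<^bsub>fun_ob H U\<^esub>" using ab(3) x H.one_closed by (auto dest: inj_onD)
  next
    fix x assume t: "\<forall>x\<in>carrier (fun_ob G U). x = \<one>\<^bsub>fun_ob G U\<^esub>" and "x \<in> carrier (fun_ob F U)"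
    then obtain y where "y \<in> carrier (fun_ob G U)" "x = \<beta> U y" using ab(5) by blast
    then show "x = \<one>\<^bsub>fun_ob F U\<^esub>" using t \<beta>1 by metis
  next
    fix x assume t: "(\<forall>x\<in>carrier (fun_ob H U). x = \<one>\<^bsub>fun_ob H U\<^esub>) \<and> (\<forall>x\<in>carrier (fun_ob F U). x = \<one>\<^bsub>fun_ob F U\<^esub>)"
      and x: "x \<in> carrier (fun_ob G U)"
    have "\<beta> U x = \<one>\<^bsub>fun_ob F U\<^esub>" using t hom_in_carrier[OF \<beta> x] by blast
    then have "x \<in> \<alpha> U ` carrier (fun_ob H U)" using x ab(4) by (simp add: kernel_def)
    then obtain y where "y \<in> carrier (fun_ob H U)" "x = \<alpha> U y" by blast
    then show "x = \<one>\<^bsub>fun_ob G U\<^esub>" using t \<alpha>1 by metis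
  qed
qed

lemma functor_iso_trivial:
  assumes F: "additive_functor R F" and G: "additive_functor R G" and iso: "functor_iso R F G" and U: "U \<in> CM R"
    and t: "trivial_group (fun_ob F U)"
  shows "trivial_group (fun_ob G U)"
proof -
  obtain \<eta> where \<eta>: "nat_trans R F G \<eta>" "bij_betw (\<eta> U) (carrier (fun_ob F U)) (carrier (fun_ob G U))"
    using iso U unfolding functor_iso_def by blast
  have \<eta>1: "\<eta> U \<one>\<^bsub>fun_ob F U\<^esub> = \<one>\<^bsub>fun_ob G U\<^esub>"
    using hom_one[OF nat_trans_act(1)[OF \<eta>(1) U]] additive_functorD(1)[OF F U] additive_functorD(1)[OF G U]
    by (simp add: comm_group_def)
  have "x = \<one>\<^bsub>fun_ob G U\<^esub>" if x: "x \<in> carrier (fun_ob G U)" for x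
  proof -
    obtain y where "y \<in> carrier (fun_ob F U)" "x = \<eta> U y" using \<eta>(2) x by (auto simp: bij_betw_def)
    then show ?thesis using t trivial_iff[OF F U] \<eta>1 by auto
  qed
  then show ?thesis using trivial_iff[OF G U] by blast
qed

text \<open>The quotient of a represented functor by all maps. It witnesses that the Serre
  subcategories of vanishing functors are nonempty.\<close>

lemma zero_functor_exists:
  obtains F where "F \<in> mod_CM R" "\<And>U. U \<in> CM R \<Longrightarrow> trivial_group (fun_ob F U)"
proof -
  let ?M = "free_module R 1"
  note M = CM_free[of 1]
  let ?I = "\<lambda>U. Hom U ?M"
  have I: "right_ideal ?M ?I" unfolding right_ideal_def
  proof (intro conjI ballI M)
    fix U assume U: "U \<in> CM R"
    interpret comm_group "hom_group R U ?M" by (rule comm_group_hom_group[OF CM_module[OF U] CM_module[OF M]])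
    show "subgroup (Hom U ?M) (hom_group R U ?M)" using subgroup_self by (simp add: hom_group_simps)
    show "ff U ?M \<subseteq> Hom U ?M" by (rule free_factoring_hom[OF CM_module[OF U]])
    show "compose (carrier U) f g \<in> Hom U ?M" if "V \<in> CM R" "f \<in> Hom V ?M" "g \<in> Hom U V" for V f g
      by (rule comp_closed[OF U that(3,2)])
  qed
  have "quo ?M ?I \<in> mod_CM R"
  proof (rule quo_in_mod_CM[OF I M id_closed[OF M]])
    fix U f assume U: "U \<in> CM R" and f: "f \<in> Hom U ?M"
    show "f \<in> Hom U ?M \<longleftrightarrow> (\<exists>u\<in>Hom U ?M. hom_diff U ?M f (compose (carrier U) (id_hom ?M) u) \<in> ff U ?M)"
      using f diff_self_ff[OF U M f] compose_id_hom(2)[OF f] by (intro iffI bexI[of _ f]) simp_all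
  qed
  moreover have "trivial_group (fun_ob (quo ?M ?I) U)" if U: "U \<in> CM R" for U
    unfolding trivial_iff[OF quo_additive[OF I] U]
    using generated_byD(3)[OF quo_generated[OF I] U] quo_one_iff[OF I U] by blast
  ultimately show ?thesis using that by blast
qed

lemma Sp_Sigma_serre:
  assumes \<U>: "\<U> \<subseteq> Sp R" shows "serre_subcategory R (Sp_Sigma R \<U>)"
  unfolding serre_subcategory_def iso_closed_subcategory_def
proof (intro conjI ballI impI)
  have c: "U \<in> CM R" if "c \<in> \<U>" "U \<in> c" for c U using Sp_CM that \<U> by blast
  show "Sp_Sigma R \<U> \<subseteq> mod_CM R" by (auto simp: Sp_Sigma_mem)
  show "G \<in> Sp_Sigma R \<U>" if "F \<in> Sp_Sigma R \<U>" "G \<in> mod_CM R" "functor_iso R F G" for F G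
    using that functor_iso_trivial[of F G] mod_CM_additive c by (auto simp: Sp_Sigma_mem)
  show "Sp_Sigma R \<U> \<noteq> {}"
  proof -
    obtain F where "F \<in> mod_CM R" "\<And>U. U \<in> CM R \<Longrightarrow> trivial_group (fun_ob F U)" using zero_functor_exists by blast
    then have "F \<in> Sp_Sigma R \<U>" using c by (auto simp: Sp_Sigma_mem)
    then show ?thesis by blast
  qed
  show "G \<in> Sp_Sigma R \<U> \<longleftrightarrow> H \<in> Sp_Sigma R \<U> \<and> F \<in> Sp_Sigma R \<U>"
    if "H \<in> mod_CM R" "G \<in> mod_CM R" "F \<in> mod_CM R" "short_exact R H G F" for H G F
    using short_exact_trivial_iff[OF mod_CM_additive[OF that(1)] mod_CM_additive[OF that(2)] mod_CM_additive[OF that(3)] that(4) c]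
      that(1-3) by (auto simp: Sp_Sigma_mem)
qed

lemma Sp_Sigma_biperp:
  assumes \<U>: "\<U> \<subseteq> Sp R" shows "right_perp R (left_perp R (Sp_Sigma R \<U>)) = Sp_Sigma R \<U>"
proof (intro equalityI subsetI)
  fix G assume G: "G \<in> right_perp R (left_perp R (Sp_Sigma R \<U>))"
  then have Gm: "G \<in> mod_CM R" by (simp add: right_perp_def)
  have "trivial_group (fun_ob G U)" if cU: "c \<in> \<U>" "U \<in> c" for c U
  proof -
    have U: "U \<in> CM R" using Sp_CM cU \<U> by blast
    have "rep U \<in> left_perp R (Sp_Sigma R \<U>)"
      using rep_mod_CM[OF U] zero_hom_rep_iff[OF _ U] cU by (auto simp: left_perp_def Sp_Sigma_mem)
    then have "zero_hom R (rep U) G" using G by (simp add: right_perp_def)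
    then show ?thesis using zero_hom_rep_iff[OF Gm U] by simp
  qed
  then show "G \<in> Sp_Sigma R \<U>" using Gm by (simp add: Sp_Sigma_mem)
next
  fix G assume "G \<in> Sp_Sigma R \<U>"
  then show "G \<in> right_perp R (left_perp R (Sp_Sigma R \<U>))" by (auto simp: right_perp_def left_perp_def Sp_Sigma_mem)
qed

end

locale complete_cm_local = cm_local + complete_local
begin

text \<open>Functors being contravariant, a right inverse \<psi> undoes the action of \<phi>; it is
  on this side that an inverse shows an element killed by \<phi> to be zero.\<close>

lemma right_inverse_dichotomy:
  assumes N: "N \<in> CM R" and ind: "indecomposable R N" and \<phi>: "\<phi> \<in> Hom N N"
  shows "(\<exists>\<psi>\<in>Hom N N. compose (carrier N) \<phi> \<psi> = id_hom N) \<or>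
    (\<exists>\<psi>\<in>Hom N N. compose (carrier N) (hom_diff N N (id_hom N) \<phi>) \<psi> = id_hom N)"
proof -
  have "fg_module R N" using N by (simp add: CM_def mcm_iff)
  then have "bij_betw \<phi> (carrier N) (carrier N) \<or> bij_betw (hom_diff N N (id_hom N) \<phi>) (carrier N) (carrier N)"
    by (rule indecomposable_endo_local[OF _ ind \<phi>])
  then show ?thesis
    using inverse_hom[OF CM_module[OF N] CM_module[OF N] \<phi>]
      inverse_hom[OF CM_module[OF N] CM_module[OF N] diff_closed[OF N N id_closed[OF N] \<phi>]] by metis
qed

text \<open>If \<open>N\<close> is indecomposable, then two nonzero quotients of the functor represented by \<open>N\<close> have a
  common nonzero quotient, because the stable endomorphism ring of \<open>N\<close> is local.\<close>

lemma Sp_Sigma_gamma: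
  assumes FF: "serre_subcategory R FF" and bi: "right_perp R (left_perp R FF) = FF"
  shows "Sp_Sigma R (Sp_gamma R FF) = FF"
proof (intro equalityI subsetI)
  have sub: "FF \<subseteq> mod_CM R" using FF by (simp add: serre_subcategory_def iso_closed_subcategory_def)
  {
    fix G assume "G \<in> FF"
    then show "G \<in> Sp_Sigma R (Sp_gamma R FF)" using sub by (auto simp: Sp_Sigma_mem Sp_gamma_def)
  }
  fix G assume G: "G \<in> Sp_Sigma R (Sp_gamma R FF)"
  then have Gm: "G \<in> mod_CM R" by (simp add: Sp_Sigma_mem)
  note GA = mod_CM_additive[OF Gm]
  have "zero_hom R H G" if "H \<in> left_perp R FF" for H
    unfolding zero_hom_def
  proof (intro allI impI ballI)
    have H: "H \<in> mod_CM R" and HF: "\<And>F. F \<in> FF \<Longrightarrow> zero_hom R H F" using that by (auto simp: left_perp_def)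
    fix \<eta> U x assume \<eta>: "nat_trans R H G \<eta>" and U: "U \<in> CM R" and x: "x \<in> carrier (fun_ob H U)"
    show "\<eta> U x = \<one>\<^bsub>fun_ob G U\<^esub>"
    proof (rule ccontr)
      assume ne: "\<eta> U x \<noteq> \<one>\<^bsub>fun_ob G U\<^esub>"
      obtain N Q \<theta> z where N: "N \<in> CM R" "indecomposable R N" "\<not> trivial_group (fun_ob G N)"
        and Q: "Q \<in> mod_CM R" "nat_trans R H Q \<theta>" and z: "z \<in> carrier (fun_ob H N)" "\<theta> N z \<noteq> \<one>\<^bsub>fun_ob Q N\<^esub>"
        and gen: "generated_by R Q N (\<theta> N z)"
        by (rule cyclic_indecomposable_quotient[OF H GA \<eta> U x ne]) (rule that, assumption+)
      note QA = mod_CM_additive[OF Q(1)]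
      \<comment> \<open>Every functor on the stable category vanishes at free modules, whereas
        \<open>G\<close> does not vanish at \<open>N\<close>; this is what admits \<open>N\<close>
        to the spectrum.\<close>
      have nfree: "\<not> mod_iso R N (free_module R 1)" using free_trivial[OF GA N(1)] N(3) by blast
      let ?c = "CM_iso_rel R `` {N}"
      have cSp: "?c \<in> Sp R" unfolding Sp_def using N(1,2) nfree by (intro quotientI) simp
      have "mod_iso R N N" unfolding mod_iso_def using id_closed[OF N(1)] by (intro bexI[of _ "id_hom N"]) (auto simp: bij_betw_def inj_on_def)
      then have Nc: "N \<in> ?c" using N(1) by (simp add: CM_iso_rel_def)
      \<comment> \<open>\<open>G\<close> vanishes on every class in \<open>Sp_gamma R FF\<close> but
        not at \<open>N\<close>, so some member of \<open>FF\<close> is nonzero at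
        \<open>N\<close>.\<close>
      have "?c \<notin> Sp_gamma R FF" using G Nc N(3) by (auto simp: Sp_Sigma_mem)
      then obtain F N' where F: "F \<in> FF" "N' \<in> ?c" "\<not> trivial_group (fun_ob F N')" using cSp by (auto simp: Sp_gamma_def)
      have FA: "additive_functor R F" using F(1) sub mod_CM_additive by blast
      have "N' \<in> CM R" "mod_iso R N N'" using F(2) by (auto simp: CM_iso_rel_def)
      then have "\<not> trivial_group (fun_ob F N)" using iso_trivial[OF FA N(1)] F(3) by blast
      then obtain y where y: "y \<in> carrier (fun_ob F N)" "y \<noteq> \<one>\<^bsub>fun_ob F N\<^esub>" using trivial_iff[OF FA N(1)] by blast
      have xq: "\<theta> N z \<in> carrier (fun_ob Q N)" by (rule generated_byD(2)[OF gen])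
      \<comment> \<open>The map k generates the relations of the generator of \<open>Q\<close>: it
        kills that generator, and every map that does so factors through k.\<close>
      obtain E k where E: "E \<in> CM R" "k \<in> Hom E N" "act R Q E N k (\<theta> N z) = \<one>\<^bsub>fun_ob Q E\<^esub>"
        "\<And>U c. \<lbrakk>U \<in> CM R; c \<in> Hom U N; act R Q U N c (\<theta> N z) = \<one>\<^bsub>fun_ob Q U\<^esub>\<rbrakk> \<Longrightarrow>
          \<exists>c'\<in>Hom U E. compose (carrier U) k c' = c"
        by (rule weak_kernel[OF Q(1) N(1) xq]) (rule that, assumption+)
      define w where "w = act R F E N k y"
      have w: "w \<in> carrier (fun_ob F E)" unfolding w_def by (rule act_mem[OF FA E(1) N(1) E(2) y(1)])
      \<comment> \<open>Dividing \<open>F\<close> by k y imposes the relations of \<open>Q\<close>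
        on y, so that \<open>Q\<close> maps to \<open>T\<close> by sending its generator to the
        image of y. \<open>T\<close> remains in \<open>FF\<close>, and \<open>H\<close> has only
        zero maps to it.\<close>
      obtain T \<tau> where T: "T \<in> FF" "nat_trans R F T \<tau>"
        "\<And>U x. \<lbrakk>U \<in> CM R; x \<in> carrier (fun_ob F U)\<rbrakk> \<Longrightarrow>
          \<tau> U x = \<one>\<^bsub>fun_ob T U\<^esub> \<longleftrightarrow> (\<exists>c\<in>Hom U E. x = act R F U E c w)"
        by (rule serre_cyclic_quotient[OF FF F(1) E(1) w]) (rule that, assumption+)
      have TA: "additive_functor R T" using T(1) sub mod_CM_additive by blast
      have \<tau>y: "\<tau> N y \<in> carrier (fun_ob T N)" using nat_trans_act(1)[OF T(2) N(1)] y(1) by (auto dest: hom_in_carrier)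
      obtain \<zeta> where \<zeta>: "nat_trans R Q T \<zeta>"
        "\<And>V f. \<lbrakk>V \<in> CM R; f \<in> Hom V N\<rbrakk> \<Longrightarrow> \<zeta> V (act R Q V N f (\<theta> N z)) = act R T V N f (\<tau> N y)"
      proof (rule nat_trans_exists[OF QA TA gen \<tau>y])
        fix V f assume V: "V \<in> CM R" and f: "f \<in> Hom V N" "act R Q V N f (\<theta> N z) = \<one>\<^bsub>fun_ob Q V\<^esub>"
        obtain c where c: "c \<in> Hom V E" "compose (carrier V) k c = f" using E(4)[OF V f] by blast
        have "act R F V N f y = act R F V E c w"
          using additive_functorD(4)[OF FA V E(1) N(1) c(1) E(2) y(1)] c(2) by (simp add: w_def)
        then have "\<tau> V (act R F V N f y) = \<one>\<^bsub>fun_ob T V\<^esub>"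
          using T(3)[OF V act_mem[OF FA V N(1) f(1) y(1)]] c(1) by blast
        then show "act R T V N f (\<tau> N y) = \<one>\<^bsub>fun_ob T V\<^esub>" using nat_trans_act(2)[OF T(2) V N(1) f(1) y(1)] by simp
      qed (rule that, assumption+)
      have "nat_trans R H T (\<lambda>U. \<zeta> U \<circ> \<theta> U)"
      proof (rule nat_transI)
        fix V assume V: "V \<in> CM R"
        show "\<zeta> V \<circ> \<theta> V \<in> hom (fun_ob H V) (fun_ob T V)"
          by (rule hom_compose[OF nat_trans_act(1)[OF Q(2) V] nat_trans_act(1)[OF \<zeta>(1) V]])
        fix W f x assume h: "W \<in> CM R" "f \<in> Hom V W" "x \<in> carrier (fun_ob H W)"
        have "\<theta> W x \<in> carrier (fun_ob Q W)" using nat_trans_act(1)[OF Q(2) h(1)] h(3) by (auto dest: hom_in_carrier)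
        then show "(\<zeta> V \<circ> \<theta> V) (act R H V W f x) = act R T V W f ((\<zeta> W \<circ> \<theta> W) x)"
          using nat_trans_act(2)[OF Q(2) V h] nat_trans_act(2)[OF \<zeta>(1) V h(1,2)] by simp
      qed
      then have "\<zeta> N (\<theta> N z) = \<one>\<^bsub>fun_ob T N\<^esub>" using HF[OF T(1)] N(1) z(1) by (auto simp: zero_hom_def)
      moreover have "\<zeta> N (\<theta> N z) = \<tau> N y"
        using \<zeta>(2)[OF N(1) id_closed[OF N(1)]] additive_functorD(3)[OF QA N(1) xq] additive_functorD(3)[OF TA N(1) \<tau>y] by simp
      \<comment> \<open>So y becomes zero in \<open>T\<close>, that is y = (k c) y. The endomorphism
        k c fixes y and kills the generator of \<open>Q\<close>.\<close>
      ultimately obtain c where c: "c \<in> Hom N E" "y = act R F N E c w" using T(3)[OF N(1) y(1)] by auto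
      define \<phi> where "\<phi> = compose (carrier N) k c"
      have \<phi>: "\<phi> \<in> Hom N N" unfolding \<phi>_def by (rule comp_closed[OF N(1) c(1) E(2)])
      have "act R F N N \<phi> y = act R F N E c w"
        unfolding \<phi>_def w_def by (rule additive_functorD(4)[OF FA N(1) E(1) N(1) c(1) E(2) y(1)])
      then have y\<phi>: "act R F N N \<phi> y = y" using c(2) by (rule trans[OF _ sym])
      have z\<phi>: "act R Q N N \<phi> (\<theta> N z) = \<one>\<^bsub>fun_ob Q N\<^esub>"
        using additive_functorD(4)[OF QA N(1) E(1) N(1) c(1) E(2) xq] E(3) act_one[OF QA N(1) E(1) c(1)] by (simp add: \<phi>_def)
      \<comment> \<open>An endomorphism with a right inverse kills only the neutral element. This
        meets \<phi> on the generator of \<open>Q\<close> and id - \<phi> on y, both of which are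
        nonzero.\<close>
      have unit: "x = \<one>\<^bsub>fun_ob K N\<^esub>"
        if "additive_functor R K" "x \<in> carrier (fun_ob K N)" "\<psi> \<in> Hom N N" "\<chi> \<in> Hom N N"
          "compose (carrier N) \<chi> \<psi> = id_hom N" "act R K N N \<chi> x = \<one>\<^bsub>fun_ob K N\<^esub>"
        for K :: "'a fp_functor" and x \<psi> \<chi>
        using additive_functorD(4)[OF that(1) N(1) N(1) N(1) that(3,4,2)] that(5,6)
          additive_functorD(3)[OF that(1) N(1) that(2)] act_one[OF that(1) N(1) N(1) that(3)] by simp
      note d = diff_closed[OF N(1) N(1) id_closed[OF N(1)] \<phi>]
      have "act R F N N (hom_diff N N (id_hom N) \<phi>) y = \<one>\<^bsub>fun_ob F N\<^esub>"
        using act_eq_iff[OF FA N(1) N(1) y(1) id_closed[OF N(1)] \<phi>] y\<phi> additive_functorD(3)[OF FA N(1) y(1)] by simp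
      then show False
        using right_inverse_dichotomy[OF N(1,2) \<phi>] unit[OF QA xq _ \<phi> _ z\<phi>] unit[OF FA y(1) _ d] z(2) y(2) by blast
    qed
  qed
  then have "G \<in> right_perp R (left_perp R FF)" using Gm by (simp add: right_perp_def)
  then show "G \<in> FF" using bi by simp
qed

end

theorem proposition2p15:
  fixes R :: "'a ring"
  assumes "local_ring R" and "noetherian_ring R"
    and "adically_complete R (max_ideal R)"
    and "cohen_macaulay_ring R"
    and "algebraically_closed (R Quot max_ideal R)"
    and "isolated_singularity R"
  shows "bij_betw (Sp_Sigma R) {\<U>. Sp_closed R \<U>}
           {\<F>. serre_subcategory R \<F> \<and> right_perp R (left_perp R \<F>) = \<F>}"
proof -
  interpret complete_cm_local R
    by (intro complete_cm_local.intro cm_local.intro complete_local.intro noetherian_local.intro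
        cm_local_axioms.intro complete_local_axioms.intro assms)
  show ?thesis
  proof (rule bij_betwI[where g = "Sp_gamma R"])
    show "Sp_Sigma R \<in> {\<U>. Sp_closed R \<U>} \<rightarrow> {\<F>. serre_subcategory R \<F> \<and> right_perp R (left_perp R \<F>) = \<F>}"
      using Sp_Sigma_serre Sp_Sigma_biperp by (auto simp: Sp_closed_def)
    \<comment> \<open>Closedness of \<open>Sp_gamma R \<F>\<close> follows by applying
      \<open>Sp_gamma R\<close> to the equation
      \<open>Sp_Sigma R (Sp_gamma R \<F>) = \<F>\<close>.\<close>
    show "Sp_gamma R \<in> {\<F>. serre_subcategory R \<F> \<and> right_perp R (left_perp R \<F>) = \<F>} \<rightarrow> {\<U>. Sp_closed R \<U>}"
      using Sp_Sigma_gamma by (auto simp: Sp_closed_def Sp_gamma_def)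
    show "Sp_gamma R (Sp_Sigma R \<U>) = \<U>" if "\<U> \<in> {\<U>. Sp_closed R \<U>}" for \<U>
      using that by (simp add: Sp_closed_def)
    show "Sp_Sigma R (Sp_gamma R \<F>) = \<F>"
      if "\<F> \<in> {\<F>. serre_subcategory R \<F> \<and> right_perp R (left_perp R \<F>) = \<F>}" for \<F>
      using that Sp_Sigma_gamma by auto
  qed
qed

end
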